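(* Let $N\in(U_9)$ be a stratified submanifold (germ) of a symplectic space $(\mathbb R^{2n},\omega)$, with associated subspaces $W,\ell_1,\ell_2,V$ and invariants $Lt,L_2$. If $N$ belongs to one of the classes below, then $(N,\omega)$ satisfies the corresponding conditions (for $(U_9)^0$, according to the parameters of the normal form to which $[\omega]_N$ is diffeomorphic): - $(U_9)^0$, with $[\pm\theta_1+c_1\theta_2+c_2\theta_3]_{U_9}$, $c_1\ne0$: $\omega|_V\ne0$ and $\omega|_{\ell_1+\ell_2}\ne0$. - $(U_9)^0$, with $[\pm\theta_1+c_2\theta_3]_{U_9}$: $\omega|_V\ne0$ and $\omega|_{\ell_1+\ell_2}=0$. - $(U_9)^1$: $\omega|_V=0$, $\omega|_{\ell_1+\ell_2}\ne0$ and $\ker\omega\ne\ell_2$. - $(U_9)^2$, $(U_9)^{3,0}$, $(U_9)^{4,0}$: $\omega|_V=0$ and $\ker\omega=\ell_2$. - $(U_9)^{3,1}$: $\omega|_W=0$ and $Lt=L_2=8$. - $(U_9)^{4,1}$: $\omega|_W=0$ and $Lt=L_2=10$. - $(U_9)^5$: $\omega|_W=0$ and $Lt=L_2=11$. - $(U_9)^6$: $\omega|_W=0$ and $Lt=L_2=13$. - $(U_9)^7$: $\omega|_W=0$, $Lt=14$ and $L_2=\infty$. - $(U_9)^8$: $\omega|_W=0$, $Lt=16$ and $L_2=\infty$. - $(U_9)^9$: $\omega|_W=0$ and $N$ is contained in a smooth Lagrangian submanifold.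
   Context: $U_9=\{x\in\mathbb R^{2n}: x_1^2+x_2x_3=x_1x_2+x_3^4=x_{\ge4}=0\}$, $2n\ge4$; $(U_9)$ is the class of germs at $0$ of subsets of the symplectic space that are images of $U_9$ under a germ of a diffeomorphism. Such $N$ is a union of a nonsingular branch $B_1$ and a singular branch $B_2$. Subspaces: $W$ is the tangent space at $0$ to some (and then any) nonsingular $3$-manifold containing $N$; $\ell_1$ the tangent line at $0$ to $B_1$; $\ell_2$ the tangent line at $0$ to $B_2$; $V$ the $2$-space tangent at $0$ to $B_2$. For $N=U_9$: $W=\mathrm{span}(\partial_{x_1},\partial_{x_2},\partial_{x_3})$, $\ell_1=\mathrm{span}(\partial_{x_2})$, $\ell_2=\mathrm{span}(\partial_{x_3})$, $V=\mathrm{span}(\partial_{x_1},\partial_{x_3})$ (for general $N$, transport by the differential of a diffeomorphism taking $U_9$ to $N$). $\ker\omega$ denotes the kernel of $\omega|_W$. Algebraic restrictions: $[\omega]_N=[\tilde\omega]_N$ if $\omega-\tilde\omega=\alpha+d\beta$ with $\alpha$ a $2$-form and $\beta$ a $1$-form both vanishing at every point of $N$. $[\omega]_N$ and $[\tilde\omega]_{\tilde N}$ are diffeomorphic if there is a germ of a diffeomorphism $\Phi$ with $\Phi(\tilde N)=N$ and $[\Phi^*\omega]_{\tilde N}=[\tilde\omega]_{\tilde N}$. Forms: $\theta_1=dx_1\wedge dx_3$, $\theta_2=dx_2\wedge dx_3$, $\theta_3=dx_1\wedge dx_2$, $\theta_4=x_3dx_1\wedge dx_3$, $\theta_5=x_1dx_1\wedge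 dx_3$, $\theta_6=x_3^2dx_1\wedge dx_3$, $\theta_7=x_1x_3dx_1\wedge dx_3$, $\theta_8=x_3^3dx_1\wedge dx_3$, $\theta_9=x_1x_3^2dx_1\wedge dx_3$. A class consists of those $N\in(U_9)$ such that $[\omega]_N$ is diffeomorphic to some member (some real parameters and sign) of the normal form with the same superscript: $[U_9]^0=[\pm\theta_1+c_1\theta_2+c_2\theta_3]_{U_9}$; $[U_9]^1=[\pm\theta_2+c_1\theta_3+c_2\theta_4+c_3\theta_6]_{U_9}$; $[U_9]^2=[\pm\theta_3+c_1\theta_4+c_2\theta_5]_{U_9}$, $c_1\ne0$; $[U_9]^{3,0}=[\pm\theta_3+c_1\theta_5+c_2\theta_6]_{U_9}$, $c_1\ne0$; $[U_9]^{4,0}=[\pm\theta_3+c_1\theta_6+c_2\theta_7]_{U_9}$; $[U_9]^{3,1}=[\theta_4+c\theta_5]_{U_9}$; $[U_9]^{4,1}=[\theta_5+c_1\theta_6+c_2\theta_8]_{U_9}$; $[U_9]^5=[\pm\theta_6+c\theta_7]_{U_9}$; $[U_9]^6=[\pm\theta_7+c\theta_8]_{U_9}$; $[U_9]^7=[\theta_8+c\theta_9]_{U_9}$; $[U_9]^8=[\theta_9]_{U_9}$; $[U_9]^9=[0]_{U_9}$. Lagrangian tangency orders: for a smooth Lagrangian submanifold germ $L$ with regular equations $H_1=\dots=H_n=0$, $t(f,L)$ is the minimum of the orders of vanishing at $0$ of $H_j\circ f$; $Lt=\max_L\min\{t(B_1,L),t(B_2,L)\}$, $L_2=\max_Lt(B_2,L)$,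 maxima over all smooth Lagrangian $L$. *)

theory Defs
  imports "HOL-Analysis.Analysis" "HOL-Library.Extended_Nat"
begin

text \<open>
  The space \<open>\<real>\<^sup>2\<^sup>n\<close> is \<open>real ^ 'n bit0\<close> with \<open>n = CARD('n)\<close>. The index type \<open>'n bit0\<close> consists of the
  residues modulo \<open>2n\<close>, so the numerals \<open>1, 2, 3\<close> are distinct indices as soon as \<open>2n \<ge> 4\<close>
  (lemma \<open>bit0_123_distinct\<close> below).

  Germs at \<open>0\<close> are represented by globally defined functions and sets of which only the behaviour
  near \<open>0\<close> matters.
\<close>

section \<open>Smooth maps and germs of diffeomorphisms\<close>

text \<open>On a finite-dimensional space and an open set, this is the class \<open>C\<^sup>k\<close>.\<close>

primrec Ck_on :: "nat \<Rightarrow> 'a::real_normed_vector set \<Rightarrow> ('a \<Rightarrow> 'b::real_normed_vector) \<Rightarrow> bool" where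
  "Ck_on 0 S f \<longleftrightarrow> continuous_on S f"
| "Ck_on (Suc k) S f \<longleftrightarrow>
     (\<forall>x\<in>S. f differentiable (at x)) \<and> (\<forall>v. Ck_on k S (\<lambda>x. frechet_derivative f (at x) v))"

definition smooth_on :: "'a::real_normed_vector set \<Rightarrow> ('a \<Rightarrow> 'b::real_normed_vector) \<Rightarrow> bool" where
  "smooth_on S f \<longleftrightarrow> (\<forall>k. Ck_on k S f)"

text \<open>\<open>germ_diffeo \<Phi> A B\<close>: \<open>\<Phi>\<close> represents a germ at \<open>0\<close> of a diffeomorphism fixing \<open>0\<close> and taking the
  germ of \<open>A\<close> at \<open>0\<close> onto the germ of \<open>B\<close> at \<open>0\<close>.\<close>

definition germ_diffeo :: "('a::real_normed_vector \<Rightarrow> 'a) \<Rightarrow> 'a set \<Rightarrow> 'a set \<Rightarrow> bool" where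
  "germ_diffeo \<Phi> A B \<longleftrightarrow> \<Phi> 0 = 0 \<and>
     (\<exists>U V \<Psi>. open U \<and> open V \<and> 0 \<in> U \<and> 0 \<in> V \<and> homeomorphism U V \<Phi> \<Psi> \<and>
        smooth_on U \<Phi> \<and> smooth_on V \<Psi> \<and> \<Phi> ` (A \<inter> U) = B \<inter> V)"

section \<open>Differential forms\<close>

type_synonym 'a form1 = "'a \<Rightarrow> 'a \<Rightarrow> real"
type_synonym 'a form2 = "'a \<Rightarrow> 'a \<Rightarrow> 'a \<Rightarrow> real"

definition one_form_on :: "'a::euclidean_space set \<Rightarrow> 'a form1 \<Rightarrow> bool" where
  "one_form_on U \<beta> \<longleftrightarrow> (\<forall>x\<in>U. linear (\<beta> x)) \<and> (\<forall>v. smooth_on U (\<lambda>x. \<beta> x v))"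

definition two_form_on :: "'a::euclidean_space set \<Rightarrow> 'a form2 \<Rightarrow> bool" where
  "two_form_on U \<alpha> \<longleftrightarrow> (\<forall>x\<in>U. bilinear (\<alpha> x) \<and> (\<forall>v. \<alpha> x v v = 0)) \<and>
     (\<forall>u v. smooth_on U (\<lambda>x. \<alpha> x u v))"

text \<open>The exterior derivatives use constant vector fields, which commute; the convention is
  \<open>d(f dx\<^sub>i) = df \<and> dx\<^sub>i\<close> with \<open>(dx\<^sub>i \<and> dx\<^sub>j)(u,v) = u\<^sub>i v\<^sub>j - u\<^sub>j v\<^sub>i\<close>.\<close>

definition ext_deriv :: "'a::euclidean_space form1 \<Rightarrow> 'a form2" where
  "ext_deriv \<beta> x u v =
     frechet_derivative (\<lambda>y. \<beta> y v) (at x) u - frechet_derivative (\<lambda>y. \<beta> y u) (at x) v"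

definition closed_form_on :: "'a::euclidean_space set \<Rightarrow> 'a form2 \<Rightarrow> bool" where
  "closed_form_on U \<omega> \<longleftrightarrow> (\<forall>x\<in>U. \<forall>u v w.
     frechet_derivative (\<lambda>y. \<omega> y v w) (at x) u
     - frechet_derivative (\<lambda>y. \<omega> y u w) (at x) v
     + frechet_derivative (\<lambda>y. \<omega> y u v) (at x) w = 0)"

definition symplectic_germ :: "'a::euclidean_space form2 \<Rightarrow> bool" where
  "symplectic_germ \<omega> \<longleftrightarrow> (\<exists>U. open U \<and> 0 \<in> U \<and> two_form_on U \<omega> \<and> closed_form_on U \<omega> \<and>
     (\<forall>x\<in>U. \<forall>u. (\<forall>v. \<omega> x u v = 0) \<longrightarrow> u = 0))"

definition pullback :: "('a::euclidean_space \<Rightarrow> 'a) \<Rightarrow> 'a form2 \<Rightarrow> 'a form2" where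
  "pullback \<Phi> \<omega> x u v =
     \<omega> (\<Phi> x) (frechet_derivative \<Phi> (at x) u) (frechet_derivative \<Phi> (at x) v)"

section \<open>Algebraic restrictions\<close>

definition alg_restr_eq :: "'a::euclidean_space set \<Rightarrow> 'a form2 \<Rightarrow> 'a form2 \<Rightarrow> bool" where
  "alg_restr_eq N \<omega> \<omega>' \<longleftrightarrow> (\<exists>U \<alpha> \<beta>. open U \<and> 0 \<in> U \<and> two_form_on U \<alpha> \<and> one_form_on U \<beta> \<and>
     (\<forall>x\<in>N \<inter> U. (\<forall>u v. \<alpha> x u v = 0) \<and> (\<forall>u. \<beta> x u = 0)) \<and>
     (\<forall>x\<in>U. \<forall>u v. \<omega> x u v - \<omega>' x u v = \<alpha> x u v + ext_deriv \<beta> x u v))"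

definition alg_restr_diffeo ::
    "'a::euclidean_space form2 \<Rightarrow> 'a set \<Rightarrow> 'a form2 \<Rightarrow> 'a set \<Rightarrow> bool" where
  "alg_restr_diffeo \<omega> N \<omega>' N' \<longleftrightarrow>
     (\<exists>\<Phi>. germ_diffeo \<Phi> N' N \<and> alg_restr_eq N' (pullback \<Phi> \<omega>) \<omega>')"

section \<open>The model \<open>U\<^sub>9\<close>\<close>

definition U9 :: "(real ^ ('n::finite) bit0) set" where
  "U9 = {x. (x $ 1)^2 + x $ 2 * x $ 3 = 0 \<and> x $ 1 * x $ 2 + (x $ 3)^4 = 0 \<and>
            (\<forall>i. i \<notin> {1, 2, 3} \<longrightarrow> x $ i = 0)}"

text \<open>Parametrizations of the nonsingular branch \<open>B\<^sub>1\<close> and of the singular branch \<open>B\<^sub>2\<close> of \<open>U\<^sub>9\<close>,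
  see lemma \<open>U9_branches\<close>. For \<open>N = \<Phi>(U\<^sub>9)\<close> the branches are parametrized by \<open>\<Phi> \<circ> branch1\<close> and
  \<open>\<Phi> \<circ> branch2\<close>.\<close>

definition branch1 :: "real \<Rightarrow> real ^ ('n::finite) bit0" where
  "branch1 t = axis 2 t"

definition branch2 :: "real \<Rightarrow> real ^ ('n::finite) bit0" where
  "branch2 t = axis 1 (t^5) - axis 2 (t^7) + axis 3 (t^3)"

lemma bit0_123_distinct:
  assumes "CARD('n::finite) \<ge> 2"
  shows "(1::'n bit0) \<noteq> 2" "(1::'n bit0) \<noteq> 3" "(2::'n bit0) \<noteq> 3"
proof -
  have not0: "(numeral k :: 'n bit0) \<noteq> 0" if "numeral k < (2::int) * int CARD('n)" for k
  proof
    assume "(numeral k :: 'n bit0) = 0"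
    then have "numeral k mod (2 * int CARD('n)) = 0"
      using bit0_iszero_numeral[of k, where 'a='n] unfolding iszero_def by simp
    with that show False
      by simp
  qed
  have n1: "(1::'n bit0) \<noteq> 0" by simp
  have n2: "(2::'n bit0) \<noteq> 0" using not0[of "num.Bit0 num.One"] assms by simp
  have "(2::'n bit0) - 1 \<noteq> 0" "(3::'n bit0) - 1 \<noteq> 0" "(3::'n bit0) - 2 \<noteq> 0"
    using n1 n2 by simp_all
  then show "(1::'n bit0) \<noteq> 2" "(1::'n bit0) \<noteq> 3" "(2::'n bit0) \<noteq> 3"
    by (metis right_minus_eq)+
qed

lemma U9_branches:
  assumes "CARD('n::finite) \<ge> 2"
  shows "(U9 :: (real ^ 'n bit0) set) = range branch1 \<union> range branch2"
proof (intro equalityI subsetI)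
  note d = bit0_123_distinct[OF assms]
  fix x :: "real ^ 'n bit0"
  assume "x \<in> U9"
  then have e1: "(x $ 1)^2 = - (x $ 2 * x $ 3)" and e2: "x $ 1 * x $ 2 = - ((x $ 3)^4)"
    and r: "\<And>i. i \<noteq> 1 \<Longrightarrow> i \<noteq> 2 \<Longrightarrow> i \<noteq> 3 \<Longrightarrow> x $ i = 0"
    by (auto simp: U9_def)
  show "x \<in> range branch1 \<union> range branch2"
  proof (cases "x $ 3 = 0")
    case True
    then have "x $ 1 = 0" using e1 by simp
    with True r have "x = branch1 (x $ 2)"
      by (simp add: vec_eq_iff branch1_def axis_def) metis
    then show ?thesis by blast
  next
    case False
    define a where "a = x $ 1"
    define b where "b = x $ 2"
    define c where "c = x $ 3"
    have c0: "c \<noteq> 0" using False by (simp add: c_def)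
    have f1: "a^2 = - (b * c)" and f2: "a * b = - (c^4)"
      using e1 e2 by (simp_all add: a_def b_def c_def)
    have a3: "a^3 = c^5"
    proof -
      have "a^3 = a * a^2" by (simp add: power3_eq_cube power2_eq_square)
      also have "\<dots> = - (a * b) * c" unfolding f1 by simp
      also have "\<dots> = c^5" unfolding f2 by (simp add: power_numeral_reduce)
      finally show ?thesis .
    qed
    have a0: "a \<noteq> 0" using a3 c0 by auto
    define t where "t = c^2 / a"
    have t3: "t^3 = c"
    proof -
      have "t^3 = c^6 / a^3" by (simp add: t_def power_divide)
      also have "\<dots> = c" using c0 unfolding a3 by (simp add: divide_simps power_numeral_reduce)
      finally show ?thesis .
    qed
    have t5: "t^5 = a"
    proof -
      have "t^5 = (c^5)^2 / a^5" by (simp add: t_def power_divide)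
      also have "\<dots> = a" using a0 unfolding a3[symmetric] by (simp add: divide_simps power_numeral_reduce)
      finally show ?thesis .
    qed
    have t7: "- (t^7) = b"
    proof -
      have t0: "t \<noteq> 0" using t3 c0 by auto
      have "(t^5)^2 = - (b * t^3)" using f1 t3 t5 by simp
      then have "(b + t^7) * t^3 = 0" by (simp add: algebra_simps flip: power_mult power_add)
      then show ?thesis using t0 by simp
    qed
    have "x = branch2 t"
      using d r t3 t5 t7 unfolding a_def b_def c_def
      by (simp add: vec_eq_iff branch2_def axis_def)
    then show ?thesis by blast
  qed
next
  note d = bit0_123_distinct[OF assms]
  fix x :: "real ^ 'n bit0"
  assume "x \<in> range branch1 \<union> range branch2"
  then show "x \<in> U9"
    using d
    by (auto simp: U9_def branch1_def branch2_def axis_def algebra_simps simp flip: power_mult power_add)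
qed

definition W0 :: "(real ^ ('n::finite) bit0) set" where
  "W0 = span {axis 1 1, axis 2 1, axis 3 1}"

definition l1_0 :: "(real ^ ('n::finite) bit0) set" where
  "l1_0 = span {axis 2 1}"

definition l2_0 :: "(real ^ ('n::finite) bit0) set" where
  "l2_0 = span {axis 3 1}"

definition V0 :: "(real ^ ('n::finite) bit0) set" where
  "V0 = span {axis 1 1, axis 3 1}"

definition transport :: "('a::real_normed_vector \<Rightarrow> 'a) \<Rightarrow> 'a set \<Rightarrow> 'a set" where
  "transport \<Phi> S = frechet_derivative \<Phi> (at 0) ` S"

text \<open>\<open>\<omega>|\<^sub>S = 0\<close> and the kernel of \<open>\<omega>|\<^sub>S\<close>, for a subspace \<open>S\<close> of the tangent space at \<open>0\<close>.\<close>

definition restr_zero :: "'a::euclidean_space form2 \<Rightarrow> 'a set \<Rightarrow> bool" where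
  "restr_zero \<omega> S \<longleftrightarrow> (\<forall>u\<in>S. \<forall>v\<in>S. \<omega> 0 u v = 0)"

definition restr_kernel :: "'a::euclidean_space form2 \<Rightarrow> 'a set \<Rightarrow> 'a set" where
  "restr_kernel \<omega> S = {u \<in> S. \<forall>v\<in>S. \<omega> 0 u v = 0}"

section \<open>The symplectic classes\<close>

definition dx_dx :: "'i \<Rightarrow> 'i \<Rightarrow> (real ^ ('i::finite)) form2" where
  "dx_dx i j x u v = u $ i * v $ j - u $ j * v $ i"

definition form_add :: "'a form2 \<Rightarrow> 'a form2 \<Rightarrow> 'a form2"  (infixl "\<oplus>\<^sub>f" 65) where
  "(\<alpha> \<oplus>\<^sub>f \<beta>) x u v = \<alpha> x u v + \<beta> x u v"

definition form_scale :: "real \<Rightarrow> 'a form2 \<Rightarrow> 'a form2"  (infixr "\<odot>\<^sub>f" 70) where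
  "(c \<odot>\<^sub>f \<alpha>) x u v = c * \<alpha> x u v"

definition zero_form :: "'a form2" where
  "zero_form x u v = 0"

definition \<theta>1 :: "(real ^ ('n::finite) bit0) form2" where
  "\<theta>1 = dx_dx 1 3"

definition \<theta>2 :: "(real ^ ('n::finite) bit0) form2" where
  "\<theta>2 = dx_dx 2 3"

definition \<theta>3 :: "(real ^ ('n::finite) bit0) form2" where
  "\<theta>3 = dx_dx 1 2"

definition \<theta>4 :: "(real ^ ('n::finite) bit0) form2" where
  "\<theta>4 x = (x $ 3 \<odot>\<^sub>f dx_dx 1 3) x"

definition \<theta>5 :: "(real ^ ('n::finite) bit0) form2" where
  "\<theta>5 x = (x $ 1 \<odot>\<^sub>f dx_dx 1 3) x"

definition \<theta>6 :: "(real ^ ('n::finite) bit0) form2" where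
  "\<theta>6 x = ((x $ 3)^2 \<odot>\<^sub>f dx_dx 1 3) x"

definition \<theta>7 :: "(real ^ ('n::finite) bit0) form2" where
  "\<theta>7 x = ((x $ 1 * x $ 3) \<odot>\<^sub>f dx_dx 1 3) x"

definition \<theta>8 :: "(real ^ ('n::finite) bit0) form2" where
  "\<theta>8 x = ((x $ 3)^3 \<odot>\<^sub>f dx_dx 1 3) x"

definition \<theta>9 :: "(real ^ ('n::finite) bit0) form2" where
  "\<theta>9 x = ((x $ 1 * (x $ 3)^2) \<odot>\<^sub>f dx_dx 1 3) x"

definition normal_form_U9 ::
    "(real ^ ('n::finite) bit0) form2 \<Rightarrow> (real ^ 'n bit0) set \<Rightarrow> (real ^ 'n bit0) form2 \<Rightarrow> bool" where
  "normal_form_U9 \<omega> N \<theta> \<longleftrightarrow> alg_restr_diffeo \<omega> N \<theta> U9"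

text \<open>\<open>class_k \<omega> N\<close> means \<open>N \<in> (U\<^sub>9)\<^sup>k\<close>; the sign \<open>\<plusminus>\<close> is the parameter \<open>s\<close>. The class \<open>(U\<^sub>9)\<^sup>0\<close> is
  split according to \<open>c\<^sub>1\<close>.\<close>

definition class_0_nonzero :: "(real ^ ('n::finite) bit0) form2 \<Rightarrow> (real ^ 'n bit0) set \<Rightarrow> bool" where
  "class_0_nonzero \<omega> N \<longleftrightarrow> (\<exists>s\<in>{1, -1}. \<exists>c1 c2. c1 \<noteq> 0 \<and>
     normal_form_U9 \<omega> N (s \<odot>\<^sub>f \<theta>1 \<oplus>\<^sub>f c1 \<odot>\<^sub>f \<theta>2 \<oplus>\<^sub>f c2 \<odot>\<^sub>f \<theta>3))"

definition class_0_zero :: "(real ^ ('n::finite) bit0) form2 \<Rightarrow> (real ^ 'n bit0) set \<Rightarrow> bool" where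
  "class_0_zero \<omega> N \<longleftrightarrow> (\<exists>s\<in>{1, -1}. \<exists>c2.
     normal_form_U9 \<omega> N (s \<odot>\<^sub>f \<theta>1 \<oplus>\<^sub>f c2 \<odot>\<^sub>f \<theta>3))"

definition class_1 :: "(real ^ ('n::finite) bit0) form2 \<Rightarrow> (real ^ 'n bit0) set \<Rightarrow> bool" where
  "class_1 \<omega> N \<longleftrightarrow> (\<exists>s\<in>{1, -1}. \<exists>c1 c2 c3.
     normal_form_U9 \<omega> N (s \<odot>\<^sub>f \<theta>2 \<oplus>\<^sub>f c1 \<odot>\<^sub>f \<theta>3 \<oplus>\<^sub>f c2 \<odot>\<^sub>f \<theta>4 \<oplus>\<^sub>f c3 \<odot>\<^sub>f \<theta>6))"

definition class_2 :: "(real ^ ('n::finite) bit0) form2 \<Rightarrow> (real ^ 'n bit0) set \<Rightarrow> bool" where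
  "class_2 \<omega> N \<longleftrightarrow> (\<exists>s\<in>{1, -1}. \<exists>c1 c2. c1 \<noteq> 0 \<and>
     normal_form_U9 \<omega> N (s \<odot>\<^sub>f \<theta>3 \<oplus>\<^sub>f c1 \<odot>\<^sub>f \<theta>4 \<oplus>\<^sub>f c2 \<odot>\<^sub>f \<theta>5))"

definition class_3_0 :: "(real ^ ('n::finite) bit0) form2 \<Rightarrow> (real ^ 'n bit0) set \<Rightarrow> bool" where
  "class_3_0 \<omega> N \<longleftrightarrow> (\<exists>s\<in>{1, -1}. \<exists>c1 c2. c1 \<noteq> 0 \<and>
     normal_form_U9 \<omega> N (s \<odot>\<^sub>f \<theta>3 \<oplus>\<^sub>f c1 \<odot>\<^sub>f \<theta>5 \<oplus>\<^sub>f c2 \<odot>\<^sub>f \<theta>6))"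

definition class_4_0 :: "(real ^ ('n::finite) bit0) form2 \<Rightarrow> (real ^ 'n bit0) set \<Rightarrow> bool" where
  "class_4_0 \<omega> N \<longleftrightarrow> (\<exists>s\<in>{1, -1}. \<exists>c1 c2.
     normal_form_U9 \<omega> N (s \<odot>\<^sub>f \<theta>3 \<oplus>\<^sub>f c1 \<odot>\<^sub>f \<theta>6 \<oplus>\<^sub>f c2 \<odot>\<^sub>f \<theta>7))"

definition class_3_1 :: "(real ^ ('n::finite) bit0) form2 \<Rightarrow> (real ^ 'n bit0) set \<Rightarrow> bool" where
  "class_3_1 \<omega> N \<longleftrightarrow> (\<exists>c. normal_form_U9 \<omega> N (\<theta>4 \<oplus>\<^sub>f c \<odot>\<^sub>f \<theta>5))"

definition class_4_1 :: "(real ^ ('n::finite) bit0) form2 \<Rightarrow> (real ^ 'n bit0) set \<Rightarrow> bool" where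
  "class_4_1 \<omega> N \<longleftrightarrow> (\<exists>c1 c2. normal_form_U9 \<omega> N (\<theta>5 \<oplus>\<^sub>f c1 \<odot>\<^sub>f \<theta>6 \<oplus>\<^sub>f c2 \<odot>\<^sub>f \<theta>8))"

definition class_5 :: "(real ^ ('n::finite) bit0) form2 \<Rightarrow> (real ^ 'n bit0) set \<Rightarrow> bool" where
  "class_5 \<omega> N \<longleftrightarrow> (\<exists>s\<in>{1, -1}. \<exists>c. normal_form_U9 \<omega> N (s \<odot>\<^sub>f \<theta>6 \<oplus>\<^sub>f c \<odot>\<^sub>f \<theta>7))"

definition class_6 :: "(real ^ ('n::finite) bit0) form2 \<Rightarrow> (real ^ 'n bit0) set \<Rightarrow> bool" where
  "class_6 \<omega> N \<longleftrightarrow> (\<exists>s\<in>{1, -1}. \<exists>c. normal_form_U9 \<omega> N (s \<odot>\<^sub>f \<theta>7 \<oplus>\<^sub>f c \<odot>\<^sub>f \<theta>8))"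

definition class_7 :: "(real ^ ('n::finite) bit0) form2 \<Rightarrow> (real ^ 'n bit0) set \<Rightarrow> bool" where
  "class_7 \<omega> N \<longleftrightarrow> (\<exists>c. normal_form_U9 \<omega> N (\<theta>8 \<oplus>\<^sub>f c \<odot>\<^sub>f \<theta>9))"

definition class_8 :: "(real ^ ('n::finite) bit0) form2 \<Rightarrow> (real ^ 'n bit0) set \<Rightarrow> bool" where
  "class_8 \<omega> N \<longleftrightarrow> normal_form_U9 \<omega> N \<theta>9"

definition class_9 :: "(real ^ ('n::finite) bit0) form2 \<Rightarrow> (real ^ 'n bit0) set \<Rightarrow> bool" where
  "class_9 \<omega> N \<longleftrightarrow> normal_form_U9 \<omega> N zero_form"

section \<open>Lagrangian tangency orders\<close>

text \<open>A germ at \<open>0\<close> of a smooth Lagrangian submanifold \<open>L\<close> is given by its regular equations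
  \<open>H\<^sub>1 = \<dots> = H\<^sub>n = 0\<close>, the components of \<open>H\<close>; its tangent space at \<open>x\<close> is the kernel of the
  derivative of \<open>H\<close> at \<open>x\<close>, of dimension \<open>2n - n\<close>.\<close>

definition lagrangian_germ ::
    "(real ^ ('n::finite) bit0) form2 \<Rightarrow> (real ^ 'n bit0 \<Rightarrow> real ^ 'n) \<Rightarrow> bool" where
  "lagrangian_germ \<omega> H \<longleftrightarrow> H 0 = 0 \<and>
     (\<exists>U. open U \<and> 0 \<in> U \<and> smooth_on U H \<and>
        (\<forall>x\<in>U. surj (frechet_derivative H (at x))) \<and>
        (\<forall>x\<in>U. H x = 0 \<longrightarrow>
           (\<forall>u v. frechet_derivative H (at x) u = 0 \<longrightarrow> frechet_derivative H (at x) v = 0 \<longrightarrow>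
              \<omega> x u v = 0)))"

text \<open>The least \<open>k\<close> with nonzero \<open>k\<close>-th derivative at \<open>0\<close>, and \<open>\<infinity>\<close> if there is none.\<close>

definition vanishing_order :: "(real \<Rightarrow> real) \<Rightarrow> enat" where
  "vanishing_order g = Inf (enat ` {k. (deriv ^^ k) g 0 \<noteq> 0})"

definition tangency_order :: "(real \<Rightarrow> 'a) \<Rightarrow> ('a \<Rightarrow> real ^ ('n::finite)) \<Rightarrow> enat" where
  "tangency_order f H = (MIN j. vanishing_order (\<lambda>t. H (f t) $ j))"

definition is_maximum :: "enat \<Rightarrow> enat set \<Rightarrow> bool" where
  "is_maximum m S \<longleftrightarrow> m \<in> S \<and> (\<forall>k\<in>S. k \<le> m)"

text \<open>\<open>Lt_is \<omega> \<Phi> m\<close> and \<open>L2_is \<omega> \<Phi> m\<close> mean \<open>Lt = m\<close> and \<open>L\<^sub>2 = m\<close> for \<open>N = \<Phi>(U\<^sub>9)\<close>; in particular the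
  maximum over all \<open>L\<close> is attained, also when it is \<open>\<infinity>\<close>.\<close>

definition Lt_is ::
    "(real ^ ('n::finite) bit0) form2 \<Rightarrow> (real ^ 'n bit0 \<Rightarrow> real ^ 'n bit0) \<Rightarrow> enat \<Rightarrow> bool" where
  "Lt_is \<omega> \<Phi> m \<longleftrightarrow> is_maximum m
     {min (tangency_order (\<Phi> \<circ> branch1) H) (tangency_order (\<Phi> \<circ> branch2) H) | H. lagrangian_germ \<omega> H}"

definition L2_is ::
    "(real ^ ('n::finite) bit0) form2 \<Rightarrow> (real ^ 'n bit0 \<Rightarrow> real ^ 'n bit0) \<Rightarrow> enat \<Rightarrow> bool" where
  "L2_is \<omega> \<Phi> m \<longleftrightarrow> is_maximum m {tangency_order (\<Phi> \<circ> branch2) H | H. lagrangian_germ \<omega> H}"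

definition in_lagrangian ::
    "(real ^ ('n::finite) bit0) form2 \<Rightarrow> (real ^ 'n bit0) set \<Rightarrow> bool" where
  "in_lagrangian \<omega> N \<longleftrightarrow>
     (\<exists>H. lagrangian_germ \<omega> H \<and> (\<forall>\<^sub>F x in nhds 0. x \<in> N \<longrightarrow> H x = 0))"

end

theory Submission
  imports Defs "HOL-Library.Landau_Symbols"
begin

text \<open>
  Moser's method shows that a symplectic form \<open>d\<mu>\<close> with \<open>\<mu>(0) = 0\<close>, isotropic on a subspace \<open>W\<close> at \<open>0\<close>,
  has a Lagrangian germ whose equations are bounded on \<open>W\<close> by \<open>\<mu>\<close>. If the algebraic restriction to
  \<open>U\<^sub>9\<close> is that of \<open>\<theta> = d\<kappa>\<close>, the remaining closed 2-form vanishes on \<open>U\<^sub>9\<close> and has a primitive vanishing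
  there, because \<open>U\<^sub>9\<close> is invariant under \<open>(s\<^sup>5 x\<^sub>1, s\<^sup>7 x\<^sub>2, s\<^sup>3 x\<^sub>3)\<close>; so \<open>\<mu> = \<kappa>\<close> on \<open>U\<^sub>9\<close>, and a primitive \<open>\<kappa>\<close>
  that is small along the branches gives a Lagrangian germ of high tangency order.

  Conversely, up to terms of the size of its equations \<open>H\<close>, the symplectic form is the differential of a
  1-form of the size of \<open>H\<close>. Tangency of order \<open>M\<close> thus makes \<open>\<theta>\<close>, up to order \<open>M\<close> along the singular
  branch, the differential of a 1-form that itself vanishes to order \<open>M\<close> there, and comparing weighted
  Taylor coefficients bounds \<open>M\<close>.

  Nothing depends on the diffeomorphism taking \<open>U\<^sub>9\<close> to \<open>N\<close>: a symmetry of the germ \<open>U\<^sub>9\<close> preserves each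
  branch, changing its parameter by a bounded factor, and its differential preserves the tangent
  spaces involved.
\<close>

section \<open>Smooth functions\<close>

text \<open>The finite orders in the theorem are weighted degrees. With weights 5, 7, 3 for x_1,
  x_2, x_3, the exponents of the singular branch, the coefficients of \<open>\<theta>4\<close> to
  \<open>\<theta>9\<close> have weights 3, 5, 6, 8, 9, 11. Integrating in x_1 adds 5: this primitive
  vanishes on the nonsingular branch and has order 8, 10, 11, 13, 14, 16 on the singular one. For
  \<open>\<theta>8\<close> and \<open>\<theta>9\<close> another primitive vanishes on the whole
  singular branch, whence the infinite L_2; it contains x_2^2 and so is visible on the nonsingular
  branch. The upper bound for Lt must then use both branches: the coefficient of x_2^2 is the one
  unknown left free by the singular branch, and tangency along the nonsingular branch removes it. A
  Lagrangian germ that is merely tangent does not contain the branches, so the vanishing of the form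
  on the germ cannot be restricted to them; every comparison is quantitative, in terms of the size
  of the equations. The germs attaining the maxima must be smooth, hence the proof that flows depend
  smoothly on initial values.\<close>

lemma frechet_at: "(f has_derivative f') (at x) \<Longrightarrow> frechet_derivative f (at x) = f'"
  using frechet_derivative_at by metis

lemma linear_eq_sum_Basis:
  fixes f :: "'a::euclidean_space \<Rightarrow> 'b::real_vector"
  assumes "linear f"
  shows "f v = (\<Sum>b\<in>Basis. (v \<bullet> b) *\<^sub>R f b)"
proof -
  have "f v = f (\<Sum>b\<in>Basis. (v \<bullet> b) *\<^sub>R b)" by (simp add: euclidean_representation)
  then show ?thesis by (simp add: linear_sum[OF assms] linear_cmul[OF assms])
qed

section \<open>Closure properties of C^k maps\<close>

lemma Ck_on_SucD:
  assumes "Ck_on (Suc k) S f" "x \<in> S"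
  shows "(f has_derivative frechet_derivative f (at x)) (at x)"
  using assms frechet_derivative_works by auto

lemma Ck_on_cong_aux:
  assumes "open S" "\<And>x. x \<in> S \<Longrightarrow> f x = g x" "Ck_on k S f"
  shows "Ck_on k S g"
  using assms(2,3)
proof (induction k arbitrary: f g)
  case 0
  then show ?case using continuous_on_cong by (metis Ck_on.simps(1))
next
  case (Suc k)
  have d: "(g has_derivative frechet_derivative f (at x)) (at x)" if "x \<in> S" for x
    using has_derivative_transform_within_open[OF Ck_on_SucD[OF Suc.prems(2) that] assms(1) that] Suc.prems(1) by blast
  then have e: "frechet_derivative f (at x) = frechet_derivative g (at x)" if "x \<in> S" for x
    using frechet_at that by metis
  have "Ck_on k S (\<lambda>x. frechet_derivative g (at x) v)" for v
    by (rule Suc.IH[of "\<lambda>x. frechet_derivative f (at x) v"]) (use Suc.prems(2) e in auto)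
  then show ?case using d by (auto simp: differentiable_def)
qed

lemma Ck_on_cong:
  "open S \<Longrightarrow> (\<And>x. x \<in> S \<Longrightarrow> f x = g x) \<Longrightarrow> Ck_on k S f \<longleftrightarrow> Ck_on k S g"
  using Ck_on_cong_aux[of S f g] Ck_on_cong_aux[of S g f] by metis

text \<open>The class is defined through \<open>frechet_derivative\<close>; uniqueness of
  derivatives allows any explicitly computed \<open>f'\<close> in its place. The inductions below
  compute a derivative by the usual rule and feed it in here.\<close>

lemma Ck_onI:
  assumes "open S" "\<And>x. x \<in> S \<Longrightarrow> (f has_derivative f' x) (at x)"
    and "\<And>v. Ck_on k S (\<lambda>x. f' x v)"
  shows "Ck_on (Suc k) S f"
proof -
  have e: "f' x = frechet_derivative f (at x)" if "x \<in> S" for x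
    using assms(2)[OF that] frechet_at by metis
  have "Ck_on k S (\<lambda>x. frechet_derivative f (at x) v)" for v
    by (rule Ck_on_cong_aux[OF assms(1) _ assms(3)[of v]]) (simp add: e)
  then show ?thesis using assms(2) by (auto simp: differentiable_def)
qed

lemma Ck_on_subset: "Ck_on k S f \<Longrightarrow> T \<subseteq> S \<Longrightarrow> Ck_on k T f"
  by (induction k arbitrary: f) (auto intro: continuous_on_subset)

lemma Ck_on_continuous: "Ck_on k S f \<Longrightarrow> continuous_on S f"
  by (cases k) (auto intro!: continuous_at_imp_continuous_on differentiable_imp_continuous_within)

lemma Ck_on_Suc_le: "Ck_on (Suc k) S f \<Longrightarrow> Ck_on k S f"
proof (induction k arbitrary: f)
  case 0
  then show ?case using Ck_on_continuous by (metis Ck_on.simps(1))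
next
  case (Suc k)
  then show ?case by (metis Ck_on.simps(2))
qed

lemma Ck_on_le: "Ck_on k S f \<Longrightarrow> j \<le> k \<Longrightarrow> Ck_on j S f"
  by (induction k) (auto simp: le_Suc_eq simp del: Ck_on.simps dest: Ck_on_Suc_le)

lemma Ck_on_const: "open S \<Longrightarrow> Ck_on k S (\<lambda>x. c)"
proof (induction k arbitrary: c)
  case (Suc k)
  show ?case by (rule Ck_onI[where f'="\<lambda>x v. 0"]) (use Suc in auto)
qed simp

lemma Ck_on_bounded_linear_compose:
  assumes "open S" "bounded_linear L" "Ck_on k S f"
  shows "Ck_on k S (\<lambda>x. L (f x))"
  using assms(3)
proof (induction k arbitrary: f)
  case 0
  then show ?case using bounded_linear.continuous_on[OF assms(2)] by simp
next
  case (Suc k)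
  show ?case
    by (rule Ck_onI[OF assms(1) bounded_linear.has_derivative[OF assms(2) Ck_on_SucD[OF Suc.prems]]])
      (use Suc in auto)
qed

lemma Ck_on_bounded_linear: "open S \<Longrightarrow> bounded_linear L \<Longrightarrow> Ck_on k S L"
proof (induction k)
  case 0 then show ?case by (simp add: linear_continuous_on)
next
  case (Suc k)
  show ?case
    by (rule Ck_onI[where f'="\<lambda>x. L"]) (use Suc Ck_on_const in \<open>auto intro: bounded_linear_imp_has_derivative\<close>)
qed

lemma Ck_on_add:
  assumes "open S" "Ck_on k S f" "Ck_on k S g"
  shows "Ck_on k S (\<lambda>x. f x + g x)"
  using assms(2,3)
proof (induction k arbitrary: f g)
  case 0
  then show ?case by (simp add: continuous_on_add)
next
  case (Suc k)
  show ?case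
    by (rule Ck_onI[OF assms(1) has_derivative_add[OF Ck_on_SucD[OF Suc.prems(1)] Ck_on_SucD[OF Suc.prems(2)]]])
      (use Suc in auto)
qed

lemma Ck_on_sum:
  assumes "open S" "\<And>i. i \<in> I \<Longrightarrow> Ck_on k S (f i)"
  shows "Ck_on k S (\<lambda>x. \<Sum>i\<in>I. f i x)"
  using assms(2)
proof (induction I rule: infinite_finite_induct)
  case (insert i I)
  then show ?case using Ck_on_add[OF assms(1)] by auto
qed (use assms Ck_on_const in auto)

text \<open>The product rule pairs one factor with the derivative of the other, so the induction
  hypothesis is needed for varying pairs, one member of which is an original function at the lowered
  order k.\<close>

lemma Ck_on_bilinear:
  assumes "open S" "bounded_bilinear h" "Ck_on k S f" "Ck_on k S g"
  shows "Ck_on k S (\<lambda>x. h (f x) (g x))"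
  using assms(3,4)
proof (induction k arbitrary: f g)
  case 0
  then show ?case using bounded_bilinear.continuous_on[OF assms(2)] by auto
next
  case (Suc k)
  note d = bounded_bilinear.FDERIV[OF assms(2) Ck_on_SucD[OF Suc.prems(1)] Ck_on_SucD[OF Suc.prems(2)]]
  have fk: "Ck_on k S f" and gk: "Ck_on k S g"
    using Suc.prems Ck_on_Suc_le by blast+
  show ?case
  proof (rule Ck_onI[OF assms(1) d])
    fix v
    show "Ck_on k S (\<lambda>x. h (f x) (frechet_derivative g (at x) v) + h (frechet_derivative f (at x) v) (g x))"
      using Suc.prems by (intro Ck_on_add[OF assms(1)] Suc.IH fk gk) auto
  qed
qed

text \<open>The chain rule gives \<open>f' (g x) (g' x v)\<close>, where x occurs both in the point
  and in the direction. Expanding the direction over \<open>Basis\<close> leaves derivatives of f in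
  constant directions composed with g, to which the induction hypothesis applies.\<close>

lemma Ck_on_compose:
  fixes g :: "'a::real_normed_vector \<Rightarrow> 'b::euclidean_space"
  assumes "open S" "open T" "g ` S \<subseteq> T" "Ck_on k T f" "Ck_on k S g"
  shows "Ck_on k S (\<lambda>x. f (g x))"
  using assms(4,5)
proof (induction k arbitrary: f)
  case 0
  then show ?case using assms(3) by (auto intro: continuous_on_compose2)
next
  case (Suc k)
  define f' where "f' = (\<lambda>x. frechet_derivative f (at x))"
  define g' where "g' = (\<lambda>x. frechet_derivative g (at x))"
  have d: "((\<lambda>x. f (g x)) has_derivative (\<lambda>v. \<Sum>b\<in>Basis. (g' x v \<bullet> b) *\<^sub>R f' (g x) b)) (at x)" if x: "x \<in> S" for x
  proof -
    have gT: "g x \<in> T" using assms(3) x by auto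
    have 1: "(f has_derivative f' (g x)) (at (g x))"
      unfolding f'_def using Ck_on_SucD[OF Suc.prems(1) gT] .
    have 2: "(g has_derivative g' x) (at x)"
      unfolding g'_def using Ck_on_SucD[OF Suc.prems(2) x] .
    have "((\<lambda>x. f (g x)) has_derivative (\<lambda>v. f' (g x) (g' x v))) (at x)"
      using has_derivative_compose[OF 2 1] .
    moreover have "(\<lambda>v. f' (g x) (g' x v)) = (\<lambda>v. \<Sum>b\<in>Basis. (g' x v \<bullet> b) *\<^sub>R f' (g x) b)"
      by (rule ext) (rule linear_eq_sum_Basis[OF has_derivative_linear[OF 1]])
    ultimately show ?thesis by (rule back_subst)
  qed
  show ?case
  proof (rule Ck_onI[OF assms(1) d])
    fix v
    show "Ck_on k S (\<lambda>x. \<Sum>b\<in>Basis. (g' x v \<bullet> b) *\<^sub>R f' (g x) b)"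
    proof (intro Ck_on_sum assms(1) Ck_on_bilinear[OF _ bounded_bilinear_scaleR])
      fix b :: 'b
      show "Ck_on k S (\<lambda>x. g' x v \<bullet> b)"
        using Suc.prems(2) unfolding g'_def
        by (intro Ck_on_bounded_linear_compose[OF assms(1) bounded_linear_inner_left]) auto
      show "Ck_on k S (\<lambda>x. f' (g x) b)"
        unfolding f'_def by (rule Suc.IH[OF _ Ck_on_Suc_le[OF Suc.prems(2)]]) (use Suc.prems(1) in auto)
    qed
  qed
qed

text \<open>The derivative is a product of the inverse itself, already of class C^k by induction,
  and the derivative of f.\<close>

lemma Ck_on_inverse:
  fixes f :: "'a::real_normed_vector \<Rightarrow> real"
  assumes "open S" "Ck_on k S f" "\<And>x. x \<in> S \<Longrightarrow> f x \<noteq> 0"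
  shows "Ck_on k S (\<lambda>x. inverse (f x))"
  using assms(2)
proof (induction k)
  case 0
  then show ?case using assms(3) by (auto intro!: continuous_intros)
next
  case (Suc k)
  let ?f' = "\<lambda>x. frechet_derivative f (at x)"
  have c: "Ck_on k S (\<lambda>x. inverse (f x))"
    using Suc Ck_on_Suc_le by blast
  show ?case
  proof (rule Ck_onI[OF assms(1), where f'="\<lambda>x v. - 1 * (inverse (f x) * ?f' x v * inverse (f x))"])
    fix x assume x: "x \<in> S"
    show "((\<lambda>x. inverse (f x)) has_derivative (\<lambda>v. - 1 * (inverse (f x) * ?f' x v * inverse (f x)))) (at x)"
      using Deriv.has_derivative_inverse[OF assms(3)[OF x] Ck_on_SucD[OF Suc.prems x]] by simp
  next
    fix v
    show "Ck_on k S (\<lambda>x. - 1 * (inverse (f x) * ?f' x v * inverse (f x)))"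
      using c Suc.prems assms(1) by (intro Ck_on_bilinear[OF _ bounded_bilinear_mult] Ck_on_const) auto
  qed
qed

section \<open>Closure properties of smooth maps\<close>

lemma smooth_on_frechet: "smooth_on S f \<Longrightarrow> smooth_on S (\<lambda>x. frechet_derivative f (at x) v)"
  unfolding smooth_on_def by (metis Ck_on.simps(2))

lemma smooth_on_has_derivative:
  "smooth_on S f \<Longrightarrow> x \<in> S \<Longrightarrow> (f has_derivative frechet_derivative f (at x)) (at x)"
  unfolding smooth_on_def by (metis Ck_on_SucD)

lemma smooth_on_linear_frechet: "smooth_on S f \<Longrightarrow> x \<in> S \<Longrightarrow> linear (frechet_derivative f (at x))"
  using smooth_on_has_derivative has_derivative_linear by blast

lemma smooth_on_subset: "smooth_on S f \<Longrightarrow> T \<subseteq> S \<Longrightarrow> smooth_on T f"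
  unfolding smooth_on_def using Ck_on_subset by blast

lemma smooth_on_cong:
  "open S \<Longrightarrow> (\<And>x. x \<in> S \<Longrightarrow> f x = g x) \<Longrightarrow> smooth_on S f \<longleftrightarrow> smooth_on S g"
  unfolding smooth_on_def using Ck_on_cong[of S f g] by auto

lemma smooth_on_continuous: "smooth_on S f \<Longrightarrow> continuous_on S f"
  unfolding smooth_on_def using Ck_on_continuous by blast

lemma smooth_on_const: "open S \<Longrightarrow> smooth_on S (\<lambda>x. c)"
  unfolding smooth_on_def using Ck_on_const by blast

lemma smooth_on_bounded_linear: "open S \<Longrightarrow> bounded_linear L \<Longrightarrow> smooth_on S L"
  unfolding smooth_on_def using Ck_on_bounded_linear by blast

lemma smooth_on_bounded_linear_compose:
  "open S \<Longrightarrow> bounded_linear L \<Longrightarrow> smooth_on S f \<Longrightarrow> smooth_on S (\<lambda>x. L (f x))"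
  unfolding smooth_on_def by (auto intro: Ck_on_bounded_linear_compose)

lemma smooth_on_add: "open S \<Longrightarrow> smooth_on S f \<Longrightarrow> smooth_on S g \<Longrightarrow> smooth_on S (\<lambda>x. f x + g x)"
  unfolding smooth_on_def by (auto intro: Ck_on_add)

lemma smooth_on_minus: "open S \<Longrightarrow> smooth_on S f \<Longrightarrow> smooth_on S (\<lambda>x. - f x)"
  by (rule smooth_on_bounded_linear_compose[OF _ bounded_linear_minus[OF bounded_linear_ident]])

lemma smooth_on_diff: "open S \<Longrightarrow> smooth_on S f \<Longrightarrow> smooth_on S g \<Longrightarrow> smooth_on S (\<lambda>x. f x - g x)"
  using smooth_on_add[of S f "\<lambda>x. - g x"] smooth_on_minus[of S g] by simp

lemma smooth_on_sum:
  "open S \<Longrightarrow> (\<And>i. i \<in> I \<Longrightarrow> smooth_on S (f i)) \<Longrightarrow> smooth_on S (\<lambda>x. \<Sum>i\<in>I. f i x)"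
  unfolding smooth_on_def by (auto intro: Ck_on_sum)

lemma smooth_on_scaleR:
  "open S \<Longrightarrow> smooth_on S f \<Longrightarrow> smooth_on S g \<Longrightarrow> smooth_on S (\<lambda>x. f x *\<^sub>R g x)"
  unfolding smooth_on_def by (auto intro: Ck_on_bilinear[OF _ bounded_bilinear_scaleR])

lemma smooth_on_mult:
  fixes f g :: "'a::real_normed_vector \<Rightarrow> real"
  shows "open S \<Longrightarrow> smooth_on S f \<Longrightarrow> smooth_on S g \<Longrightarrow> smooth_on S (\<lambda>x. f x * g x)"
  unfolding smooth_on_def by (auto intro: Ck_on_bilinear[OF _ bounded_bilinear_mult])

lemma smooth_on_prod:
  fixes f :: "'i \<Rightarrow> 'a::real_normed_vector \<Rightarrow> real"
  assumes "open S" "\<And>i. i \<in> I \<Longrightarrow> smooth_on S (f i)"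
  shows "smooth_on S (\<lambda>x. \<Prod>i\<in>I. f i x)"
  using assms(2)
proof (induction I rule: infinite_finite_induct)
  case (insert i I)
  then show ?case using smooth_on_mult[OF assms(1)] by auto
qed (use assms smooth_on_const in auto)

lemma smooth_on_power:
  fixes f :: "'a::real_normed_vector \<Rightarrow> real"
  assumes "open S" "smooth_on S f"
  shows "smooth_on S (\<lambda>x. f x ^ n)"
  by (induction n) (use assms smooth_on_const smooth_on_mult in auto)

lemma smooth_on_divide:
  fixes f g :: "'a::real_normed_vector \<Rightarrow> real"
  assumes "open S" "smooth_on S f" "smooth_on S g" "\<And>x. x \<in> S \<Longrightarrow> g x \<noteq> 0"
  shows "smooth_on S (\<lambda>x. f x / g x)"
proof -
  have "smooth_on S (\<lambda>x. inverse (g x))"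
    using assms Ck_on_inverse unfolding smooth_on_def by blast
  then show ?thesis using smooth_on_mult[OF assms(1,2)] by (simp add: divide_inverse)
qed

lemma smooth_on_compose:
  fixes g :: "'a::real_normed_vector \<Rightarrow> 'b::euclidean_space"
  shows "open S \<Longrightarrow> open T \<Longrightarrow> g ` S \<subseteq> T \<Longrightarrow> smooth_on T f \<Longrightarrow> smooth_on S g \<Longrightarrow> smooth_on S (\<lambda>x. f (g x))"
  unfolding smooth_on_def by (auto intro: Ck_on_compose)

lemma smooth_on_euclidean:
  fixes f :: "'a::real_normed_vector \<Rightarrow> 'b::euclidean_space"
  assumes "open S" "\<And>b. b \<in> Basis \<Longrightarrow> smooth_on S (\<lambda>x. f x \<bullet> b)"
  shows "smooth_on S f"
proof -
  have "smooth_on S (\<lambda>x. \<Sum>b\<in>Basis. (f x \<bullet> b) *\<^sub>R b)"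
    by (intro smooth_on_sum smooth_on_scaleR smooth_on_const assms)
  then show ?thesis by (simp add: euclidean_representation)
qed

lemma smooth_on_vec:
  fixes f :: "'a::real_normed_vector \<Rightarrow> real ^ 'n"
  assumes "open S" "\<And>i. smooth_on S (\<lambda>x. f x $ i)"
  shows "smooth_on S f"
proof (rule smooth_on_euclidean[OF assms(1)])
  fix b :: "real ^ 'n" assume "b \<in> Basis"
  then obtain i where "b = axis i 1" by (auto simp: Basis_vec_def)
  then show "smooth_on S (\<lambda>x. f x \<bullet> b)"
    using assms(2)[of i] by (simp add: inner_axis)
qed

lemma smooth_on_vec_nth:
  fixes f :: "'a::real_normed_vector \<Rightarrow> real ^ 'n"
  shows "open S \<Longrightarrow> smooth_on S f \<Longrightarrow> smooth_on S (\<lambda>x. f x $ i)"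
  by (rule smooth_on_bounded_linear_compose[OF _ bounded_linear_vec_nth])

lemma smooth_on_UN_open:
  assumes "open S" "\<And>x. x \<in> S \<Longrightarrow> \<exists>T. open T \<and> x \<in> T \<and> smooth_on T f"
  shows "smooth_on S f"
proof -
  have *: "Ck_on k S f" if "\<And>x. x \<in> S \<Longrightarrow> \<exists>T. open T \<and> x \<in> T \<and> Ck_on k T f" for k and f :: "'a \<Rightarrow> 'b"
    using that
  proof (induction k arbitrary: f)
    case 0
    show ?case unfolding Ck_on.simps
    proof (rule continuous_at_imp_continuous_on, rule ballI)
      fix x assume "x \<in> S"
      from 0[OF this] show "continuous (at x) f"
        by (auto simp: continuous_on_eq_continuous_at)
    qed
  next
    case (Suc k)
    have "f differentiable at x" if "x \<in> S" for x
      using Suc.prems[OF that] Ck_on.simps(2) by blast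
    moreover have "Ck_on k S (\<lambda>x. frechet_derivative f (at x) v)" for v
    proof (rule Suc.IH)
      fix x assume "x \<in> S"
      from Suc.prems[OF this] show "\<exists>T. open T \<and> x \<in> T \<and> Ck_on k T (\<lambda>x. frechet_derivative f (at x) v)"
        using Ck_on.simps(2) by blast
    qed
    ultimately show ?case by simp
  qed
  have "Ck_on k S f" for k
  proof (rule *)
    fix x assume "x \<in> S"
    then obtain T where "open T" "x \<in> T" "smooth_on T f" using assms(2) by metis
    then show "\<exists>T. open T \<and> x \<in> T \<and> Ck_on k T f"
      unfolding smooth_on_def by metis
  qed
  then show ?thesis by (simp add: smooth_on_def)
qed

lemma smooth_on_det:
  fixes A :: "'a::real_normed_vector \<Rightarrow> real ^ 'n ^ 'n"
  assumes "open S" "\<And>i j. smooth_on S (\<lambda>x. A x $ i $ j)"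
  shows "smooth_on S (\<lambda>x. det (A x))"
  unfolding det_def by (intro smooth_on_sum smooth_on_mult smooth_on_const smooth_on_prod assms)

text \<open>By Cramer's rule the solution is a quotient of determinants in the entries of A and b.
  Moser's vector field and the inverse of a Jacobian are both seen to be smooth in this way.\<close>

lemma smooth_on_linear_solve:
  fixes A :: "'a::real_normed_vector \<Rightarrow> real ^ 'n ^ 'n"
  assumes "open S" "\<And>i j. smooth_on S (\<lambda>x. A x $ i $ j)" "\<And>i. smooth_on S (\<lambda>x. b x $ i)"
    and "\<And>x. x \<in> S \<Longrightarrow> det (A x) \<noteq> 0" "\<And>x. x \<in> S \<Longrightarrow> A x *v y x = b x"
  shows "smooth_on S y"
proof -
  have "smooth_on S (\<lambda>x. \<chi> k. det (\<chi> i j. if j = k then b x $ i else A x $ i $ j) / det (A x))"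
  proof (rule smooth_on_vec[OF assms(1)], simp, intro smooth_on_divide smooth_on_det assms)
    fix k i j
    show "smooth_on S (\<lambda>x. (\<chi> i j. if j = k then b x $ i else A x $ i $ j) $ i $ j)"
      by (cases "j = k") (use assms in auto)
  qed
  moreover have "(\<chi> k. det (\<chi> i j. if j = k then b x $ i else A x $ i $ j) / det (A x)) = y x" if "x \<in> S" for x
    using cramer[OF assms(4)[OF that], of "y x" "b x"] assms(5)[OF that] by simp
  ultimately show ?thesis
    using smooth_on_cong[OF assms(1)] by (metis (no_types, lifting))
qed

section \<open>Symmetry of second derivatives\<close>

lemma has_derivative_line:
  fixes f :: "'a::real_normed_vector \<Rightarrow> 'b::real_normed_vector"
  assumes "(f has_derivative f') (at (a + s *\<^sub>R u))"
  shows "((\<lambda>s. f (a + s *\<^sub>R u)) has_derivative (\<lambda>h. f' (h *\<^sub>R u))) (at s)"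
proof -
  have "((\<lambda>s. a + s *\<^sub>R u) has_derivative (\<lambda>h. h *\<^sub>R u)) (at s)"
    by (auto intro!: derivative_eq_intros)
  from has_derivative_compose[OF this assms] show ?thesis .
qed

lemma has_real_derivative_line:
  fixes f :: "'a::real_normed_vector \<Rightarrow> real"
  assumes "(f has_derivative f') (at (a + s *\<^sub>R u))"
  shows "((\<lambda>s. f (a + s *\<^sub>R u)) has_real_derivative f' u) (at s)"
proof -
  have "(\<lambda>h. f' (h *\<^sub>R u)) = (\<lambda>h. f' u * h)"
    using linear_cmul[OF has_derivative_linear[OF assms]] by (simp add: mult.commute fun_eq_iff)
  then show ?thesis using has_derivative_line[OF assms] by (simp add: has_field_derivative_def)
qed

text \<open>The mean value theorem is applied to the second difference over the parallelogram
  spanned by h u and h v, once in each direction. The left side is symmetric in u and v, the right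
  side is not visibly so.\<close>

lemma second_difference_mvt:
  fixes f :: "'a::real_normed_vector \<Rightarrow> real"
  assumes C: "Ck_on (Suc (Suc 0)) S f" and h: "0 < h"
    and S: "\<And>s t. 0 \<le> s \<Longrightarrow> s \<le> h \<Longrightarrow> 0 \<le> t \<Longrightarrow> t \<le> h \<Longrightarrow> x + s *\<^sub>R u + t *\<^sub>R v \<in> S"
  shows "\<exists>s t. 0 \<le> s \<and> s \<le> h \<and> 0 \<le> t \<and> t \<le> h \<and>
    f (x + h *\<^sub>R u + h *\<^sub>R v) - f (x + h *\<^sub>R u) - f (x + h *\<^sub>R v) + f x =
    h\<^sup>2 * frechet_derivative (\<lambda>y. frechet_derivative f (at y) u) (at (x + s *\<^sub>R u + t *\<^sub>R v)) v"
proof -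
  let ?D = "\<lambda>y. frechet_derivative f (at y) u"
  let ?g = "\<lambda>s. f ((x + h *\<^sub>R v) + s *\<^sub>R u) - f (x + s *\<^sub>R u)"
  have S1: "(x + h *\<^sub>R v) + s *\<^sub>R u \<in> S" "x + s *\<^sub>R u \<in> S" if "0 \<le> s" "s \<le> h" for s
    using S[of s h] S[of s 0] that h by (simp_all add: algebra_simps)
  have "DERIV ?g s :> ?D ((x + h *\<^sub>R v) + s *\<^sub>R u) - ?D (x + s *\<^sub>R u)" if "0 \<le> s" "s \<le> h" for s
    by (intro DERIV_diff has_real_derivative_line Ck_on_SucD[OF C] S1 that)
  from MVT2[OF h this] obtain s where s: "0 < s" "s < h"
    "?g h - ?g 0 = (h - 0) * (?D ((x + h *\<^sub>R v) + s *\<^sub>R u) - ?D (x + s *\<^sub>R u))" by auto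
  have C': "Ck_on (Suc 0) S ?D" using C by simp
  have S2: "(x + s *\<^sub>R u) + t *\<^sub>R v \<in> S" if "0 \<le> t" "t \<le> h" for t
    using S[of s t] s that by simp
  have "DERIV (\<lambda>t. ?D ((x + s *\<^sub>R u) + t *\<^sub>R v)) t :> frechet_derivative ?D (at ((x + s *\<^sub>R u) + t *\<^sub>R v)) v"
    if "0 \<le> t" "t \<le> h" for t
    by (intro has_real_derivative_line Ck_on_SucD[OF C'] S2 that)
  from MVT2[OF h this] obtain t where t: "0 < t" "t < h"
    "?D ((x + s *\<^sub>R u) + h *\<^sub>R v) - ?D ((x + s *\<^sub>R u) + 0 *\<^sub>R v) =
      (h - 0) * frechet_derivative ?D (at ((x + s *\<^sub>R u) + t *\<^sub>R v)) v" by auto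
  have "f (x + h *\<^sub>R u + h *\<^sub>R v) - f (x + h *\<^sub>R u) - f (x + h *\<^sub>R v) + f x = ?g h - ?g 0"
    by (simp add: algebra_simps)
  also have "\<dots> = h * (h * frechet_derivative ?D (at ((x + s *\<^sub>R u) + t *\<^sub>R v)) v)"
    using s(3) t(3) by (simp add: add.assoc add.commute add.left_commute)
  finally show ?thesis using s t by (intro exI[of _ s] exI[of _ t]) (auto simp: power2_eq_square)
qed

text \<open>Both orders of differentiation, taken at suitable points of a small parallelogram at x,
  equal the same second difference divided by h^2; continuity moves these points to x.\<close>

lemma symmetric_second_derivative_real:
  fixes f :: "'a::real_normed_vector \<Rightarrow> real"
  assumes C: "Ck_on (Suc (Suc 0)) S f" and S: "open S" "x \<in> S"
  shows "frechet_derivative (\<lambda>y. frechet_derivative f (at y) u) (at x) v =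
         frechet_derivative (\<lambda>y. frechet_derivative f (at y) v) (at x) u"
proof -
  let ?D = "\<lambda>u v y. frechet_derivative (\<lambda>y. frechet_derivative f (at y) u) (at y) v"
  have cont: "continuous (at x) (?D u v)" for u v
    using C S by (simp add: continuous_on_eq_continuous_at)
  have "\<bar>?D u v x - ?D v u x\<bar> \<le> 0"
  proof (rule field_le_epsilon)
    fix e :: real assume e: "0 < e"
    have "\<exists>d>0. ball x d \<subseteq> S \<and> (\<forall>y\<in>ball x d. \<bar>?D u v y - ?D u v x\<bar> < e/2) \<and> (\<forall>y\<in>ball x d. \<bar>?D v u y - ?D v u x\<bar> < e/2)"
    proof -
      obtain d1 where d1: "d1 > 0" "ball x d1 \<subseteq> S" using S openE by blast
      obtain d2 where d2: "d2 > 0" "\<And>y. dist y x < d2 \<Longrightarrow> dist (?D u v y) (?D u v x) < e/2"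
        using cont[of u v, unfolded continuous_at_eps_delta] e by (metis half_gt_zero)
      obtain d3 where d3: "d3 > 0" "\<And>y. dist y x < d3 \<Longrightarrow> dist (?D v u y) (?D v u x) < e/2"
        using cont[of v u, unfolded continuous_at_eps_delta] e by (metis half_gt_zero)
      show ?thesis
        by (rule exI[of _ "min d1 (min d2 d3)"]) (use d1 d2 d3 in \<open>auto simp: dist_commute dist_real_def subset_iff\<close>)
    qed
    then obtain d where d: "d > 0" "ball x d \<subseteq> S" "\<And>y. y \<in> ball x d \<Longrightarrow> \<bar>?D u v y - ?D u v x\<bar> < e/2"
      "\<And>y. y \<in> ball x d \<Longrightarrow> \<bar>?D v u y - ?D v u x\<bar> < e/2" by blast
    \<comment> \<open>This size keeps the whole parallelogram inside the ball of radius d; the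
      summand 1 prevents a division by zero when u = v = 0.\<close>
    define h where "h = d / (2 * (norm u + norm v + 1))"
    have nn: "norm u + norm v + 1 > 0" using norm_ge_zero[of u] norm_ge_zero[of v] by linarith
    then have h: "h > 0" using d by (simp add: h_def)
    have hd: "h * (norm u + norm v) < d"
    proof -
      have "h * (norm u + norm v) \<le> h * (norm u + norm v + 1)" using h by (intro mult_left_mono) auto
      also have "\<dots> = d / 2" using nn by (simp add: h_def field_simps)
      finally show ?thesis using d by simp
    qed
    have inb: "x + s *\<^sub>R u + t *\<^sub>R v \<in> ball x d" if "0 \<le> s" "s \<le> h" "0 \<le> t" "t \<le> h" for s t
    proof -
      have "norm (s *\<^sub>R u + t *\<^sub>R v) \<le> norm (s *\<^sub>R u) + norm (t *\<^sub>R v)" by (rule norm_triangle_ineq)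
      also have "\<dots> \<le> h * norm u + h * norm v" using that by (intro add_mono) (auto intro: mult_right_mono)
      also have "\<dots> < d" using hd by (simp add: algebra_simps)
      finally show ?thesis unfolding mem_ball dist_commute[of x] by (simp add: dist_norm add.assoc)
    qed
    have inb': "x + s *\<^sub>R v + t *\<^sub>R u \<in> ball x d" if "0 \<le> s" "s \<le> h" "0 \<le> t" "t \<le> h" for s t
      using inb[of t s] that by (simp add: add.assoc add.commute add.left_commute)
    obtain s t where st: "0 \<le> s" "s \<le> h" "0 \<le> t" "t \<le> h"
      "f (x + h *\<^sub>R u + h *\<^sub>R v) - f (x + h *\<^sub>R u) - f (x + h *\<^sub>R v) + f x = h\<^sup>2 * ?D u v (x + s *\<^sub>R u + t *\<^sub>R v)"
      using second_difference_mvt[OF C h, of x u v] inb d(2) by blast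
    obtain s' t' where st': "0 \<le> s'" "s' \<le> h" "0 \<le> t'" "t' \<le> h"
      "f (x + h *\<^sub>R v + h *\<^sub>R u) - f (x + h *\<^sub>R v) - f (x + h *\<^sub>R u) + f x = h\<^sup>2 * ?D v u (x + s' *\<^sub>R v + t' *\<^sub>R u)"
      using second_difference_mvt[OF C h, of x v u] inb' d(2) by blast
    have "h\<^sup>2 * ?D u v (x + s *\<^sub>R u + t *\<^sub>R v) = h\<^sup>2 * ?D v u (x + s' *\<^sub>R v + t' *\<^sub>R u)"
    proof -
      have "x + h *\<^sub>R v + h *\<^sub>R u = x + h *\<^sub>R u + h *\<^sub>R v" by (simp add: algebra_simps)
      note eq = this
      show ?thesis using st(5) st'(5) unfolding eq by linarith
    qed
    then have "?D u v (x + s *\<^sub>R u + t *\<^sub>R v) = ?D v u (x + s' *\<^sub>R v + t' *\<^sub>R u)" using h by simp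
    then show "\<bar>?D u v x - ?D v u x\<bar> \<le> 0 + e"
      using d(3)[OF inb[OF st(1-4)]] d(4)[OF inb'[OF st'(1-4)]] by argo
  qed
  then show ?thesis by simp
qed

lemma frechet_derivative_inner:
  assumes "f differentiable (at x)"
  shows "frechet_derivative (\<lambda>y. f y \<bullet> b) (at x) v = frechet_derivative f (at x) v \<bullet> b"
  using frechet_at[OF has_derivative_inner_left[OF iffD1[OF frechet_derivative_works assms]]] by metis

lemma symmetric_second_derivative:
  fixes f :: "'a::real_normed_vector \<Rightarrow> 'b::euclidean_space"
  assumes sm: "smooth_on S f" and S: "open S" "x \<in> S"
  shows "frechet_derivative (\<lambda>y. frechet_derivative f (at y) u) (at x) v =
         frechet_derivative (\<lambda>y. frechet_derivative f (at y) v) (at x) u"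
proof (rule euclidean_eqI)
  fix b :: 'b
  let ?f = "\<lambda>y. f y \<bullet> b"
  have smb: "smooth_on S ?f"
    by (rule smooth_on_bounded_linear_compose[OF S(1) bounded_linear_inner_left sm])
  have 1: "frechet_derivative ?f (at y) u = frechet_derivative f (at y) u \<bullet> b" if "y \<in> S" for y u
    by (rule frechet_derivative_inner) (use smooth_on_has_derivative[OF sm that] differentiable_def in blast)
  have 2: "frechet_derivative (\<lambda>y. frechet_derivative ?f (at y) u) (at x) v =
        frechet_derivative (\<lambda>y. frechet_derivative f (at y) u) (at x) v \<bullet> b" for u v
  proof -
    have d: "((\<lambda>y. frechet_derivative f (at y) u) has_derivative frechet_derivative (\<lambda>y. frechet_derivative f (at y) u) (at x)) (at x)"
      by (rule smooth_on_has_derivative[OF smooth_on_frechet[OF sm] S(2)])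
    have "((\<lambda>y. frechet_derivative f (at y) u \<bullet> b) has_derivative (\<lambda>v. frechet_derivative (\<lambda>y. frechet_derivative f (at y) u) (at x) v \<bullet> b)) (at x)"
      by (rule has_derivative_inner_left[OF d])
    then have "((\<lambda>y. frechet_derivative ?f (at y) u) has_derivative (\<lambda>v. frechet_derivative (\<lambda>y. frechet_derivative f (at y) u) (at x) v \<bullet> b)) (at x)"
      by (rule has_derivative_transform_within_open[OF _ S]) (simp add: 1)
    from frechet_at[OF this] show ?thesis by simp
  qed
  show "frechet_derivative (\<lambda>y. frechet_derivative f (at y) u) (at x) v \<bullet> b =
         frechet_derivative (\<lambda>y. frechet_derivative f (at y) v) (at x) u \<bullet> b"
    using symmetric_second_derivative_real[of S ?f x u v] smb S unfolding 2 smooth_on_def by metis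
qed

section \<open>Differentiation under the integral sign\<close>

lemma frechet_derivative_Pair_snd:
  assumes "(g has_derivative D) (at (s, x))" "((\<lambda>x. g (s, x)) has_derivative d) (at x)"
  shows "D (0, v) = d v"
proof -
  have "((\<lambda>y. (s, y)) has_derivative (\<lambda>v. (0, v))) (at x)" by (auto intro!: derivative_eq_intros)
  from has_derivative_compose[OF this assms(1)]
  have "((\<lambda>x. g (s, x)) has_derivative (\<lambda>v. D (0, v))) (at x)" .
  from has_derivative_unique[OF this assms(2)] show ?thesis by metis
qed

text \<open>The integration variable is treated as a further coordinate of g, so that a single
  notion of smoothness on a product covers integrand and derivative; only directions (0, v)
  enter.\<close>

lemma has_derivative_integral_param:
  fixes g :: "real \<times> 'a::euclidean_space \<Rightarrow> 'b::euclidean_space"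
  assumes I: "{0..1} \<subseteq> I" and S: "open S" "convex S" and C: "Ck_on (Suc 0) (I \<times> S) g" and x: "x \<in> S"
  shows "((\<lambda>x. integral {0..1} (\<lambda>s. g (s, x))) has_derivative
    (\<lambda>v. integral {0..1} (\<lambda>s. frechet_derivative g (at (s, x)) (0, v)))) (at x)"
proof -
  let ?D = "\<lambda>p. frechet_derivative g (at p)"
  have d: "(g has_derivative ?D p) (at p)" if "p \<in> I \<times> S" for p
    using Ck_on_SucD[OF C that] .
  have lin: "linear (\<lambda>v. ?D p (0, v))" if "p \<in> I \<times> S" for p
  proof -
    have "linear (?D p)" using d[OF that] has_derivative_linear by blast
    then show ?thesis unfolding linear_iff by (metis (no_types, lifting) add_Pair add_0 scaleR_Pair scaleR_zero_right)
  qed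
  \<comment> \<open>The Leibniz rule wants the partial derivative as a continuous family of bounded
    operators; in finite dimension continuity may be tested on each basis vector.\<close>
  define F where "F = (\<lambda>x t. Blinfun (\<lambda>v. ?D (t, x) (0, v)))"
  have F: "blinfun_apply (F x t) v = ?D (t, x) (0, v)" if "x \<in> S" "t \<in> {0..1}" for x t v
    unfolding F_def using lin[of "(t,x)"] that I
    by (subst bounded_linear_Blinfun_apply) (auto simp: linear_conv_bounded_linear)
  have contD: "continuous_on (I \<times> S) (\<lambda>p. ?D p w)" for w
    using C Ck_on_continuous Ck_on.simps(2) by blast
  have contD': "continuous_on (S \<times> {0..1}) (\<lambda>(x, t). ?D (t, x) (0, v))" for v
    unfolding case_prod_beta
    by (rule continuous_on_compose2[where f="\<lambda>p. (snd p, fst p)" and t="I \<times> S", OF contD])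
      (use I in \<open>auto intro!: continuous_intros\<close>)
  have contF: "continuous_on (S \<times> cbox 0 1) (\<lambda>(x, t). F x t)"
  proof (rule continuous_on_blinfun_componentwise)
    fix i :: 'a
    show "continuous_on (S \<times> cbox 0 1) (\<lambda>p. blinfun_apply (case p of (x, t) \<Rightarrow> F x t) i)"
      by (rule continuous_on_eq[OF contD'[of i, folded box_real]]) (auto simp: F)
  qed
  have contg: "continuous_on {0..1} (\<lambda>s. g (s, x))" if "x \<in> S" for x
    by (rule continuous_on_compose2[OF Ck_on_continuous[OF C]])
      (use I that in \<open>auto intro!: continuous_intros\<close>)
  have "((\<lambda>x. integral (cbox 0 1) (\<lambda>t. g (t, x))) has_derivative blinfun_apply (integral (cbox 0 1) (F x))) (at x within S)"
  proof (rule leibniz_rule[OF _ _ contF x S(2)])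
    fix y t assume y: "y \<in> S" and t: "t \<in> cbox (0::real) 1"
    then have p: "(t, y) \<in> I \<times> S" using I by auto
    have "((\<lambda>y. (t, y)) has_derivative (\<lambda>v. (0, v))) (at y)" by (auto intro!: derivative_eq_intros)
    from has_derivative_compose[OF this d[OF p]]
    have "((\<lambda>x. g (t, x)) has_derivative (\<lambda>v. ?D (t, y) (0, v))) (at y)" .
    moreover have "(\<lambda>v. ?D (t, y) (0, v)) = blinfun_apply (F y t)" using F[OF y] t by auto
    ultimately show "((\<lambda>x. g (t, x)) has_derivative blinfun_apply (F y t)) (at y within S)"
      using has_derivative_at_withinI by metis
  next
    fix y assume "y \<in> S"
    then show "(\<lambda>t. g (t, y)) integrable_on cbox 0 1"
      using integrable_continuous_interval[OF contg] by simp
  qed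
  moreover have "blinfun_apply (integral (cbox 0 1) (F x)) v = integral {0..1} (\<lambda>s. ?D (s, x) (0, v))" for v
  proof -
    have cF: "continuous_on (cbox 0 1) (F x)"
    proof -
      have "continuous_on (cbox 0 1) (\<lambda>t. (x, t))" by (intro continuous_intros)
      from continuous_on_compose2[OF contF this] x show ?thesis by auto
    qed
    have "integral (cbox 0 1) ((\<lambda>B. blinfun_apply B v) \<circ> F x) = blinfun_apply (integral (cbox 0 1) (F x)) v"
      by (rule integral_linear[OF integrable_continuous[OF cF] blinfun.bounded_linear_left])
    moreover have "integral {0..1} (\<lambda>s. ?D (s, x) (0, v)) = integral (cbox 0 1) ((\<lambda>B. blinfun_apply B v) \<circ> F x)"
      unfolding box_real by (rule integral_cong) (simp add: F x)
    ultimately show ?thesis by simp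
  qed
  ultimately show ?thesis using at_within_open[OF x S(1)] by (metis (no_types, lifting) box_real(2) ext)
qed

text \<open>The derivative of the integral is again an integral of the same shape, with a
  directional derivative of g as integrand; hence the induction with arbitrary g.\<close>

lemma Ck_on_integral:
  fixes g :: "real \<times> 'a::euclidean_space \<Rightarrow> 'b::euclidean_space"
  assumes I: "{0..1} \<subseteq> I" and S: "open S" "convex S" and "Ck_on k (I \<times> S) g"
  shows "Ck_on k S (\<lambda>x. integral {0..1} (\<lambda>s. g (s, x)))"
  using assms(4)
proof (induction k arbitrary: g)
  case 0
  have "continuous_on (S \<times> cbox 0 1) (\<lambda>(x, t). g (t, x))"
    unfolding case_prod_beta
    by (rule continuous_on_compose2[where f="\<lambda>p. (snd p, fst p)" and t="I \<times> S"])
      (use 0 I in \<open>auto intro!: continuous_intros\<close>)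
  from integral_continuous_on_param[OF this] show ?case by simp
next
  case (Suc k)
  have C1: "Ck_on (Suc 0) (I \<times> S) g" by (rule Ck_on_le[OF Suc.prems]) simp
  show ?case
  proof (rule Ck_onI[OF S(1) has_derivative_integral_param[OF I S C1]])
    fix v
    show "Ck_on k S (\<lambda>x. integral {0..1} (\<lambda>s. frechet_derivative g (at (s, x)) (0, v)))"
      by (rule Suc.IH[of "\<lambda>p. frechet_derivative g (at p) (0, v)"]) (use Suc.prems in auto)
  qed
qed

lemma smooth_on_integral:
  fixes g :: "real \<times> 'a::euclidean_space \<Rightarrow> 'b::euclidean_space"
  assumes "{0..1} \<subseteq> I" "open S" "convex S" "smooth_on (I \<times> S) g"
  shows "smooth_on S (\<lambda>x. integral {0..1} (\<lambda>s. g (s, x)))"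
  using Ck_on_integral[OF assms(1-3)] assms(4) unfolding smooth_on_def by metis

section \<open>Differential forms\<close>

text \<open>The direction of differentiation comes first and the argument of the form last. The same
  holds for \<open>dform2\<close>, so that in these terms closedness is an alternating sum over the
  choice of the first slot.\<close>

definition dform1 :: "'a::euclidean_space form1 \<Rightarrow> 'a \<Rightarrow> 'a \<Rightarrow> 'a \<Rightarrow> real" where
  "dform1 \<beta> x h u = frechet_derivative (\<lambda>y. \<beta> y u) (at x) h"

definition dform2 :: "'a::euclidean_space form2 \<Rightarrow> 'a \<Rightarrow> 'a \<Rightarrow> 'a \<Rightarrow> 'a \<Rightarrow> real" where
  "dform2 \<omega> x h u v = frechet_derivative (\<lambda>y. \<omega> y u v) (at x) h"

lemma ext_deriv_alt: "ext_deriv \<beta> x u v = dform1 \<beta> x u v - dform1 \<beta> x v u"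
  by (simp add: ext_deriv_def dform1_def)

lemma one_form_onD:
  assumes "one_form_on U \<beta>"
  shows "x \<in> U \<Longrightarrow> linear (\<beta> x)" "smooth_on U (\<lambda>x. \<beta> x v)"
  using assms by (auto simp: one_form_on_def)

lemma two_form_onD:
  assumes "two_form_on U \<omega>"
  shows "x \<in> U \<Longrightarrow> bilinear (\<omega> x)" "x \<in> U \<Longrightarrow> \<omega> x v v = 0" "smooth_on U (\<lambda>x. \<omega> x u v)"
  using assms by (auto simp: two_form_on_def)

lemma bilinear_alternating_antisym:
  fixes B :: "'a::real_vector \<Rightarrow> 'a \<Rightarrow> real"
  assumes "bilinear B" "\<And>v. B v v = 0"
  shows "B u v = - B v u"
proof -
  have "B (u + v) (u + v) = B u u + B u v + (B v u + B v v)"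
    unfolding bilinear_ladd[OF assms(1)] bilinear_radd[OF assms(1)] by simp
  then show ?thesis using assms(2)[of u] assms(2)[of v] assms(2)[of "u + v"] by linarith
qed

lemma two_form_on_antisym: "two_form_on U \<omega> \<Longrightarrow> x \<in> U \<Longrightarrow> \<omega> x u v = - \<omega> x v u"
  using bilinear_alternating_antisym two_form_onD by metis

lemma one_form_has_derivative_at:
  "one_form_on U \<beta> \<Longrightarrow> x \<in> U \<Longrightarrow> ((\<lambda>y. \<beta> y u) has_derivative (\<lambda>h. dform1 \<beta> x h u)) (at x)"
  unfolding dform1_def using smooth_on_has_derivative[OF one_form_onD(2)] .

lemma two_form_has_derivative_at:
  "two_form_on U \<omega> \<Longrightarrow> x \<in> U \<Longrightarrow> ((\<lambda>y. \<omega> y u v) has_derivative (\<lambda>h. dform2 \<omega> x h u v)) (at x)"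
  unfolding dform2_def using smooth_on_has_derivative[OF two_form_onD(3)] .

lemma bilinear_eq_sum_Basis:
  fixes B :: "'a::euclidean_space \<Rightarrow> 'b::euclidean_space \<Rightarrow> real"
  assumes "bilinear B"
  shows "B u v = (\<Sum>i\<in>Basis. \<Sum>j\<in>Basis. (u \<bullet> i) * (v \<bullet> j) * B i j)"
proof -
  have "B u v = (\<Sum>i\<in>Basis. (u \<bullet> i) *\<^sub>R B i v)"
    by (rule linear_eq_sum_Basis) (use assms bilinear_def in blast)
  also have "\<dots> = (\<Sum>i\<in>Basis. (u \<bullet> i) *\<^sub>R (\<Sum>j\<in>Basis. (v \<bullet> j) *\<^sub>R B i j))"
    by (intro sum.cong refl arg_cong[where f="scaleR _"] linear_eq_sum_Basis) (use assms bilinear_def in blast)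
  finally show ?thesis by (simp add: sum_distrib_left mult.assoc)
qed

lemma linear_dform1_left: "one_form_on U \<beta> \<Longrightarrow> x \<in> U \<Longrightarrow> linear (\<lambda>h. dform1 \<beta> x h u)"
  using has_derivative_linear[OF one_form_has_derivative_at] .

lemma linear_dform2_left: "two_form_on U \<omega> \<Longrightarrow> x \<in> U \<Longrightarrow> linear (\<lambda>h. dform2 \<omega> x h u v)"
  using has_derivative_linear[OF two_form_has_derivative_at] .

text \<open>Linearity in u survives differentiation in the base point because it holds on the whole
  open set U.\<close>

lemma dform1_eq_sum:
  assumes "open U" "one_form_on U \<beta>" "x \<in> U"
  shows "dform1 \<beta> x h u = (\<Sum>i\<in>Basis. (u \<bullet> i) * dform1 \<beta> x h i)"
proof -
  have "((\<lambda>y. \<Sum>i\<in>Basis. (u \<bullet> i) * \<beta> y i) has_derivative (\<lambda>h. \<Sum>i\<in>Basis. (u \<bullet> i) * dform1 \<beta> x h i)) (at x)"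
    by (intro has_derivative_sum has_derivative_mult_right one_form_has_derivative_at[OF assms(2,3)])
  then have "((\<lambda>y. \<beta> y u) has_derivative (\<lambda>h. \<Sum>i\<in>Basis. (u \<bullet> i) * dform1 \<beta> x h i)) (at x)"
    by (rule has_derivative_transform_within_open[OF _ assms(1,3)])
      (use linear_eq_sum_Basis[OF one_form_onD(1)[OF assms(2)]] in simp)
  from frechet_at[OF this] show ?thesis unfolding dform1_def by metis
qed

lemma dform2_eq_sum:
  assumes "open U" "two_form_on U \<omega>" "x \<in> U"
  shows "dform2 \<omega> x h u v = (\<Sum>i\<in>Basis. \<Sum>j\<in>Basis. (u \<bullet> i) * (v \<bullet> j) * dform2 \<omega> x h i j)"
proof -
  have "((\<lambda>y. \<Sum>i\<in>Basis. \<Sum>j\<in>Basis. (u \<bullet> i) * (v \<bullet> j) * \<omega> y i j) has_derivative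
      (\<lambda>h. \<Sum>i\<in>Basis. \<Sum>j\<in>Basis. (u \<bullet> i) * (v \<bullet> j) * dform2 \<omega> x h i j)) (at x)"
    by (intro has_derivative_sum has_derivative_mult_right two_form_has_derivative_at[OF assms(2,3)])
  then have "((\<lambda>y. \<omega> y u v) has_derivative (\<lambda>h. \<Sum>i\<in>Basis. \<Sum>j\<in>Basis. (u \<bullet> i) * (v \<bullet> j) * dform2 \<omega> x h i j)) (at x)"
    by (rule has_derivative_transform_within_open[OF _ assms(1,3)])
      (use bilinear_eq_sum_Basis[OF two_form_onD(1)[OF assms(2)]] in simp)
  from frechet_at[OF this] show ?thesis unfolding dform2_def by metis
qed

text \<open>A product rule with three factors: the base point and the two vectors may all vary.
  Expansion over \<open>Basis\<close> reduces it to the scalar rule.\<close>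

lemma two_form_has_derivative:
  fixes f a b :: "'c::real_normed_vector \<Rightarrow> 'a::euclidean_space"
  assumes U: "open U" "two_form_on U \<omega>" "f x \<in> U"
    and f: "(f has_derivative f') (at x)" and a: "(a has_derivative a') (at x)" and b: "(b has_derivative b') (at x)"
  shows "((\<lambda>x. \<omega> (f x) (a x) (b x)) has_derivative
     (\<lambda>h. dform2 \<omega> (f x) (f' h) (a x) (b x) + \<omega> (f x) (a' h) (b x) + \<omega> (f x) (a x) (b' h))) (at x)"
proof -
  have d: "((\<lambda>x. \<omega> (f x) i j) has_derivative (\<lambda>h. dform2 \<omega> (f x) (f' h) i j)) (at x)" for i j
    by (rule has_derivative_compose[OF f two_form_has_derivative_at[OF U(2,3)]])
  have c: "continuous (at x) f" by (rule has_derivative_continuous[OF f])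
  obtain T where T: "open T" "x \<in> T" "f ` T \<subseteq> U"
    using c U(1,3) unfolding continuous_at_open by (metis image_subsetI)
  let ?d = "\<lambda>h. \<Sum>i\<in>Basis. \<Sum>j\<in>Basis. (a x \<bullet> i) * (b x \<bullet> j) * dform2 \<omega> (f x) (f' h) i j +
       ((a x \<bullet> i) * (b' h \<bullet> j) + (a' h \<bullet> i) * (b x \<bullet> j)) * \<omega> (f x) i j"
  have "((\<lambda>x. \<Sum>i\<in>Basis. \<Sum>j\<in>Basis. (a x \<bullet> i) * (b x \<bullet> j) * \<omega> (f x) i j) has_derivative ?d) (at x)"
    by (intro has_derivative_sum has_derivative_mult has_derivative_inner_left d a b)
  then have "((\<lambda>x. \<omega> (f x) (a x) (b x)) has_derivative ?d) (at x)"
    by (rule has_derivative_transform_within_open[OF _ T(1,2)])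
      (use bilinear_eq_sum_Basis[OF two_form_onD(1)[OF U(2)]] T(3) in \<open>auto simp: image_subset_iff\<close>)
  moreover have "?d h = dform2 \<omega> (f x) (f' h) (a x) (b x) + \<omega> (f x) (a' h) (b x) + \<omega> (f x) (a x) (b' h)" for h
    using dform2_eq_sum[OF U, of "f' h" "a x" "b x"]
      bilinear_eq_sum_Basis[OF two_form_onD(1)[OF U(2,3)], of "a' h" "b x"]
      bilinear_eq_sum_Basis[OF two_form_onD(1)[OF U(2,3)], of "a x" "b' h"]
    by (simp add: sum.distrib distrib_right)
  ultimately show ?thesis by simp
qed

lemma smooth_on_two_form:
  fixes f a b :: "'c::real_normed_vector \<Rightarrow> 'a::euclidean_space"
  assumes "open S" "open U" "two_form_on U \<omega>" "f ` S \<subseteq> U" "smooth_on S f" "smooth_on S a" "smooth_on S b"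
  shows "smooth_on S (\<lambda>x. \<omega> (f x) (a x) (b x))"
proof -
  have "smooth_on S (\<lambda>x. \<Sum>i\<in>Basis. \<Sum>j\<in>Basis. (a x \<bullet> i) * (b x \<bullet> j) * \<omega> (f x) i j)"
    by (intro smooth_on_sum smooth_on_mult assms(1)
        smooth_on_bounded_linear_compose[OF _ bounded_linear_inner_left assms(6)]
        smooth_on_bounded_linear_compose[OF _ bounded_linear_inner_left assms(7)]
        smooth_on_compose[OF assms(1,2,4) two_form_onD(3)[OF assms(3)] assms(5)])
  moreover have "(\<Sum>i\<in>Basis. \<Sum>j\<in>Basis. (a x \<bullet> i) * (b x \<bullet> j) * \<omega> (f x) i j) = \<omega> (f x) (a x) (b x)" if "x \<in> S" for x
    using bilinear_eq_sum_Basis[OF two_form_onD(1)[OF assms(3)], of "f x" "a x" "b x"] assms(4) that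
    by (simp add: image_subset_iff)
  ultimately show ?thesis
    using smooth_on_cong[OF assms(1), of "\<lambda>x. \<Sum>i\<in>Basis. \<Sum>j\<in>Basis. (a x \<bullet> i) * (b x \<bullet> j) * \<omega> (f x) i j" "\<lambda>x. \<omega> (f x) (a x) (b x)"] by blast
qed

lemma one_form_on_subset: "one_form_on U \<beta> \<Longrightarrow> T \<subseteq> U \<Longrightarrow> one_form_on T \<beta>"
  unfolding one_form_on_def by (metis smooth_on_subset subsetD)

lemma two_form_on_subset: "two_form_on U \<omega> \<Longrightarrow> T \<subseteq> U \<Longrightarrow> two_form_on T \<omega>"
  unfolding two_form_on_def by (metis smooth_on_subset subsetD)

lemma closed_form_on_subset: "closed_form_on U \<omega> \<Longrightarrow> T \<subseteq> U \<Longrightarrow> closed_form_on T \<omega>"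
  unfolding closed_form_on_def by blast

lemma closed_form_on_alt:
  "closed_form_on U \<omega> \<longleftrightarrow> (\<forall>x\<in>U. \<forall>u v w. dform2 \<omega> x u v w - dform2 \<omega> x v u w + dform2 \<omega> x w u v = 0)"
  by (simp add: closed_form_on_def dform2_def)

lemma smooth_on_dform1: "one_form_on U \<beta> \<Longrightarrow> smooth_on U (\<lambda>x. dform1 \<beta> x u v)"
  unfolding dform1_def by (intro smooth_on_frechet one_form_onD)

lemma linear_dform1_right: "open U \<Longrightarrow> one_form_on U \<beta> \<Longrightarrow> x \<in> U \<Longrightarrow> linear (\<lambda>u. dform1 \<beta> x h u)"
  by (subst dform1_eq_sum)
    (auto simp: linear_iff inner_add_left algebra_simps sum.distrib sum_distrib_left)

lemma ext_deriv_two_form: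
  assumes "open U" "one_form_on U \<beta>"
  shows "two_form_on U (ext_deriv \<beta>)"
proof -
  have "bilinear (ext_deriv \<beta> x)" if "x \<in> U" for x
    unfolding bilinear_def ext_deriv_alt
    using linear_dform1_left[OF assms(2) that] linear_dform1_right[OF assms that]
    by (auto intro!: linear_compose_sub)
  moreover have "smooth_on U (\<lambda>x. ext_deriv \<beta> x u v)" for u v
    unfolding ext_deriv_alt by (intro smooth_on_diff smooth_on_dform1 assms)
  ultimately show ?thesis by (simp add: two_form_on_def ext_deriv_alt)
qed

text \<open>The identity dd = 0: the six second derivatives cancel in pairs by symmetry.\<close>

lemma ext_deriv_closed:
  assumes "open U" "one_form_on U \<beta>"
  shows "closed_form_on U (ext_deriv \<beta>)"
  unfolding closed_form_on_alt
proof (intro ballI allI)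
  fix x u v w assume x: "x \<in> U"
  let ?D = "\<lambda>a b c. frechet_derivative (\<lambda>y. frechet_derivative (\<lambda>y. \<beta> y c) (at y) b) (at x) a"
  have sym: "?D a b c = ?D b a c" for a b c
    by (rule symmetric_second_derivative[OF one_form_onD(2)[OF assms(2)] assms(1) x])
  have d: "dform2 (ext_deriv \<beta>) x a b c = ?D a b c - ?D a c b" for a b c
  proof -
    have "((\<lambda>y. dform1 \<beta> y b c - dform1 \<beta> y c b) has_derivative (\<lambda>a. ?D a b c - ?D a c b)) (at x)"
      unfolding dform1_def
      by (intro has_derivative_diff smooth_on_has_derivative[OF smooth_on_frechet[OF one_form_onD(2)[OF assms(2)]] x])
    from frechet_at[OF this] show ?thesis unfolding dform2_def ext_deriv_alt by metis
  qed
  show "dform2 (ext_deriv \<beta>) x u v w - dform2 (ext_deriv \<beta>) x v u w + dform2 (ext_deriv \<beta>) x w u v = 0"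
    unfolding d using sym[where a=u and b=v and c=w] sym[where a=u and b=w and c=v]
      sym[where a=v and b=w and c=u] by linarith
qed

lemma pullback_two_form:
  fixes \<Phi> :: "'a::euclidean_space \<Rightarrow> 'a"
  assumes "open S" "open U" "two_form_on U \<omega>" "\<Phi> ` S \<subseteq> U" "smooth_on S \<Phi>"
  shows "two_form_on S (pullback \<Phi> \<omega>)"
  unfolding two_form_on_def
proof (intro conjI ballI allI)
  fix x assume x: "x \<in> S"
  then have bl: "bilinear (\<omega> (\<Phi> x))" using two_form_onD(1)[OF assms(3)] assms(4) by (simp add: image_subset_iff)
  have l: "linear (frechet_derivative \<Phi> (at x))" by (rule smooth_on_linear_frechet[OF assms(5) x])
  show "bilinear (pullback \<Phi> \<omega> x)"
    using bl l unfolding bilinear_def pullback_def linear_iff by simp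
  show "pullback \<Phi> \<omega> x v v = 0" for v
    unfolding pullback_def using two_form_onD(2)[OF assms(3)] assms(4) x by (simp add: image_subset_iff)
next
  fix u v
  show "smooth_on S (\<lambda>x. pullback \<Phi> \<omega> x u v)"
    unfolding pullback_def by (intro smooth_on_two_form[OF assms] smooth_on_frechet assms)
qed

text \<open>The terms containing second derivatives of \<Phi> cancel in pairs, by their symmetry and
  the antisymmetry of \<omega>; what remains is closedness of \<omega> at \<Phi> x.\<close>

lemma pullback_closed:
  fixes \<Phi> :: "'a::euclidean_space \<Rightarrow> 'a"
  assumes "open S" "open U" "two_form_on U \<omega>" "closed_form_on U \<omega>" "\<Phi> ` S \<subseteq> U" "smooth_on S \<Phi>"
  shows "closed_form_on S (pullback \<Phi> \<omega>)"
  unfolding closed_form_on_alt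
proof (intro ballI allI)
  fix x u v w assume x: "x \<in> S"
  let ?P = "\<lambda>a. frechet_derivative \<Phi> (at x) a"
  let ?Q = "\<lambda>a b. frechet_derivative (\<lambda>y. frechet_derivative \<Phi> (at y) b) (at x) a"
  have pU: "\<Phi> x \<in> U" using assms(5) x by auto
  have sym: "?Q a b = ?Q b a" for a b
    by (rule symmetric_second_derivative[OF assms(6,1) x])
  have d: "dform2 (pullback \<Phi> \<omega>) x a b c = dform2 \<omega> (\<Phi> x) (?P a) (?P b) (?P c) + \<omega> (\<Phi> x) (?Q a b) (?P c) + \<omega> (\<Phi> x) (?P b) (?Q a c)" for a b c
    using frechet_at[OF two_form_has_derivative[OF assms(2,3) pU smooth_on_has_derivative[OF assms(6) x]
        smooth_on_has_derivative[OF smooth_on_frechet[OF assms(6)] x, of b]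
        smooth_on_has_derivative[OF smooth_on_frechet[OF assms(6)] x, of c]]]
    unfolding dform2_def pullback_def by metis
  have anti: "\<omega> (\<Phi> x) a b = - \<omega> (\<Phi> x) b a" for a b by (rule two_form_on_antisym[OF assms(3) pU])
  have cl: "dform2 \<omega> (\<Phi> x) a b c - dform2 \<omega> (\<Phi> x) b a c + dform2 \<omega> (\<Phi> x) c a b = 0" for a b c
    using assms(4) pU unfolding closed_form_on_alt by blast
  show "dform2 (pullback \<Phi> \<omega>) x u v w - dform2 (pullback \<Phi> \<omega>) x v u w + dform2 (pullback \<Phi> \<omega>) x w u v = 0"
    unfolding d using cl[of "?P u" "?P v" "?P w"] sym[of u v] sym[of u w] sym[of v w]
      anti[of "?P u" "?Q w v"] anti[of "?P v" "?Q u w"] anti[of "?Q w u" "?P v"] by simp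
qed

section \<open>A Poincare lemma for weighted dilations\<close>

definition wscale :: "('i::finite \<Rightarrow> nat) \<Rightarrow> real \<Rightarrow> real ^ 'i \<Rightarrow> real ^ 'i" where
  "wscale w s x = (\<chi> i. s ^ w i * x $ i)"

text \<open>The derivative of \<open>wscale\<close> in s. The truncated exponent is harmless: where
  w i = 0 the factor in front vanishes as well.\<close>

definition wscale_deriv :: "('i::finite \<Rightarrow> nat) \<Rightarrow> real \<Rightarrow> real ^ 'i \<Rightarrow> real ^ 'i" where
  "wscale_deriv w s x = (\<chi> i. of_nat (w i) * s ^ (w i - 1) * x $ i)"

lemma linear_wscale: "linear (wscale w s)"
  by (auto simp: linear_iff wscale_def vec_eq_iff algebra_simps)

lemma linear_wscale_deriv: "linear (wscale_deriv w s)"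
  by (auto simp: linear_iff wscale_deriv_def vec_eq_iff algebra_simps)

lemma wscale_1 [simp]: "wscale w 1 x = x"
  by (simp add: wscale_def vec_eq_iff)

lemma wscale_0 [simp]: "(\<And>i. w i \<noteq> 0) \<Longrightarrow> wscale w 0 x = 0"
  by (simp add: wscale_def vec_eq_iff)

lemma wscale_has_derivative:
  "((\<lambda>s. wscale w s x) has_derivative (\<lambda>h. h *\<^sub>R wscale_deriv w s x)) (at s)"
proof -
  have "((\<lambda>s. wscale w s x) has_derivative (\<lambda>h. h *\<^sub>R wscale_deriv w s x)) (at s within UNIV)"
  proof (rule iffD2[OF has_derivative_componentwise_within], rule ballI)
    fix b :: "real ^ 'a" assume "b \<in> Basis"
    then obtain i where b: "b = axis i 1" by (auto simp: Basis_vec_def)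
    show "((\<lambda>s. wscale w s x \<bullet> b) has_derivative (\<lambda>h. h *\<^sub>R wscale_deriv w s x \<bullet> b)) (at s within UNIV)"
      unfolding b inner_axis wscale_def wscale_deriv_def
      by (auto intro!: derivative_eq_intros simp: algebra_simps)
  qed
  then show ?thesis by simp
qed

lemma norm_wscale_le:
  assumes "\<bar>s\<bar> \<le> 2"
  shows "norm (wscale w s x) \<le> (\<Sum>i\<in>UNIV. 2 ^ w i) * norm x"
proof -
  have "norm (wscale w s x) \<le> (\<Sum>i\<in>UNIV. \<bar>wscale w s x $ i\<bar>)" by (rule norm_le_l1_cart)
  also have "\<dots> \<le> (\<Sum>i\<in>UNIV. 2 ^ w i * norm x)"
  proof (rule sum_mono)
    fix i
    have "\<bar>s\<bar> ^ w i * \<bar>x $ i\<bar> \<le> 2 ^ w i * norm x"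
      by (intro mult_mono power_mono component_le_norm_cart) (use assms in auto)
    then show "\<bar>wscale w s x $ i\<bar> \<le> 2 ^ w i * norm x"
      by (simp add: wscale_def abs_mult power_abs)
  qed
  finally show ?thesis by (simp add: sum_distrib_right)
qed

lemma smooth_on_wscale:
  assumes "open S" "smooth_on S f" "smooth_on S g"
  shows "smooth_on S (\<lambda>p. wscale w (f p) (g p))" "smooth_on S (\<lambda>p. wscale_deriv w (f p) (g p))"
proof -
  show "smooth_on S (\<lambda>p. wscale w (f p) (g p))"
    unfolding wscale_def
    by (rule smooth_on_vec[OF assms(1)], simp, intro smooth_on_mult smooth_on_power smooth_on_vec_nth assms)
  show "smooth_on S (\<lambda>p. wscale_deriv w (f p) (g p))"
    unfolding wscale_deriv_def
    by (rule smooth_on_vec[OF assms(1)], simp,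
        intro smooth_on_mult smooth_on_const smooth_on_power smooth_on_vec_nth assms)
qed

text \<open>The homotopy formula for the weighted contraction to 0: \<gamma> integrates \<alpha>,
  contracted with the velocity of the contraction, over the orbit of x. Hence \<gamma> vanishes at x
  whenever \<alpha> vanishes along that orbit. Ordinary dilations would not do, since U9 is a union
  of weighted orbits only.\<close>

lemma weighted_poincare:
  fixes \<alpha> :: "(real ^ 'i::finite) form2"
  assumes U: "open U" "0 \<in> U" "two_form_on U \<alpha>" "closed_form_on U \<alpha>" and w: "\<And>i. w i \<noteq> 0"
  obtains r \<gamma> where "0 < r" "ball 0 r \<subseteq> U" "one_form_on (ball 0 r) \<gamma>"
    "\<And>x u v. x \<in> ball 0 r \<Longrightarrow> ext_deriv \<gamma> x u v = \<alpha> x u v"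
    "\<And>x s. x \<in> ball 0 r \<Longrightarrow> s \<in> {0..1} \<Longrightarrow> wscale w s x \<in> U"
    "\<And>x u. x \<in> ball 0 r \<Longrightarrow> (\<And>s u v. s \<in> {0..1} \<Longrightarrow> \<alpha> (wscale w s x) u v = 0) \<Longrightarrow> \<gamma> x u = 0"
proof -
  obtain R where R: "R > 0" "ball 0 R \<subseteq> U" using U openE by blast
  define K :: real where "K = (\<Sum>i::'i\<in>UNIV. 2 ^ w i)"
  have K: "K > 0" unfolding K_def by (intro sum_pos) auto
  define r where "r = min R (R / K)"
  have r: "r > 0" using R K by (simp add: r_def)
  define S where "S = ball (0 :: real ^ 'i) r"
  have SU: "S \<subseteq> U" using R by (auto simp: S_def r_def)
  have S: "open S" "convex S" by (auto simp: S_def)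
  \<comment> \<open>An open interval around [0,1], so that the integrand is differentiable jointly
    in s and x also at the end points; the bound 2 fits \<open>norm_wscale_le\<close>.\<close>
  define I where "I = {-1<..<2::real}"
  have I: "{0..1} \<subseteq> I" "open I" by (auto simp: I_def)
  have O: "open (I \<times> S)" using I S by (simp add: open_Times)
  have FU: "wscale w s x \<in> U" if "s \<in> I" "x \<in> S" for s x
  proof -
    have "norm (wscale w s x) \<le> K * norm x" using norm_wscale_le[of s w x] that by (auto simp: K_def I_def)
    also have "\<dots> < K * (R / K)" using that K by (intro mult_strict_left_mono) (auto simp: S_def r_def)
    also have "\<dots> = R" using K by simp
    finally show ?thesis using R by (auto simp: subset_iff)
  qed
  define g where "g = (\<lambda>v p. \<alpha> (wscale w (fst p) (snd p)) (wscale_deriv w (fst p) (snd p)) (wscale w (fst p) v))"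
  have smfst: "smooth_on (I \<times> S) fst" "smooth_on (I \<times> S) snd"
    by (intro smooth_on_bounded_linear O bounded_linear_fst bounded_linear_snd)+
  have smg: "smooth_on (I \<times> S) (g v)" for v
    unfolding g_def
  proof (rule smooth_on_two_form[OF O U(1,3)])
    show "(\<lambda>p. wscale w (fst p) (snd p)) ` (I \<times> S) \<subseteq> U" using FU by auto
  qed (intro smooth_on_wscale O smooth_on_const smfst)+
  have dg: "((\<lambda>x. g v (s, x)) has_derivative (\<lambda>h. dform2 \<alpha> (wscale w s x) (wscale w s h) (wscale_deriv w s x) (wscale w s v)
      + \<alpha> (wscale w s x) (wscale_deriv w s h) (wscale w s v))) (at x)" if "s \<in> I" "x \<in> S" for s x v
  proof -
    have "((\<lambda>x. \<alpha> (wscale w s x) (wscale_deriv w s x) (wscale w s v)) has_derivative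
       (\<lambda>h. dform2 \<alpha> (wscale w s x) (wscale w s h) (wscale_deriv w s x) (wscale w s v)
      + \<alpha> (wscale w s x) (wscale_deriv w s h) (wscale w s v) + \<alpha> (wscale w s x) (wscale_deriv w s x) 0)) (at x)"
      by (rule two_form_has_derivative[OF U(1,3)])
        (use FU[OF that] in \<open>auto intro!: linear_imp_has_derivative linear_wscale linear_wscale_deriv\<close>)
    then show ?thesis using bilinear_rzero[OF two_form_onD(1)[OF U(3) FU[OF that]]] by (simp add: g_def)
  qed
  define \<gamma> where "\<gamma> = (\<lambda>x v. integral {0..1} (\<lambda>s. g v (s, x)))"
  have contg: "continuous_on {0..1} (\<lambda>s. g v (s, x))" if "x \<in> S" for x v
    by (rule continuous_on_compose2[OF smooth_on_continuous[OF smg]])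
      (use I that in \<open>auto intro!: continuous_intros\<close>)
  have intg: "(\<lambda>s. g v (s, x)) integrable_on {0..1}" if "x \<in> S" for x v
    by (rule integrable_continuous_interval[OF contg[OF that]])
  have lin: "linear (\<gamma> x)" if x: "x \<in> S" for x
  proof -
    have bl: "bilinear (\<alpha> (wscale w s x))" if "s \<in> {0..1}" for s
      using two_form_onD(1)[OF U(3) FU] x that I by auto
    show ?thesis unfolding linear_iff
    proof (intro conjI allI)
      fix u v
      have "\<gamma> x (u + v) = integral {0..1} (\<lambda>s. g u (s, x) + g v (s, x))"
        unfolding \<gamma>_def by (rule integral_cong) (simp add: g_def linear_add[OF linear_wscale] bilinear_radd[OF bl])
      then show "\<gamma> x (u + v) = \<gamma> x u + \<gamma> x v"
        unfolding \<gamma>_def using integral_add[OF intg[OF x] intg[OF x]] by simp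
    next
      fix c v
      have "\<gamma> x (c *\<^sub>R v) = integral {0..1} (\<lambda>s. c *\<^sub>R g v (s, x))"
        unfolding \<gamma>_def by (rule integral_cong) (simp add: g_def linear_cmul[OF linear_wscale] bilinear_rmul[OF bl])
      then show "\<gamma> x (c *\<^sub>R v) = c *\<^sub>R \<gamma> x v"
        unfolding \<gamma>_def by simp
    qed
  qed
  have one: "one_form_on S \<gamma>"
    unfolding one_form_on_def
  proof (intro conjI ballI allI)
    show "smooth_on S (\<lambda>x. \<gamma> x v)" for v
      unfolding \<gamma>_def by (rule smooth_on_integral[OF I(1) S smg])
  qed (rule lin)
  have der\<gamma>: "dform1 \<gamma> x u v = integral {0..1} (\<lambda>s. dform2 \<alpha> (wscale w s x) (wscale w s u) (wscale_deriv w s x) (wscale w s v)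
      + \<alpha> (wscale w s x) (wscale_deriv w s u) (wscale w s v))"
     and int\<gamma>: "(\<lambda>s. dform2 \<alpha> (wscale w s x) (wscale w s u) (wscale_deriv w s x) (wscale w s v)
      + \<alpha> (wscale w s x) (wscale_deriv w s u) (wscale w s v)) integrable_on {0..1}"
     if x: "x \<in> S" for x u v
  proof -
    have C: "Ck_on (Suc 0) (I \<times> S) (g v)" using smg unfolding smooth_on_def by blast
    have e: "frechet_derivative (g v) (at (s, x)) (0, u) = dform2 \<alpha> (wscale w s x) (wscale w s u) (wscale_deriv w s x) (wscale w s v)
      + \<alpha> (wscale w s x) (wscale_deriv w s u) (wscale w s v)" if "s \<in> {0..1}" for s
      by (rule frechet_derivative_Pair_snd[OF smooth_on_has_derivative[OF smg] dg]) (use that I x in auto)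
    have "dform1 \<gamma> x u v = integral {0..1} (\<lambda>s. frechet_derivative (g v) (at (s, x)) (0, u))"
      unfolding dform1_def \<gamma>_def using frechet_at[OF has_derivative_integral_param[OF I(1) S C x]] by metis
    also have "\<dots> = integral {0..1} (\<lambda>s. dform2 \<alpha> (wscale w s x) (wscale w s u) (wscale_deriv w s x) (wscale w s v)
      + \<alpha> (wscale w s x) (wscale_deriv w s u) (wscale w s v))"
      by (rule integral_cong) (simp add: e)
    finally show "dform1 \<gamma> x u v = integral {0..1} (\<lambda>s. dform2 \<alpha> (wscale w s x) (wscale w s u) (wscale_deriv w s x) (wscale w s v)
      + \<alpha> (wscale w s x) (wscale_deriv w s u) (wscale w s v))" .
    have "continuous_on {0..1} (\<lambda>s. frechet_derivative (g v) (at (s, x)) (0, u))"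
      by (rule continuous_on_compose2[OF smooth_on_continuous[OF smooth_on_frechet[OF smg]]])
        (use I x in \<open>auto intro!: continuous_intros\<close>)
    from integrable_eq[OF integrable_continuous_interval[OF this] e]
    show "(\<lambda>s. dform2 \<alpha> (wscale w s x) (wscale w s u) (wscale_deriv w s x) (wscale w s v)
      + \<alpha> (wscale w s x) (wscale_deriv w s u) (wscale w s v)) integrable_on {0..1}" .
  qed
  have ext: "ext_deriv \<gamma> x u v = \<alpha> x u v" if x: "x \<in> S" for x u v
  proof -
    \<comment> \<open>The pullback of \<alpha> under the contraction, evaluated on u and v. It is
      \<alpha> x u v at s = 1 and 0 at s = 0, so it suffices that the integrand of d \<gamma> is its
      s-derivative.\<close>
    let ?h = "\<lambda>s. \<alpha> (wscale w s x) (wscale w s u) (wscale w s v)"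
    let ?h' = "\<lambda>s. dform2 \<alpha> (wscale w s x) (wscale_deriv w s x) (wscale w s u) (wscale w s v) +
       \<alpha> (wscale w s x) (wscale_deriv w s u) (wscale w s v) + \<alpha> (wscale w s x) (wscale w s u) (wscale_deriv w s v)"
    have "(?h has_vector_derivative ?h' s) (at s within {0..1})" if s: "s \<in> {0..1}" for s
    proof -
      have sU: "wscale w s x \<in> U" using FU s x I by auto
      note bl = two_form_onD(1)[OF U(3) sU]
      have "(?h has_derivative (\<lambda>h. dform2 \<alpha> (wscale w s x) (h *\<^sub>R wscale_deriv w s x) (wscale w s u) (wscale w s v) +
       \<alpha> (wscale w s x) (h *\<^sub>R wscale_deriv w s u) (wscale w s v) + \<alpha> (wscale w s x) (wscale w s u) (h *\<^sub>R wscale_deriv w s v))) (at s)"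
        by (rule two_form_has_derivative[OF U(1,3) sU wscale_has_derivative wscale_has_derivative wscale_has_derivative])
      moreover have "dform2 \<alpha> (wscale w s x) (h *\<^sub>R wscale_deriv w s x) (wscale w s u) (wscale w s v) +
       \<alpha> (wscale w s x) (h *\<^sub>R wscale_deriv w s u) (wscale w s v) + \<alpha> (wscale w s x) (wscale w s u) (h *\<^sub>R wscale_deriv w s v) = h *\<^sub>R ?h' s" for h
        using linear_cmul[OF linear_dform2_left[OF U(3) sU]] by (simp add: bilinear_lmul[OF bl] bilinear_rmul[OF bl] distrib_left)
      ultimately show ?thesis unfolding has_vector_derivative_def using has_derivative_at_withinI by simp
    qed
    from fundamental_theorem_of_calculus[OF _ this]
    have "(?h' has_integral ?h 1 - ?h 0) {0..1}" by simp
    then have h': "integral {0..1} ?h' = \<alpha> x u v"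
      using bilinear_lzero[OF two_form_onD(1)[OF U(3,2)]] by (simp add: integral_unique w)
    have "ext_deriv \<gamma> x u v = integral {0..1} (\<lambda>s. (dform2 \<alpha> (wscale w s x) (wscale w s u) (wscale_deriv w s x) (wscale w s v)
      + \<alpha> (wscale w s x) (wscale_deriv w s u) (wscale w s v)) - (dform2 \<alpha> (wscale w s x) (wscale w s v) (wscale_deriv w s x) (wscale w s u)
      + \<alpha> (wscale w s x) (wscale_deriv w s v) (wscale w s u)))"
      unfolding ext_deriv_alt der\<gamma>[OF x] by (rule integral_diff[symmetric]) (rule int\<gamma>[OF x])+
    also have "\<dots> = integral {0..1} ?h'"
    proof (rule integral_cong)
      fix s :: real assume s: "s \<in> {0..1}"
      have sU: "wscale w s x \<in> U" using FU s x I by auto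
      \<comment> \<open>This is Cartan's formula in coordinates: closedness exchanges the derivative
        of \<alpha> along the velocity for derivatives along u and v.\<close>
      have cl: "dform2 \<alpha> (wscale w s x) a b c - dform2 \<alpha> (wscale w s x) b a c + dform2 \<alpha> (wscale w s x) c a b = 0" for a b c
        using U(4) sU unfolding closed_form_on_alt by blast
      show "dform2 \<alpha> (wscale w s x) (wscale w s u) (wscale_deriv w s x) (wscale w s v)
      + \<alpha> (wscale w s x) (wscale_deriv w s u) (wscale w s v) - (dform2 \<alpha> (wscale w s x) (wscale w s v) (wscale_deriv w s x) (wscale w s u)
      + \<alpha> (wscale w s x) (wscale_deriv w s v) (wscale w s u)) = ?h' s"
        using cl[of "wscale_deriv w s x" "wscale w s u" "wscale w s v"]
          two_form_on_antisym[OF U(3) sU, of "wscale w s u" "wscale_deriv w s v"] by linarith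
    qed
    finally show ?thesis using h' by simp
  qed
  have vanish: "\<gamma> x u = 0" if "x \<in> S" "\<And>s u v. s \<in> {0..1} \<Longrightarrow> \<alpha> (wscale w s x) u v = 0" for x u
  proof -
    have "\<gamma> x u = integral {0..1::real} (\<lambda>s. 0)" unfolding \<gamma>_def by (rule integral_cong) (simp add: g_def that(2))
    then show ?thesis by simp
  qed
  show thesis
    by (rule that[OF r, of \<gamma>]) (use SU one ext FU vanish I in \<open>auto simp: S_def[symmetric]\<close>)
qed

section \<open>Ordinary differential equations\<close>

lemma gronwall:
  fixes f :: "real \<Rightarrow> real"
  assumes f: "continuous_on {0..1} f" and L: "0 \<le> L"
    and le: "\<And>t. t \<in> {0..1} \<Longrightarrow> f t \<le> a + L * integral {0..t} f"
    and t: "t \<in> {0..1}"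
  shows "f t \<le> a * exp (L * t)"
proof -
  define g where "g = (\<lambda>t. a + L * integral {0..t} f)"
  have dg: "(g has_real_derivative L * f x) (at x within {0..1})" if "x \<in> {0..1}" for x
    using integral_has_vector_derivative[OF f that] unfolding g_def has_real_derivative_iff_has_vector_derivative[symmetric]
    by (auto intro!: derivative_eq_intros)
  \<comment> \<open>The integrating factor makes this function nonincreasing, which is the whole
    content of the inequality.\<close>
  let ?k = "\<lambda>x. g x * exp (- L * x)"
  have dk: "(?k has_real_derivative L * f x * exp (- L * x) + g x * (- L * exp (- L * x))) (at x within {0..1})" if "x \<in> {0..1}" for x
    by (rule derivative_eq_intros dg that refl | simp)+
  have "?k t \<le> ?k 0"
  proof (rule DERIV_nonpos_imp_decreasing_open[where f="?k" and a=0 and b=t])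
    show "continuous_on {0..t} ?k"
      by (rule continuous_on_subset[OF DERIV_continuous_on[OF dk]]) (use t in auto)
  next
    fix x assume x: "0 < x" "x < t"
    then have x1: "x \<in> {0..1}" "x \<in> {0<..<1}" using t by auto
    have "at x within {0..1} = at x"
      by (rule at_within_nhd[of _ "{0<..<1}" _ UNIV, simplified]) (use x1 in auto)
    then have "(?k has_real_derivative L * f x * exp (- L * x) + g x * (- L * exp (- L * x))) (at x)"
      using dk[OF x1(1)] by simp
    moreover have "L * f x * exp (- L * x) + g x * (- L * exp (- L * x)) \<le> 0"
    proof -
      have "L * (f x - g x) * exp (- L * x) \<le> 0"
        using le[OF x1(1)] L by (auto simp: g_def mult_le_0_iff)
      then show ?thesis by (simp add: algebra_simps)
    qed
    ultimately show "\<exists>y. DERIV ?k x :> y \<and> y \<le> 0" by blast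
  qed (use t in auto)
  also have "?k 0 = a" by (simp add: g_def)
  finally have "g t * exp (- L * t) * exp (L * t) \<le> a * exp (L * t)"
    by (intro mult_right_mono) auto
  then have "g t \<le> a * exp (L * t)" by (simp add: mult.assoc flip: exp_add)
  then show ?thesis using le[OF t] by (simp add: g_def)
qed

lemma integral_equation_continuous:
  fixes f :: "real \<Rightarrow> 'a::euclidean_space"
  assumes "continuous_on {0..1} f" "\<And>t. t \<in> {0..1} \<Longrightarrow> u t = x + integral {0..t} f"
  shows "continuous_on {0..1} u"
proof -
  have "continuous_on {0..1} (\<lambda>t. x + integral {0..t} f)"
    by (intro continuous_intros indefinite_integral_continuous_1 integrable_continuous_interval assms(1))
  then show ?thesis by (rule continuous_on_eq) (simp add: assms(2))
qed

text \<open>The one estimate behind uniqueness, Lipschitz dependence, differentiability and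
  parameter dependence of solutions: initial difference and defect e between the two right-hand
  sides are amplified at most by an exponential.\<close>

lemma integral_equation_compare:
  fixes f g :: "real \<Rightarrow> 'a::euclidean_space"
  assumes f: "continuous_on {0..1} f" and g: "continuous_on {0..1} g"
    and u: "\<And>t. t \<in> {0..1} \<Longrightarrow> u t = x + integral {0..t} f"
    and v: "\<And>t. t \<in> {0..1} \<Longrightarrow> v t = y + integral {0..t} g"
    and L: "0 \<le> L" and e: "0 \<le> e"
    and le: "\<And>s. s \<in> {0..1} \<Longrightarrow> norm (f s - g s) \<le> L * norm (u s - v s) + e"
    and t: "t \<in> {0..1}"
  shows "norm (u t - v t) \<le> (norm (x - y) + e) * exp (L * t)"
proof -
  have cu: "continuous_on {0..1} u" by (rule integral_equation_continuous[OF f u])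
  have cv: "continuous_on {0..1} v" by (rule integral_equation_continuous[OF g v])
  have cn: "continuous_on {0..1} (\<lambda>s. norm (u s - v s))" by (intro continuous_intros cu cv)
  have "norm (u t - v t) \<le> norm (x - y) + e + L * integral {0..t} (\<lambda>s. norm (u s - v s))" if t: "t \<in> {0..1}" for t
  proof -
    have sub: "{0..t} \<subseteq> {0..1}" using t by auto
    have i: "f integrable_on {0..t}" "g integrable_on {0..t}" "(\<lambda>s. L * norm (u s - v s) + e) integrable_on {0..t}"
      "(\<lambda>s. L * norm (u s - v s)) integrable_on {0..t}"
      by (intro integrable_continuous_interval continuous_on_subset[OF _ sub] continuous_intros f g cu cv)+
    have "u t - v t = (x - y) + integral {0..t} (\<lambda>s. f s - g s)"
      using u[OF t] v[OF t] integral_diff[OF i(1,2)] by simp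
    also have "norm \<dots> \<le> norm (x - y) + norm (integral {0..t} (\<lambda>s. f s - g s))" by (rule norm_triangle_ineq)
    also have "norm (integral {0..t} (\<lambda>s. f s - g s)) \<le> integral {0..t} (\<lambda>s. L * norm (u s - v s) + e)"
      by (rule Henstock_Kurzweil_Integration.integral_norm_bound_integral[OF integrable_diff[OF i(1,2)] i(3)])
        (use le sub in auto)
    also have "\<dots> = L * integral {0..t} (\<lambda>s. norm (u s - v s)) + t * e"
      using integral_add[OF i(4) integrable_const_ivl[of e]] t by simp
    also have "t * e \<le> e" using t e by (simp add: mult_left_le_one_le)
    finally show ?thesis by simp
  qed
  from gronwall[OF cn L this t] show ?thesis .
qed

text \<open>Banach's fixed point theorem for exp(-M t) u(t) in place of u(t): in this weighted
  supremum norm the integral operator contracts on all of [0,1], however large L is.\<close>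

lemma picard_global:
  fixes F :: "real \<Rightarrow> 'a::euclidean_space \<Rightarrow> 'a"
  assumes F: "continuous_on ({0..1} \<times> UNIV) (\<lambda>(t, x). F t x)" and L: "0 \<le> L"
    and lip: "\<And>t x y. t \<in> {0..1} \<Longrightarrow> norm (F t x - F t y) \<le> L * norm (x - y)"
  obtains u where "continuous_on {0..1} u" "\<And>t. t \<in> {0..1} \<Longrightarrow> u t = z + integral {0..t} (\<lambda>s. F s (u s))"
proof -
  \<comment> \<open>Clamping time to [0,1] turns functions on the interval into bounded continuous
    functions on the real line, where the complete metric space is at hand.\<close>
  define c :: "real \<Rightarrow> real" where "c = (\<lambda>t. max 0 (min 1 t))"
  have c: "c t \<in> {0..1}" "continuous_on S c" for t S
    unfolding c_def by (auto intro!: continuous_intros)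
  have c_id: "c t = t" if "t \<in> {0..1}" for t using that by (auto simp: c_def)
  \<comment> \<open>The weight is chosen so that L / M \<le> 1/2, the contraction constant.\<close>
  define M where "M = 2 * L + 1"
  have M: "M > 0" using L by (simp add: M_def)
  define G where "G = (\<lambda>v s. F s (exp (M * s) *\<^sub>R v s))"
  define T where "T = (\<lambda>v t. exp (- M * c t) *\<^sub>R (z + integral {0..c t} (G v)))"
  have cF: "continuous_on {0..1} (\<lambda>s. F s (h s))" if "continuous_on {0..1} h" for h
  proof -
    have "continuous_on {0..1} (\<lambda>s. (\<lambda>(t, x). F t x) (s, h s))"
      by (rule continuous_on_compose2[OF F]) (use that in \<open>auto intro!: continuous_intros\<close>)
    then show ?thesis by simp
  qed
  have cG: "continuous_on {0..1} (G v)" if "continuous_on {0..1} v" for v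
    unfolding G_def by (intro cF continuous_intros that)
  have cT: "continuous_on UNIV (T v)" if v: "continuous_on {0..1} v" for v
  proof -
    have "continuous_on UNIV (\<lambda>t. integral {0..c t} (G v))"
      by (rule continuous_on_compose2[OF indefinite_integral_continuous_1[OF integrable_continuous_interval[OF cG[OF v]]]])
        (use c in auto)
    then show ?thesis unfolding T_def by (intro continuous_intros c)
  qed
  have bT: "T v \<in> bcontfun" if v: "continuous_on {0..1} v" for v
  proof -
    have "T v = T v \<circ> c" using c_id[OF c(1)] by (auto simp: T_def)
    then have "range (T v) \<subseteq> T v ` {0..1}" using c(1) by (metis (no_types, lifting) comp_apply image_subset_iff imageI)
    moreover have "bounded (T v ` {0..1})"
      by (intro compact_imp_bounded compact_continuous_image continuous_on_subset[OF cT[OF v]]) auto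
    ultimately show ?thesis unfolding bcontfun_def using cT[OF v] bounded_subset by blast
  qed
  define P where "P = (\<lambda>v :: real \<Rightarrow>\<^sub>C 'a. Bcontfun (T (apply_bcontfun v)))"
  have P: "apply_bcontfun (P v) = T (apply_bcontfun v)" for v
    unfolding P_def by (rule Bcontfun_inverse) (intro bT continuous_on_apply_bcontfun)
  have contr: "dist (P v) (P w) \<le> 1/2 * dist v w" for v w
  proof (rule dist_bound)
    fix t
    let ?d = "dist v w"
    let ?f = "\<lambda>s. G (apply_bcontfun v) s - G (apply_bcontfun w) s"
    have sub: "{0..c t} \<subseteq> {0..1}" using c(1)[of t] by auto
    have i: "G (apply_bcontfun v) integrable_on {0..c t}" for v
      by (rule integrable_continuous_interval[OF continuous_on_subset[OF cG sub]]) simp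
    have hi: "((\<lambda>s. L * ?d * exp (M * s)) has_integral L * ?d / M * exp (M * c t) - L * ?d / M * exp (M * 0)) {0..c t}"
      using M c(1)[of t]
      by (intro fundamental_theorem_of_calculus)
        (auto intro!: derivative_eq_intros simp: has_real_derivative_iff_has_vector_derivative[symmetric])
    have "dist (apply_bcontfun (P v) t) (apply_bcontfun (P w) t) = exp (- M * c t) * norm (integral {0..c t} ?f)"
      unfolding P T_def dist_norm scaleR_right_diff_distrib[symmetric] using integral_diff[OF i i, of v w] by simp
    also have "norm (integral {0..c t} ?f) \<le> integral {0..c t} (\<lambda>s. L * ?d * exp (M * s))"
    proof (rule Henstock_Kurzweil_Integration.integral_norm_bound_integral[OF integrable_diff[OF i i] has_integral_integrable[OF hi]])
      fix s assume "s \<in> {0..c t}"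
      then have s: "s \<in> {0..1}" using sub by auto
      have "norm (?f s) \<le> L * norm (exp (M * s) *\<^sub>R apply_bcontfun v s - exp (M * s) *\<^sub>R apply_bcontfun w s)"
        unfolding G_def by (rule lip[OF s])
      also have "\<dots> = L * exp (M * s) * dist (apply_bcontfun v s) (apply_bcontfun w s)"
        by (simp add: dist_norm flip: scaleR_right_diff_distrib)
      also have "\<dots> \<le> L * exp (M * s) * ?d" by (intro mult_left_mono dist_bounded) (use L in auto)
      finally show "norm (?f s) \<le> L * ?d * exp (M * s)" by (simp add: mult.commute mult.left_commute)
    qed
    also have "\<dots> = L * ?d / M * (exp (M * c t) - 1)"
      using integral_unique[OF hi] by (simp add: right_diff_distrib)
    also have "\<dots> \<le> L * ?d / M * exp (M * c t)" using L M by (intro mult_left_mono) auto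
    also have "exp (- M * c t) * (L * ?d / M * exp (M * c t)) = L / M * ?d"
      by (simp add: exp_minus field_simps)
    also have "\<dots> \<le> 1/2 * ?d" using M L by (intro mult_right_mono) (auto simp: M_def field_simps)
    finally show "dist (apply_bcontfun (P v) t) (apply_bcontfun (P w) t) \<le> 1/2 * ?d" by simp
  qed
  obtain v where v: "P v = v"
    using banach_fix_type[of "1/2" P] contr by auto
  define u where "u = (\<lambda>s. exp (M * s) *\<^sub>R apply_bcontfun v s)"
  show thesis
  proof (rule that)
    show "continuous_on {0..1} u" unfolding u_def by (intro continuous_intros) simp
    fix t :: real assume t: "t \<in> {0..1}"
    have "apply_bcontfun v t = exp (- M * t) *\<^sub>R (z + integral {0..t} (\<lambda>s. F s (u s)))"
      using fun_cong[OF P[of v], of t] unfolding v T_def G_def u_def c_id[OF t] .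
    then show "u t = z + integral {0..t} (\<lambda>s. F s (u s))"
      unfolding u_def by (simp flip: exp_add)
  qed
qed

section \<open>Differentiability of a flow in its initial value\<close>

lemma continuous_on_case_prod:
  assumes "continuous_on (A \<times> B) (\<lambda>(s, x). f s x)" "continuous_on C g" "continuous_on C h"
    "\<And>c. c \<in> C \<Longrightarrow> g c \<in> A" "\<And>c. c \<in> C \<Longrightarrow> h c \<in> B"
  shows "continuous_on C (\<lambda>c. f (g c) (h c))"
  using continuous_on_compose2[OF assms(1) continuous_on_Pair[OF assms(2,3)]] assms(4,5) by auto

lemma compact_uniformly_continuousE:
  assumes "continuous_on K f" "compact K" "0 < (e::real)"
  obtains d where "0 < d" "\<And>p q. p \<in> K \<Longrightarrow> q \<in> K \<Longrightarrow> dist q p < d \<Longrightarrow> dist (f q) (f p) < e"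
  using compact_uniformly_continuous[OF assms(1,2)] assms(3)
  unfolding uniformly_continuous_on_def by metis

lemma norm_linear_le_Basis:
  fixes f :: "'a::euclidean_space \<Rightarrow> 'b::real_normed_vector"
  assumes "linear f" "\<And>b. b \<in> Basis \<Longrightarrow> norm (f b) \<le> e"
  shows "norm (f v) \<le> of_nat DIM('a) * e * norm v"
proof -
  have "norm (f v) = norm (\<Sum>b\<in>Basis. (v \<bullet> b) *\<^sub>R f b)"
    using linear_eq_sum_Basis[OF assms(1), of v] by simp
  also have "\<dots> \<le> (\<Sum>b\<in>Basis. norm ((v \<bullet> b) *\<^sub>R f b))" by (rule norm_sum)
  also have "\<dots> \<le> (\<Sum>b\<in>(Basis :: 'a set). norm v * e)"
    by (rule sum_mono) (auto intro!: mult_mono Basis_le_norm assms(2))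
  finally show ?thesis by (simp add: mult.commute mult.left_commute)
qed

text \<open>Solutions enter through their integral equation, which covers the times 0 and 1 without
  one-sided derivatives. Initial values lie in D and all trajectories in S. Joint continuity of u is
  part of the data: compactness then makes the estimates below uniform in time.\<close>

locale flow_family =
  fixes F :: "real \<Rightarrow> 'a::euclidean_space \<Rightarrow> 'a" and F' :: "real \<Rightarrow> 'a \<Rightarrow> 'a \<Rightarrow> 'a"
    and S D :: "'a set" and u :: "real \<Rightarrow> 'a \<Rightarrow> 'a"
  assumes S: "open S" and D: "open D"
    and contF: "continuous_on ({0..1} \<times> S) (\<lambda>(t, x). F t x)"
    and dF: "\<And>t x. t \<in> {0..1} \<Longrightarrow> x \<in> S \<Longrightarrow> (F t has_derivative F' t x) (at x)"
    and contF': "\<And>v. continuous_on ({0..1} \<times> S) (\<lambda>(t, x). F' t x v)"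
    and contu: "continuous_on ({0..1} \<times> D) (\<lambda>(t, x). u t x)"
    and uS: "\<And>t x. t \<in> {0..1} \<Longrightarrow> x \<in> D \<Longrightarrow> u t x \<in> S"
    and u: "\<And>t x. t \<in> {0..1} \<Longrightarrow> x \<in> D \<Longrightarrow> u t x = x + integral {0..t} (\<lambda>s. F s (u s x))"
begin

lemma contu1: "x \<in> D \<Longrightarrow> continuous_on {0..1} (\<lambda>s. u s x)"
  by (rule continuous_on_case_prod[OF contu continuous_on_id continuous_on_const]) auto

lemma contFu: "x \<in> D \<Longrightarrow> continuous_on {0..1} (\<lambda>s. F s (u s x))"
  by (rule continuous_on_case_prod[OF contF continuous_on_id contu1]) (use uS in auto)

lemma contF'u: "continuous_on ({0..1} \<times> D) (\<lambda>(s, x). F' s (u s x) v)"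
proof -
  have "continuous_on ({0..1} \<times> D) (\<lambda>p. (\<lambda>(t, x). F' t x v) (fst p, (\<lambda>(t, x). u t x) p))"
    by (rule continuous_on_compose2[OF contF'], rule continuous_on_Pair[OF continuous_on_fst[OF continuous_on_id] contu])
      (use uS in auto)
  then show ?thesis by (simp add: case_prod_beta)
qed

lemma contF'u1: "x \<in> D \<Longrightarrow> continuous_on {0..1} (\<lambda>s. F' s (u s x) v)"
  by (rule continuous_on_case_prod[OF contF'u continuous_on_id continuous_on_const]) auto

lemma linF': "t \<in> {0..1} \<Longrightarrow> x \<in> S \<Longrightarrow> linear (F' t x)"
  using dF has_derivative_linear by blast

lemma bound_F'u:
  assumes "x \<in> D"
  obtains B where "0 \<le> B" "\<And>s v. s \<in> {0..1} \<Longrightarrow> norm (F' s (u s x) v) \<le> B * norm v"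
proof -
  have "\<exists>B. \<forall>s\<in>{0..1}. norm (F' s (u s x) b) \<le> B" for b
    using compact_imp_bounded[OF compact_continuous_image[OF contF'u1[OF assms, of b] compact_Icc]]
    by (auto simp: bounded_iff)
  then obtain B where B: "\<And>b s. s \<in> {0..1} \<Longrightarrow> norm (F' s (u s x) b) \<le> B b" by metis
  define C where "C = (\<Sum>b\<in>Basis. \<bar>B b\<bar>)"
  have "norm (F' s (u s x) v) \<le> of_nat DIM('a) * C * norm v" if s: "s \<in> {0..1}" for s v
  proof (rule norm_linear_le_Basis[OF linF'[OF s uS[OF s assms]]])
    fix b :: 'a assume b: "b \<in> Basis"
    have "norm (F' s (u s x) b) \<le> \<bar>B b\<bar>" using B[OF s, of b] by linarith
    also have "\<dots> \<le> C" unfolding C_def by (rule member_le_sum[OF b]) auto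
    finally show "norm (F' s (u s x) b) \<le> C" .
  qed
  moreover have "0 \<le> of_nat DIM('a) * C" by (simp add: C_def sum_nonneg)
  ultimately show thesis using that by blast
qed

text \<open>The first-order expansion of F holds with one and the same d at all times because the
  trajectory of x is compact and the spatial derivative is uniformly continuous near it.\<close>

lemma uniform_linearization:
  assumes x: "x \<in> D" and e: "0 < e"
  obtains d where "0 < d"
    "\<And>s y. s \<in> {0..1} \<Longrightarrow> norm (y - u s x) < d \<Longrightarrow> y \<in> S \<and>
      norm (F s y - F s (u s x) - F' s (u s x) (y - u s x)) \<le> e * norm (y - u s x)"
proof -
  have "compact ((\<lambda>s. u s x) ` {0..1})" by (rule compact_continuous_image[OF contu1[OF x] compact_Icc])
  moreover have "(\<lambda>s. u s x) ` {0..1} \<subseteq> S" using uS x by auto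
  ultimately obtain d0 where d0: "d0 > 0" "(\<Union>y\<in>(\<lambda>s. u s x) ` {0..1}. cball y d0) \<subseteq> S"
    using compact_subset_open_imp_cball_epsilon_subset[OF _ S] by metis
  have inS: "u s x + z \<in> S" if "s \<in> {0..1}" "z \<in> cball 0 d0" for s z
  proof -
    have "u s x + z \<in> cball (u s x) d0" using that by (simp add: dist_norm)
    then show ?thesis using d0(2) that(1) by blast
  qed
  define e' where "e' = e / of_nat DIM('a)"
  have e': "e' > 0" using e by (simp add: e'_def)
  have "\<exists>d>0. \<forall>s\<in>{0..1}. \<forall>z. norm z < d \<longrightarrow> norm (F' s (u s x + z) b - F' s (u s x) b) < e'" for b
  proof -
    let ?G = "\<lambda>(s, z). F' s (u s x + z) b"
    have "continuous_on ({0..1} \<times> cball 0 d0) (\<lambda>p. (\<lambda>(t, x). F' t x b) (fst p, u (fst p) x + snd p))"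
      by (rule continuous_on_compose2[OF contF'])
        (use inS in \<open>auto intro!: continuous_intros continuous_on_compose2[OF contu1[OF x]]\<close>)
    then have c: "continuous_on ({0..1} \<times> cball 0 d0) ?G" by (simp add: case_prod_beta)
    obtain d1 where d1: "d1 > 0"
      "\<And>p q. p \<in> {0..1} \<times> cball 0 d0 \<Longrightarrow> q \<in> {0..1} \<times> cball 0 d0 \<Longrightarrow> dist q p < d1 \<Longrightarrow> dist (?G q) (?G p) < e'"
      by (rule compact_uniformly_continuousE[OF c compact_Times[OF compact_Icc compact_cball] e']) blast
    show ?thesis
    proof (intro exI[of _ "min d0 d1"] conjI ballI allI impI)
      fix s :: real and z :: 'a assume s: "s \<in> {0..1}" and z: "norm z < min d0 d1"
      have "dist (?G (s, z)) (?G (s, 0)) < e'"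
        by (rule d1(2)) (use s z d0 in \<open>auto simp: dist_Pair_Pair\<close>)
      then show "norm (F' s (u s x + z) b - F' s (u s x) b) < e'" by (simp add: dist_norm)
    qed (use d0 d1 in auto)
  qed
  then obtain d1 where d1: "\<And>b. d1 b > 0"
    "\<And>b s z. s \<in> {0..1} \<Longrightarrow> norm z < d1 b \<Longrightarrow> norm (F' s (u s x + z) b - F' s (u s x) b) < e'" by metis
  define d where "d = Min (insert d0 (d1 ` Basis))"
  have d: "d > 0" "d \<le> d0" "\<And>b. b \<in> Basis \<Longrightarrow> d \<le> d1 b"
    using d1(1) d0(1) by (auto simp: d_def intro: min.coboundedI2)
  show thesis
  proof (rule that[OF d(1)], intro conjI)
    fix s y assume s: "s \<in> {0..1}" and y: "norm (y - u s x) < d"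
    have ball: "z \<in> S" if "z \<in> ball (u s x) d" for z
      using inS[OF s, of "z - u s x"] that d by (auto simp: dist_norm norm_minus_commute)
    then show "y \<in> S" using y by (auto simp: dist_norm norm_minus_commute)
    \<comment> \<open>Subtracting the linear part leaves a map with derivative at most e in norm, to
      which the mean value inequality applies.\<close>
    let ?h = "\<lambda>z. F s z - F' s (u s x) z"
    have lin: "linear (F' s (u s x))" using linF' s uS x by blast
    have "norm (?h y - ?h (u s x)) \<le> e * norm (y - u s x)"
    proof (rule differentiable_bound[OF convex_ball[of "u s x" d]])
      fix z assume z: "z \<in> ball (u s x) d"
      show "(?h has_derivative (\<lambda>v. F' s z v - F' s (u s x) v)) (at z within ball (u s x) d)"
        by (intro has_derivative_at_withinI[OF has_derivative_diff] dF s ball z linear_imp_has_derivative lin)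
      show "onorm (\<lambda>v. F' s z v - F' s (u s x) v) \<le> e"
      proof (rule onorm_le)
        fix v
        have "norm (F' s z v - F' s (u s x) v) \<le> of_nat DIM('a) * e' * norm v"
        proof (rule norm_linear_le_Basis)
          show "linear (\<lambda>v. F' s z v - F' s (u s x) v)"
            by (intro linear_compose_sub lin linF' s ball z)
          fix b :: 'a assume b: "b \<in> Basis"
          have "norm (F' s (u s x + (z - u s x)) b - F' s (u s x) b) < e'"
            by (rule d1(2)[OF s]) (use d(3)[OF b] z in \<open>auto simp: dist_norm norm_minus_commute\<close>)
          then show "norm (F' s z b - F' s (u s x) b) \<le> e'" by simp
        qed
        then show "norm (F' s z v - F' s (u s x) v) \<le> e * norm v" by (simp add: e'_def)
      qed
    qed (use y d in \<open>auto simp: dist_norm norm_minus_commute\<close>)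
    then show "norm (F s y - F s (u s x) - F' s (u s x) (y - u s x)) \<le> e * norm (y - u s x)"
      by (simp add: linear_diff[OF lin] algebra_simps)
  qed
qed

lemma uniform_close:
  assumes x: "x \<in> D" and e: "0 < e"
  obtains d where "0 < d" "\<And>y. norm (y - x) < d \<Longrightarrow> y \<in> D \<and> (\<forall>s\<in>{0..1}. norm (u s y - u s x) < e)"
proof -
  obtain d0 where d0: "d0 > 0" "cball x d0 \<subseteq> D" using D x open_contains_cball by blast
  have "continuous_on ({0..1} \<times> cball x d0) (\<lambda>(t, x). u t x)"
    by (rule continuous_on_subset[OF contu]) (use d0 in auto)
  note unif = compact_uniformly_continuousE[OF this compact_Times[OF compact_Icc compact_cball] e]
  obtain d1 where d1: "d1 > 0" "\<And>p q. p \<in> {0..1} \<times> cball x d0 \<Longrightarrow> q \<in> {0..1} \<times> cball x d0 \<Longrightarrow> dist q p < d1 \<Longrightarrow>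
     dist ((\<lambda>(t, x). u t x) q) ((\<lambda>(t, x). u t x) p) < e"
    by (rule unif) blast
  show thesis
  proof (rule that[of "min d0 d1"])
    fix y assume y: "norm (y - x) < min d0 d1"
    have yc: "y \<in> cball x d0" using y by (simp add: dist_norm norm_minus_commute)
    have "norm (u s y - u s x) < e" if "s \<in> {0..1}" for s
      using d1(2)[of "(s, x)" "(s, y)"] that yc y d0 by (simp add: dist_Pair_Pair dist_norm norm_minus_commute)
    then show "y \<in> D \<and> (\<forall>s\<in>{0..1}. norm (u s y - u s x) < e)" using yc d0 by blast
  qed (use d0 d1 in auto)
qed

text \<open>The expansion with error factor 1 makes F Lipschitz with constant B + 1 relative to the
  trajectory of x; comparison of solutions then yields the factor exp (B + 1).\<close>

lemma lipschitz_near: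
  assumes x: "x \<in> D"
  obtains d C where "0 < d" "0 \<le> C" "\<And>y s. norm (y - x) < d \<Longrightarrow> s \<in> {0..1} \<Longrightarrow> norm (u s y - u s x) \<le> C * norm (y - x)"
proof -
  obtain B where B: "0 \<le> B" "\<And>s v. s \<in> {0..1} \<Longrightarrow> norm (F' s (u s x) v) \<le> B * norm v"
    by (rule bound_F'u[OF x]) blast
  obtain d1 where d1: "0 < d1" "\<And>s y. s \<in> {0..1} \<Longrightarrow> norm (y - u s x) < d1 \<Longrightarrow> y \<in> S \<and>
      norm (F s y - F s (u s x) - F' s (u s x) (y - u s x)) \<le> 1 * norm (y - u s x)"
    by (rule uniform_linearization[OF x zero_less_one]) blast
  obtain d2 where d2: "0 < d2" "\<And>y. norm (y - x) < d2 \<Longrightarrow> y \<in> D \<and> (\<forall>s\<in>{0..1}. norm (u s y - u s x) < d1)"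
    by (rule uniform_close[OF x d1(1)]) blast
  show thesis
  proof (rule that[OF d2(1), of "exp (B + 1)"])
    fix y s assume y: "norm (y - x) < d2" and s: "s \<in> {0..(1::real)}"
    have yD: "y \<in> D" using d2(2)[OF y] by blast
    have "norm (u s y - u s x) \<le> (norm (y - x) + 0) * exp ((B + 1) * s)"
    proof (rule integral_equation_compare[OF contFu[OF yD] contFu[OF x] u[OF _ yD] u[OF _ x]])
      fix r assume r: "r \<in> {0..(1::real)}"
      have "norm (F r (u r y) - F r (u r x)) \<le>
        norm (F r (u r y) - F r (u r x) - F' r (u r x) (u r y - u r x)) + norm (F' r (u r x) (u r y - u r x))"
        using norm_triangle_ineq[of "F r (u r y) - F r (u r x) - F' r (u r x) (u r y - u r x)" "F' r (u r x) (u r y - u r x)"] by simp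
      also have "\<dots> \<le> 1 * norm (u r y - u r x) + B * norm (u r y - u r x)"
        using d1(2)[OF r, of "u r y"] d2(2)[OF y] r by (intro add_mono B(2)[OF r]) blast
      finally show "norm (F r (u r y) - F r (u r x)) \<le> (B + 1) * norm (u r y - u r x) + 0" by (simp add: algebra_simps)
    qed (use s B in auto)
    also have "\<dots> \<le> norm (y - x) * exp (B + 1)"
      using s B(1) mult_left_le[of s "B + 1"] by (auto intro!: mult_left_mono)
    finally show "norm (u s y - u s x) \<le> exp (B + 1) * norm (y - x)" by (simp add: mult.commute)
  qed simp
qed

text \<open>The linear equation is solved for each basis vector as initial value and the solutions
  are combined linearly, so that linearity of w t holds by construction.\<close>

lemma variational_solution:
  assumes x: "x \<in> D"
  obtains w where "\<And>v. continuous_on {0..1} (\<lambda>t. w t v)" "\<And>t. t \<in> {0..1} \<Longrightarrow> linear (w t)"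
    "\<And>t v. t \<in> {0..1} \<Longrightarrow> w t v = v + integral {0..t} (\<lambda>s. F' s (u s x) (w s v))"
proof -
  obtain B where B: "0 \<le> B" "\<And>s v. s \<in> {0..1} \<Longrightarrow> norm (F' s (u s x) v) \<le> B * norm v"
    by (rule bound_F'u[OF x]) blast
  have lin: "linear (F' s (u s x))" if "s \<in> {0..1}" for s using linF' that uS x by blast
  have cont: "continuous_on ({0..1} \<times> UNIV) (\<lambda>(s, v). F' s (u s x) v)"
  proof -
    have "continuous_on ({0..1} \<times> UNIV) (\<lambda>p. \<Sum>b\<in>Basis. (snd p \<bullet> b) *\<^sub>R F' (fst p) (u (fst p) x) b)"
      by (intro continuous_intros continuous_on_compose2[OF contF'u1[OF x]]) auto
    then show ?thesis
      by (rule continuous_on_eq) (use linear_eq_sum_Basis[OF lin] in auto)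
  qed
  have "\<exists>w. continuous_on {0..1} w \<and> (\<forall>t\<in>{0..1}. w t = b + integral {0..t} (\<lambda>s. F' s (u s x) (w s)))" for b
  proof -
    have "norm (F' t (u t x) a - F' t (u t x) c) \<le> B * norm (a - c)" if "t \<in> {0..1}" for t a c
      using B(2)[OF that, of "a - c"] by (simp add: linear_diff[OF lin[OF that]])
    from picard_global[OF cont B(1) this] show ?thesis by metis
  qed
  then obtain W where W: "\<And>b. continuous_on {0..1} (W b)"
    "\<And>b t. t \<in> {0..1} \<Longrightarrow> W b t = b + integral {0..t} (\<lambda>s. F' s (u s x) (W b s))" by metis
  define w where "w = (\<lambda>t v. \<Sum>b\<in>Basis. (v \<bullet> b) *\<^sub>R W b t)"
  show thesis
  proof (rule that[of w])
    show cw: "continuous_on {0..1} (\<lambda>t. w t v)" for v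
      unfolding w_def by (intro continuous_intros W)
    show "linear (w t)" for t
      unfolding w_def by (auto simp: linear_iff inner_add_left algebra_simps sum.distrib scaleR_sum_right)
    fix t v assume t: "t \<in> {0..(1::real)}"
    have sub: "{0..t} \<subseteq> {0..1}" using t by auto
    have int: "(\<lambda>s. (v \<bullet> b) *\<^sub>R F' s (u s x) (W b s)) integrable_on {0..t}" for b v
    proof -
      have "continuous_on {0..1} (\<lambda>s. (\<lambda>(s, v). F' s (u s x) v) (s, W b s))"
        by (rule continuous_on_compose2[OF cont]) (use W in \<open>auto intro!: continuous_intros\<close>)
      then have "continuous_on {0..1} (\<lambda>s. (v \<bullet> b) *\<^sub>R F' s (u s x) (W b s))" by (intro continuous_intros) simp
      then show ?thesis by (intro integrable_continuous_interval continuous_on_subset[OF _ sub])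
    qed
    have "w t v = (\<Sum>b\<in>Basis. (v \<bullet> b) *\<^sub>R (b + integral {0..t} (\<lambda>s. F' s (u s x) (W b s))))"
      unfolding w_def using W(2)[OF t] by simp
    also have "\<dots> = v + (\<Sum>b\<in>Basis. integral {0..t} (\<lambda>s. (v \<bullet> b) *\<^sub>R F' s (u s x) (W b s)))"
      by (simp add: scaleR_add_right sum.distrib euclidean_representation)
    also have "\<dots> = v + integral {0..t} (\<lambda>s. \<Sum>b\<in>Basis. (v \<bullet> b) *\<^sub>R F' s (u s x) (W b s))"
      using integral_sum[of Basis "\<lambda>b s. (v \<bullet> b) *\<^sub>R F' s (u s x) (W b s)" "{0..t}"] int by simp
    also have "integral {0..t} (\<lambda>s. \<Sum>b\<in>Basis. (v \<bullet> b) *\<^sub>R F' s (u s x) (W b s)) = integral {0..t} (\<lambda>s. F' s (u s x) (w s v))"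
    proof (rule integral_cong)
      fix s assume "s \<in> {0..t}"
      then have "linear (F' s (u s x))" using lin sub by blast
      then show "(\<Sum>b\<in>Basis. (v \<bullet> b) *\<^sub>R F' s (u s x) (W b s)) = F' s (u s x) (w s v)"
        unfolding w_def by (simp add: linear_sum linear_cmul)
    qed
    finally show "w t v = v + integral {0..t} (\<lambda>s. F' s (u s x) (w s v))" .
  qed
qed

text \<open>The affine approximation \<open>u t x + w t (y - x)\<close> starts at y and satisfies
  the equation of \<open>u t y\<close> up to the first-order remainder of F along the trajectory of
  x. This defect is small compared with y - x by \<open>lipschitz_near\<close>, and comparison
  carries the smallness over to the solutions.\<close>

lemma has_derivative_flow:
  assumes x: "x \<in> D"
    and contw: "\<And>v. continuous_on {0..1} (\<lambda>t. w t v)" and linw: "\<And>t. t \<in> {0..1} \<Longrightarrow> linear (w t)"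
    and w: "\<And>t v. t \<in> {0..1} \<Longrightarrow> w t v = v + integral {0..t} (\<lambda>s. F' s (u s x) (w s v))"
    and t: "t \<in> {0..1}"
  shows "(u t has_derivative w t) (at x)"
  unfolding has_derivative_at_alt
proof (intro conjI allI impI)
  show "bounded_linear (w t)" using linw[OF t] linear_conv_bounded_linear by blast
next
  fix e :: real assume e: "0 < e"
  obtain B where B: "0 \<le> B" "\<And>s v. s \<in> {0..1} \<Longrightarrow> norm (F' s (u s x) v) \<le> B * norm v"
    by (rule bound_F'u[OF x]) blast
  obtain d1 C where d1: "0 < d1" "0 \<le> C" "\<And>y s. norm (y - x) < d1 \<Longrightarrow> s \<in> {0..1} \<Longrightarrow> norm (u s y - u s x) \<le> C * norm (y - x)"
    by (rule lipschitz_near[OF x]) blast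
  \<comment> \<open>Chosen so that the final factor e' C exp B is at most e; C + 1 avoids a division
    by zero.\<close>
  define e' where "e' = e / ((C + 1) * exp B)"
  have e': "e' > 0" using e d1(2) by (simp add: e'_def)
  obtain d2 where d2: "0 < d2" "\<And>s y. s \<in> {0..1} \<Longrightarrow> norm (y - u s x) < d2 \<Longrightarrow> y \<in> S \<and>
      norm (F s y - F s (u s x) - F' s (u s x) (y - u s x)) \<le> e' * norm (y - u s x)"
    by (rule uniform_linearization[OF x e']) blast
  obtain d3 where d3: "0 < d3" "\<And>y. norm (y - x) < d3 \<Longrightarrow> y \<in> D \<and> (\<forall>s\<in>{0..1}. norm (u s y - u s x) < d2)"
    by (rule uniform_close[OF x d2(1)]) blast
  show "\<exists>d>0. \<forall>y. norm (y - x) < d \<longrightarrow> norm (u t y - u t x - w t (y - x)) \<le> e * norm (y - x)"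
  proof (intro exI[of _ "min d1 d3"] conjI allI impI)
    fix y assume y: "norm (y - x) < min d1 d3"
    have yD: "y \<in> D" using d3(2) y by simp
    let ?v = "\<lambda>t. u t x + w t (y - x)"
    let ?g = "\<lambda>s. F s (u s x) + F' s (u s x) (w s (y - x))"
    have cF'w: "continuous_on {0..1} (\<lambda>s. F' s (u s x) (w s (y - x)))"
    proof -
      have "continuous_on {0..1} (\<lambda>s. \<Sum>b\<in>Basis. (w s (y - x) \<bullet> b) *\<^sub>R F' s (u s x) b)"
        by (intro continuous_intros contw contF'u1 x)
      then show ?thesis
        by (rule continuous_on_eq) (use linear_eq_sum_Basis[OF linF'[OF _ uS[OF _ x]]] in auto)
    qed
    have "norm (u t y - ?v t) \<le> (norm (y - y) + e' * C * norm (y - x)) * exp (B * t)"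
    proof (rule integral_equation_compare[OF contFu[OF yD] _ u[OF _ yD]])
      show "continuous_on {0..1} ?g" by (intro continuous_intros contFu x cF'w)
      fix s assume s: "s \<in> {0..(1::real)}"
      have sub: "{0..s} \<subseteq> {0..1}" using s by auto
      have "integral {0..s} ?g = integral {0..s} (\<lambda>s. F s (u s x)) + integral {0..s} (\<lambda>s. F' s (u s x) (w s (y - x)))"
        by (intro integral_add integrable_continuous_interval continuous_on_subset[OF _ sub] contFu x cF'w)
      then show "?v s = y + integral {0..s} ?g" using u[OF s x] w[OF s, of "y - x"] by simp
      have lin: "linear (F' s (u s x))" using linF' s uS x by blast
      have "norm (F s (u s y) - ?g s) = norm ((F s (u s y) - F s (u s x) - F' s (u s x) (u s y - u s x)) + F' s (u s x) (u s y - ?v s))"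
        by (simp add: linear_diff[OF lin] linear_add[OF lin] diff_diff_eq)
      also have "\<dots> \<le> norm (F s (u s y) - F s (u s x) - F' s (u s x) (u s y - u s x)) + norm (F' s (u s x) (u s y - ?v s))"
        by (rule norm_triangle_ineq)
      also have "\<dots> \<le> e' * norm (u s y - u s x) + B * norm (u s y - ?v s)"
      proof (rule add_mono[OF _ B(2)[OF s]])
        have "norm (u s y - u s x) < d2" using d3(2)[of y] y s by fastforce
        from d2(2)[OF s this]
        show "norm (F s (u s y) - F s (u s x) - F' s (u s x) (u s y - u s x)) \<le> e' * norm (u s y - u s x)" by (rule conjunct2)
      qed
      also have "e' * norm (u s y - u s x) \<le> e' * (C * norm (y - x))"
        using e' d1(3)[of y s] y s by (intro mult_left_mono) auto
      finally show "norm (F s (u s y) - ?g s) \<le> B * norm (u s y - ?v s) + e' * C * norm (y - x)" by simp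
    qed (use t B e' d1 in auto)
    also have "\<dots> \<le> e' * C * norm (y - x) * exp B"
      using t B(1) e' d1(2) mult_left_le[of t B] by (auto intro!: mult_left_mono)
    also have "\<dots> \<le> e' * (C + 1) * norm (y - x) * exp B"
      using e' by (intro mult_right_mono mult_left_mono) auto
    also have "\<dots> = e * norm (y - x)" using d1(2) by (simp add: e'_def)
    finally show "norm (u t y - u t x - w t (y - x)) \<le> e * norm (y - x)" by (simp add: algebra_simps)
  qed (use d1 d3 in auto)
qed

end

text \<open>The class \<open>C\<^sup>k\<close> in \<open>x\<close>, with derivatives jointly continuous in \<open>(t, x)\<close> for \<open>t \<in> [0, 1]\<close>.\<close>

primrec tCk :: "nat \<Rightarrow> 'a::real_normed_vector set \<Rightarrow> (real \<Rightarrow> 'a \<Rightarrow> 'b::real_normed_vector) \<Rightarrow> bool" where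
  "tCk 0 D f \<longleftrightarrow> continuous_on ({0..1} \<times> D) (\<lambda>(t, x). f t x)"
| "tCk (Suc k) D f \<longleftrightarrow> continuous_on ({0..1} \<times> D) (\<lambda>(t, x). f t x) \<and>
     (\<forall>t\<in>{0..1}. \<forall>x\<in>D. f t differentiable (at x)) \<and>
     (\<forall>v. tCk k D (\<lambda>t x. frechet_derivative (f t) (at x) v))"

lemma tCk_continuous: "tCk k D f \<Longrightarrow> continuous_on ({0..1} \<times> D) (\<lambda>(t, x). f t x)"
  by (cases k) auto

lemma tCk_has_derivative:
  "tCk (Suc k) D f \<Longrightarrow> t \<in> {0..1} \<Longrightarrow> x \<in> D \<Longrightarrow> (f t has_derivative frechet_derivative (f t) (at x)) (at x)"
  unfolding tCk.simps by (metis frechet_derivative_works)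

lemma tCk_frechet: "tCk (Suc k) D f \<Longrightarrow> tCk k D (\<lambda>t x. frechet_derivative (f t) (at x) v)"
  by simp

lemma tCk_Suc_le: "tCk (Suc k) D f \<Longrightarrow> tCk k D f"
proof (induction k arbitrary: f)
  case (Suc k)
  then show ?case by (metis tCk.simps(2))
qed simp

lemma tCk_cong_aux:
  assumes "open D" "\<And>t x. t \<in> {0..1} \<Longrightarrow> x \<in> D \<Longrightarrow> f t x = g t x" "tCk k D f"
  shows "tCk k D g"
  using assms(2,3)
proof (induction k arbitrary: f g)
  case 0
  from 0(2)[unfolded tCk.simps] have "continuous_on ({0..1} \<times> D) (\<lambda>(t, x). g t x)"
    by (rule continuous_on_eq) (use 0(1) in auto)
  then show ?case by simp
next
  case (Suc k)
  from tCk_continuous[OF Suc.prems(2)] have c: "continuous_on ({0..1} \<times> D) (\<lambda>(t, x). g t x)"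
    by (rule continuous_on_eq) (use Suc.prems(1) in auto)
  have d: "(g t has_derivative frechet_derivative (f t) (at x)) (at x)" if "t \<in> {0..1}" "x \<in> D" for t x
    by (rule has_derivative_transform_within_open[OF tCk_has_derivative[OF Suc.prems(2) that] assms(1) that(2)])
      (use Suc.prems(1) that in auto)
  have "tCk k D (\<lambda>t x. frechet_derivative (g t) (at x) v)" for v
    by (rule Suc.IH[OF _ tCk_frechet[OF Suc.prems(2)]]) (use frechet_at[OF d] in simp)
  moreover have "\<forall>t\<in>{0..1}. \<forall>x\<in>D. g t differentiable (at x)" using d differentiable_def by blast
  ultimately show ?case using c by simp
qed

lemma tCk_I:
  assumes "open D" "continuous_on ({0..1} \<times> D) (\<lambda>(t, x). f t x)"
    "\<And>t x. t \<in> {0..1} \<Longrightarrow> x \<in> D \<Longrightarrow> (f t has_derivative f' t x) (at x)"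
    "\<And>v. tCk k D (\<lambda>t x. f' t x v)"
  shows "tCk (Suc k) D f"
proof -
  have "tCk k D (\<lambda>t x. frechet_derivative (f t) (at x) v)" for v
    by (rule tCk_cong_aux[OF assms(1) _ assms(4)[of v]]) (use frechet_at[OF assms(3)] in simp)
  moreover have "\<forall>t\<in>{0..1}. \<forall>x\<in>D. f t differentiable (at x)" using assms(3) differentiable_def by blast
  ultimately show ?thesis using assms(2) by simp
qed

lemma tCk_add:
  assumes "open D" "tCk k D f" "tCk k D g"
  shows "tCk k D (\<lambda>t x. f t x + g t x)"
  using assms(2,3)
proof (induction k arbitrary: f g)
  case 0
  then show ?case by (simp add: case_prod_beta continuous_on_add)
next
  case (Suc k)
  show ?case
  proof (rule tCk_I[OF assms(1)])
    show "continuous_on ({0..1} \<times> D) (\<lambda>(t, x). f t x + g t x)"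
      using continuous_on_add[OF tCk_continuous[OF Suc.prems(1)] tCk_continuous[OF Suc.prems(2)]] by (simp add: case_prod_beta)
  next
    fix t x assume "t \<in> {0..(1::real)}" "x \<in> D"
    then show "((\<lambda>x. f t x + g t x) has_derivative (\<lambda>v. frechet_derivative (f t) (at x) v + frechet_derivative (g t) (at x) v)) (at x)"
      by (intro has_derivative_add tCk_has_derivative[OF Suc.prems(1)] tCk_has_derivative[OF Suc.prems(2)])
  next
    fix v
    show "tCk k D (\<lambda>t x. frechet_derivative (f t) (at x) v + frechet_derivative (g t) (at x) v)"
      by (rule Suc.IH[OF tCk_frechet[OF Suc.prems(1)] tCk_frechet[OF Suc.prems(2)]])
  qed
qed

lemma tCk_const: "open D \<Longrightarrow> tCk k D (\<lambda>t x. c)"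
proof (induction k arbitrary: c)
  case (Suc k)
  show ?case by (rule tCk_I[where f'="\<lambda>t x v. 0"]) (use Suc in auto)
qed simp

lemma tCk_sum:
  assumes "open D" "\<And>i. i \<in> I \<Longrightarrow> tCk k D (f i)"
  shows "tCk k D (\<lambda>t x. \<Sum>i\<in>I. f i t x)"
  using assms(2)
proof (induction I rule: infinite_finite_induct)
  case (insert i I)
  have "tCk k D (\<lambda>t x. f i t x + (\<Sum>i\<in>I. f i t x))"
    using insert by (intro tCk_add[OF assms(1)]) auto
  with insert show ?case by simp
qed (use tCk_const[OF assms(1)] in simp_all)

lemma tCk_bilinear:
  assumes "open D" "bounded_bilinear h" "tCk k D f" "tCk k D g"
  shows "tCk k D (\<lambda>t x. h (f t x) (g t x))"
  using assms(3,4)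
proof (induction k arbitrary: f g)
  case 0
  then show ?case using bounded_bilinear.continuous_on[OF assms(2)] by (simp add: case_prod_beta)
next
  case (Suc k)
  show ?case
  proof (rule tCk_I[OF assms(1)])
    show "continuous_on ({0..1} \<times> D) (\<lambda>(t, x). h (f t x) (g t x))"
      using bounded_bilinear.continuous_on[OF assms(2) tCk_continuous[OF Suc.prems(1)] tCk_continuous[OF Suc.prems(2)]]
      by (simp add: case_prod_beta)
  next
    fix t x assume "t \<in> {0..(1::real)}" "x \<in> D"
    then show "((\<lambda>x. h (f t x) (g t x)) has_derivative
      (\<lambda>v. h (f t x) (frechet_derivative (g t) (at x) v) + h (frechet_derivative (f t) (at x) v) (g t x))) (at x)"
      by (intro bounded_bilinear.FDERIV[OF assms(2)] tCk_has_derivative[OF Suc.prems(1)] tCk_has_derivative[OF Suc.prems(2)])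
  next
    fix v
    show "tCk k D (\<lambda>t x. h (f t x) (frechet_derivative (g t) (at x) v) + h (frechet_derivative (f t) (at x) v) (g t x))"
      by (intro tCk_add[OF assms(1)] Suc.IH tCk_frechet[OF Suc.prems(1)] tCk_frechet[OF Suc.prems(2)]
          tCk_Suc_le[OF Suc.prems(1)] tCk_Suc_le[OF Suc.prems(2)])
  qed
qed

lemmas tCk_scaleR = tCk_bilinear[OF _ bounded_bilinear_scaleR]

lemma tCk_inner_const: "open D \<Longrightarrow> tCk k D f \<Longrightarrow> tCk k D (\<lambda>t x. f t x \<bullet> b)"
  by (intro tCk_bilinear[OF _ bounded_bilinear_inner] tCk_const)

lemma tCk_compose:
  fixes u :: "real \<Rightarrow> 'a::real_normed_vector \<Rightarrow> 'b::euclidean_space"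
  assumes "open D" "{0..1} \<subseteq> I" "\<And>t x. t \<in> {0..1} \<Longrightarrow> x \<in> D \<Longrightarrow> u t x \<in> S"
    and "Ck_on k (I \<times> S) G" "tCk k D u"
  shows "tCk k D (\<lambda>t x. G (t, u t x))"
  using assms(4,5)
proof (induction k arbitrary: G)
  case 0
  have "continuous_on ({0..1} \<times> D) (\<lambda>p. G (fst p, (\<lambda>(t, x). u t x) p))"
    by (rule continuous_on_compose2[OF 0(1)[unfolded Ck_on.simps]],
        rule continuous_on_Pair[OF continuous_on_fst[OF continuous_on_id] 0(2)[unfolded tCk.simps]])
      (use assms(2,3) in auto)
  then show ?case by (simp add: case_prod_beta)
next
  case (Suc k)
  show ?case
  proof (rule tCk_I[OF assms(1)])
    have "continuous_on ({0..1} \<times> D) (\<lambda>p. G (fst p, (\<lambda>(t, x). u t x) p))"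
      by (rule continuous_on_compose2[OF Ck_on_continuous[OF Suc.prems(1)]],
          rule continuous_on_Pair[OF continuous_on_fst[OF continuous_on_id] tCk_continuous[OF Suc.prems(2)]])
        (use assms(2,3) in auto)
    then show "continuous_on ({0..1} \<times> D) (\<lambda>(t, x). G (t, u t x))" by (simp add: case_prod_beta)
  next
    fix t x assume t: "t \<in> {0..(1::real)}" and x: "x \<in> D"
    have "(t, u t x) \<in> I \<times> S" using t x assms(2,3) by auto
    note dG = Ck_on_SucD[OF Suc.prems(1) this]
    note du = tCk_has_derivative[OF Suc.prems(2) t x]
    let ?D = "frechet_derivative G (at (t, u t x))" and ?u = "frechet_derivative (u t) (at x)"
    have "((\<lambda>x. (t, u t x)) has_derivative (\<lambda>v. (0, ?u v))) (at x)"
      by (intro has_derivative_Pair has_derivative_const du)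
    from has_derivative_compose[OF this dG]
    have "((\<lambda>x. G (t, u t x)) has_derivative (\<lambda>v. ?D (0, ?u v))) (at x)" .
    moreover have "(\<lambda>v. ?D (0, ?u v)) = (\<lambda>v. \<Sum>b\<in>Basis. (?u v \<bullet> b) *\<^sub>R ?D (0, b))"
    proof -
      have "linear (\<lambda>w. ?D (0, w))"
        using linear_compose[OF _ has_derivative_linear[OF dG], of "\<lambda>w. (0, w)"] by (simp add: linear_iff o_def)
      from linear_eq_sum_Basis[OF this] show ?thesis by (rule ext)
    qed
    ultimately show "((\<lambda>x. G (t, u t x)) has_derivative (\<lambda>v. \<Sum>b\<in>Basis. (?u v \<bullet> b) *\<^sub>R ?D (0, b))) (at x)"
      by (rule back_subst)
  next
    fix v
    show "tCk k D (\<lambda>t x. \<Sum>b\<in>Basis. (frechet_derivative (u t) (at x) v \<bullet> b) *\<^sub>R frechet_derivative G (at (t, u t x)) (0, b))"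
    proof (intro tCk_sum tCk_scaleR tCk_inner_const assms(1) tCk_frechet[OF Suc.prems(2)])
      fix b :: 'b
      show "tCk k D (\<lambda>t x. frechet_derivative G (at (t, u t x)) (0, b))"
        by (rule Suc.IH[of "\<lambda>p. frechet_derivative G (at p) (0, b)"])
          (use Suc.prems(1) tCk_Suc_le[OF Suc.prems(2)] in auto)
    qed
  qed
qed

lemma tCk_imp_Ck_on:
  assumes "open D" "t \<in> {0..1}" "tCk k D f"
  shows "Ck_on k D (f t)"
  using assms(3)
proof (induction k arbitrary: f)
  case 0
  then show ?case
    using continuous_on_case_prod[OF 0[unfolded tCk.simps], of D "\<lambda>x. t" "\<lambda>x. x"] assms(2) by auto
next
  case (Suc k)
  show ?case
    by (rule Ck_onI[OF assms(1) tCk_has_derivative[OF Suc.prems assms(2)]])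
      (use Suc.IH[OF tCk_frechet[OF Suc.prems]] in auto)
qed

section \<open>Linear equations depending on a parameter\<close>

lemma norm_sum_scaleR_Basis_le:
  fixes z :: "'a::euclidean_space" and a :: "'a \<Rightarrow> 'b::real_normed_vector"
  assumes "\<And>b. b \<in> Basis \<Longrightarrow> norm (a b) \<le> B"
  shows "norm (\<Sum>b\<in>Basis. (z \<bullet> b) *\<^sub>R a b) \<le> of_nat DIM('a) * B * norm z"
proof -
  have "linear (\<lambda>z. \<Sum>b\<in>Basis. (z \<bullet> b) *\<^sub>R a b)"
    by (auto simp: linear_iff inner_add_left algebra_simps sum.distrib scaleR_sum_right)
  then show ?thesis
  proof (rule norm_linear_le_Basis)
    fix c :: 'a assume c: "c \<in> Basis"
    have "(\<Sum>b\<in>Basis. (c \<bullet> b) *\<^sub>R a b) = (\<Sum>b\<in>Basis. if b = c then a b else 0)"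
      by (rule sum.cong) (auto simp: inner_Basis c)
    then show "norm (\<Sum>b\<in>Basis. (c \<bullet> b) *\<^sub>R a b) \<le> B" using assms c by simp
  qed
qed

text \<open>The linear field is given by its values a b on the basis, so that its dependence on the
  parameter sits in finitely many curves. The solutions at x and x0 are compared uniformly in time;
  continuity in t at x0 then gives joint continuity.\<close>

lemma linear_ode_joint_continuous:
  fixes a :: "'a::euclidean_space \<Rightarrow> real \<Rightarrow> 'p::euclidean_space \<Rightarrow> 'a"
  assumes D: "open D" and a: "\<And>b. b \<in> Basis \<Longrightarrow> continuous_on ({0..1} \<times> D) (\<lambda>(t, x). a b t x)"
    and c: "continuous_on ({0..1} \<times> D) (\<lambda>(t, x). c t x)" and w0: "continuous_on D w0"
    and cw: "\<And>x. x \<in> D \<Longrightarrow> continuous_on {0..1} (\<lambda>t. w t x)"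
    and w: "\<And>t x. t \<in> {0..1} \<Longrightarrow> x \<in> D \<Longrightarrow>
      w t x = w0 x + integral {0..t} (\<lambda>s. (\<Sum>b\<in>Basis. (w s x \<bullet> b) *\<^sub>R a b s x) + c s x)"
  shows "continuous_on ({0..1} \<times> D) (\<lambda>(t, x). w t x)"
proof -
  let ?R = "\<lambda>x s. (\<Sum>b\<in>Basis. (w s x \<bullet> b) *\<^sub>R a b s x) + c s x"
  have ca1: "continuous_on {0..1} (\<lambda>s. a b s x)" if "b \<in> Basis" "x \<in> D" for b x
    by (rule continuous_on_case_prod[OF a[OF that(1)] continuous_on_id continuous_on_const]) (use that in auto)
  have cc1: "continuous_on {0..1} (\<lambda>s. c s x)" if "x \<in> D" for x
    by (rule continuous_on_case_prod[OF c continuous_on_id continuous_on_const]) (use that in auto)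
  have cR: "continuous_on {0..1} (?R x)" if "x \<in> D" for x
    by (intro continuous_intros cw ca1 cc1 that)
  have key: "\<exists>d>0. \<forall>x. dist x x0 < d \<longrightarrow> x \<in> D \<and> (\<forall>t\<in>{0..1}. norm (w t x - w t x0) \<le> e)"
    if x0: "x0 \<in> D" and e: "0 < e" for x0 e
  proof -
    obtain r where r: "0 < r" "cball x0 r \<subseteq> D" using D x0 open_contains_cball by blast
    let ?K = "{0..1::real} \<times> cball x0 r"
    have K: "compact ?K" by (intro compact_Times compact_Icc compact_cball)
    have KD: "?K \<subseteq> {0..1} \<times> D" using r by auto
    have "\<exists>B. \<forall>p\<in>?K. norm ((\<lambda>(t, x). a b t x) p) \<le> B" if "b \<in> Basis" for b
      using compact_imp_bounded[OF compact_continuous_image[OF continuous_on_subset[OF a[OF that] KD] K]]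
      by (auto simp: bounded_iff)
    then obtain B where B: "\<And>b p. b \<in> Basis \<Longrightarrow> p \<in> ?K \<Longrightarrow> norm ((\<lambda>(t, x). a b t x) p) \<le> B b" by metis
    define C where "C = (\<Sum>b\<in>Basis. \<bar>B b\<bar>)"
    have aC: "norm (a b s x) \<le> C" if "b \<in> Basis" "s \<in> {0..1}" "x \<in> cball x0 r" for b s x
    proof -
      have "norm (a b s x) \<le> \<bar>B b\<bar>" using B[OF that(1), of "(s, x)"] that by simp
      also have "\<dots> \<le> C" unfolding C_def by (rule member_le_sum[OF that(1)]) auto
      finally show ?thesis .
    qed
    define L where "L = of_nat DIM('a) * C"
    have L: "0 \<le> L" by (simp add: L_def C_def sum_nonneg)
    define e' where "e' = e / (2 * exp L)"
    have e': "0 < e'" using e by (simp add: e'_def)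
    \<comment> \<open>The right-hand side at parameter x, evaluated along the solution for x0: its
      variation in x is the defect in the comparison.\<close>
    let ?G = "\<lambda>p. (\<Sum>b\<in>Basis. (w (fst p) x0 \<bullet> b) *\<^sub>R (\<lambda>(t, x). a b t x) p) + (\<lambda>(t, x). c t x) p"
    have cG: "continuous_on ?K ?G"
      by (intro continuous_intros continuous_on_subset[OF a KD] continuous_on_subset[OF c KD]
          continuous_on_compose2[OF cw[OF x0]]) auto
    obtain d1 where d1: "0 < d1" "\<And>p q. p \<in> ?K \<Longrightarrow> q \<in> ?K \<Longrightarrow> dist q p < d1 \<Longrightarrow> dist (?G q) (?G p) < e'"
      by (rule compact_uniformly_continuousE[OF cG K e']) blast
    obtain d2 where d2: "0 < d2" "\<And>x. x \<in> D \<Longrightarrow> dist x x0 < d2 \<Longrightarrow> dist (w0 x) (w0 x0) < e'"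
      using w0[unfolded continuous_on_iff, rule_format, OF x0 e'] by blast
    show ?thesis
    proof (intro exI[of _ "min r (min d1 d2)"] conjI allI impI ballI)
      fix x assume x: "dist x x0 < min r (min d1 d2)"
      then have xr: "x \<in> cball x0 r" by (simp add: dist_commute)
      then show xD: "x \<in> D" using r by auto
      fix t :: real assume t: "t \<in> {0..1}"
      have "norm (w t x - w t x0) \<le> (norm (w0 x - w0 x0) + e') * exp (L * t)"
      proof (rule integral_equation_compare[OF cR[OF xD] cR[OF x0] w[OF _ xD] w[OF _ x0] L])
        fix s :: real assume s: "s \<in> {0..1}"
        have "dist (?G (s, x)) (?G (s, x0)) < e'"
          by (rule d1(2)) (use s x xr r in \<open>auto simp: dist_Pair_Pair\<close>)
        then have 1: "norm (?G (s, x) - ?G (s, x0)) \<le> e'" by (simp add: dist_norm)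
        have 2: "norm (\<Sum>b\<in>Basis. ((w s x - w s x0) \<bullet> b) *\<^sub>R a b s x) \<le> L * norm (w s x - w s x0)"
          unfolding L_def by (rule norm_sum_scaleR_Basis_le) (use aC s xr in auto)
        have "norm (?R x s - ?R x0 s) = norm ((\<Sum>b\<in>Basis. ((w s x - w s x0) \<bullet> b) *\<^sub>R a b s x) + (?G (s, x) - ?G (s, x0)))"
          by (rule arg_cong[where f=norm]) (simp add: inner_diff_left scaleR_diff_left sum_subtractf)
        also have "\<dots> \<le> norm (\<Sum>b\<in>Basis. ((w s x - w s x0) \<bullet> b) *\<^sub>R a b s x) + norm (?G (s, x) - ?G (s, x0))"
          by (rule norm_triangle_ineq)
        also have "\<dots> \<le> L * norm (w s x - w s x0) + e'" by (rule add_mono[OF 2 1])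
        finally show "norm (?R x s - ?R x0 s) \<le> L * norm (w s x - w s x0) + e'" .
      qed (use e' t in auto)
      also have "\<dots> \<le> (e' + e') * exp L"
        using d2(2)[OF xD] x t L mult_left_le[of t L] e' by (intro mult_mono add_mono) (auto simp: dist_norm)
      also have "\<dots> = e" by (simp add: e'_def)
      finally show "norm (w t x - w t x0) \<le> e" .
    qed (use r d1 d2 in auto)
  qed
  show ?thesis
    unfolding continuous_on_iff
  proof (intro ballI allI impI)
    fix p :: "real \<times> 'p" and e :: real assume p: "p \<in> {0..1} \<times> D" and e: "0 < e"
    obtain t0 x0 where p0: "p = (t0, x0)" "t0 \<in> {0..1}" "x0 \<in> D" using p by auto
    have e2: "0 < e / 2" using e by simp
    obtain d where d: "d > 0" "\<And>x. dist x x0 < d \<Longrightarrow> x \<in> D \<and> (\<forall>t\<in>{0..1}. norm (w t x - w t x0) \<le> e / 2)"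
      using key[OF p0(3) e2] by blast
    obtain d' where d': "d' > 0" "\<And>t. t \<in> {0..1} \<Longrightarrow> dist t t0 < d' \<Longrightarrow> dist (w t x0) (w t0 x0) < e / 2"
      using cw[OF p0(3), unfolded continuous_on_iff, rule_format, OF p0(2) e2] by blast
    show "\<exists>d>0. \<forall>q\<in>{0..1} \<times> D. dist q p < d \<longrightarrow> dist ((\<lambda>(t, x). w t x) q) ((\<lambda>(t, x). w t x) p) < e"
    proof (intro exI[of _ "min d d'"] conjI ballI impI)
      fix q assume q: "q \<in> {0..1} \<times> D" "dist q p < min d d'"
      obtain t x where tx: "q = (t, x)" "t \<in> {0..1}" "x \<in> D" using q by auto
      have "dist x x0 < d" "dist t t0 < d'"
        using q(2) dist_snd_le[of q p] dist_fst_le[of q p] unfolding tx p0 by auto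
      then have "norm (w t x - w t x0) \<le> e / 2" "dist (w t x0) (w t0 x0) < e / 2"
        using d(2) d'(2) tx by auto
      then have "dist (w t x) (w t0 x0) < e"
        using dist_triangle[of "w t x" "w t0 x0" "w t x0"] by (simp add: dist_norm)
      then show "dist ((\<lambda>(t, x). w t x) q) ((\<lambda>(t, x). w t x) p) < e" by (simp add: tx p0)
    qed (use d d' in auto)
  qed
qed

text \<open>Adjoining the parameter to the state turns a linear equation with parameter into a flow, to
  which the theorem on differentiation with respect to the initial value applies.\<close>

lemma linear_ode_has_derivative:
  fixes a :: "'a::euclidean_space \<Rightarrow> real \<Rightarrow> 'p::euclidean_space \<Rightarrow> 'a"
  assumes D: "open D" and a: "\<And>b. b \<in> Basis \<Longrightarrow> tCk (Suc 0) D (a b)" and c: "tCk (Suc 0) D c"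
    and cw: "\<And>x. x \<in> D \<Longrightarrow> continuous_on {0..1} (\<lambda>t. w t x)"
    and w: "\<And>t x. t \<in> {0..1} \<Longrightarrow> x \<in> D \<Longrightarrow>
      w t x = w0 + integral {0..t} (\<lambda>s. (\<Sum>b\<in>Basis. (w s x \<bullet> b) *\<^sub>R a b s x) + c s x)"
  obtains w' where "\<And>t x. t \<in> {0..1} \<Longrightarrow> x \<in> D \<Longrightarrow> (w t has_derivative w' t x) (at x)"
    "\<And>x v. x \<in> D \<Longrightarrow> continuous_on {0..1} (\<lambda>t. w' t x v)"
    "\<And>t x v. t \<in> {0..1} \<Longrightarrow> x \<in> D \<Longrightarrow>
      w' t x v = integral {0..t} (\<lambda>s. (\<Sum>b\<in>Basis. (w' s x v \<bullet> b) *\<^sub>R a b s x) +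
        ((\<Sum>b\<in>Basis. (w s x \<bullet> b) *\<^sub>R frechet_derivative (a b s) (at x) v) + frechet_derivative (c s) (at x) v))"
proof -
  define F where "F = (\<lambda>t (q :: 'p \<times> 'a). (0 :: 'p, (\<Sum>b\<in>Basis. (snd q \<bullet> b) *\<^sub>R a b t (fst q)) + c t (fst q)))"
  define F' where "F' = (\<lambda>t (q :: 'p \<times> 'a) (h :: 'p \<times> 'a). (0 :: 'p,
     (\<Sum>b\<in>Basis. (snd q \<bullet> b) *\<^sub>R frechet_derivative (a b t) (at (fst q)) (fst h) + (snd h \<bullet> b) *\<^sub>R a b t (fst q))
       + frechet_derivative (c t) (at (fst q)) (fst h)))"
  have ca: "continuous_on ({0..1} \<times> D) (\<lambda>(t, x). a b t x)" if "b \<in> Basis" for b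
    by (rule tCk_continuous[OF a[OF that]])
  have cc: "continuous_on ({0..1} \<times> D) (\<lambda>(t, x). c t x)" by (rule tCk_continuous[OF c])
  have ca1: "continuous_on {0..1} (\<lambda>s. a b s x)" if "b \<in> Basis" "x \<in> D" for b x
    by (rule continuous_on_case_prod[OF ca[OF that(1)] continuous_on_id continuous_on_const]) (use that in auto)
  have cc1: "continuous_on {0..1} (\<lambda>s. c s x)" if "x \<in> D" for x
    by (rule continuous_on_case_prod[OF cc continuous_on_id continuous_on_const]) (use that in auto)
  have ex: "\<exists>y. continuous_on {0..1} y \<and> (\<forall>t\<in>{0..1}. y t = z + integral {0..t} (\<lambda>s. (\<Sum>b\<in>Basis. (y s \<bullet> b) *\<^sub>R a b s x) + c s x))"
    if x: "x \<in> D" for x z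
  proof -
    let ?G = "\<lambda>s y. (\<Sum>b\<in>Basis. (y \<bullet> b) *\<^sub>R a b s x) + c s x"
    have "\<exists>B. \<forall>s\<in>{0..1}. norm (a b s x) \<le> B" if "b \<in> Basis" for b
      using compact_imp_bounded[OF compact_continuous_image[OF ca1[OF that x] compact_Icc]] by (auto simp: bounded_iff)
    then obtain B where B: "\<And>b s. b \<in> Basis \<Longrightarrow> s \<in> {0..1} \<Longrightarrow> norm (a b s x) \<le> B b" by metis
    define C where "C = (\<Sum>b\<in>Basis. \<bar>B b\<bar>)"
    have aC: "norm (a b s x) \<le> C" if "b \<in> Basis" "s \<in> {0..1}" for b s
    proof -
      have "norm (a b s x) \<le> \<bar>B b\<bar>" using B[OF that] by linarith
      also have "\<dots> \<le> C" unfolding C_def by (rule member_le_sum[OF that(1)]) auto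
      finally show ?thesis .
    qed
    have cG: "continuous_on ({0..1} \<times> UNIV) (\<lambda>(s, y). ?G s y)"
      unfolding case_prod_beta
      by (intro continuous_intros continuous_on_compose2[OF ca1[OF _ x]] continuous_on_compose2[OF cc1[OF x]]) auto
    have "norm (?G t y - ?G t y') \<le> of_nat DIM('a) * C * norm (y - y')" if t: "t \<in> {0..1}" for t y y'
    proof -
      have "?G t y - ?G t y' = (\<Sum>b\<in>Basis. ((y - y') \<bullet> b) *\<^sub>R a b t x)"
        by (simp add: inner_diff_left scaleR_diff_left sum_subtractf)
      then show ?thesis using norm_sum_scaleR_Basis_le[of "\<lambda>b. a b t x" C "y - y'"] aC t by simp
    qed
    note lip = this
    have C0: "0 \<le> of_nat DIM('a) * C" by (simp add: C_def sum_nonneg)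
    show ?thesis
    proof (rule picard_global[OF cG C0 lip, of z])
      fix y assume "continuous_on {0..1} y" "\<And>t. t \<in> {0..1} \<Longrightarrow> y t = z + integral {0..t} (\<lambda>s. ?G s (y s))"
      then show ?thesis by (intro exI[of _ y] conjI ballI)
    qed
  qed
  \<comment> \<open>Solutions for all initial values z, so that the flow lives on an open set of
    states (x, z); w is recovered at z = w0 by uniqueness.\<close>
  define y where "y = (\<lambda>x z. SOME y. continuous_on {0..1} y \<and> (\<forall>t\<in>{0..1}. y t = z + integral {0..t} (\<lambda>s. (\<Sum>b\<in>Basis. (y s \<bullet> b) *\<^sub>R a b s x) + c s x)))"
  have y: "continuous_on {0..1} (y x z)" "t \<in> {0..1} \<Longrightarrow> y x z t = z + integral {0..t} (\<lambda>s. (\<Sum>b\<in>Basis. (y x z s \<bullet> b) *\<^sub>R a b s x) + c s x)"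
    if "x \<in> D" for x z t
    using someI_ex[OF ex[OF that, of z]] unfolding y_def by blast+
  define u where "u = (\<lambda>t (q :: 'p \<times> 'a). (fst q, y (fst q) (snd q) t))"
  have oD: "open (D \<times> (UNIV :: 'a set))" using D by (simp add: open_Times)
  have cfst: "continuous_on ({0..1} \<times> (D \<times> (UNIV :: 'a set))) (\<lambda>p. f (fst p) (fst (snd p)))"
    if "continuous_on ({0..1} \<times> D) (\<lambda>(t, x). f t x)" for f :: "real \<Rightarrow> 'p \<Rightarrow> 'a"
    by (rule continuous_on_case_prod[OF that, where g = fst and h = "\<lambda>p. fst (snd p)"])
      (auto intro!: continuous_on_fst continuous_on_snd continuous_on_id)
  have cfst': "continuous_on ({0..1} \<times> (D \<times> (UNIV :: 'a set))) (\<lambda>(t, q). f t (fst q))"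
    if "continuous_on ({0..1} \<times> D) (\<lambda>(t, x). f t x)" for f :: "real \<Rightarrow> 'p \<Rightarrow> 'a"
    using cfst[OF that] by (simp add: case_prod_beta)
  have cy: "continuous_on ({0..1} \<times> (D \<times> (UNIV :: 'a set))) (\<lambda>(t, q). y (fst q) (snd q) t)"
  proof (rule linear_ode_joint_continuous[OF oD cfst'[OF ca] cfst'[OF cc], where ?w0.0 = snd])
    show "continuous_on (D \<times> (UNIV :: 'a set)) snd" by (intro continuous_on_snd continuous_on_id)
    fix q assume "q \<in> D \<times> (UNIV :: 'a set)"
    then have q: "fst q \<in> D" by auto
    show "continuous_on {0..1} (\<lambda>t. y (fst q) (snd q) t)" using y(1)[OF q] by simp
    show "y (fst q) (snd q) t = snd q + integral {0..t}
        (\<lambda>s. (\<Sum>b\<in>Basis. (y (fst q) (snd q) s \<bullet> b) *\<^sub>R a b s (fst q)) + c s (fst q))" if "t \<in> {0..1}" for t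
      by (rule y(2)[OF q that])
  qed
  interpret flow_family F F' "D \<times> UNIV" "D \<times> UNIV" u
  proof
    show "open (D \<times> (UNIV :: 'a set))" by (rule oD)
    show "continuous_on ({0..1} \<times> (D \<times> UNIV)) (\<lambda>(t, x). F t x)"
      unfolding F_def case_prod_beta by (intro continuous_intros cfst ca cc)
    show "(F t has_derivative F' t q) (at q)" if t: "t \<in> {0..1}" and q: "q \<in> D \<times> UNIV" for t q
    proof -
      have fq: "fst q \<in> D" using q by auto
      have da: "((\<lambda>q. a b t (fst q)) has_derivative (\<lambda>h. frechet_derivative (a b t) (at (fst q)) (fst h))) (at q)" if "b \<in> Basis" for b
        by (rule has_derivative_compose[OF has_derivative_fst[OF has_derivative_ident] tCk_has_derivative[OF a[OF that] t fq]])
      have dc: "((\<lambda>q. c t (fst q)) has_derivative (\<lambda>h. frechet_derivative (c t) (at (fst q)) (fst h))) (at q)"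
        by (rule has_derivative_compose[OF has_derivative_fst[OF has_derivative_ident] tCk_has_derivative[OF c t fq]])
      show ?thesis unfolding F_def F'_def
        by (intro has_derivative_Pair has_derivative_const has_derivative_add has_derivative_sum has_derivative_scaleR
            has_derivative_inner_left has_derivative_snd has_derivative_ident da dc)
    qed
    show "continuous_on ({0..1} \<times> (D \<times> UNIV)) (\<lambda>(t, x). F' t x v)" for v
      unfolding F'_def case_prod_beta
      by (intro continuous_intros cfst ca tCk_continuous[OF tCk_frechet[OF a]] tCk_continuous[OF tCk_frechet[OF c]])
    have "continuous_on ({0..1} \<times> (D \<times> UNIV)) (\<lambda>p. (fst (snd p), (\<lambda>(t, q). y (fst q) (snd q) t) p))"
      by (intro continuous_intros cy)
    then show "continuous_on ({0..1} \<times> (D \<times> UNIV)) (\<lambda>(t, x). u t x)"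
      by (simp add: u_def case_prod_beta)
    show "u t q \<in> D \<times> UNIV" if "q \<in> D \<times> UNIV" for t q using that by (auto simp: u_def)
    show "u t q = q + integral {0..t} (\<lambda>s. F s (u s q))" if t: "t \<in> {0..1}" and q: "q \<in> D \<times> UNIV" for t q
    proof -
      have fq: "fst q \<in> D" using q by auto
      let ?h = "\<lambda>s. (\<Sum>b\<in>Basis. (y (fst q) (snd q) s \<bullet> b) *\<^sub>R a b s (fst q)) + c s (fst q)"
      have ch: "continuous_on {0..t} ?h"
        by (rule continuous_on_subset[of "{0..1}"]) (use t in \<open>auto intro!: continuous_intros y ca1 cc1 fq\<close>)
      have "((\<lambda>s. (0 :: 'p, ?h s)) has_integral (0, integral {0..t} ?h)) {0..t}"
      proof -
        have "((\<lambda>s. (0 :: 'p, 1 *\<^sub>R ?h s)) has_integral (0, integral {0..t} ?h)) {0..t}"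
          using has_integral_linear[OF integrable_integral[OF integrable_continuous_interval[OF ch]], of "\<lambda>z. (0 :: 'p, z)"]
          by (simp add: o_def bounded_linear_Pair bounded_linear_zero bounded_linear_ident)
        then show ?thesis by simp
      qed
      then have "integral {0..t} (\<lambda>s. F s (u s q)) = (0, integral {0..t} ?h)"
        by (simp add: F_def u_def integral_unique)
      then show ?thesis using y(2)[OF fq t, of "snd q"] by (simp add: u_def prod_eq_iff)
    qed
  qed
  have wy: "w t x = y x w0 t" if x: "x \<in> D" and t: "t \<in> {0..1}" for t x
  proof -
    let ?h = "\<lambda>w s. (\<Sum>b\<in>Basis. (w s \<bullet> b) *\<^sub>R a b s x) + c s x"
    have "\<exists>B. \<forall>s\<in>{0..1}. norm (a b s x) \<le> B" if "b \<in> Basis" for b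
      using compact_imp_bounded[OF compact_continuous_image[OF ca1[OF that x] compact_Icc]] by (auto simp: bounded_iff)
    then obtain B where B: "\<And>b s. b \<in> Basis \<Longrightarrow> s \<in> {0..1} \<Longrightarrow> norm (a b s x) \<le> B b" by metis
    define C where "C = (\<Sum>b\<in>Basis. \<bar>B b\<bar>)"
    have aC: "norm (a b s x) \<le> C" if "b \<in> Basis" "s \<in> {0..1}" for b s
    proof -
      have "norm (a b s x) \<le> \<bar>B b\<bar>" using B[OF that] by linarith
      also have "\<dots> \<le> C" unfolding C_def by (rule member_le_sum[OF that(1)]) auto
      finally show ?thesis .
    qed
    have "norm (w t x - y x w0 t) \<le> (norm (w0 - w0) + 0) * exp (of_nat DIM('a) * C * t)"
    proof (rule integral_equation_compare[where f="?h (\<lambda>s. w s x)" and g="?h (y x w0)" and u="\<lambda>t. w t x" and v="y x w0"])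
      show "continuous_on {0..1} (?h (\<lambda>s. w s x))" by (intro continuous_intros cw ca1 cc1 x)
      show "continuous_on {0..1} (?h (y x w0))" by (intro continuous_intros y ca1 cc1 x)
      show "0 \<le> of_nat DIM('a) * C" by (simp add: C_def sum_nonneg)
      fix s :: real assume s: "s \<in> {0..1}"
      have "?h (\<lambda>s. w s x) s - ?h (y x w0) s = (\<Sum>b\<in>Basis. ((w s x - y x w0 s) \<bullet> b) *\<^sub>R a b s x)"
        by (simp add: inner_diff_left scaleR_diff_left sum_subtractf)
      then show "norm (?h (\<lambda>s. w s x) s - ?h (y x w0) s) \<le> of_nat DIM('a) * C * norm (w s x - y x w0 s) + 0"
        using norm_sum_scaleR_Basis_le[of "\<lambda>b. a b s x" C "w s x - y x w0 s"] aC s by simp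
    qed (use w[OF _ x] y[OF x] t in auto)
    then show ?thesis by simp
  qed
  define P where "P = (\<lambda>x w'. (\<forall>v. continuous_on {0..1} (\<lambda>t. w' t v)) \<and> (\<forall>t\<in>{0..1}. (u t has_derivative w' t) (at (x, w0))) \<and>
    (\<forall>t\<in>{0..1}. \<forall>v. w' t v = v + integral {0..t} (\<lambda>s. F' s (u s (x, w0)) (w' s v))))"
  have "\<exists>w'. P x w'" if x: "x \<in> D" for x
  proof -
    have xD: "(x, w0) \<in> D \<times> UNIV" using x by simp
    show ?thesis unfolding P_def by (rule variational_solution[OF xD]) (use has_derivative_flow[OF xD] in blast)
  qed
  then obtain W where PW: "\<And>x. x \<in> D \<Longrightarrow> P x (W x)" by metis
  have W: "x \<in> D \<Longrightarrow> continuous_on {0..1} (\<lambda>t. W x t v)"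
    "x \<in> D \<Longrightarrow> t \<in> {0..1} \<Longrightarrow> (u t has_derivative W x t) (at (x, w0))"
    "x \<in> D \<Longrightarrow> t \<in> {0..1} \<Longrightarrow> W x t v = v + integral {0..t} (\<lambda>s. F' s (u s (x, w0)) (W x s v))" for x t v
    using PW[of x] unfolding P_def by blast+
  define w' where "w' = (\<lambda>t x v. snd (W x t (v, 0)))"
  show thesis
  proof (rule that[of w'])
    fix t x assume t: "t \<in> {0..(1::real)}" and x: "x \<in> D"
    have "((\<lambda>x. (x, w0)) has_derivative (\<lambda>v. (v, 0))) (at x)"
      by (intro has_derivative_Pair has_derivative_ident has_derivative_const)
    from has_derivative_snd[OF has_derivative_compose[OF this W(2)[OF x t]]]
    have "((\<lambda>x. snd (u t (x, w0))) has_derivative w' t x) (at x)" by (simp add: w'_def)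
    then show "(w t has_derivative w' t x) (at x)"
      by (rule has_derivative_transform_within_open[OF _ assms(1) x]) (use wy t in \<open>simp add: u_def\<close>)
  next
    fix x v assume x: "x \<in> D"
    show "continuous_on {0..1} (\<lambda>t. w' t x v)" unfolding w'_def by (intro continuous_on_snd W x)
  next
    fix t x v assume t: "t \<in> {0..(1::real)}" and x: "x \<in> D"
    have sub: "{0..t} \<subseteq> {0..1}" using t by auto
    have cF'W: "continuous_on {0..1} (\<lambda>s. F' s (u s (x, w0)) (W x s (v, 0)))"
    proof -
      have "continuous_on {0..1} (\<lambda>s. \<Sum>b\<in>Basis. (W x s (v, 0) \<bullet> b) *\<^sub>R F' s (u s (x, w0)) b)"
        by (intro continuous_intros W contF'u1 x) (use x in simp)
      then show ?thesis
        by (rule continuous_on_eq) (use linear_eq_sum_Basis[OF linF'[OF _ uS]] x in auto)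
    qed
    have int: "(\<lambda>s. F' s (u s (x, w0)) (W x s (v, 0))) integrable_on {0..r}" if "{0..r} \<subseteq> {0..1}" for r
      by (intro integrable_continuous_interval continuous_on_subset[OF cF'W that])
    \<comment> \<open>The parameter does not move along the flow, so the parameter part of the
      variation stays equal to v. Its effect on the state part is the inhomogeneity of the equation
      for w'.\<close>
    have fstW: "fst (W x r (v, 0)) = v" if r: "r \<in> {0..1}" for r
    proof -
      have sub: "{0..r} \<subseteq> {0..1}" using r by auto
      have "fst (integral {0..r} (\<lambda>s. F' s (u s (x, w0)) (W x s (v, 0)))) = integral {0..r} (fst \<circ> (\<lambda>s. F' s (u s (x, w0)) (W x s (v, 0))))"
        by (rule integral_linear[OF int[OF sub] bounded_linear_fst, symmetric])
      also have "\<dots> = 0" by (simp add: F'_def o_def)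
      finally show ?thesis using arg_cong[OF W(3)[OF x r, of "(v, 0)"], of fst] by simp
    qed
    have "w' t x v = snd (integral {0..t} (\<lambda>s. F' s (u s (x, w0)) (W x s (v, 0))))"
      unfolding w'_def using arg_cong[OF W(3)[OF x t, of "(v, 0)"], of snd] by simp
    also have "\<dots> = integral {0..t} (snd \<circ> (\<lambda>s. F' s (u s (x, w0)) (W x s (v, 0))))"
      by (rule integral_linear[OF int[OF sub] bounded_linear_snd, symmetric])
    also have "\<dots> = integral {0..t} (\<lambda>s. (\<Sum>b\<in>Basis. (w' s x v \<bullet> b) *\<^sub>R a b s x) +
        ((\<Sum>b\<in>Basis. (w s x \<bullet> b) *\<^sub>R frechet_derivative (a b s) (at x) v) + frechet_derivative (c s) (at x) v))"
    proof (rule integral_cong)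
      fix s assume "s \<in> {0..t}"
      then have s: "s \<in> {0..1}" using sub by auto
      show "(snd \<circ> (\<lambda>s. F' s (u s (x, w0)) (W x s (v, 0)))) s = (\<Sum>b\<in>Basis. (w' s x v \<bullet> b) *\<^sub>R a b s x) +
        ((\<Sum>b\<in>Basis. (w s x \<bullet> b) *\<^sub>R frechet_derivative (a b s) (at x) v) + frechet_derivative (c s) (at x) v)"
        using fstW[OF s] wy[OF x s] by (simp add: F'_def u_def w'_def sum.distrib)
    qed
    finally show "w' t x v = integral {0..t} (\<lambda>s. (\<Sum>b\<in>Basis. (w' s x v \<bullet> b) *\<^sub>R a b s x) +
        ((\<Sum>b\<in>Basis. (w s x \<bullet> b) *\<^sub>R frechet_derivative (a b s) (at x) v) + frechet_derivative (c s) (at x) v))" .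
  qed
qed

text \<open>The derivative in the parameter solves a linear equation with the same a, initial value
  0 and an inhomogeneity built from w and the derivatives of a and c. The induction hypothesis is
  used twice: for w, which puts this inhomogeneity in class C^k, and then for the
  derivative.\<close>

lemma linear_ode_tCk:
  fixes a :: "'a::euclidean_space \<Rightarrow> real \<Rightarrow> 'p::euclidean_space \<Rightarrow> 'a"
  assumes D: "open D" and a: "\<And>b. b \<in> Basis \<Longrightarrow> tCk k D (a b)" and c: "tCk k D c"
    and cw: "\<And>x. x \<in> D \<Longrightarrow> continuous_on {0..1} (\<lambda>t. w t x)"
    and w: "\<And>t x. t \<in> {0..1} \<Longrightarrow> x \<in> D \<Longrightarrow>
      w t x = w0 + integral {0..t} (\<lambda>s. (\<Sum>b\<in>Basis. (w s x \<bullet> b) *\<^sub>R a b s x) + c s x)"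
  shows "tCk k D w"
  using a c cw w
proof (induction k arbitrary: c w w0)
  case 0
  show ?case unfolding tCk.simps
    by (rule linear_ode_joint_continuous[OF D 0(1)[unfolded tCk.simps] 0(2)[unfolded tCk.simps] continuous_on_const[of _ w0] 0(3,4)])
next
  case (Suc k)
  have le: "tCk (Suc 0) D f" if "tCk (Suc k) D f" for f :: "real \<Rightarrow> 'p \<Rightarrow> 'a"
    using that by (induction k) (metis tCk_Suc_le)+
  have ak: "tCk k D (a b)" if "b \<in> Basis" for b by (rule tCk_Suc_le[OF Suc.prems(1)[OF that]])
  have wk: "tCk k D w"
    by (rule Suc.IH[OF ak tCk_Suc_le[OF Suc.prems(2)] Suc.prems(3,4)])
  show ?case
  proof (rule linear_ode_has_derivative[OF D le[OF Suc.prems(1)] le[OF Suc.prems(2)] Suc.prems(3,4)])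
    fix w' assume w': "\<And>t x. t \<in> {0..1} \<Longrightarrow> x \<in> D \<Longrightarrow> (w t has_derivative w' t x) (at x)"
      "\<And>x v. x \<in> D \<Longrightarrow> continuous_on {0..1} (\<lambda>t. w' t x v)"
      "\<And>t x v. t \<in> {0..1} \<Longrightarrow> x \<in> D \<Longrightarrow>
      w' t x v = integral {0..t} (\<lambda>s. (\<Sum>b\<in>Basis. (w' s x v \<bullet> b) *\<^sub>R a b s x) +
        ((\<Sum>b\<in>Basis. (w s x \<bullet> b) *\<^sub>R frechet_derivative (a b s) (at x) v) + frechet_derivative (c s) (at x) v))"
    show ?case
    proof (rule tCk_I[OF D tCk_continuous[OF wk] w'(1)])
      fix v
      have "tCk k D (\<lambda>s x. (\<Sum>b\<in>Basis. (w s x \<bullet> b) *\<^sub>R frechet_derivative (a b s) (at x) v) + frechet_derivative (c s) (at x) v)"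
        by (intro tCk_add tCk_sum tCk_scaleR tCk_inner_const D wk tCk_frechet[OF Suc.prems(1)] tCk_frechet[OF Suc.prems(2)])
      from Suc.IH[OF ak this, of "\<lambda>t x. w' t x v" 0] w'(2,3) show "tCk k D (\<lambda>t x. w' t x v)" by simp
    qed
  qed
qed

section \<open>Smoothness of flows\<close>

locale smooth_flow =
  fixes X :: "real \<times> 'a::euclidean_space \<Rightarrow> 'a" and I :: "real set" and S D :: "'a set" and u :: "real \<Rightarrow> 'a \<Rightarrow> 'a"
  assumes I: "{0..1} \<subseteq> I" and S: "open S" and D: "open D"
    and X: "smooth_on (I \<times> S) X"
    and contu: "continuous_on ({0..1} \<times> D) (\<lambda>(t, x). u t x)"
    and uS: "\<And>t x. t \<in> {0..1} \<Longrightarrow> x \<in> D \<Longrightarrow> u t x \<in> S"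
    and u: "\<And>t x. t \<in> {0..1} \<Longrightarrow> x \<in> D \<Longrightarrow> u t x = x + integral {0..t} (\<lambda>s. X (s, u s x))"
begin

definition X' where "X' t x v = frechet_derivative X (at (t, x)) (0, v)"

sublocale flow_family "\<lambda>t x. X (t, x)" X' S D u
proof
  have sub: "{0..1} \<times> S \<subseteq> I \<times> S" using I by auto
  show "continuous_on ({0..1} \<times> S) (\<lambda>(t, x). X (t, x))"
    using continuous_on_subset[OF smooth_on_continuous[OF X] sub] by (simp add: case_prod_beta)
  show "continuous_on ({0..1} \<times> S) (\<lambda>(t, x). X' t x v)" for v
    using continuous_on_subset[OF smooth_on_continuous[OF smooth_on_frechet[OF X, of "(0, v)"]] sub]
    by (simp add: case_prod_beta X'_def)
  show "((\<lambda>x. X (t, x)) has_derivative X' t x) (at x)" if "t \<in> {0..1}" "x \<in> S" for t x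
  proof -
    have "(t, x) \<in> I \<times> S" using that I by auto
    note dX = smooth_on_has_derivative[OF X this]
    have "((\<lambda>x. (t, x)) has_derivative (\<lambda>v. (0, v))) (at x)"
      by (intro has_derivative_Pair has_derivative_ident has_derivative_const)
    from has_derivative_compose[OF this dX]
    show ?thesis unfolding X'_def .
  qed
qed (use S D contu uS u in auto)

lemma flow_derivative:
  obtains w where "\<And>t x. t \<in> {0..1} \<Longrightarrow> x \<in> D \<Longrightarrow> (u t has_derivative w t x) (at x)"
    "\<And>x v. x \<in> D \<Longrightarrow> continuous_on {0..1} (\<lambda>t. w t x v)"
    "\<And>t x v. t \<in> {0..1} \<Longrightarrow> x \<in> D \<Longrightarrow> w t x v = v + integral {0..t} (\<lambda>s. X' s (u s x) (w s x v))"
proof -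
  define P where "P = (\<lambda>x w. (\<forall>v. continuous_on {0..1} (\<lambda>t. w t v)) \<and> (\<forall>t\<in>{0..1}. (u t has_derivative w t) (at x)) \<and>
    (\<forall>t\<in>{0..1}. \<forall>v. w t v = v + integral {0..t} (\<lambda>s. X' s (u s x) (w s v))))"
  have "\<exists>w. P x w" if x: "x \<in> D" for x
    unfolding P_def by (rule variational_solution[OF x]) (use has_derivative_flow[OF x] in blast)
  then obtain W where PW: "\<And>x. x \<in> D \<Longrightarrow> P x (W x)" by metis
  have W: "x \<in> D \<Longrightarrow> continuous_on {0..1} (\<lambda>t. W x t v)"
    "x \<in> D \<Longrightarrow> t \<in> {0..1} \<Longrightarrow> (u t has_derivative W x t) (at x)"
    "x \<in> D \<Longrightarrow> t \<in> {0..1} \<Longrightarrow> W x t v = v + integral {0..t} (\<lambda>s. X' s (u s x) (W x s v))" for x t v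
    using PW[of x] unfolding P_def by blast+
  show thesis by (rule that[of "\<lambda>t x. W x t"]) (rule W; assumption)+
qed

text \<open>Bootstrapping: the derivative of u solves the variational equation, linear with
  coefficients \<open>X' s (u s x) b\<close> that are as regular as u itself. So u of class C^k
  gives a derivative of class C^k.\<close>

lemma flow_tCk: "tCk k D u"
proof (induction k)
  case 0
  then show ?case using contu by simp
next
  case (Suc k)
  have a: "tCk k D (\<lambda>s x. X' s (u s x) b)" for b
    unfolding X'_def
    by (rule tCk_compose[OF D I uS _ Suc.IH, where G = "\<lambda>p. frechet_derivative X (at p) (0, b)"])
      (use smooth_on_frechet[OF X] in \<open>auto simp: smooth_on_def\<close>)
  show ?case
  proof (rule flow_derivative)
    fix w assume w: "\<And>t x. t \<in> {0..1} \<Longrightarrow> x \<in> D \<Longrightarrow> (u t has_derivative w t x) (at x)"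
      "\<And>x v. x \<in> D \<Longrightarrow> continuous_on {0..1} (\<lambda>t. w t x v)"
      "\<And>t x v. t \<in> {0..1} \<Longrightarrow> x \<in> D \<Longrightarrow> w t x v = v + integral {0..t} (\<lambda>s. X' s (u s x) (w s x v))"
  show ?case
  proof (rule tCk_I[OF D contu w(1)])
    fix v
    show "tCk k D (\<lambda>t x. w t x v)"
    proof (rule linear_ode_tCk[OF D a tCk_const[OF D, of k 0] w(2), where ?w0.0 = v])
      fix t x assume t: "t \<in> {0..(1::real)}" and x: "x \<in> D"
      have "integral {0..t} (\<lambda>s. X' s (u s x) (w s x v)) = integral {0..t} (\<lambda>s. (\<Sum>b\<in>Basis. (w s x v \<bullet> b) *\<^sub>R X' s (u s x) b) + 0)"
      proof (rule integral_cong)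
        fix s assume "s \<in> {0..t}"
        then have "linear (X' s (u s x))" using linF' uS t x by auto
        then show "X' s (u s x) (w s x v) = (\<Sum>b\<in>Basis. (w s x v \<bullet> b) *\<^sub>R X' s (u s x) b) + 0"
          unfolding add_0_right by (rule linear_eq_sum_Basis)
      qed
      then show "w t x v = v + integral {0..t} (\<lambda>s. (\<Sum>b\<in>Basis. (w s x v \<bullet> b) *\<^sub>R X' s (u s x) b) + 0)"
        using w(3)[OF t x] by simp
    qed
  qed
  qed
qed

lemma flow_smooth: "t \<in> {0..1} \<Longrightarrow> smooth_on D (u t)"
  unfolding smooth_on_def using tCk_imp_Ck_on[OF D _ flow_tCk] by blast

end

section \<open>Lagrangian germs by Moser's method\<close>

lemma bilinear_rsum: "bilinear B \<Longrightarrow> B x (\<Sum>i\<in>I. f i) = (\<Sum>i\<in>I. B x (f i))"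
  unfolding bilinear_def by (simp add: linear_sum)

lemma bilinear_span_right_zero:
  assumes B: "bilinear B" and z: "\<And>v. v \<in> S \<Longrightarrow> B u v = 0" and v: "v \<in> span S"
  shows "B u v = 0"
  using v
proof (induction rule: span_induct_alt)
  case base
  then show ?case by (rule bilinear_rzero[OF B])
next
  case (step c x y)
  then show ?case using z by (simp add: bilinear_radd[OF B] bilinear_rmul[OF B])
qed

text \<open>Among the isotropic subspaces containing W take one of largest dimension. A vector
  B-orthogonal to it could be adjoined, so it equals its own B-complement, and nondegeneracy forces
  half the dimension.\<close>

lemma lagrangian_subspace_exists:
  fixes B :: "real ^ ('n::finite) bit0 \<Rightarrow> real ^ 'n bit0 \<Rightarrow> real"
  assumes bl: "bilinear B" and alt: "\<And>v. B v v = 0" and nd: "\<And>u. (\<And>v. B u v = 0) \<Longrightarrow> u = 0"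
    and W: "\<And>u v. u \<in> W \<Longrightarrow> v \<in> W \<Longrightarrow> B u v = 0" "subspace W"
  obtains \<Lambda> where "subspace \<Lambda>" "W \<subseteq> \<Lambda>" "dim \<Lambda> = CARD('n)" "\<And>u. u \<in> \<Lambda> \<longleftrightarrow> (\<forall>v\<in>\<Lambda>. B u v = 0)"
proof -
  let ?P = "\<lambda>L. subspace L \<and> W \<subseteq> L \<and> (\<forall>u\<in>L. \<forall>v\<in>L. B u v = 0)"
  have anti: "B u v = - B v u" for u v by (rule bilinear_alternating_antisym[OF bl alt])
  have PW: "?P W" using W by blast
  have "dim L < Suc (2 * CARD('n))" for L :: "(real ^ 'n bit0) set"
    using dim_subset_UNIV_cart[of L] by simp
  then have "\<exists>L. ?P L \<and> (\<forall>M. ?P M \<longrightarrow> dim M \<le> dim L)"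
    by (intro ex_has_greatest_nat[where P = ?P and f = dim, OF PW]) blast
  then obtain \<Lambda> where \<Lambda>: "?P \<Lambda>" and max: "\<And>L. ?P L \<Longrightarrow> dim L \<le> dim \<Lambda>"
    by (elim exE conjE) (rule that; blast)
  have perp: "u \<in> \<Lambda> \<longleftrightarrow> (\<forall>v\<in>\<Lambda>. B u v = 0)" for u
  proof
    assume "u \<in> \<Lambda>" then show "\<forall>v\<in>\<Lambda>. B u v = 0" using \<Lambda> by blast
  next
    assume u: "\<forall>v\<in>\<Lambda>. B u v = 0"
    show "u \<in> \<Lambda>"
    proof (rule ccontr)
      assume nu: "u \<notin> \<Lambda>"
      have 1: "B a b = 0" if "a \<in> insert u \<Lambda>" "b \<in> insert u \<Lambda>" for a b
        using that u \<Lambda> alt anti[of a u] by auto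
      have 2: "B a b = 0" if "a \<in> insert u \<Lambda>" "b \<in> span (insert u \<Lambda>)" for a b
        by (rule bilinear_span_right_zero[OF bl 1[OF that(1)] that(2)])
      have 3: "B a b = 0" if "a \<in> span (insert u \<Lambda>)" "b \<in> span (insert u \<Lambda>)" for a b
      proof -
        have "B b a = 0"
          by (rule bilinear_span_right_zero[OF bl _ that(1)]) (use 2[OF _ that(2)] anti[of b] in simp)
        then show ?thesis using anti[of a b] by simp
      qed
      have "?P (span (insert u \<Lambda>))"
        using 3 \<Lambda> span_superset[of "insert u \<Lambda>"] by auto
      from max[OF this] have "dim (insert u \<Lambda>) \<le> dim \<Lambda>" by simp
      moreover have "u \<notin> span \<Lambda>" using nu \<Lambda> span_eq_iff by blast
      ultimately show False by (simp add: dim_insert)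
    qed
  qed
  \<comment> \<open>J represents B by the inner product and is bijective; it carries \<Lambda> onto
    its Euclidean orthogonal complement, where the dimension formula is available.\<close>
  define J where "J = (\<lambda>u. \<Sum>b\<in>Basis. B u b *\<^sub>R b)"
  have J: "J u \<bullet> v = B u v" for u v
  proof -
    have "J u \<bullet> v = (\<Sum>b\<in>Basis. (v \<bullet> b) * B u b)"
      by (simp add: J_def inner_sum_left) (simp add: inner_commute mult.commute)
    also have "\<dots> = B u v"
      using linear_eq_sum_Basis[of "B u" v] bl unfolding bilinear_def by simp
    finally show ?thesis .
  qed
  have linJ: "linear J"
    unfolding J_def linear_iff
    by (simp add: bilinear_ladd[OF bl] bilinear_lmul[OF bl] scaleR_add_left sum.distrib scaleR_sum_right)
  have injJ: "inj J"
    unfolding linear_injective_0[OF linJ] using nd J by (metis inner_zero_left)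
  have surjJ: "surj J" by (rule linear_injective_imp_surjective[OF linJ injJ refl])
  have "J ` \<Lambda> = {y \<in> UNIV. \<forall>x\<in>\<Lambda>. orthogonal x y}"
  proof (intro equalityI subsetI)
    fix y assume "y \<in> {y \<in> UNIV. \<forall>x\<in>\<Lambda>. orthogonal x y}"
    then have y: "\<forall>x\<in>\<Lambda>. y \<bullet> x = 0" by (auto simp: orthogonal_def inner_commute)
    obtain u where u: "y = J u" using surjJ by blast
    have "\<forall>v\<in>\<Lambda>. B u v = 0" using y u J by simp
    then have "u \<in> \<Lambda>" by (rule perp[THEN iffD2])
    then show "y \<in> J ` \<Lambda>" using u by blast
  next
    fix y assume "y \<in> J ` \<Lambda>"
    then obtain u where "u \<in> \<Lambda>" "y = J u" by blast
    then show "y \<in> {y \<in> UNIV. \<forall>x\<in>\<Lambda>. orthogonal x y}"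
      using perp[of u] J by (auto simp: orthogonal_def inner_commute)
  qed
  moreover have "dim (J ` \<Lambda>) = dim \<Lambda>"
    by (rule dim_image_eq[OF linJ]) (use injJ inj_on_subset in blast)
  ultimately have "dim \<Lambda> + dim \<Lambda> = dim (UNIV :: (real ^ 'n bit0) set)"
    using dim_subspace_orthogonal_to_vectors[of \<Lambda> UNIV] \<Lambda> by simp
  then have "dim \<Lambda> = CARD('n)" by simp
  then show thesis using that \<Lambda> perp by blast
qed

text \<open>The equations are the pairings with a basis of a Lagrangian subspace; their common
  kernel is that subspace because it is its own complement. A relation among them would make a
  nontrivial combination of basis vectors B-orthogonal to everything.\<close>

lemma lagrangian_linear_equations:
  fixes B :: "real ^ ('n::finite) bit0 \<Rightarrow> real ^ 'n bit0 \<Rightarrow> real"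
  assumes bl: "bilinear B" and alt: "\<And>v. B v v = 0" and nd: "\<And>u. (\<And>v. B u v = 0) \<Longrightarrow> u = 0"
    and W: "\<And>u v. u \<in> W \<Longrightarrow> v \<in> W \<Longrightarrow> B u v = 0" "subspace W"
  obtains H :: "real ^ 'n bit0 \<Rightarrow> real ^ 'n" where "linear H" "surj H" "\<And>u. u \<in> W \<Longrightarrow> H u = 0"
    "\<And>u v. H u = 0 \<Longrightarrow> H v = 0 \<Longrightarrow> B u v = 0"
proof -
  obtain \<Lambda> where \<Lambda>: "subspace \<Lambda>" "W \<subseteq> \<Lambda>" "dim \<Lambda> = CARD('n)" "\<And>u. u \<in> \<Lambda> \<longleftrightarrow> (\<forall>v\<in>\<Lambda>. B u v = 0)"
    by (rule lagrangian_subspace_exists[OF bl alt nd W]) (assumption | rule that)+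
  obtain A where A: "A \<subseteq> \<Lambda>" "independent A" "\<Lambda> \<subseteq> span A" "card A = CARD('n)"
    using basis_exists[of \<Lambda>] \<Lambda>(3) by metis
  have fA: "finite A" using A(2) independent_imp_finite by blast
  obtain a where a: "bij_betw a (UNIV :: 'n set) A"
    using finite_same_card_bij[of "UNIV :: 'n set" A] A(4) fA by auto
  define H where "H = (\<lambda>u. \<chi> i. B u (a i))"
  have linH: "linear H"
    by (auto simp: H_def linear_iff vec_eq_iff bilinear_ladd[OF bl] bilinear_lmul[OF bl])
  have ker: "H u = 0 \<longleftrightarrow> u \<in> \<Lambda>" for u
  proof
    assume "H u = 0"
    then have "B u (a i) = 0" for i by (simp add: H_def vec_eq_iff)
    then have "B u v = 0" if "v \<in> A" for v using that a by (metis bij_betw_imp_surj_on imageE)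
    then have "B u v = 0" if "v \<in> span A" for v using bilinear_span_right_zero[OF bl _ that] by blast
    then show "u \<in> \<Lambda>" using \<Lambda>(4) A(3) by blast
  next
    assume "u \<in> \<Lambda>"
    then have "B u (a i) = 0" for i using \<Lambda>(4)[of u] A(1) a bij_betwE by blast
    then show "H u = 0" by (simp add: H_def vec_eq_iff)
  qed
  have "surj H"
  proof (rule ccontr)
    assume "\<not> surj H"
    then have "span (range H) \<noteq> UNIV" using linear_subspace_image[OF linH subspace_UNIV] by (metis span_eq_iff)
    then have "span (range H) \<subset> span UNIV" by auto
    then obtain c where c: "c \<noteq> 0" "\<And>y. y \<in> span (range H) \<Longrightarrow> orthogonal c y"
      by (rule orthogonal_to_subspace_exists_gen) blast
    have "B u (\<Sum>i\<in>UNIV. c $ i *\<^sub>R a i) = 0" for u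
    proof -
      have "B u (\<Sum>i\<in>UNIV. c $ i *\<^sub>R a i) = (\<Sum>i\<in>UNIV. c $ i * B u (a i))"
        by (simp add: bilinear_rsum[OF bl] bilinear_rmul[OF bl])
      also have "\<dots> = c \<bullet> H u" by (simp add: inner_vec_def H_def)
      also have "\<dots> = 0" using c(2)[OF span_base[of "H u" "range H"]] by (simp add: orthogonal_def)
      finally show ?thesis .
    qed
    then have "B (\<Sum>i\<in>UNIV. c $ i *\<^sub>R a i) u = 0" for u
      using bilinear_alternating_antisym[OF bl alt, of "\<Sum>i\<in>UNIV. c $ i *\<^sub>R a i" u] by simp
    then have "(\<Sum>i\<in>UNIV. c $ i *\<^sub>R a i) = 0" by (rule nd)
    then have s: "(\<Sum>v\<in>A. c $ (inv_into UNIV a v) *\<^sub>R v) = 0"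
      using sum.reindex_bij_betw[OF a, of "\<lambda>v. c $ (inv_into UNIV a v) *\<^sub>R v"] a
      by (simp add: bij_betw_def)
    have "c $ i = 0" for i
    proof -
      have "a i \<in> A" using a bij_betwE by blast
      then have "c $ (inv_into UNIV a (a i)) = 0"
        using independentD[OF A(2) fA order_refl s] by simp
      then show ?thesis using a by (simp add: bij_betw_def)
    qed
    then show False using c(1) by (simp add: vec_eq_iff)
  qed
  show thesis
  proof (rule that[OF linH \<open>surj H\<close>])
    show "H u = 0" if "u \<in> W" for u using ker \<Lambda>(2) that by blast
    show "B u v = 0" if "H u = 0" "H v = 0" for u v using ker \<Lambda>(4)[of u] that by blast
  qed
qed

section \<open>Moser's vector field and its flow\<close>

lemma det_nonzeroI:
  fixes A :: "real ^ 'n ^ 'n"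
  assumes "\<And>y. A *v y = 0 \<Longrightarrow> y = 0"
  shows "det A \<noteq> 0"
proof
  assume "det A = 0"
  then have "rank A \<noteq> CARD('n)" using det_eq_0_rank[of A] by simp
  then obtain y where "y \<noteq> 0" "A *v y = 0" using matrix_nonfull_linear_equations_eq[of A] by blast
  then show False using assms by blast
qed

text \<open>Solving \<open>\<omega>\<^sub>t(X,\<cdot>) = -\<eta>\<close> along the segment \<open>\<omega>\<^sub>t = (1 - t)\<omega> + t\<omega>(0)\<close>.\<close>

lemma moser_vector_field:
  fixes \<omega> :: "(real ^ 'i::finite) form2"
  assumes U: "open U" "0 \<in> U" "two_form_on U \<omega>" and nd: "\<And>u. (\<And>v. \<omega> 0 u v = 0) \<Longrightarrow> u = 0"
    and \<eta>: "one_form_on U \<eta>"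
  obtains r C X where "0 < r" "ball 0 r \<subseteq> U" "smooth_on ({-1<..<2} \<times> ball 0 r) X"
    "\<And>t x v. t \<in> {-1<..<2} \<Longrightarrow> x \<in> ball 0 r \<Longrightarrow> (1 - t) * \<omega> x (X (t, x)) v + t * \<omega> 0 (X (t, x)) v = - \<eta> x v"
    "0 \<le> C" "\<And>t x. t \<in> {-1<..<2} \<Longrightarrow> x \<in> ball 0 r \<Longrightarrow> norm (X (t, x)) \<le> C * (\<Sum>b\<in>Basis. \<bar>\<eta> x b\<bar>)"
proof -
  note bl = two_form_onD(1)[OF U(3)]
  define wt where "wt = (\<lambda>p u v. (1 - fst p) * \<omega> (snd p) u v + fst p * \<omega> 0 u v)"
  \<comment> \<open>Row j and column i hold the value on (e_i, e_j), so that A y lists the pairings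
    of y with the coordinate vectors: the unknown sits in the first slot of the form.\<close>
  define A where "A = (\<lambda>p. (\<chi> j i. wt p (axis i 1) (axis j 1)) :: real ^ 'i ^ 'i)"
  define b where "b = (\<lambda>p :: real \<times> (real ^ 'i). \<chi> j. - \<eta> (snd p) (axis j 1))"
  define X where "X = (\<lambda>p. \<chi> k. det (\<chi> i j. if j = k then b p $ i else A p $ i $ j) / det (A p))"
  have blwt: "bilinear (wt p)" if "snd p \<in> U" for p
    using bl[OF that] bl[OF U(2)] unfolding wt_def bilinear_def linear_iff
    by (simp add: algebra_simps)
  have Av: "(A p *v y) $ j = wt p y (axis j 1)" if "snd p \<in> U" for p y j
  proof -
    have l: "linear (\<lambda>y. wt p y (axis j 1))" using blwt[OF that] by (simp add: bilinear_def)
    have "wt p y (axis j 1) = wt p (\<Sum>i\<in>UNIV. y $ i *s axis i 1) (axis j 1)"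
      by (simp add: basis_expansion)
    also have "\<dots> = (\<Sum>i\<in>UNIV. wt p (y $ i *s axis i 1) (axis j 1))" by (rule linear_sum[OF l])
    also have "\<dots> = (\<Sum>i\<in>UNIV. y $ i * wt p (axis i 1) (axis j 1))"
      using linear_cmul[OF l] by (simp add: scalar_mult_eq_scaleR)
    finally show ?thesis by (simp add: A_def matrix_vector_mult_def mult.commute)
  qed
  have oU: "open (UNIV \<times> U :: (real \<times> (real ^ 'i)) set)" using U by (simp add: open_Times)
  have smfst: "smooth_on (UNIV \<times> U) (fst :: real \<times> (real ^ 'i) \<Rightarrow> real)" "smooth_on (UNIV \<times> U) (snd :: real \<times> (real ^ 'i) \<Rightarrow> _)"
    by (intro smooth_on_bounded_linear oU bounded_linear_fst bounded_linear_snd)+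
  have smA: "smooth_on (UNIV \<times> U) (\<lambda>p. A p $ i $ j)" for i j
  proof -
    have "smooth_on (UNIV \<times> U) (\<lambda>p :: real \<times> (real ^ 'i). \<omega> (snd p) (axis j 1) (axis i 1))"
      by (rule smooth_on_compose[OF oU U(1) _ two_form_onD(3)[OF U(3), of "axis j 1" "axis i 1"] smfst(2)]) auto
    then show ?thesis unfolding A_def wt_def
      by (simp, intro smooth_on_add smooth_on_mult smooth_on_diff smooth_on_const oU smfst)
  qed
  have smb: "smooth_on (UNIV \<times> U) (\<lambda>p. b p $ i)" for i
    unfolding b_def
    by (simp, intro smooth_on_minus oU, rule smooth_on_compose[OF oU U(1) _ one_form_onD(2)[OF \<eta>, of "axis i 1"] smfst(2)]) auto
  \<comment> \<open>At the origin the segment of forms is constantly \<open>\<omega> 0\<close>,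
    hence nondegenerate for every t; compactness of the time interval then gives a radius valid for
    all t.\<close>
  have det0: "det (A (t, 0)) \<noteq> 0" for t
  proof (rule det_nonzeroI)
    fix y assume y: "A (t, 0) *v y = 0"
    have "\<omega> 0 y (axis j 1) = 0" for j
      using Av[of "(t, 0)" y j] U(2) y by (simp add: wt_def algebra_simps)
    then have z: "\<omega> 0 y b = 0" if "b \<in> Basis" for b using that by (auto simp: Basis_vec_def)
    have "linear (\<omega> 0 y)" using bl[OF U(2)] by (simp add: bilinear_def)
    from linear_eq_sum_Basis[OF this] z have "\<omega> 0 y v = 0" for v by simp
    then show "y = 0" by (rule nd)
  qed
  have smdet: "smooth_on (UNIV \<times> U) (\<lambda>p. det (A p))" by (rule smooth_on_det[OF oU smA])
  define Z where "Z = (UNIV \<times> U) \<inter> (\<lambda>p. det (A p)) -` (- {0})"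
  have oZ: "open Z"
    unfolding Z_def by (rule continuous_open_preimage[OF smooth_on_continuous[OF smdet] oU]) auto
  have "compact ({-1..2::real} \<times> {0 :: real ^ 'i})" by (intro compact_Times compact_Icc) auto
  moreover have "{-1..2::real} \<times> {0 :: real ^ 'i} \<subseteq> Z" using det0 U(2) by (auto simp: Z_def)
  ultimately obtain e where e: "e > 0" "(\<Union>p\<in>{-1..2::real} \<times> {0}. cball p e) \<subseteq> Z"
    using compact_subset_open_imp_cball_epsilon_subset[OF _ oZ] by metis
  have inZ: "(t, x) \<in> Z" if "t \<in> {-1..2}" "x \<in> cball 0 e" for t x
  proof -
    have "(t, x) \<in> cball (t, 0) e" using that by (simp add: dist_Pair_Pair)
    then show ?thesis using e(2) that(1) by blast
  qed
  let ?J = "{-1<..<2::real}" and ?B = "ball (0 :: real ^ 'i) e"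
  have JB: "?J \<times> ?B \<subseteq> Z" using inZ by auto
  have BU: "x \<in> U" if "x \<in> ?B" for x using inZ[of 0 x] that by (simp add: Z_def)
  have ZU: "Z \<subseteq> UNIV \<times> U" by (auto simp: Z_def)
  have solve: "A p *v X p = b p" if "p \<in> Z" for p
    using cramer[of "A p" "X p" "b p"] that by (simp add: Z_def X_def)
  have oJB: "open (?J \<times> ?B)" by (intro open_Times) auto
  have smX: "smooth_on (?J \<times> ?B) X"
  proof (rule smooth_on_linear_solve[OF oJB, of A b])
    show "smooth_on (?J \<times> ?B) (\<lambda>p. A p $ i $ j)" for i j by (rule smooth_on_subset[OF smA]) (use JB ZU in blast)
    show "smooth_on (?J \<times> ?B) (\<lambda>p. b p $ i)" for i by (rule smooth_on_subset[OF smb]) (use JB ZU in blast)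
    show "det (A p) \<noteq> 0" if "p \<in> ?J \<times> ?B" for p using JB that by (auto simp: Z_def)
    show "A p *v X p = b p" if "p \<in> ?J \<times> ?B" for p by (rule solve) (use JB that in blast)
  qed
  have eq: "(1 - t) * \<omega> x (X (t, x)) v + t * \<omega> 0 (X (t, x)) v = - \<eta> x v" if t: "t \<in> ?J" and x: "x \<in> ?B" for t x v
  proof -
    have Z: "(t, x) \<in> Z" and xU: "x \<in> U" using JB BU t x by auto
    have "wt (t, x) (X (t, x)) (axis j 1) = - \<eta> x (axis j 1)" for j
      using Av[of "(t, x)" "X (t, x)" j] xU solve[OF Z] by (simp add: b_def)
    then have B: "wt (t, x) (X (t, x)) i = - \<eta> x i" if "i \<in> Basis" for i using that by (auto simp: Basis_vec_def)
    have l1: "linear (wt (t, x) (X (t, x)))" using blwt[of "(t, x)"] xU by (simp add: bilinear_def)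
    have "wt (t, x) (X (t, x)) v = (\<Sum>i\<in>Basis. (v \<bullet> i) *\<^sub>R wt (t, x) (X (t, x)) i)"
      by (rule linear_eq_sum_Basis[OF l1])
    also have "\<dots> = - (\<Sum>i\<in>Basis. (v \<bullet> i) *\<^sub>R \<eta> x i)" by (simp add: B sum_negf)
    also have "(\<Sum>i\<in>Basis. (v \<bullet> i) *\<^sub>R \<eta> x i) = \<eta> x v"
      by (rule linear_eq_sum_Basis[OF one_form_onD(1)[OF \<eta> xU], symmetric])
    finally show ?thesis by (simp add: wt_def)
  qed
  \<comment> \<open>The minimum of the norm of A y over unit vectors y and a compact set of
    parameters is positive. It bounds the inverse matrix uniformly, so that X is no larger than a
    constant times \<eta>.\<close>
  let ?K = "({-1..2::real} \<times> cball (0 :: real ^ 'i) e) \<times> sphere (0 :: real ^ 'i) 1"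
  have KZ: "fst ` ?K \<subseteq> Z" using inZ by auto
  have "continuous_on ?K (\<lambda>q. norm (A (fst q) *v snd q))"
  proof -
    have c: "continuous_on ?K (\<lambda>q. A (fst q) $ i $ j)" for i j
      by (rule continuous_on_compose2[OF smooth_on_continuous[OF smA] continuous_on_fst[OF continuous_on_id]])
        (use KZ ZU in blast)
    show ?thesis unfolding matrix_vector_mult_def
      by (intro continuous_intros c)
  qed
  moreover have "compact ?K" by (intro compact_Times) auto
  moreover have "?K \<noteq> {}"
  proof -
    have "((0, 0), axis undefined 1) \<in> ?K" using e by simp
    then show ?thesis by blast
  qed
  ultimately obtain q0 where q0: "q0 \<in> ?K" "\<And>q. q \<in> ?K \<Longrightarrow> norm (A (fst q0) *v snd q0) \<le> norm (A (fst q) *v snd q)"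
    using continuous_attains_inf[of ?K "\<lambda>q. norm (A (fst q) *v snd q)"] by blast
  define m where "m = norm (A (fst q0) *v snd q0)"
  have inj: "y = 0" if "p \<in> Z" "A p *v y = 0" for p y
    using cramer[of "A p" y 0] that cramer[of "A p" 0 0] by (simp add: Z_def)
  have m: "m > 0"
  proof -
    have "A (fst q0) *v snd q0 \<noteq> 0" using inj[of "fst q0" "snd q0"] q0(1) KZ by auto
    then show ?thesis by (simp add: m_def)
  qed
  have mle: "m * norm y \<le> norm (A (t, x) *v y)" if "t \<in> {-1..2}" "x \<in> cball 0 e" for t x y
  proof (cases "y = 0")
    case False
    have "m \<le> norm (A (t, x) *v (inverse (norm y) *\<^sub>R y))"
      unfolding m_def using q0(2)[of "((t, x), inverse (norm y) *\<^sub>R y)"] that False by simp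
    also have "\<dots> = norm (A (t, x) *v y) / norm y"
      by (simp add: matrix_vector_mult_scaleR divide_inverse mult.commute)
    finally show ?thesis using False by (simp add: field_simps)
  qed simp
  have bound: "norm (X (t, x)) \<le> (1 / m) * (\<Sum>b\<in>Basis. \<bar>\<eta> x b\<bar>)" if t: "t \<in> ?J" and x: "x \<in> ?B" for t x
  proof -
    have "m * norm (X (t, x)) \<le> norm (b (t, x))"
      using mle[of t x "X (t, x)"] solve[of "(t, x)"] JB t x by (simp add: subset_iff)
    also have "\<dots> \<le> (\<Sum>j\<in>UNIV. \<bar>b (t, x) $ j\<bar>)" by (rule norm_le_l1_cart)
    also have "\<dots> = (\<Sum>j\<in>UNIV. \<bar>\<eta> x (axis j 1)\<bar>)" by (simp add: b_def)
    also have "\<dots> = (\<Sum>b\<in>Basis. \<bar>\<eta> x b\<bar>)"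
    proof -
      have "bij_betw (\<lambda>j. axis j 1) UNIV (Basis :: (real ^ 'i) set)"
        unfolding bij_betw_def by (auto simp: inj_on_def axis_eq_axis Basis_vec_def)
      from sum.reindex_bij_betw[OF this] show ?thesis .
    qed
    finally show ?thesis using m by (simp add: field_simps)
  qed
  show thesis
  proof (rule that[of e X "1 / m"])
    show "?B \<subseteq> U" using BU by blast
  qed (use e m smX eq bound in auto)
qed

text \<open>Picard's theorem above needs a global Lipschitz bound, so the field is cut off by the
  nearest-point projection to a ball. As 0 is stationary, trajectories from a small ball stay
  inside, where the cut-off changes nothing. The last property controls the displacement of x by the
  field at the starting point alone.\<close>

lemma local_flow_exists:
  fixes X :: "real \<times> 'a::euclidean_space \<Rightarrow> 'a"
  assumes r: "0 < r" and I: "{0..1} \<subseteq> I" "open I" and X: "smooth_on (I \<times> ball 0 r) X" and X0: "\<And>t. t \<in> {0..1} \<Longrightarrow> X (t, 0) = 0"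
  obtains \<rho> \<delta> C u where "0 < \<rho>" "\<rho> < r" "0 < \<delta>" "\<delta> \<le> \<rho>" "0 \<le> C" "smooth_flow X I (ball 0 \<rho>) (ball 0 \<delta>) u"
    "\<And>x t e. x \<in> ball 0 \<delta> \<Longrightarrow> t \<in> {0..1} \<Longrightarrow> 0 \<le> e \<Longrightarrow> (\<And>s. s \<in> {0..1} \<Longrightarrow> norm (X (s, x)) \<le> e) \<Longrightarrow> norm (u t x - x) \<le> C * e"
proof -
  define \<rho> where "\<rho> = r / 2"
  have \<rho>: "0 < \<rho>" "\<rho> < r" using r by (auto simp: \<rho>_def)
  let ?K = "cball (0 :: 'a) \<rho>"
  have Kr: "?K \<subseteq> ball 0 r" using \<rho> by auto
  have sub: "{0..1} \<times> ?K \<subseteq> I \<times> ball 0 r" using Kr I by auto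
  have compK: "compact ({0..1::real} \<times> ?K)" by (intro compact_Times compact_Icc compact_cball)
  have dX: "((\<lambda>x. X (t, x)) has_derivative (\<lambda>v. frechet_derivative X (at (t, x)) (0, v))) (at x)"
    if "t \<in> {0..1}" "x \<in> ?K" for t x
  proof -
    have "(t, x) \<in> I \<times> ball 0 r" by (rule subsetD[OF sub]) (use that in simp)
    note dX = smooth_on_has_derivative[OF X this]
    have "((\<lambda>x. (t, x)) has_derivative (\<lambda>v. (0, v))) (at x)"
      by (intro has_derivative_Pair has_derivative_ident has_derivative_const)
    from has_derivative_compose[OF this dX] show ?thesis .
  qed
  have "\<exists>B. \<forall>p\<in>{0..1} \<times> ?K. norm (frechet_derivative X (at p) (0, b)) \<le> B" for b
    using compact_imp_bounded[OF compact_continuous_image[OF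
      continuous_on_subset[OF smooth_on_continuous[OF smooth_on_frechet[OF X]] sub] compK]]
    by (auto simp: bounded_iff)
  then obtain B where B: "\<And>b p. p \<in> {0..1} \<times> ?K \<Longrightarrow> norm (frechet_derivative X (at p) (0, b)) \<le> B b" by metis
  define M where "M = (\<Sum>b\<in>Basis. \<bar>B b\<bar>)"
  have BM: "norm (frechet_derivative X (at p) (0, b)) \<le> M" if "b \<in> Basis" "p \<in> {0..1} \<times> ?K" for b p
  proof -
    have "norm (frechet_derivative X (at p) (0, b)) \<le> \<bar>B b\<bar>" using B[OF that(2), of b] by linarith
    also have "\<dots> \<le> M" unfolding M_def by (rule member_le_sum[OF that(1)]) auto
    finally show ?thesis .
  qed
  define L where "L = of_nat DIM('a) * M"
  have L: "0 \<le> L" by (simp add: L_def M_def sum_nonneg)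
  have lip: "norm (X (t, x) - X (t, y)) \<le> L * norm (x - y)" if t: "t \<in> {0..1}" and x: "x \<in> ?K" and y: "y \<in> ?K" for t x y
  proof (rule differentiable_bound[OF convex_cball[of 0 \<rho>] _ _ x y])
    fix z assume z: "z \<in> ?K"
    show "((\<lambda>x. X (t, x)) has_derivative (\<lambda>v. frechet_derivative X (at (t, z)) (0, v))) (at z within ?K)"
      by (rule has_derivative_at_withinI[OF dX[OF t z]])
    show "onorm (\<lambda>v. frechet_derivative X (at (t, z)) (0, v)) \<le> L"
      unfolding L_def
      by (rule onorm_le, rule norm_linear_le_Basis[OF has_derivative_linear[OF dX[OF t z]]]) (use BM t z in auto)
  qed
  \<comment> \<open>The projection is 1-Lipschitz, so precomposing with it preserves the Lipschitz
    constant of X on the ball.\<close>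
  define P where "P = closest_point ?K"
  have PK: "P x \<in> ?K" for x unfolding P_def by (rule closest_point_in_set) (use \<rho> in auto)
  have Pid: "P x = x" if "x \<in> ?K" for x unfolding P_def by (rule closest_point_self[OF that])
  have Plip: "norm (P x - P y) \<le> norm (x - y)" for x y
    using closest_point_lipschitz[of ?K x y] \<rho> by (simp add: P_def dist_norm)
  have cP: "continuous_on S P" for S
    unfolding P_def using continuous_on_closest_point[of ?K S] \<rho> by simp
  define F where "F = (\<lambda>t x. X (t, P x))"
  have cF: "continuous_on ({0..1} \<times> UNIV) (\<lambda>(t, x). F t x)"
  proof -
    have "continuous_on ({0..1} \<times> UNIV) (\<lambda>p :: real \<times> 'a. X (fst p, P (snd p)))"
      by (rule continuous_on_compose2[OF continuous_on_subset[OF smooth_on_continuous[OF X] sub]])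
        (use PK in \<open>auto intro!: continuous_on_Pair continuous_on_fst continuous_on_id continuous_on_compose2[OF cP[of UNIV]] continuous_on_snd\<close>)
    then show ?thesis by (simp add: F_def case_prod_beta)
  qed
  have Flip: "norm (F t x - F t y) \<le> L * norm (x - y)" if "t \<in> {0..1}" for t x y
  proof -
    have "norm (F t x - F t y) \<le> L * norm (P x - P y)" unfolding F_def by (rule lip[OF that PK PK])
    also have "\<dots> \<le> L * norm (x - y)" by (rule mult_left_mono[OF Plip L])
    finally show ?thesis .
  qed
  define Q where "Q = (\<lambda>x u. continuous_on {0..1} u \<and> (\<forall>t\<in>{0..1}. u t = x + integral {0..t} (\<lambda>s. F s (u s))))"
  have "\<exists>u. Q x u" for x
    by (rule picard_global[OF cF L Flip, of x]) (auto simp: Q_def)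
  then obtain w where w: "\<And>x. Q x (w x)" by metis
  have cw: "continuous_on {0..1} (w x)" for x using w[of x] by (simp add: Q_def)
  have weq: "w x t = x + integral {0..t} (\<lambda>s. F s (w x s))" if "t \<in> {0..1}" for x t using w[of x] that by (simp add: Q_def)
  have cFw: "continuous_on {0..1} (\<lambda>s. F s (w x s))" for x
    by (rule continuous_on_case_prod[OF cF continuous_on_id cw]) auto
  have wlip: "norm (w x t - w y t) \<le> exp L * norm (x - y)" if t: "t \<in> {0..1}" for x y t
  proof -
    have "norm (w x t - w y t) \<le> (norm (x - y) + 0) * exp (L * t)"
      by (rule integral_equation_compare[OF cFw cFw weq weq L]) (use Flip t in auto)
    also have "\<dots> \<le> norm (x - y) * exp L"
      using t L mult_left_le[of t L] by (auto intro!: mult_left_mono)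
    finally show ?thesis by (simp add: mult.commute)
  qed
  \<comment> \<open>Comparison of the trajectory with the constant curve x, whose defect is the
    field at x.\<close>
  have near: "norm (w x t - x) \<le> exp L * e" if x: "x \<in> ?K" and t: "t \<in> {0..1}" and e: "0 \<le> e" "\<And>s. s \<in> {0..1} \<Longrightarrow> norm (X (s, x)) \<le> e" for x t e
  proof -
    have "norm (w x t - x) \<le> (norm (x - x) + e) * exp (L * t)"
    proof (rule integral_equation_compare[OF cFw continuous_on_const[of _ 0] weq _ L e(1) _ t])
      show "x = x + integral {0..t} (\<lambda>s. 0)" for t :: real by simp
      fix s :: real assume s: "s \<in> {0..1}"
      have "norm (F s (w x s) - 0) \<le> norm (F s (w x s) - F s x) + norm (F s x)"
        using norm_triangle_sub[of "F s (w x s)" "F s x"] by simp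
      also have "\<dots> \<le> L * norm (w x s - x) + e"
        by (intro add_mono Flip[OF s]) (simp add: F_def Pid[OF x] e(2)[OF s])
      finally show "norm (F s (w x s) - 0) \<le> L * norm (w x s - x) + e" .
    qed simp
    also have "\<dots> \<le> e * exp L" using t L e mult_left_le[of t L] by (auto intro!: mult_left_mono)
    finally show ?thesis by (simp add: mult.commute)
  qed
  \<comment> \<open>Distances to the stationary point grow by at most exp L in unit time.\<close>
  define \<delta> where "\<delta> = \<rho> / exp L"
  have \<delta>: "0 < \<delta>" "\<delta> \<le> \<rho>" using \<rho> L by (auto simp: \<delta>_def field_simps)
  have w0: "w 0 t = 0" if t: "t \<in> {0..1}" for t
    using near[of 0 t 0] t X0 \<rho> by simp
  have wb: "w x t \<in> ball 0 \<rho>" if x: "x \<in> ball 0 \<delta>" and t: "t \<in> {0..1}" for x t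
  proof -
    have "norm (w x t) \<le> exp L * norm x" using wlip[OF t, of x 0] w0[OF t] by simp
    also have "\<dots> < exp L * \<delta>" using x by (intro mult_strict_left_mono) auto
    also have "\<dots> = \<rho>" by (simp add: \<delta>_def)
    finally show ?thesis by simp
  qed
  have cu: "continuous_on ({0..1} \<times> ball 0 \<delta>) (\<lambda>(t, x). w x t)"
    unfolding continuous_on_iff
  proof (intro ballI allI impI)
    fix p :: "real \<times> 'a" and e :: real assume p: "p \<in> {0..1} \<times> ball 0 \<delta>" and e: "0 < e"
    obtain t0 x0 where p0: "p = (t0, x0)" "t0 \<in> {0..1}" using p by auto
    have e2: "0 < e / 2" using e by simp
    obtain d where d: "d > 0" "\<And>t. t \<in> {0..1} \<Longrightarrow> dist t t0 < d \<Longrightarrow> dist (w x0 t) (w x0 t0) < e / 2"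
      using cw[of x0, unfolded continuous_on_iff, rule_format, OF p0(2) e2] by blast
    show "\<exists>d>0. \<forall>q\<in>{0..1} \<times> ball 0 \<delta>. dist q p < d \<longrightarrow> dist ((\<lambda>(t, x). w x t) q) ((\<lambda>(t, x). w x t) p) < e"
    proof (intro exI[of _ "min d (e / (2 * exp L))"] conjI ballI impI)
      fix q :: "real \<times> 'a" assume q: "q \<in> {0..1} \<times> ball 0 \<delta>" "dist q p < min d (e / (2 * exp L))"
      obtain t x where tx: "q = (t, x)" "t \<in> {0..1}" using q by auto
      have 1: "dist x x0 < e / (2 * exp L)" "dist t t0 < d"
        using q(2) dist_snd_le[of q p] dist_fst_le[of q p] unfolding tx p0 by auto
      have "dist (w x t) (w x0 t) \<le> exp L * dist x x0" using wlip[OF tx(2), of x x0] by (simp add: dist_norm)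
      also have "\<dots> < exp L * (e / (2 * exp L))" using 1 by (intro mult_strict_left_mono) auto
      also have "\<dots> = e / 2" by simp
      finally have "dist (w x t) (w x0 t) < e / 2" .
      moreover have "dist (w x0 t) (w x0 t0) < e / 2" by (rule d(2)[OF tx(2) 1(2)])
      ultimately have "dist (w x t) (w x0 t0) < e"
        using dist_triangle[of "w x t" "w x0 t0" "w x0 t"] by simp
      then show "dist ((\<lambda>(t, x). w x t) q) ((\<lambda>(t, x). w x t) p) < e" by (simp add: tx p0)
    qed (use d e in auto)
  qed
  have "smooth_flow X I (ball 0 \<rho>) (ball 0 \<delta>) (\<lambda>t x. w x t)"
  proof
    show "smooth_on (I \<times> ball 0 \<rho>) X" by (rule smooth_on_subset[OF X]) (use \<rho> in auto)
    show "w x t = x + integral {0..t} (\<lambda>s. X (s, w x s))" if t: "t \<in> {0..1}" and x: "x \<in> ball 0 \<delta>" for t x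
    proof -
      have "integral {0..t} (\<lambda>s. F s (w x s)) = integral {0..t} (\<lambda>s. X (s, w x s))"
      proof (rule integral_cong)
        fix s assume "s \<in> {0..t}"
        then have "w x s \<in> ball 0 \<rho>" using t by (intro wb[OF x]) auto
        then show "F s (w x s) = X (s, w x s)" using Pid[of "w x s"] by (simp add: F_def)
      qed
      then show ?thesis using weq[OF t, of x] by simp
    qed
  qed (use I cu wb in auto)
  then show thesis
    by (rule that[OF \<rho> \<delta> exp_ge_zero[of L]]) (use near \<delta> in auto)
qed

lemma integral_equation_has_derivative:
  fixes f :: "real \<Rightarrow> 'a::euclidean_space"
  assumes f: "continuous_on {0..1} f" and v: "\<And>t. t \<in> {0..1} \<Longrightarrow> v t = c + integral {0..t} f"
    and t: "0 < t" "t < 1"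
  shows "(v has_derivative (\<lambda>h. h *\<^sub>R f t)) (at t)"
proof -
  have "((\<lambda>t. c + integral {0..t} f) has_vector_derivative f t) (at t within {0..1})"
    using has_vector_derivative_add[OF has_vector_derivative_const integral_has_vector_derivative[OF f, of t]] t by simp
  moreover have "at t within {0..1} = at t"
    by (rule at_within_nhd[of _ "{0<..<1}" _ UNIV, simplified]) (use t in auto)
  ultimately have "((\<lambda>t. c + integral {0..t} f) has_derivative (\<lambda>h. h *\<^sub>R f t)) (at t)"
    by (simp add: has_vector_derivative_def)
  then show ?thesis
    by (rule has_derivative_transform_within_open[where s="{0<..<1}"]) (use t v in auto)
qed

lemma one_form_on_diff:
  assumes "open U" "one_form_on U \<alpha>" "one_form_on U \<beta>"
  shows "one_form_on U (\<lambda>x v. \<alpha> x v - \<beta> x v)"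
    and "x \<in> U \<Longrightarrow> dform1 (\<lambda>x v. \<alpha> x v - \<beta> x v) x u v = dform1 \<alpha> x u v - dform1 \<beta> x u v"
proof -
  show "one_form_on U (\<lambda>x v. \<alpha> x v - \<beta> x v)"
    using assms unfolding one_form_on_def by (auto intro: linear_compose_sub smooth_on_diff)
  assume x: "x \<in> U"
  show "dform1 (\<lambda>x v. \<alpha> x v - \<beta> x v) x u v = dform1 \<alpha> x u v - dform1 \<beta> x u v"
    using frechet_at[OF has_derivative_diff[OF one_form_has_derivative_at[OF assms(2) x] one_form_has_derivative_at[OF assms(3) x]]]
    unfolding dform1_def by metis
qed

lemma one_form_on_add:
  assumes "open U" "one_form_on U \<alpha>" "one_form_on U \<beta>"
  shows "one_form_on U (\<lambda>x v. \<alpha> x v + \<beta> x v)"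
    and "x \<in> U \<Longrightarrow> dform1 (\<lambda>x v. \<alpha> x v + \<beta> x v) x u v = dform1 \<alpha> x u v + dform1 \<beta> x u v"
proof -
  show "one_form_on U (\<lambda>x v. \<alpha> x v + \<beta> x v)"
    using assms unfolding one_form_on_def by (auto intro: linear_compose_add smooth_on_add)
  assume x: "x \<in> U"
  show "dform1 (\<lambda>x v. \<alpha> x v + \<beta> x v) x u v = dform1 \<alpha> x u v + dform1 \<beta> x u v"
    using frechet_at[OF has_derivative_add[OF one_form_has_derivative_at[OF assms(2) x] one_form_has_derivative_at[OF assms(3) x]]]
    unfolding dform1_def by metis
qed

text \<open>Along the flow the pullback of the segment of forms is constant: by Cartan's formula the
  Lie derivative along X contributes -d \<eta>, and the derivative in t contributes
  \<open>\<omega> 0\<close> - \<omega> = d \<eta>. Here w is the derivative of the flow at x, known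
  through the variational equation.\<close>

lemma (in smooth_flow) moser_pullback:
  assumes U: "open U" "S \<subseteq> U" "0 \<in> U" "two_form_on U \<omega>" "closed_form_on U \<omega>" "one_form_on U \<eta>"
    and d\<eta>: "\<And>x u v. x \<in> S \<Longrightarrow> ext_deriv \<eta> x u v = \<omega> 0 u v - \<omega> x u v"
    and eq: "\<And>t x v. t \<in> {0..1} \<Longrightarrow> x \<in> S \<Longrightarrow> (1 - t) * \<omega> x (X (t, x)) v + t * \<omega> 0 (X (t, x)) v = - \<eta> x v"
    and x: "x \<in> D"
    and w: "\<And>v. continuous_on {0..1} (\<lambda>t. w t v)"
      "\<And>t v. t \<in> {0..1} \<Longrightarrow> w t v = v + integral {0..t} (\<lambda>s. X' s (u s x) (w s v))"
  shows "\<omega> 0 (w 1 a) (w 1 b) = \<omega> x a b"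
proof -
  note bl0 = two_form_onD(1)[OF U(4,3)]
  have Om: "two_form_on UNIV (\<lambda>x. \<omega> 0)"
    unfolding two_form_on_def
    by (intro conjI ballI allI bl0 two_form_onD(2)[OF U(4,3)] smooth_on_const[OF open_UNIV])
  have dOm: "dform2 (\<lambda>x. \<omega> 0) y h c d = 0" for y h c d
    by (simp add: dform2_def)
  define g where "g = (\<lambda>t. (1 - t) * \<omega> (u t x) (w t a) (w t b) + t * \<omega> 0 (w t a) (w t b))"
  have cX: "continuous_on {0..1} (\<lambda>s. X' s (u s x) (w s v))" for v
  proof -
    have "continuous_on {0..1} (\<lambda>s. \<Sum>b\<in>Basis. (w s v \<bullet> b) *\<^sub>R X' s (u s x) b)"
      by (intro continuous_intros w contF'u1 x)
    then show ?thesis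
      by (rule continuous_on_eq) (use linear_eq_sum_Basis[OF linF'[OF _ uS[OF _ x]]] in auto)
  qed
  have du: "((\<lambda>t. u t x) has_derivative (\<lambda>h. h *\<^sub>R X (t, u t x))) (at t)" if "0 < t" "t < 1" for t
    by (rule integral_equation_has_derivative[OF contFu[OF x] u[OF _ x] that])
  have dw: "((\<lambda>t. w t v) has_derivative (\<lambda>h. h *\<^sub>R X' t (u t x) (w t v))) (at t)" if "0 < t" "t < 1" for t v
    by (rule integral_equation_has_derivative[OF cX w(2) that])
  \<comment> \<open>The cancellation as an identity between real numbers. The hypotheses are Moser's
    equation differentiated in the two directions A and B, closedness of \<omega>, and the formula
    for d \<eta>.\<close>
  have alg: "(0 - 1) * w0 + (dX + pA + - pB) * (1 - t) + (1 * w1 + (qA + - qB) * t) = 0"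
    if "(1 - t) * (dA + pA) + t * qA = - eA" "(1 - t) * (dB + pB) + t * qB = - eB"
      "dX - dA + dB = 0" "eA - eB = w1 - w0" for t w0 w1 dX dA dB pA pB qA qB eA eB :: real
    using that by algebra
  have "DERIV g t :> 0" if t: "0 < t" "t < 1" for t
  proof -
    have t01: "t \<in> {0..1}" using t by simp
    let ?y = "u t x" and ?A = "w t a" and ?B = "w t b"
    let ?X = "X (t, ?y)" and ?XA = "X' t ?y ?A" and ?XB = "X' t ?y ?B"
    have yS: "?y \<in> S" by (rule uS[OF t01 x])
    then have yU: "?y \<in> U" using U(2) by auto
    note bl = two_form_onD(1)[OF U(4) yU]
    have 1: "((\<lambda>t. \<omega> (u t x) (w t a) (w t b)) has_derivative
      (\<lambda>h. dform2 \<omega> ?y (h *\<^sub>R ?X) ?A ?B + \<omega> ?y (h *\<^sub>R ?XA) ?B + \<omega> ?y ?A (h *\<^sub>R ?XB))) (at t)"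
      by (rule two_form_has_derivative[OF U(1,4) yU du[OF t] dw[OF t] dw[OF t]])
    have 2: "((\<lambda>t. \<omega> 0 (w t a) (w t b)) has_derivative
      (\<lambda>h. dform2 (\<lambda>x. \<omega> 0) ?y (h *\<^sub>R ?X) ?A ?B + \<omega> 0 (h *\<^sub>R ?XA) ?B + \<omega> 0 ?A (h *\<^sub>R ?XB))) (at t)"
      by (rule two_form_has_derivative[OF open_UNIV Om UNIV_I du[OF t] dw[OF t] dw[OF t]])
    let ?g1 = "dform2 \<omega> ?y ?X ?A ?B + \<omega> ?y ?XA ?B + \<omega> ?y ?A ?XB" and ?g2 = "\<omega> 0 ?XA ?B + \<omega> 0 ?A ?XB"
    have e1: "DERIV (\<lambda>t. \<omega> (u t x) (w t a) (w t b)) t :> ?g1"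
      unfolding has_field_derivative_def
      by (rule has_derivative_eq_rhs[OF 1])
        (simp add: fun_eq_iff linear_cmul[OF linear_dform2_left[OF U(4) yU]] bilinear_lmul[OF bl] bilinear_rmul[OF bl] algebra_simps)
    have e2: "DERIV (\<lambda>t. \<omega> 0 (w t a) (w t b)) t :> ?g2"
      unfolding has_field_derivative_def
      by (rule has_derivative_eq_rhs[OF 2])
        (simp add: fun_eq_iff dOm bilinear_lmul[OF bl0] bilinear_rmul[OF bl0] algebra_simps)
    have "DERIV g t :> (0 - 1) * \<omega> ?y ?A ?B + ?g1 * (1 - t) + (1 * \<omega> 0 ?A ?B + ?g2 * t)"
      unfolding g_def
      by (intro DERIV_add DERIV_mult' e1 e2 DERIV_mult DERIV_diff DERIV_const DERIV_ident)
    \<comment> \<open>Moser's equation holds at all points near the trajectory and may be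
      differentiated in the base point, in direction c.\<close>
    moreover have E: "(1 - t) * (dform2 \<omega> ?y c ?X d + \<omega> ?y (X' t ?y c) d) + t * \<omega> 0 (X' t ?y c) d = - dform1 \<eta> ?y c d" for c d
    proof -
      have dX: "((\<lambda>y. X (t, y)) has_derivative X' t ?y) (at ?y)" by (rule dF[OF t01 yS])
      have d1: "((\<lambda>y. \<omega> y (X (t, y)) d) has_derivative (\<lambda>h. dform2 \<omega> ?y h ?X d + \<omega> ?y (X' t ?y h) d + \<omega> ?y ?X 0)) (at ?y)"
        by (rule two_form_has_derivative[OF U(1,4) yU has_derivative_ident dX has_derivative_const])
      have d2: "((\<lambda>y. \<omega> 0 (X (t, y)) d) has_derivative (\<lambda>h. dform2 (\<lambda>x. \<omega> 0) ?y h ?X d + \<omega> 0 (X' t ?y h) d + \<omega> 0 ?X 0)) (at ?y)"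
        by (rule two_form_has_derivative[OF open_UNIV Om UNIV_I has_derivative_ident dX has_derivative_const])
      have "((\<lambda>y. (1 - t) * \<omega> y (X (t, y)) d + t * \<omega> 0 (X (t, y)) d) has_derivative
         (\<lambda>h. (1 - t) * (dform2 \<omega> ?y h ?X d + \<omega> ?y (X' t ?y h) d + \<omega> ?y ?X 0) +
           t * (dform2 (\<lambda>x. \<omega> 0) ?y h ?X d + \<omega> 0 (X' t ?y h) d + \<omega> 0 ?X 0))) (at ?y)"
        by (intro has_derivative_add has_derivative_mult_right d1 d2)
      then have "((\<lambda>y. - \<eta> y d) has_derivative
         (\<lambda>h. (1 - t) * (dform2 \<omega> ?y h ?X d + \<omega> ?y (X' t ?y h) d + \<omega> ?y ?X 0) +
           t * (dform2 (\<lambda>x. \<omega> 0) ?y h ?X d + \<omega> 0 (X' t ?y h) d + \<omega> 0 ?X 0))) (at ?y)"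
        by (rule has_derivative_transform_within_open[OF _ S yS]) (use eq[OF t01] in simp)
      from has_derivative_unique[OF this has_derivative_minus[OF one_form_has_derivative_at[OF U(6) yU]]]
      show ?thesis by (simp add: fun_eq_iff dOm bilinear_rzero[OF bl] bilinear_rzero[OF bl0])
    qed
    moreover have "(0 - 1) * \<omega> ?y ?A ?B + ?g1 * (1 - t) + (1 * \<omega> 0 ?A ?B + ?g2 * t) = 0"
    proof -
      have cl: "dform2 \<omega> ?y ?X ?A ?B - dform2 \<omega> ?y ?A ?X ?B + dform2 \<omega> ?y ?B ?X ?A = 0"
        using U(5) yU unfolding closed_form_on_alt by blast
      have a1: "\<omega> ?y ?A ?XB = - \<omega> ?y ?XB ?A" by (rule two_form_on_antisym[OF U(4) yU])
      have a2: "\<omega> 0 ?A ?XB = - \<omega> 0 ?XB ?A" by (rule two_form_on_antisym[OF U(4,3)])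
      have ed: "dform1 \<eta> ?y ?A ?B - dform1 \<eta> ?y ?B ?A = \<omega> 0 ?A ?B - \<omega> ?y ?A ?B"
        using d\<eta>[OF yS, of ?A ?B] by (simp add: ext_deriv_alt)
      show ?thesis unfolding a1 a2 by (rule alg[OF E[of ?A ?B] E[of ?B ?A] cl ed])
    qed
    ultimately show ?thesis by simp
  qed
  moreover have "continuous_on {0..1} g"
  proof -
    have "continuous_on {0..1} (\<lambda>t. \<Sum>i\<in>Basis. \<Sum>j\<in>Basis. (w t a \<bullet> i) * (w t b \<bullet> j) * \<omega> (u t x) i j)"
      by (intro continuous_intros w continuous_on_compose2[OF smooth_on_continuous[OF two_form_onD(3)[OF U(4)]] contu1[OF x]])
        (use uS x U(2) in auto)
    then have 1: "continuous_on {0..1} (\<lambda>t. \<omega> (u t x) (w t a) (w t b))"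
      by (rule continuous_on_eq) (use bilinear_eq_sum_Basis[OF two_form_onD(1)[OF U(4)]] uS x U(2) in \<open>simp add: subset_iff\<close>)
    have "continuous_on {0..1} (\<lambda>t. \<Sum>i\<in>Basis. \<Sum>j\<in>Basis. (w t a \<bullet> i) * (w t b \<bullet> j) * \<omega> 0 i j)"
      by (intro continuous_intros w)
    then have 2: "continuous_on {0..1} (\<lambda>t. \<omega> 0 (w t a) (w t b))"
      by (rule continuous_on_eq) (rule bilinear_eq_sum_Basis[OF bl0, symmetric])
    show ?thesis unfolding g_def by (intro continuous_intros 1 2)
  qed
  ultimately have "g 1 = g 0" using DERIV_isconst_end[of 0 1 g] by simp
  moreover have "g 0 = \<omega> x a b" using u[of 0 x] x w(2)[of 0] by (simp add: g_def)
  moreover have "g 1 = \<omega> 0 (w 1 a) (w 1 b)" by (simp add: g_def)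
  ultimately show ?thesis by simp
qed

text \<open>Moser's method: a primitive that is small along an isotropic subspace yields a Lagrangian germ
  equally close to that subspace.\<close>

theorem lagrangian_from_primitive:
  fixes \<omega> :: "(real ^ ('n::finite) bit0) form2"
  assumes U: "open U" "0 \<in> U" "two_form_on U \<omega>" "closed_form_on U \<omega>" and nd: "\<And>x u. x \<in> U \<Longrightarrow> (\<And>v. \<omega> x u v = 0) \<Longrightarrow> u = 0"
    and \<mu>: "one_form_on U \<mu>" "\<And>x u v. x \<in> U \<Longrightarrow> ext_deriv \<mu> x u v = \<omega> x u v" "\<And>v. \<mu> 0 v = 0"
    and W: "subspace W" "\<And>u v. u \<in> W \<Longrightarrow> v \<in> W \<Longrightarrow> \<omega> 0 u v = 0"
  obtains H C \<delta> where "lagrangian_germ \<omega> H" "0 < \<delta>" "\<And>x. x \<in> W \<Longrightarrow> norm x < \<delta> \<Longrightarrow> norm (H x) \<le> C * (\<Sum>b\<in>Basis. \<bar>\<mu> x b\<bar>)"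
proof -
  note bl0 = two_form_onD(1)[OF U(3,2)]
  obtain H0 :: "real ^ 'n bit0 \<Rightarrow> real ^ 'n" where H0: "linear H0" "surj H0" "\<And>u. u \<in> W \<Longrightarrow> H0 u = 0"
    "\<And>u v. H0 u = 0 \<Longrightarrow> H0 v = 0 \<Longrightarrow> \<omega> 0 u v = 0"
    by (rule lagrangian_linear_equations[OF bl0 two_form_onD(2)[OF U(3,2)] nd[OF U(2)] W(2,1)]) (assumption | rule that)+
  obtain R where R: "linear R" "H0 \<circ> R = id" using linear_surjective_right_inverse[OF H0(1,2)] by blast
  \<comment> \<open>A projection with the same kernel as \<open>H0\<close>, so that v - q v always
    lies in the linear Lagrangian subspace.\<close>
  define q where "q = (\<lambda>x. R (H0 x))"
  have linq: "linear q" using linear_compose[OF H0(1) R(1)] by (simp add: q_def o_def)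
  have qp: "H0 (v - q v) = 0" for v
    using fun_cong[OF R(2), of "H0 v"] by (simp add: q_def linear_diff[OF H0(1)])
  \<comment> \<open>A primitive of the constant form \<open>\<omega> 0\<close> that vanishes at the
    points of the linear Lagrangian subspace, in particular on W. Antisymmetrization counts the (q,
    q) term twice, hence the factor 1/2.\<close>
  define \<gamma> where "\<gamma> = (\<lambda>x v. \<omega> 0 (q x) (v - (1/2) *\<^sub>R q v))"
  have lin\<gamma>1: "linear (\<lambda>x. \<gamma> x v)" for v
    by (simp add: \<gamma>_def linear_iff linear_add[OF linq] linear_cmul[OF linq] bilinear_ladd[OF bl0] bilinear_lmul[OF bl0])
  have lin\<gamma>2: "linear (\<gamma> x)" for x
    by (simp add: \<gamma>_def linear_iff linear_add[OF linq] linear_cmul[OF linq] bilinear_radd[OF bl0] bilinear_rmul[OF bl0]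
        bilinear_rsub[OF bl0] algebra_simps)
  have \<gamma>: "one_form_on U \<gamma>"
    unfolding one_form_on_def
    by (intro conjI ballI allI lin\<gamma>2 smooth_on_bounded_linear U(1) lin\<gamma>1[unfolded linear_conv_bounded_linear])
  have d\<gamma>: "dform1 \<gamma> x u v = \<gamma> u v" for x u v
    unfolding dform1_def using frechet_at[OF linear_imp_has_derivative[OF lin\<gamma>1]] by metis
  have ext\<gamma>: "ext_deriv \<gamma> x u v = \<omega> 0 u v" for x u v
  proof -
    have "\<omega> 0 (u - q u) (v - q v) = 0" by (rule H0(4)[OF qp qp])
    then have "\<omega> 0 u v - \<omega> 0 u (q v) - (\<omega> 0 (q u) v - \<omega> 0 (q u) (q v)) = 0"
      unfolding bilinear_lsub[OF bl0] bilinear_rsub[OF bl0] by linarith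
    moreover have "ext_deriv \<gamma> x u v = \<omega> 0 (q u) v - (1/2) * \<omega> 0 (q u) (q v) - (\<omega> 0 (q v) u - (1/2) * \<omega> 0 (q v) (q u))"
      unfolding ext_deriv_alt d\<gamma> by (simp add: \<gamma>_def bilinear_rsub[OF bl0] bilinear_rmul[OF bl0])
    moreover have "\<omega> 0 (q v) u = - \<omega> 0 u (q v)" "\<omega> 0 (q v) (q u) = - \<omega> 0 (q u) (q v)"
      by (rule two_form_on_antisym[OF U(3,2)])+
    ultimately show ?thesis by linarith
  qed
  define \<eta> where "\<eta> = (\<lambda>x v. \<gamma> x v - \<mu> x v)"
  have \<eta>: "one_form_on U \<eta>" unfolding \<eta>_def by (rule one_form_on_diff(1)[OF U(1) \<gamma> \<mu>(1)])
  have d\<eta>: "ext_deriv \<eta> x u v = \<omega> 0 u v - \<omega> x u v" if "x \<in> U" for x u v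
    using ext\<gamma>[of x u v] \<mu>(2)[OF that, of u v] one_form_on_diff(2)[OF U(1) \<gamma> \<mu>(1) that]
    by (simp add: \<eta>_def ext_deriv_alt)
  obtain r C1 X where vf: "0 < r" "ball 0 r \<subseteq> U" "smooth_on ({-1<..<2} \<times> ball 0 r) X"
    "\<And>t x v. t \<in> {-1<..<2} \<Longrightarrow> x \<in> ball 0 r \<Longrightarrow> (1 - t) * \<omega> x (X (t, x)) v + t * \<omega> 0 (X (t, x)) v = - \<eta> x v"
    "0 \<le> C1" "\<And>t x. t \<in> {-1<..<2} \<Longrightarrow> x \<in> ball 0 r \<Longrightarrow> norm (X (t, x)) \<le> C1 * (\<Sum>b\<in>Basis. \<bar>\<eta> x b\<bar>)"
    by (rule moser_vector_field[OF U(1-3) nd[OF U(2)] \<eta>]) (assumption | rule that)+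
  have \<eta>0: "\<eta> 0 v = 0" for v
    using linear_0[OF lin\<gamma>1] \<mu>(3) by (simp add: \<eta>_def)
  have X0: "X (t, 0) = 0" if "t \<in> {0..1}" for t
    using vf(6)[of t 0] vf(1) that \<eta>0 by simp
  have I: "{0..1} \<subseteq> {-1<..<2::real}" "open {-1<..<2::real}" by auto
  obtain \<rho> \<delta> C2 u where fl: "0 < \<rho>" "\<rho> < r" "0 < \<delta>" "\<delta> \<le> \<rho>" "0 \<le> C2" "smooth_flow X {-1<..<2} (ball 0 \<rho>) (ball 0 \<delta>) u"
    "\<And>x t e. x \<in> ball 0 \<delta> \<Longrightarrow> t \<in> {0..1} \<Longrightarrow> 0 \<le> e \<Longrightarrow> (\<And>s. s \<in> {0..1} \<Longrightarrow> norm (X (s, x)) \<le> e) \<Longrightarrow> norm (u t x - x) \<le> C2 * e"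
    apply (rule local_flow_exists[OF vf(1) I vf(3) X0], assumption)
    subgoal premises p for \<rho> \<delta> C u by (rule that[OF p(2-8)])
    done
  interpret smooth_flow X "{-1<..<2}" "ball 0 \<rho>" "ball 0 \<delta>" u by (rule fl(6))
  obtain w where w: "\<And>t x. t \<in> {0..1} \<Longrightarrow> x \<in> ball 0 \<delta> \<Longrightarrow> (u t has_derivative w t x) (at x)"
    "\<And>x v. x \<in> ball 0 \<delta> \<Longrightarrow> continuous_on {0..1} (\<lambda>t. w t x v)"
    "\<And>t x v. t \<in> {0..1} \<Longrightarrow> x \<in> ball 0 \<delta> \<Longrightarrow> w t x v = v + integral {0..t} (\<lambda>s. X' s (u s x) (w s x v))"
    by (rule flow_derivative) (assumption | rule that)+
  have pull: "\<omega> 0 (w 1 x a) (w 1 x b) = \<omega> x a b" if x: "x \<in> ball 0 \<delta>" for x a b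
  proof (rule moser_pullback[OF U(1) _ U(2-4) \<eta> _ _ x w(2)[OF x] w(3)[OF _ x]])
    show "ball 0 \<rho> \<subseteq> U" using vf(2) fl(2) by auto
    then show "ext_deriv \<eta> y a b = \<omega> 0 a b - \<omega> y a b" if "y \<in> ball 0 \<rho>" for y a b using d\<eta> that by blast
    show "(1 - t) * \<omega> y (X (t, y)) v + t * \<omega> 0 (X (t, y)) v = - \<eta> y v" if "t \<in> {0..1}" "y \<in> ball 0 \<rho>" for t y v
      by (rule vf(4)) (use that fl(2) in auto)
  qed
  \<comment> \<open>The time-one map pulls \<open>\<omega> 0\<close> back to \<omega>, so it carries
    the linear equations of a Lagrangian subspace to equations of a Lagrangian germ.\<close>
  define H where "H = (\<lambda>x. H0 (u 1 x))"
  have blH0: "bounded_linear H0" using H0(1) linear_conv_bounded_linear by blast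
  have smu: "smooth_on (ball 0 \<delta>) (u 1)" by (rule flow_smooth) simp
  have smH: "smooth_on (ball 0 \<delta>) H" unfolding H_def by (rule smooth_on_bounded_linear_compose[OF open_ball blH0 smu])
  have dH: "frechet_derivative H (at x) = (\<lambda>v. H0 (w 1 x v))" if "x \<in> ball 0 \<delta>" for x
    unfolding H_def by (rule frechet_at[OF bounded_linear.has_derivative[OF blH0 w(1)]]) (use that in auto)
  have xU: "x \<in> U" if "x \<in> ball 0 \<delta>" for x using that vf(2) fl(2,4) by auto
  have small: "norm (u 1 x - x) \<le> C2 * (C1 * (\<Sum>b\<in>Basis. \<bar>\<eta> x b\<bar>))" if x: "x \<in> ball 0 \<delta>" for x
  proof (rule fl(7)[OF x])
    show "0 \<le> C1 * (\<Sum>b\<in>Basis. \<bar>\<eta> x b\<bar>)" using vf(5) by (intro mult_nonneg_nonneg sum_nonneg) auto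
    show "norm (X (s, x)) \<le> C1 * (\<Sum>b\<in>Basis. \<bar>\<eta> x b\<bar>)" if "s \<in> {0..1}" for s
      by (rule vf(6)) (use that x fl(2,4) in auto)
  qed simp
  have "lagrangian_germ \<omega> H"
    unfolding lagrangian_germ_def
  proof (intro conjI exI[of _ "ball 0 \<delta>"] ballI allI impI)
    show "H 0 = 0" using small[of 0] fl(3) \<eta>0 linear_0[OF H0(1)] by (simp add: H_def)
    show "surj (frechet_derivative H (at x))" if x: "x \<in> ball 0 \<delta>" for x
    proof -
      have l: "linear (w 1 x)" by (rule has_derivative_linear[OF w(1)]) (use x in auto)
      have "inj (w 1 x)"
        unfolding linear_injective_0[OF l]
      proof (intro allI impI)
        fix a assume "w 1 x a = 0"
        then have "\<omega> x a b = 0" for b using pull[OF x, of a b] bilinear_lzero[OF bl0] by simp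
        then show "a = 0" by (rule nd[OF xU[OF x]])
      qed
      then have "surj (w 1 x)" by (rule linear_injective_imp_surjective[OF l _ refl])
      from comp_surj[OF this H0(2)] show ?thesis unfolding dH[OF x] by (simp add: o_def)
    qed
    show "\<omega> x a b = 0" if x: "x \<in> ball 0 \<delta>" and "frechet_derivative H (at x) a = 0" "frechet_derivative H (at x) b = 0" for x a b
      using that(2,3) H0(4)[of "w 1 x a" "w 1 x b"] pull[OF x, of a b] unfolding dH[OF x] by simp
  qed (use fl smH in auto)
  moreover obtain K where K: "\<And>v. norm (H0 v) \<le> norm v * K" "0 \<le> K"
    using bounded_linear.nonneg_bounded[OF blH0] by blast
  have "norm (H x) \<le> K * C2 * C1 * (\<Sum>b\<in>Basis. \<bar>\<mu> x b\<bar>)" if x: "x \<in> W" "norm x < \<delta>" for x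
  proof -
    have xb: "x \<in> ball 0 \<delta>" using x by simp
    \<comment> \<open>On W the form \<gamma> drops out and \<eta> is -\<mu> there. Since
      \<open>H0\<close> kills x, the value of H is \<open>H0\<close> applied to the displacement of
      x, which is of the size of \<mu>.\<close>
    have "q x = 0" using H0(3)[OF x(1)] linear_0[OF R(1)] by (simp add: q_def)
    then have "\<bar>\<eta> x b\<bar> = \<bar>\<mu> x b\<bar>" for b by (simp add: \<eta>_def \<gamma>_def bilinear_lzero[OF bl0])
    then have s: "norm (u 1 x - x) \<le> C2 * (C1 * (\<Sum>b\<in>Basis. \<bar>\<mu> x b\<bar>))" using small[OF xb] by simp
    have "norm (H x) = norm (H0 (u 1 x - x))" using H0(3)[OF x(1)] by (simp add: H_def linear_diff[OF H0(1)])
    also have "\<dots> \<le> norm (u 1 x - x) * K" by (rule K(1))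
    also have "\<dots> \<le> C2 * (C1 * (\<Sum>b\<in>Basis. \<bar>\<mu> x b\<bar>)) * K" by (rule mult_right_mono[OF s K(2)])
    finally show ?thesis by (simp add: algebra_simps)
  qed
  ultimately show thesis using that fl(3) by blast
qed

section \<open>Weighted Taylor expansion along the branches\<close>

text \<open>The factors are the integrals of the partial derivatives over the segment from 0 to x;
  the identity is the fundamental theorem of calculus on that segment.\<close>

lemma hadamard:
  fixes a :: "real ^ 'i::finite \<Rightarrow> real"
  assumes sm: "smooth_on (ball 0 r) a"
  obtains b where "\<And>i. smooth_on (ball 0 r) (b i)" "\<And>x. x \<in> ball 0 r \<Longrightarrow> a x = a 0 + (\<Sum>i\<in>UNIV. x $ i * b i x)"
proof -
  let ?B = "ball (0 :: real ^ 'i) r"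
  define b where "b = (\<lambda>i x. integral {0..1} (\<lambda>s. frechet_derivative a (at (s *\<^sub>R x)) (axis i 1)))"
  have inB: "s *\<^sub>R x \<in> ?B" if "x \<in> ?B" "s \<in> {0..1}" for x s
  proof -
    have "norm (s *\<^sub>R x) \<le> norm x" using that by (simp add: mult_left_le_one_le)
    then show ?thesis using that by simp
  qed
  have smb: "smooth_on ?B (b i)" for i
  proof (rule smooth_on_UN_open[OF open_ball])
    fix x0 assume x0: "x0 \<in> ?B"
    \<comment> \<open>Smoothness of the integral wants s in an interval slightly longer than [0,1].
      On a smaller ball containing x0 the points s x still lie in the ball of radius r; smoothness
      is then glued together.\<close>
    define r' where "r' = (norm x0 + r) / 2"
    have r': "norm x0 < r'" "r' < r" "0 < r'"
    proof -
      have "norm x0 < r" "0 \<le> norm x0" using x0 by auto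
      then show "norm x0 < r'" "r' < r" by (simp_all add: r'_def)
      then show "0 < r'" using \<open>0 \<le> norm x0\<close> by linarith
    qed
    define I where "I = {-1<..<r / r'}"
    have "1 < r / r'" using r' by (simp add: field_simps)
    then have I: "{0..1} \<subseteq> I" "open I" by (auto simp: I_def)
    have O: "open (I \<times> ball (0 :: real ^ 'i) r')" using I by (simp add: open_Times)
    have "(\<lambda>p. fst p *\<^sub>R snd p) ` (I \<times> ball 0 r') \<subseteq> ?B"
    proof safe
      fix s and x :: "real ^ 'i" assume s: "s \<in> I" and x: "x \<in> ball 0 r'"
      have "\<bar>s\<bar> \<le> r / r'" using s \<open>1 < r / r'\<close> by (auto simp: I_def)
      then have "\<bar>s\<bar> * norm x \<le> r / r' * norm x" by (intro mult_right_mono) auto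
      also have "\<dots> < r / r' * r'" using x r' by (intro mult_strict_left_mono) auto
      finally show "fst (s, x) *\<^sub>R snd (s, x) \<in> ?B" using r' by simp
    qed
    moreover have "smooth_on (I \<times> ball (0 :: real ^ 'i) r') (\<lambda>p. fst p *\<^sub>R snd p)"
      by (intro smooth_on_scaleR smooth_on_bounded_linear O bounded_linear_fst bounded_linear_snd)
    ultimately have "smooth_on (I \<times> ball 0 r') (\<lambda>p. frechet_derivative a (at (fst p *\<^sub>R snd p)) (axis i 1))"
      by (intro smooth_on_compose[OF O open_ball _ smooth_on_frechet[OF sm, of "axis i 1"]])
    from smooth_on_integral[OF I(1) open_ball convex_ball this]
    have "smooth_on (ball 0 r') (b i)" by (simp add: b_def)
    then show "\<exists>T. open T \<and> x0 \<in> T \<and> smooth_on T (b i)"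
      using r' by (intro exI[of _ "ball 0 r'"]) auto
  qed
  have eq: "a x = a 0 + (\<Sum>i\<in>UNIV. x $ i * b i x)" if x: "x \<in> ?B" for x
  proof -
    let ?D = "\<lambda>s i. frechet_derivative a (at (s *\<^sub>R x)) (axis i 1)"
    have d: "((\<lambda>s. a (s *\<^sub>R x)) has_vector_derivative (\<Sum>i\<in>UNIV. x $ i * ?D s i)) (at s within {0..1})" if s: "s \<in> {0..1}" for s
    proof -
      note da = smooth_on_has_derivative[OF sm inB[OF x s]]
      have "((\<lambda>s. a (0 + s *\<^sub>R x)) has_real_derivative frechet_derivative a (at (s *\<^sub>R x)) x) (at s)"
        by (rule has_real_derivative_line) (use da in simp)
      moreover have "frechet_derivative a (at (s *\<^sub>R x)) x = (\<Sum>i\<in>UNIV. x $ i * ?D s i)"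
      proof -
        have l: "linear (frechet_derivative a (at (s *\<^sub>R x)))" by (rule has_derivative_linear[OF da])
        have "frechet_derivative a (at (s *\<^sub>R x)) x = frechet_derivative a (at (s *\<^sub>R x)) (\<Sum>i\<in>UNIV. x $ i *\<^sub>R axis i 1)"
          by (simp add: basis_expansion flip: scalar_mult_eq_scaleR)
        then show ?thesis by (simp add: linear_sum[OF l] linear_cmul[OF l])
      qed
      ultimately show ?thesis
        by (simp add: has_real_derivative_iff_has_vector_derivative has_vector_derivative_at_within)
    qed
    have int: "(\<lambda>s. ?D s i) integrable_on {0..1}" for i
      by (rule integrable_continuous_interval,
          rule continuous_on_compose2[OF smooth_on_continuous[OF smooth_on_frechet[OF sm]]])
        (use inB[OF x] in \<open>auto intro!: continuous_intros\<close>)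
    have "a x - a 0 = integral {0..1} (\<lambda>s. \<Sum>i\<in>UNIV. x $ i * ?D s i)"
      using integral_unique[OF fundamental_theorem_of_calculus[OF _ d]] by simp
    also have "\<dots> = (\<Sum>i\<in>UNIV. integral {0..1} (\<lambda>s. x $ i * ?D s i))"
      by (rule integral_sum) (use integrable_on_cmult_left[OF int] in auto)
    also have "\<dots> = (\<Sum>i\<in>UNIV. x $ i * b i x)" by (simp add: b_def)
    finally show ?thesis by simp
  qed
  show thesis by (rule that[of b]) (rule smb eq; assumption)+
qed

text \<open>The quasi-homogeneous weights of \<open>U\<^sub>9\<close>. The remaining coordinates vanish on \<open>U\<^sub>9\<close> and count as
  infinitely small in the filtration below; their weight \<open>1\<close> only serves the contraction to \<open>0\<close>.\<close>

definition U9_weight :: "'n::finite bit0 \<Rightarrow> nat" where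
  "U9_weight i = (if i = 1 then 5 else if i = 2 then 7 else if i = 3 then 3 else 1)"

text \<open>Level k is the ideal generated by the monomials of weight at least k and by the
  coordinates vanishing on U9; the latter lie in every level, as \<open>other\<close> holds for all
  k. Generating it inductively lets differentiation and extraction of leading terms be proved
  generator by generator. All equalities are meant on the ball only.\<close>

inductive wfilt :: "real \<Rightarrow> nat \<Rightarrow> (real ^ ('n::finite) bit0 \<Rightarrow> real) \<Rightarrow> bool" for r where
  base: "smooth_on (ball 0 r) a \<Longrightarrow> wfilt r 0 a"
| mult: "wfilt r k a \<Longrightarrow> i \<in> {1, 2, 3} \<Longrightarrow> wfilt r (k + U9_weight i) (\<lambda>x. x $ i * a x)"
| other: "smooth_on (ball 0 r) a \<Longrightarrow> i \<notin> {1, 2, 3} \<Longrightarrow> wfilt r k (\<lambda>x. x $ i * a x)"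
| add: "wfilt r k a \<Longrightarrow> wfilt r k b \<Longrightarrow> wfilt r k (\<lambda>x. a x + b x)"
| Suc: "wfilt r (Suc k) a \<Longrightarrow> wfilt r k a"
| cong: "wfilt r k a \<Longrightarrow> (\<And>x. x \<in> ball 0 r \<Longrightarrow> a x = b x) \<Longrightarrow> wfilt r k b"

lemma wfilt_le: "wfilt r k a \<Longrightarrow> j \<le> k \<Longrightarrow> wfilt r j a"
  by (induction k) (auto simp: le_Suc_eq dest: wfilt.Suc)

lemma smooth_on_component: "open S \<Longrightarrow> smooth_on S (\<lambda>x :: real ^ 'i. x $ i)"
  by (rule smooth_on_bounded_linear[OF _ bounded_linear_vec_nth])

lemma wfilt_smooth: "wfilt r k a \<Longrightarrow> smooth_on (ball 0 r) a"
proof (induction rule: wfilt.induct)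
  case (cong k a b)
  then show ?case using smooth_on_cong[OF open_ball] by metis
qed (auto intro!: smooth_on_mult smooth_on_add smooth_on_component)

lemma wfilt_zero: "wfilt r k (\<lambda>x :: real ^ ('n::finite) bit0. 0)"
proof (induction k)
  case 0
  show ?case by (rule wfilt.base) (rule smooth_on_const[OF open_ball])
next
  case (Suc k)
  have "wfilt r (k + U9_weight (1 :: 'n bit0)) (\<lambda>x :: real ^ 'n bit0. x $ 1 * 0)"
    using wfilt.mult[OF Suc, of "1 :: 'n bit0"] by simp
  from wfilt_le[OF this, of "Suc k"] show ?case by (simp add: U9_weight_def)
qed

lemma wfilt_sum:
  "(\<And>j. j \<in> J \<Longrightarrow> wfilt r k (a j)) \<Longrightarrow> wfilt r k (\<lambda>x. \<Sum>j\<in>J. a j x)"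
  by (induction J rule: infinite_finite_induct) (auto intro: wfilt.add wfilt_zero)

text \<open>Differentiating in x_j costs the weight of x_j. The generators of type
  \<open>other\<close> survive because j is one of the three weighted coordinates. Truncated
  subtraction is harmless, level 0 containing all smooth functions.\<close>

lemma wfilt_deriv:
  fixes a :: "real ^ ('n::finite) bit0 \<Rightarrow> real"
  assumes "wfilt r k a" "j \<in> {1, 2, 3}"
  shows "wfilt r (k - U9_weight j) (\<lambda>x. frechet_derivative a (at x) (axis j 1))"
  using assms(1)
proof (induction rule: wfilt.induct)
  case (base a)
  show ?case unfolding diff_0_eq_0 by (rule wfilt.base[OF smooth_on_frechet[OF base]])
next
  case (mult k a i)
  have sm: "smooth_on (ball 0 r) a" by (rule wfilt_smooth[OF mult(1)])
  have d: "frechet_derivative (\<lambda>x. x $ i * a x) (at x) (axis j 1) =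
    x $ i * frechet_derivative a (at x) (axis j 1) + (if i = j then a x else 0)" if "x \<in> ball 0 r" for x
  proof -
    have "((\<lambda>x. x $ i * a x) has_derivative (\<lambda>h. x $ i * frechet_derivative a (at x) h + h $ i * a x)) (at x)"
      by (intro has_derivative_mult smooth_on_has_derivative[OF sm that] bounded_linear_imp_has_derivative bounded_linear_vec_nth)
    from frechet_at[OF this] show ?thesis by (simp add: axis_def)
  qed
  have 1: "wfilt r (k + U9_weight i - U9_weight j) (\<lambda>x. x $ i * frechet_derivative a (at x) (axis j 1))"
    by (rule wfilt_le[OF wfilt.mult[OF mult.IH mult(2)]]) simp
  have 2: "wfilt r (k + U9_weight i - U9_weight j) (\<lambda>x. if i = j then a x else 0)"
    using mult(1) wfilt_zero by (cases "i = j") auto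
  show ?case by (rule wfilt.cong[OF wfilt.add[OF 1 2]]) (simp add: d)
next
  case (other a i k)
  have "frechet_derivative (\<lambda>x. x $ i * a x) (at x) (axis j 1) =
    x $ i * frechet_derivative a (at x) (axis j 1)" if "x \<in> ball 0 r" for x
  proof -
    have "((\<lambda>x. x $ i * a x) has_derivative (\<lambda>h. x $ i * frechet_derivative a (at x) h + h $ i * a x)) (at x)"
      by (intro has_derivative_mult smooth_on_has_derivative[OF other(1) that] bounded_linear_imp_has_derivative bounded_linear_vec_nth)
    from frechet_at[OF this] show ?thesis using other(2) assms(2) by (auto simp: axis_def)
  qed
  then show ?case
    by (intro wfilt.cong[OF wfilt.other[OF smooth_on_frechet[OF other(1), of "axis j 1"] other(2)]]) simp
next
  case (add k a b)
  have "frechet_derivative (\<lambda>x. a x + b x) (at x) (axis j 1) =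
    frechet_derivative a (at x) (axis j 1) + frechet_derivative b (at x) (axis j 1)" if "x \<in> ball 0 r" for x
    using frechet_at[OF has_derivative_add[OF smooth_on_has_derivative[OF wfilt_smooth[OF add(1)] that]
      smooth_on_has_derivative[OF wfilt_smooth[OF add(2)] that]]] by simp
  then show ?case by (intro wfilt.cong[OF wfilt.add[OF add.IH]]) simp
next
  case (Suc k a)
  show ?case by (rule wfilt_le[OF Suc.IH]) simp
next
  case (cong k a b)
  have "frechet_derivative b (at x) (axis j 1) = frechet_derivative a (at x) (axis j 1)" if "x \<in> ball 0 r" for x
    using frechet_at[OF has_derivative_transform_within_open[OF smooth_on_has_derivative[OF wfilt_smooth[OF cong(1)] that]
      open_ball that cong(2)]] by simp
  then show ?case by (intro wfilt.cong[OF cong.IH]) simp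
qed

type_synonym expo = "nat \<times> nat \<times> nat"

definition wt :: "expo \<Rightarrow> nat" where "wt = (\<lambda>(a, b, c). 5 * a + 7 * b + 3 * c)"

definition mon :: "expo \<Rightarrow> real ^ ('n::finite) bit0 \<Rightarrow> real" where
  "mon = (\<lambda>(a, b, c) x. x $ 1 ^ a * x $ 2 ^ b * x $ 3 ^ c)"

definition expo_shift :: "'n::finite bit0 \<Rightarrow> expo \<Rightarrow> expo" where
  "expo_shift i = (\<lambda>(a, b, c). if i = 1 then (Suc a, b, c) else if i = 2 then (a, Suc b, c) else (a, b, Suc c))"

lemma wt_expo_shift:
  assumes "CARD('n) \<ge> 2" "i \<in> {1, 2, 3}"
  shows "wt (expo_shift (i :: 'n::finite bit0) m) = wt m + U9_weight i"
  using assms(2) bit0_123_distinct[OF assms(1)] by (cases m) (auto simp: wt_def expo_shift_def U9_weight_def)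

lemma mon_expo_shift:
  assumes "CARD('n) \<ge> 2" "i \<in> {1, 2, 3}"
  shows "mon (expo_shift i m) x = x $ (i :: 'n::finite bit0) * mon m x"
  using assms(2) bit0_123_distinct[OF assms(1)] by (cases m) (auto simp: mon_def expo_shift_def)

lemma inj_expo_shift: "inj_on (expo_shift i) S"
  by (auto simp: inj_on_def expo_shift_def split: prod.splits if_splits)

lemma finite_wt: "finite {m. wt m = k}" "finite {m. wt m < k}"
proof -
  have "{m. wt m = k} \<subseteq> {0..k} \<times> {0..k} \<times> {0..k}" "{m. wt m < k} \<subseteq> {0..k} \<times> {0..k} \<times> {0..k}"
    by (auto simp: wt_def)
  then show "finite {m. wt m = k}" "finite {m. wt m < k}"
    using finite_subset[of _ "{0..k} \<times> {0..k} \<times> {0..k}"] by blast+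
qed

lemma sum_reindex_into:
  fixes f :: "'b \<Rightarrow> real"
  assumes "finite B" "inj_on h A" "h ` A \<subseteq> B"
  shows "(\<Sum>x\<in>A. f x * g (h x)) = (\<Sum>y\<in>B. (if y \<in> h ` A then f (inv_into A h y) else 0) * g y)"
proof -
  have "(\<Sum>y\<in>B. (if y \<in> h ` A then f (inv_into A h y) else 0) * g y) = (\<Sum>y\<in>h ` A. f (inv_into A h y) * g y)"
    by (rule sum.mono_neutral_cong_right) (use assms in auto)
  also have "\<dots> = (\<Sum>x\<in>A. f x * g (h x))"
    by (subst sum.reindex[OF assms(2)]) (simp add: inv_into_f_f[OF assms(2)])
  finally show ?thesis by simp
qed

text \<open>On the generators: a smooth function has its value at 0 as leading term, by Hadamard's
  lemma; multiplication by a weighted coordinate shifts the exponents; elements of higher level have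
  leading part 0.\<close>

lemma wfilt_leading_part:
  fixes a :: "real ^ ('n::finite) bit0 \<Rightarrow> real"
  assumes n: "CARD('n) \<ge> 2" and "wfilt r k a"
  shows "\<exists>f. wfilt r (Suc k) (\<lambda>x. a x - (\<Sum>m | wt m = k. f m * mon m x))"
  using assms(2)
proof (induction rule: wfilt.induct)
  case (base a)
  obtain b where b: "\<And>i. smooth_on (ball 0 r) (b i)" "\<And>x. x \<in> ball 0 r \<Longrightarrow> a x = a 0 + (\<Sum>i\<in>UNIV. x $ i * b i x)"
    by (rule hadamard[OF base]) (assumption | rule that)+
  have wt0: "{m. wt m = 0} = {(0, 0, 0)}" by (auto simp: wt_def)
  have "wfilt r (Suc 0) (\<lambda>x. \<Sum>i\<in>UNIV. x $ i * b i x)"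
  proof (rule wfilt_sum)
    fix i :: "'n bit0"
    show "wfilt r (Suc 0) (\<lambda>x. x $ i * b i x)"
    proof (cases "i \<in> {1, 2, 3}")
      case True
      show ?thesis by (rule wfilt_le[OF wfilt.mult[OF wfilt.base[OF b(1)] True]]) (simp add: U9_weight_def)
    next
      case False
      then show ?thesis by (rule wfilt.other[OF b(1)])
    qed
  qed
  then have "wfilt r (Suc 0) (\<lambda>x. a x - (\<Sum>m | wt m = 0. a 0 * mon m x))"
    by (rule wfilt.cong) (use b(2) in \<open>simp add: wt0 mon_def\<close>)
  then show ?case by (rule exI[of _ "\<lambda>m. a 0"])
next
  case (mult k a i)
  from mult.IH obtain f where f: "wfilt r (Suc k) (\<lambda>x. a x - (\<Sum>m | wt m = k. f m * mon m x))" by blast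
  let ?S = "{m. wt m = k}" and ?T = "{m. wt m = k + U9_weight i}"
  \<comment> \<open>The shifted coefficients, extended by 0 to the exponents of that weight which
    are not divisible by x_i.\<close>
  let ?f = "\<lambda>m. if m \<in> expo_shift i ` ?S then f (inv_into ?S (expo_shift i) m) else 0"
  have "wfilt r (Suc k + U9_weight i) (\<lambda>x. x $ i * (a x - (\<Sum>m\<in>?S. f m * mon m x)))"
    by (rule wfilt.mult[OF f mult(2)])
  moreover have "x $ i * (a x - (\<Sum>m\<in>?S. f m * mon m x)) = x $ i * a x - (\<Sum>m\<in>?T. ?f m * mon m x)" for x
  proof -
    have "x $ i * (\<Sum>m\<in>?S. f m * mon m x) = (\<Sum>m\<in>?S. f m * mon (expo_shift i m) x)"
      by (simp add: sum_distrib_left mon_expo_shift[OF n mult(2)] mult.left_commute)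
    also have "\<dots> = (\<Sum>m\<in>?T. ?f m * mon m x)"
      by (rule sum_reindex_into[OF finite_wt(1) inj_expo_shift]) (auto simp: wt_expo_shift[OF n mult(2)])
    finally show ?thesis by (simp add: right_diff_distrib)
  qed
  ultimately show ?case by (intro exI[of _ ?f]) simp
next
  case (other a i k)
  have "wfilt r (Suc k) (\<lambda>x. x $ i * a x - (\<Sum>m | wt m = k. 0 * mon m x))"
    using wfilt.other[OF other] by simp
  then show ?case by (rule exI[of _ "\<lambda>m. 0"])
next
  case (add k a b)
  then obtain f g where f: "wfilt r (Suc k) (\<lambda>x. a x - (\<Sum>m | wt m = k. f m * mon m x))"
    and g: "wfilt r (Suc k) (\<lambda>x. b x - (\<Sum>m | wt m = k. g m * mon m x))" by blast
  have "wfilt r (Suc k) (\<lambda>x. a x + b x - (\<Sum>m | wt m = k. (f m + g m) * mon m x))"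
    by (rule wfilt.cong[OF wfilt.add[OF f g]]) (simp add: sum.distrib distrib_right)
  then show ?case by (rule exI[of _ "\<lambda>m. f m + g m"])
next
  case (Suc k a)
  have "wfilt r (Suc k) (\<lambda>x. a x - (\<Sum>m | wt m = k. 0 * mon m x))" using Suc(1) by simp
  then show ?case by (rule exI[of _ "\<lambda>m. 0"])
next
  case (cong k a b)
  then obtain f where f: "wfilt r (Suc k) (\<lambda>x. a x - (\<Sum>m | wt m = k. f m * mon m x))" by blast
  have "wfilt r (Suc k) (\<lambda>x. b x - (\<Sum>m | wt m = k. f m * mon m x))"
    by (rule wfilt.cong[OF f]) (simp add: cong(2))
  then show ?case by blast
qed

lemma weighted_taylor:
  fixes a :: "real ^ ('n::finite) bit0 \<Rightarrow> real"
  assumes n: "CARD('n) \<ge> 2" and sm: "smooth_on (ball 0 r) a"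
  shows "\<exists>f. wfilt r k (\<lambda>x. a x - (\<Sum>m | wt m < k. f m * mon m x))"
proof (induction k)
  case 0
  show ?case using wfilt.base[OF sm] by simp
next
  case (Suc k)
  then obtain f where f: "wfilt r k (\<lambda>x. a x - (\<Sum>m | wt m < k. f m * mon m x))" by blast
  from wfilt_leading_part[OF n this] obtain g where
    g: "wfilt r (Suc k) (\<lambda>x. a x - (\<Sum>m | wt m < k. f m * mon m x) - (\<Sum>m | wt m = k. g m * mon m x))" by blast
  have U: "{m. wt m < Suc k} = {m. wt m < k} \<union> {m. wt m = k}" by auto
  have "(\<Sum>m | wt m < Suc k. (if wt m < k then f m else g m) * mon m x) =
    (\<Sum>m | wt m < k. f m * mon m x) + (\<Sum>m | wt m = k. g m * mon m x)" for x :: "real ^ 'n bit0"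
    unfolding U by (subst sum.union_disjoint[OF finite_wt(2) finite_wt(1)]) auto
  then have "wfilt r (Suc k) (\<lambda>x. a x - (\<Sum>m | wt m < Suc k. (if wt m < k then f m else g m) * mon m x))"
    using g by (simp add: diff_diff_eq)
  then show ?case by (rule exI[of _ "\<lambda>m. if wt m < k then f m else g m"])
qed

text \<open>Curves adapted to the grading: a monomial of weight k restricts to a multiple of t^k,
  with factor s. Both branches are of this kind, so one Taylor expansion serves both.\<close>

definition wcurve :: "(real \<Rightarrow> real ^ ('n::finite) bit0) \<Rightarrow> (expo \<Rightarrow> real) \<Rightarrow> bool" where
  "wcurve c s \<longleftrightarrow> (\<forall>t. \<forall>i\<in>{1, 2, 3}. \<bar>c t $ i\<bar> \<le> \<bar>t\<bar> ^ U9_weight i) \<and> (\<forall>t i. i \<notin> {1, 2, 3} \<longrightarrow> c t $ i = 0) \<and>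
     (\<forall>m t. mon m (c t) = s m * t ^ wt m)"

lemma branch2_component:
  assumes "CARD('n::finite) \<ge> 2"
  shows "(branch2 t :: real ^ 'n bit0) $ 1 = t ^ 5" "(branch2 t :: real ^ 'n bit0) $ 2 = - (t ^ 7)"
    "(branch2 t :: real ^ 'n bit0) $ 3 = t ^ 3" "i \<notin> {1, 2, 3} \<Longrightarrow> (branch2 t :: real ^ 'n bit0) $ i = 0"
  using bit0_123_distinct[OF assms] by (auto simp: branch2_def axis_def)

definition sgn2 :: "expo \<Rightarrow> real" where "sgn2 = (\<lambda>(a, b, c). (-1) ^ b)"

lemma wcurve_branch2:
  assumes n: "CARD('n::finite) \<ge> 2"
  shows "wcurve (branch2 :: real \<Rightarrow> real ^ 'n bit0) sgn2"
  unfolding wcurve_def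
proof (intro conjI allI ballI impI)
  fix t and i :: "'n bit0" assume "i \<in> {1, 2, 3}"
  then show "\<bar>(branch2 t :: real ^ 'n bit0) $ i\<bar> \<le> \<bar>t\<bar> ^ U9_weight i"
    using bit0_123_distinct[OF n] by (auto simp: branch2_component[OF n] U9_weight_def power_abs)
next
  fix t and i :: "'n bit0" assume "i \<notin> {1, 2, 3}"
  then show "(branch2 t :: real ^ 'n bit0) $ i = 0" by (rule branch2_component(4)[OF n])
next
  fix m :: expo and t
  obtain a b c where m: "m = (a, b, c)" by (cases m) auto
  show "mon m (branch2 t :: real ^ 'n bit0) = sgn2 m * t ^ wt m"
    by (simp add: m mon_def sgn2_def wt_def branch2_component[OF n] power_minus[of "t ^ 7" b] power_mult[symmetric] power_add mult.commute)
qed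

text \<open>The nonsingular branch run through at speed t^7, which makes the order of x_2 equal to
  its weight; only pure powers of x_2 survive on it.\<close>

lemma wcurve_axis:
  assumes n: "CARD('n::finite) \<ge> 2"
  shows "wcurve (\<lambda>t. axis 2 (t ^ 7) :: real ^ 'n bit0) (\<lambda>(a, b, c). if a = 0 \<and> c = 0 then 1 else 0)"
  unfolding wcurve_def
proof (intro conjI allI ballI impI)
  fix t :: real and i :: "'n bit0" assume "i \<in> {1, 2, 3}"
  then show "\<bar>(axis 2 (t ^ 7) :: real ^ 'n bit0) $ i\<bar> \<le> \<bar>t\<bar> ^ U9_weight i"
    using bit0_123_distinct[OF n] by (auto simp: axis_def U9_weight_def power_abs)
next
  fix t :: real and i :: "'n bit0" assume "i \<notin> {1, 2, 3}"
  then show "(axis 2 (t ^ 7) :: real ^ 'n bit0) $ i = 0" by (auto simp: axis_def)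
next
  fix m :: expo and t :: real
  obtain a b c where m: "m = (a, b, c)" by (cases m) auto
  show "mon m (axis 2 (t ^ 7) :: real ^ 'n bit0) = (case m of (a, b, c) \<Rightarrow> if a = 0 \<and> c = 0 then 1 else 0) * t ^ wt m"
    using bit0_123_distinct[OF n]
    by (cases "a = 0"; cases "c = 0") (auto simp: m mon_def wt_def axis_def power_mult[symmetric] mult.commute)
qed

lemma wcurve_tendsto:
  fixes c :: "real \<Rightarrow> real ^ ('n::finite) bit0"
  assumes "wcurve c s"
  shows "(c \<longlongrightarrow> 0) (at 0)"
proof (rule vec_tendstoI)
  fix i
  show "((\<lambda>t. c t $ i) \<longlongrightarrow> 0 $ i) (at 0)"
  proof (cases "i \<in> {1, 2, 3}")
    case True
    have pos: "U9_weight i > 0" by (simp add: U9_weight_def)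
    have "((\<lambda>t::real. \<bar>t\<bar> ^ U9_weight i) \<longlongrightarrow> \<bar>0\<bar> ^ U9_weight i) (at 0)" by (intro tendsto_intros)
    then have "((\<lambda>t::real. \<bar>t\<bar> ^ U9_weight i) \<longlongrightarrow> 0) (at 0)" using pos by (simp add: power_0_left)
    then have "((\<lambda>t. c t $ i) \<longlongrightarrow> 0) (at 0)"
      by (rule Lim_null_comparison[rotated]) (use assms True in \<open>auto simp: wcurve_def\<close>)
    then show ?thesis by simp
  qed (use assms in \<open>simp add: wcurve_def\<close>)
qed

section \<open>Orders of vanishing and jets along curves\<close>

lemma bigo_power_le: "j \<le> k \<Longrightarrow> (\<lambda>t::real. t ^ k) \<in> O[at 0](\<lambda>t. t ^ j)"
proof (rule bigoI[where c=1])
  assume jk: "j \<le> k"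
  have "eventually (\<lambda>t::real. \<bar>t\<bar> < 1) (at 0)"
    unfolding eventually_at by (auto intro!: exI[of _ 1])
  then show "eventually (\<lambda>t::real. norm (t ^ k) \<le> 1 * norm (t ^ j)) (at 0)"
    by eventually_elim (use jk in \<open>simp add: power_abs power_decreasing\<close>)
qed

lemma bigo_power_weaken: "g \<in> O[at 0](\<lambda>t::real. t ^ k) \<Longrightarrow> j \<le> k \<Longrightarrow> g \<in> O[at 0](\<lambda>t. t ^ j)"
  using landau_o.big_trans[OF _ bigo_power_le] .

lemma bigo_power_sum:
  assumes "\<And>m. m \<in> M \<Longrightarrow> K \<le> e m"
  shows "(\<lambda>t::real. \<Sum>m\<in>M. g m * t ^ e m) \<in> O[at 0](\<lambda>t. t ^ K)"
proof (rule big_sum_in_bigo)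
  fix m assume "m \<in> M"
  from bigo_power_le[OF assms[OF this]] show "(\<lambda>t. g m * t ^ e m) \<in> O[at 0](\<lambda>t. t ^ K)"
    by (cases "g m = 0") simp_all
qed

lemma wfilt_bigo:
  assumes "wfilt r k a" and c: "wcurve c s" and r: "0 < r"
  shows "(\<lambda>t. a (c t)) \<in> O[at 0](\<lambda>t. t ^ k)"
  using assms(1)
proof (induction rule: wfilt.induct)
  case (base a)
  have "isCont a 0"
    using smooth_on_continuous[OF base] r by (simp add: continuous_on_eq_continuous_at)
  then have "((\<lambda>t. a (c t)) \<longlongrightarrow> a 0) (at 0)" by (rule isCont_tendsto_compose[OF _ wcurve_tendsto[OF c]])
  then show ?case by (intro bigoI_tendsto[of _ _ "a 0"]) auto
next
  case (mult k a i)
  have "(\<lambda>t. c t $ i) \<in> O[at 0](\<lambda>t. t ^ U9_weight i)"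
    by (rule bigoI[where c=1]) (use c mult(2) in \<open>auto simp: wcurve_def power_abs\<close>)
  from landau_o.big_mult[OF this mult.IH] show ?case by (simp add: power_add mult.commute)
next
  case (other a i k)
  then have "c t $ i = 0" for t using c by (auto simp: wcurve_def)
  then show ?case by simp
next
  case (add k a b)
  from sum_in_bigo(1)[OF add.IH] show ?case .
next
  case (Suc k a)
  show ?case by (rule bigo_power_weaken[OF Suc.IH]) simp
next
  case (cong k a b)
  have "eventually (\<lambda>t. c t \<in> ball 0 r) (at 0)"
    by (rule topological_tendstoD[OF wcurve_tendsto[OF c]]) (use r in auto)
  then have "eventually (\<lambda>t. a (c t) = b (c t)) (at 0)"
    by eventually_elim (use cong(2) in simp)
  from landau_o.big.in_cong[OF this] cong.IH show ?case by simp
qed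

text \<open>A Taylor expansion stated as an estimate, which passes through sums and perturbations of
  order K without differentiating anything. Only the entries of c below K matter.\<close>

definition has_jet :: "nat \<Rightarrow> (real \<Rightarrow> real) \<Rightarrow> (nat \<Rightarrow> real) \<Rightarrow> bool" where
  "has_jet K g c \<longleftrightarrow> (\<lambda>t. g t - (\<Sum>k<K. c k * t ^ k)) \<in> O[at 0](\<lambda>t. t ^ K)"

lemma has_jet_less:
  assumes "has_jet K g c" "J \<le> K"
  shows "has_jet J g c"
proof -
  have U: "{..<K} = {..<J} \<union> {J..<K}" using assms(2) by auto
  have "(\<Sum>k<K. c k * t ^ k) = (\<Sum>k<J. c k * t ^ k) + (\<Sum>k\<in>{J..<K}. c k * t ^ k)" for t
    unfolding U by (rule sum.union_disjoint) auto
  then have eq: "g t - (\<Sum>k<J. c k * t ^ k) = (g t - (\<Sum>k<K. c k * t ^ k)) + (\<Sum>k\<in>{J..<K}. c k * t ^ k)" for t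
    by simp
  have "(\<lambda>t. \<Sum>k\<in>{J..<K}. c k * t ^ k) \<in> O[at 0](\<lambda>t. t ^ J)"
    by (rule bigo_power_sum) simp
  with bigo_power_weaken[OF assms(1)[unfolded has_jet_def] assms(2)]
  show ?thesis unfolding has_jet_def eq by (rule sum_in_bigo(1))
qed

lemma has_jet_diff: "has_jet K g c \<Longrightarrow> has_jet K h d \<Longrightarrow> has_jet K (\<lambda>t. g t - h t) (\<lambda>k. c k - d k)"
  using sum_in_bigo(2)[of "\<lambda>t. g t - (\<Sum>k<K. c k * t ^ k)" "at 0" "\<lambda>t. t ^ K" "\<lambda>t. h t - (\<Sum>k<K. d k * t ^ k)"]
  unfolding has_jet_def by (simp add: left_diff_distrib sum_subtractf algebra_simps)

lemma has_jet_bigo: "g \<in> O[at 0](\<lambda>t. t ^ K) \<Longrightarrow> has_jet K g (\<lambda>k. 0)"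
  by (simp add: has_jet_def)

text \<open>Once the lower coefficients vanish, c_k t^k is bounded by a multiple of t^(k+1) near 0,
  which forces c_k = 0.\<close>

lemma has_jet_zero:
  assumes "has_jet K (\<lambda>t. 0) c" "k < K"
  shows "c k = 0"
  using assms(2)
proof (induction k rule: less_induct)
  case (less k)
  from has_jet_less[OF assms(1), of "Suc k"] less.prems
  have "(\<lambda>t. 0 - (\<Sum>j<Suc k. c j * t ^ j)) \<in> O[at 0](\<lambda>t. t ^ Suc k)" by (simp add: has_jet_def)
  moreover have "(\<Sum>j<Suc k. c j * t ^ j) = c k * t ^ k" for t :: real
    using less by simp
  ultimately have "(\<lambda>t. - (c k * t ^ k)) \<in> O[at 0](\<lambda>t. t ^ Suc k)" by simp
  then obtain C where C: "C > 0" "eventually (\<lambda>t. norm (- (c k * t ^ k)) \<le> C * norm (t ^ Suc k)) (at 0)"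
    by (rule landau_o.bigE)
  have "eventually (\<lambda>t. \<bar>c k\<bar> \<le> C * \<bar>t\<bar>) (at 0)"
    using C(2) eventually_neq_at_within[of 0 0 UNIV]
  proof eventually_elim
    case (elim t)
    then have "\<bar>c k\<bar> * \<bar>t\<bar> ^ k \<le> (C * \<bar>t\<bar>) * \<bar>t\<bar> ^ k" by (simp add: abs_mult power_abs)
    then show ?case using elim(2) by simp
  qed
  moreover have "((\<lambda>t::real. C * \<bar>t\<bar>) \<longlongrightarrow> C * \<bar>0\<bar>) (at 0)" by (intro tendsto_intros)
  ultimately have "\<bar>c k\<bar> \<le> C * \<bar>0\<bar>" by (intro tendsto_lowerbound[where F="at (0::real)" and f="\<lambda>t. C * \<bar>t\<bar>"]) auto
  then show ?case by simp
qed

lemma has_jet_unique: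
  assumes "has_jet K g c" "has_jet K g d" "k < K"
  shows "c k = d k"
  using has_jet_zero[of K "\<lambda>k. c k - d k" k] has_jet_diff[OF assms(1,2)] assms(3) by simp

lemma has_jet_sum:
  assumes "finite T"
  shows "has_jet K (\<lambda>t. \<Sum>m\<in>T. g m * t ^ e m) (\<lambda>k. \<Sum>m | m \<in> T \<and> e m = k. g m)"
proof -
  have 1: "(\<Sum>k<K. (\<Sum>m | m \<in> T \<and> e m = k. g m) * t ^ k) = (\<Sum>m | m \<in> T \<and> e m < K. g m * t ^ e m)" for t :: real
  proof -
    have "(\<Sum>m | m \<in> T \<and> e m < K. g m * t ^ e m) = (\<Sum>k<K. \<Sum>m | m \<in> {m. m \<in> T \<and> e m < K} \<and> e m = k. g m * t ^ e m)"
      by (rule sum.group[symmetric]) (use assms in auto)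
    also have "\<dots> = (\<Sum>k<K. (\<Sum>m | m \<in> T \<and> e m = k. g m) * t ^ k)"
      unfolding sum_distrib_right by (intro sum.cong) auto
    finally show ?thesis by simp
  qed
  have 2: "(\<Sum>m\<in>T. g m * t ^ e m) = (\<Sum>m | m \<in> T \<and> e m < K. g m * t ^ e m) + (\<Sum>m | m \<in> T \<and> \<not> e m < K. g m * t ^ e m)" for t :: real
  proof -
    have U: "T = {m \<in> T. e m < K} \<union> {m \<in> T. \<not> e m < K}" by auto
    show ?thesis by (subst U, rule sum.union_disjoint) (use assms in auto)
  qed
  have "(\<lambda>t. \<Sum>m | m \<in> T \<and> \<not> e m < K. g m * t ^ e m) \<in> O[at 0](\<lambda>t. t ^ K)"
    by (rule bigo_power_sum) simp
  then show ?thesis unfolding has_jet_def 1 2 by simp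
qed

lemma has_jet_add_bigo:
  assumes "has_jet K g c" "(\<lambda>t. h t - g t) \<in> O[at 0](\<lambda>t. t ^ K)"
  shows "has_jet K h c"
  using sum_in_bigo(1)[OF assms(2) assms(1)[unfolded has_jet_def]] by (simp add: has_jet_def)

text \<open>The factor of the remaining power of t when a partial derivative of a monomial is
  restricted to the singular branch; the signs stem from x_2 = -t^7. For b = 0 the factor b hides
  the truncated exponent b - 1.\<close>

definition mon_deriv :: "'n::finite bit0 \<Rightarrow> expo \<Rightarrow> real" where
  "mon_deriv i = (\<lambda>(a, b, c). if i = 1 then of_nat a * (-1) ^ b else if i = 2 then of_nat b * (-1) ^ (b - 1) else of_nat c * (-1) ^ b)"

lemma mon_smooth: "open S \<Longrightarrow> smooth_on S (mon m)"
  unfolding mon_def by (cases m) (auto intro!: smooth_on_mult smooth_on_power smooth_on_component)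

lemma mon_has_derivative:
  fixes x :: "real ^ ('n::finite) bit0"
  shows "(mon (a, b, c) has_derivative (\<lambda>h. of_nat a * h $ 1 * x $ 1 ^ (a - 1) * x $ 2 ^ b * x $ 3 ^ c +
     x $ 1 ^ a * (of_nat b * h $ 2 * x $ 2 ^ (b - 1)) * x $ 3 ^ c + x $ 1 ^ a * x $ 2 ^ b * (of_nat c * h $ 3 * x $ 3 ^ (c - 1)))) (at x)"
proof -
  have d: "((\<lambda>x :: real ^ 'n bit0. x $ i) has_derivative (\<lambda>h. h $ i)) (at x)" for i
    by (rule bounded_linear_imp_has_derivative[OF bounded_linear_vec_nth])
  show ?thesis unfolding mon_def prod.case
    by (rule has_derivative_eq_rhs[OF has_derivative_mult[OF has_derivative_mult[OF
          has_derivative_power[OF d] has_derivative_power[OF d]] has_derivative_power[OF d]]])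
      (simp add: fun_eq_iff algebra_simps)
qed

lemma mon_deriv_branch2:
  assumes n: "CARD('n::finite) \<ge> 2" and i: "i \<in> {1, 2, 3}"
  shows "frechet_derivative (mon m) (at (branch2 t :: real ^ 'n bit0)) (axis i 1) = mon_deriv i m * t ^ (wt m - U9_weight i)"
proof -
  obtain a b c where m: "m = (a, b, c)" by (cases m) auto
  note d = bit0_123_distinct[OF n]
  have neg: "(- (t ^ 7)) ^ k = (-1) ^ k * t ^ (7 * k)" for k
    by (simp add: power_minus[of "t ^ 7"] power_mult)
  have pw: "(t ^ j) ^ k = t ^ (j * k)" for j k by (simp add: power_mult)
  let ?x = "branch2 t :: real ^ 'n bit0" and ?h = "axis i 1 :: real ^ 'n bit0"
  show ?thesis unfolding m frechet_at[OF mon_has_derivative]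
  proof -
    consider "i = 1" | "i = 2" | "i = 3" using i by blast
    then show "of_nat a * ?h $ 1 * ?x $ 1 ^ (a - 1) * ?x $ 2 ^ b * ?x $ 3 ^ c +
     ?x $ 1 ^ a * (of_nat b * ?h $ 2 * ?x $ 2 ^ (b - 1)) * ?x $ 3 ^ c +
     ?x $ 1 ^ a * ?x $ 2 ^ b * (of_nat c * ?h $ 3 * ?x $ 3 ^ (c - 1)) =
     mon_deriv i (a, b, c) * t ^ (wt (a, b, c) - U9_weight i)"
    proof cases
      case 1
      show ?thesis
        using d by (cases a) (simp_all add: 1 axis_def branch2_component[OF n] mon_deriv_def U9_weight_def wt_def neg pw power_add)
    next
      case 2
      show ?thesis
        using d by (cases b) (simp_all add: 2 axis_def branch2_component[OF n] mon_deriv_def U9_weight_def wt_def neg pw power_add)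
    next
      case 3
      show ?thesis
        using d by (cases c) (simp_all add: 3 axis_def branch2_component[OF n] mon_deriv_def U9_weight_def wt_def neg pw power_add)
    qed
  qed
qed

text \<open>One list f of Taylor coefficients governs the values along both branches and the
  derivatives along the singular one; this link between values and derivatives is what later yields
  linear relations. Order 17 is one more than the largest tangency order, 16.\<close>

lemma curve_jets:
  fixes a :: "real ^ ('n::finite) bit0 \<Rightarrow> real"
  assumes n: "CARD('n) \<ge> 2" and r: "0 < r" and sm: "smooth_on (ball 0 r) a"
  obtains f where "\<And>c s. wcurve c s \<Longrightarrow> has_jet 17 (\<lambda>t. a (c t)) (\<lambda>k. \<Sum>m | wt m = k. f m * s m)"
    "\<And>i. i \<in> {1, 2, 3} \<Longrightarrow> \<exists>g. has_jet (17 - U9_weight i) (\<lambda>t. frechet_derivative a (at (branch2 t)) (axis i 1)) g \<and>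
       (\<forall>k. 0 < k \<and> k + U9_weight i < 17 \<longrightarrow> g k = (\<Sum>m | wt m = k + U9_weight i. f m * mon_deriv i m))"
proof -
  obtain f where f: "wfilt r 17 (\<lambda>x. a x - (\<Sum>m | wt m < 17. f m * mon m x))"
    using weighted_taylor[OF n sm, of 17] by blast
  let ?T = "{m. wt m < 17}" and ?R = "\<lambda>x. a x - (\<Sum>m | wt m < 17. f m * mon m x)"
  show thesis
  proof (rule that[of f])
    fix c :: "real \<Rightarrow> real ^ 'n bit0" and s assume c: "wcurve c s"
    have 1: "has_jet 17 (\<lambda>t. \<Sum>m\<in>?T. (f m * s m) * t ^ wt m) (\<lambda>k. \<Sum>m | m \<in> ?T \<and> wt m = k. f m * s m)"
      by (rule has_jet_sum[OF finite_wt(2)])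
    have "(\<lambda>t. ?R (c t)) \<in> O[at 0](\<lambda>t. t ^ 17)" by (rule wfilt_bigo[OF f c r])
    moreover have "?R (c t) = a (c t) - (\<Sum>m\<in>?T. (f m * s m) * t ^ wt m)" for t
    proof -
      have "mon m (c t) = s m * t ^ wt m" for m using c unfolding wcurve_def by blast
      then show ?thesis by (simp add: mult.assoc)
    qed
    ultimately have "has_jet 17 (\<lambda>t. a (c t)) (\<lambda>k. \<Sum>m | m \<in> ?T \<and> wt m = k. f m * s m)"
      by (intro has_jet_add_bigo[OF 1]) simp
    moreover have "(\<Sum>k<17. (\<Sum>m | m \<in> ?T \<and> wt m = k. f m * s m) * t ^ k) = (\<Sum>k<17. (\<Sum>m | wt m = k. f m * s m) * t ^ k)" for t
      by (intro sum.cong refl arg_cong2[where f="(*)"]) auto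
    ultimately show "has_jet 17 (\<lambda>t. a (c t)) (\<lambda>k. \<Sum>m | wt m = k. f m * s m)"
      unfolding has_jet_def by simp
  next
    fix i :: "'n bit0" assume i: "i \<in> {1, 2, 3}"
    let ?g = "\<lambda>k. \<Sum>m | m \<in> ?T \<and> wt m - U9_weight i = k. f m * mon_deriv i m"
    let ?K = "17 - U9_weight i"
    have 1: "has_jet ?K (\<lambda>t. \<Sum>m\<in>?T. (f m * mon_deriv i m) * t ^ (wt m - U9_weight i)) ?g"
      by (rule has_jet_sum[OF finite_wt(2)])
    have 2: "(\<lambda>t. frechet_derivative ?R (at (branch2 t)) (axis i 1)) \<in> O[at 0](\<lambda>t. t ^ ?K)"
      by (rule wfilt_bigo[OF wfilt_deriv[OF f i] wcurve_branch2[OF n] r])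
    have "eventually (\<lambda>t. branch2 t \<in> ball (0 :: real ^ 'n bit0) r) (at 0)"
      by (rule topological_tendstoD[OF wcurve_tendsto[OF wcurve_branch2[OF n]]]) (use r in auto)
    then have "eventually (\<lambda>t. frechet_derivative ?R (at (branch2 t)) (axis i 1) =
      frechet_derivative a (at (branch2 t)) (axis i 1) - (\<Sum>m\<in>?T. (f m * mon_deriv i m) * t ^ (wt m - U9_weight i))) (at 0)"
    proof eventually_elim
      case (elim t)
      have "(?R has_derivative (\<lambda>h. frechet_derivative a (at (branch2 t)) h - (\<Sum>m\<in>?T. f m * frechet_derivative (mon m) (at (branch2 t)) h))) (at (branch2 t))"
        by (intro has_derivative_diff has_derivative_sum has_derivative_mult_right smooth_on_has_derivative[OF sm elim]
            smooth_on_has_derivative[OF mon_smooth[OF open_UNIV]] UNIV_I)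
      from frechet_at[OF this] show ?case by (simp add: mon_deriv_branch2[OF n i] mult.assoc)
    qed
    from landau_o.big.in_cong[OF this] 2
    have "(\<lambda>t. frechet_derivative a (at (branch2 t)) (axis i 1) - (\<Sum>m\<in>?T. (f m * mon_deriv i m) * t ^ (wt m - U9_weight i))) \<in> O[at 0](\<lambda>t. t ^ ?K)"
      by simp
    note O = this
    have jet: "has_jet ?K (\<lambda>t. frechet_derivative a (at (branch2 t)) (axis i 1)) ?g"
      by (rule has_jet_add_bigo[OF 1 O])
    \<comment> \<open>Truncated subtraction sends every weight up to \<open>U9_weight i\<close> to
      0, so only for 0 < k does the exponent k single out one weight.\<close>
    have "{m. m \<in> ?T \<and> wt m - U9_weight i = k} = {m. wt m = k + U9_weight i}" if "0 < k" "k + U9_weight i < 17" for k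
      using that by auto
    with jet show "\<exists>g. has_jet ?K (\<lambda>t. frechet_derivative a (at (branch2 t)) (axis i 1)) g \<and>
       (\<forall>k. 0 < k \<and> k + U9_weight i < 17 \<longrightarrow> g k = (\<Sum>m | wt m = k + U9_weight i. f m * mon_deriv i m))"
      by (intro exI[of _ ?g] conjI allI impI) simp_all
  qed
qed

lemma has_jet_monomial: "has_jet K (\<lambda>t. c * t ^ e) (\<lambda>k. if k = e then c else 0)"
proof -
  have "(\<Sum>m | m \<in> {()} \<and> e = k. c) = (if k = e then c else 0)" for k by auto
  with has_jet_sum[of "{()}" K "\<lambda>_. c" "\<lambda>_. e"] show ?thesis by simp
qed

lemma has_jet_add: "has_jet K g c \<Longrightarrow> has_jet K h d \<Longrightarrow> has_jet K (\<lambda>t. g t + h t) (\<lambda>k. c k + d k)"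
  using sum_in_bigo(1)[of "\<lambda>t. g t - (\<Sum>k<K. c k * t ^ k)" "at 0" "\<lambda>t. t ^ K" "\<lambda>t. h t - (\<Sum>k<K. d k * t ^ k)"]
  unfolding has_jet_def by (simp add: distrib_right sum.distrib algebra_simps)

section \<open>Obstructions to a high order of tangency\<close>

lemma wt_cases:
  assumes "wt m = k" "k \<le> 16"
  shows "\<exists>a\<in>{0, 1, 2, 3}. \<exists>b\<in>{0, 1, 2}. \<exists>c\<in>{0, 1, 2, 3, 4, 5}. m = (a, b, c) \<and> 5 * a + 7 * b + 3 * c = k"
proof -
  obtain a b c where m: "m = (a, b, c)" by (cases m) auto
  then have e: "5 * a + 7 * b + 3 * c = k" using assms by (simp add: wt_def)
  have "a = 0 \<or> a = 1 \<or> a = 2 \<or> a = 3" "b = 0 \<or> b = 1 \<or> b = 2"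
    "c = 0 \<or> c = 1 \<or> c = 2 \<or> c = 3 \<or> c = 4 \<or> c = 5"
    using e assms(2) by linarith+
  then have "a \<in> {0, 1, 2, 3}" "b \<in> {0, 1, 2}" "c \<in> {0, 1, 2, 3, 4, 5}" by blast+
  then show ?thesis using m e by (intro bexI[of _ a] bexI[of _ b] bexI[of _ c]) simp_all
qed

lemma wt_sets:
  "{m. wt m = 6} = {(0, 0, 2)}"
  "{m. wt m = 8} = {(1, 0, 1)}"
  "{m. wt m = 9} = {(0, 0, 3)}"
  "{m. wt m = 10} = {(2, 0, 0), (0, 1, 1)}"
  "{m. wt m = 11} = {(1, 0, 2)}"
  "{m. wt m = 12} = {(0, 0, 4), (1, 1, 0)}"
  "{m. wt m = 13} = {(2, 0, 1), (0, 1, 2)}"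
  "{m. wt m = 14} = {(1, 0, 3), (0, 2, 0)}"
  "{m. wt m = 16} = {(2, 0, 2), (0, 1, 3)}"
proof -
  have eq: "{m. wt m = k} = S" if "k \<le> 16" "\<And>m. m \<in> S \<Longrightarrow> wt m = k"
    "\<forall>a\<in>{0, 1, 2, 3}. \<forall>b\<in>{0, 1, 2}. \<forall>c\<in>{0, 1, 2, 3, 4, 5}. 5 * a + 7 * b + 3 * c = k \<longrightarrow> (a, b, c) \<in> S" for k S
    using wt_cases[OF _ that(1)] that(2,3) by blast
  show "{m. wt m = 6} = {(0, 0, 2)}" by (rule eq) (auto simp: wt_def)
  show "{m. wt m = 8} = {(1, 0, 1)}" by (rule eq) (auto simp: wt_def)
  show "{m. wt m = 9} = {(0, 0, 3)}" by (rule eq) (auto simp: wt_def)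
  show "{m. wt m = 10} = {(2, 0, 0), (0, 1, 1)}" by (rule eq) (auto simp: wt_def)
  show "{m. wt m = 11} = {(1, 0, 2)}" by (rule eq) (auto simp: wt_def)
  show "{m. wt m = 12} = {(0, 0, 4), (1, 1, 0)}" by (rule eq) (auto simp: wt_def)
  show "{m. wt m = 13} = {(2, 0, 1), (0, 1, 2)}" by (rule eq) (auto simp: wt_def)
  show "{m. wt m = 14} = {(1, 0, 3), (0, 2, 0)}" by (rule eq) (auto simp: wt_def)
  show "{m. wt m = 16} = {(2, 0, 2), (0, 1, 3)}" by (rule eq) (auto simp: wt_def)
qed

lemma U9_weight_simps:
  assumes "CARD('n::finite) \<ge> 2"
  shows "U9_weight (1 :: 'n bit0) = 5" "U9_weight (2 :: 'n bit0) = 7" "U9_weight (3 :: 'n bit0) = 3"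
  using bit0_123_distinct[OF assms] by (auto simp: U9_weight_def)

lemma mon_deriv_simps:
  assumes "CARD('n::finite) \<ge> 2"
  shows "mon_deriv (1 :: 'n bit0) (a, b, c) = of_nat a * (-1) ^ b" "mon_deriv (2 :: 'n bit0) (a, b, c) = of_nat b * (-1) ^ (b - 1)"
    "mon_deriv (3 :: 'n bit0) (a, b, c) = of_nat c * (-1) ^ b"
  using bit0_123_distinct[OF assms] by (auto simp: mon_deriv_def)

text \<open>A primitive \<open>a\<close> of \<open>\<phi> dx\<^sub>1 \<and> dx\<^sub>3\<close> along the singular branch, up to order \<open>M\<close>, that itself
  vanishes to order \<open>M\<close> there. The Taylor coefficients of its components satisfy linear relations that
  are inconsistent when \<open>M\<close> exceeds the tangency order of the class of \<open>\<phi>\<close>.\<close>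

locale U9_primitive =
  fixes a :: "(real ^ ('n::finite) bit0) form1" and r :: real and M :: nat and \<phi> :: "real \<Rightarrow> real" and p :: "nat \<Rightarrow> real"
  assumes n: "CARD('n) \<ge> 2" and r: "0 < r" and a: "one_form_on (ball 0 r) a"
    and M: "M \<le> 17"
    and order: "\<And>j. (\<lambda>t. a (branch2 t) (axis j 1)) \<in> O[at 0](\<lambda>t. t ^ M)"
    and ext13: "(\<lambda>t. ext_deriv a (branch2 t) (axis 1 1) (axis 3 1) - \<phi> t) \<in> O[at 0](\<lambda>t. t ^ M)"
    and ext12: "(\<lambda>t. ext_deriv a (branch2 t) (axis 1 1) (axis 2 1)) \<in> O[at 0](\<lambda>t. t ^ M)"
    and ext23: "(\<lambda>t. ext_deriv a (branch2 t) (axis 2 1) (axis 3 1)) \<in> O[at 0](\<lambda>t. t ^ M)"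
    and jet: "has_jet M \<phi> p"
begin

text \<open>Comparison of coefficients in the hypotheses of the locale: vanishing of the components
  on the singular branch, then the dx_1 dx_3, dx_1 dx_2 and dx_2 dx_3 components of the
  differential. The limits 12 = 17 - 5 and 10 = 17 - 7 are the orders to which the derivatives are
  known. The last relation is the only one taken from the nonsingular branch.\<close>

lemma coefficient_relations:
  obtains f where
    "\<And>j k. k < M \<Longrightarrow> (\<Sum>m | wt m = k. f j m * sgn2 m) = 0"
    "\<And>k. 0 < k \<Longrightarrow> k < 12 \<Longrightarrow> k < M \<Longrightarrow>
      (\<Sum>m | wt m = k + 5. f 3 m * mon_deriv (1 :: 'n bit0) m) - (\<Sum>m | wt m = k + 3. f 1 m * mon_deriv (3 :: 'n bit0) m) = p k"
    "\<And>k. 0 < k \<Longrightarrow> k < 10 \<Longrightarrow> k < M \<Longrightarrow>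
      (\<Sum>m | wt m = k + 5. f 2 m * mon_deriv (1 :: 'n bit0) m) - (\<Sum>m | wt m = k + 7. f 1 m * mon_deriv (2 :: 'n bit0) m) = 0"
    "\<And>k. 0 < k \<Longrightarrow> k < 10 \<Longrightarrow> k < M \<Longrightarrow>
      (\<Sum>m | wt m = k + 7. f 3 m * mon_deriv (2 :: 'n bit0) m) - (\<Sum>m | wt m = k + 3. f 2 m * mon_deriv (3 :: 'n bit0) m) = 0"
    "\<And>j. (\<lambda>s. a (axis 2 s) (axis j 1)) \<in> O[at 0](\<lambda>s. s ^ 3) \<Longrightarrow> f j (0, 2, 0) = 0"
proof -
  define Q where "Q = (\<lambda>j f. (\<forall>c s. wcurve c s \<longrightarrow> has_jet 17 (\<lambda>t. a (c t) (axis j 1)) (\<lambda>k. \<Sum>m | wt m = k. f m * s m)) \<and>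
    (\<forall>i\<in>{1, 2, 3}. \<exists>g. has_jet (17 - U9_weight i) (\<lambda>t. frechet_derivative (\<lambda>x. a x (axis j 1)) (at (branch2 t)) (axis i 1)) g \<and>
       (\<forall>k. 0 < k \<and> k + U9_weight i < 17 \<longrightarrow> g k = (\<Sum>m | wt m = k + U9_weight i. f m * mon_deriv i m))))"
  have "\<exists>f. Q j f" for j
  proof (rule curve_jets[OF n r one_form_onD(2)[OF a, of "axis j 1"]])
    fix f assume f: "\<And>c s. wcurve c s \<Longrightarrow> has_jet 17 (\<lambda>t. a (c t) (axis j 1)) (\<lambda>k. \<Sum>m | wt m = k. f m * s m)"
      "\<And>i. i \<in> {1, 2, 3} \<Longrightarrow> \<exists>g. has_jet (17 - U9_weight i) (\<lambda>t. frechet_derivative (\<lambda>x. a x (axis j 1)) (at (branch2 t)) (axis i 1)) g \<and>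
       (\<forall>k. 0 < k \<and> k + U9_weight i < 17 \<longrightarrow> g k = (\<Sum>m | wt m = k + U9_weight i. f m * mon_deriv i m))"
    show ?thesis
      unfolding Q_def by (rule exI[of _ f], intro conjI allI impI ballI) (rule f, assumption)+
  qed
  then obtain f where f: "\<And>j. Q j (f j)" by metis
  have curve: "has_jet 17 (\<lambda>t. a (c t) (axis j 1)) (\<lambda>k. \<Sum>m | wt m = k. f j m * s m)" if "wcurve c s" for c s j
    using f[of j] that by (simp add: Q_def)
  have deriv: "\<exists>g. has_jet (17 - U9_weight i) (\<lambda>t. dform1 a (branch2 t) (axis i 1) (axis j 1)) g \<and>
       (\<forall>k. 0 < k \<and> k + U9_weight i < 17 \<longrightarrow> g k = (\<Sum>m | wt m = k + U9_weight i. f j m * mon_deriv i m))"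
    if "i \<in> {1, 2, 3}" for i j
    using f[of j] that unfolding Q_def dform1_def by blast
  have rel: "(\<Sum>m | wt m = k + U9_weight i. f j m * mon_deriv i m) - (\<Sum>m | wt m = k + U9_weight j. f i m * mon_deriv j m) = q k"
    if ij: "i \<in> {1, 2, 3}" "j \<in> {1, 2, 3}" and k: "0 < k" "k + U9_weight i < 17" "k + U9_weight j < 17" "k < M"
      and ext: "(\<lambda>t. ext_deriv a (branch2 t) (axis i 1) (axis j 1) - \<psi> t) \<in> O[at 0](\<lambda>t. t ^ M)" and q: "has_jet M \<psi> q"
    for i j k q \<psi>
  proof -
    obtain g where g: "has_jet (17 - U9_weight i) (\<lambda>t. dform1 a (branch2 t) (axis i 1) (axis j 1)) g"
      "g k = (\<Sum>m | wt m = k + U9_weight i. f j m * mon_deriv i m)"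
      using deriv[OF ij(1), of j] k by blast
    obtain h where h: "has_jet (17 - U9_weight j) (\<lambda>t. dform1 a (branch2 t) (axis j 1) (axis i 1)) h"
      "h k = (\<Sum>m | wt m = k + U9_weight j. f i m * mon_deriv j m)"
      using deriv[OF ij(2), of i] k by blast
    have g': "has_jet (Suc k) (\<lambda>t. dform1 a (branch2 t) (axis i 1) (axis j 1)) g"
      by (rule has_jet_less[OF g(1)]) (use k in simp)
    have h': "has_jet (Suc k) (\<lambda>t. dform1 a (branch2 t) (axis j 1) (axis i 1)) h"
      by (rule has_jet_less[OF h(1)]) (use k in simp)
    have q': "has_jet (Suc k) \<psi> q" by (rule has_jet_less[OF q]) (use k in simp)
    have "has_jet (Suc k) (\<lambda>t. ext_deriv a (branch2 t) (axis i 1) (axis j 1)) (\<lambda>k. g k - h k)"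
      using has_jet_diff[OF g' h'] by (simp add: ext_deriv_alt)
    moreover have "has_jet (Suc k) (\<lambda>t. ext_deriv a (branch2 t) (axis i 1) (axis j 1)) q"
      by (rule has_jet_add_bigo[OF q' bigo_power_weaken[OF ext]]) (use k in simp)
    ultimately have "g k - h k = q k" by (rule has_jet_unique) simp
    then show ?thesis by (simp add: g(2) h(2))
  qed
  note w = U9_weight_simps[OF n]
  have z: "has_jet M (\<lambda>t. 0) (\<lambda>k. 0)" by (simp add: has_jet_def)
  show thesis
  proof (rule that[of f])
    fix j k assume k: "k < M"
    have "(\<lambda>t. a (branch2 t) (axis j 1)) \<in> O[at 0](\<lambda>t. t ^ M)" by (rule order)
    from has_jet_unique[OF has_jet_less[OF curve[OF wcurve_branch2[OF n]] M] has_jet_bigo[OF this] k]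
    show "(\<Sum>m | wt m = k. f j m * sgn2 m) = 0" .
  next
    fix k :: nat assume "0 < k" "k < 12" "k < M"
    then show "(\<Sum>m | wt m = k + 5. f 3 m * mon_deriv (1 :: 'n bit0) m) - (\<Sum>m | wt m = k + 3. f 1 m * mon_deriv (3 :: 'n bit0) m) = p k"
      using rel[of 1 3 k \<phi> p] ext13 jet by (simp add: w)
  next
    fix k :: nat assume "0 < k" "k < 10" "k < M"
    then show "(\<Sum>m | wt m = k + 5. f 2 m * mon_deriv (1 :: 'n bit0) m) - (\<Sum>m | wt m = k + 7. f 1 m * mon_deriv (2 :: 'n bit0) m) = 0"
      using rel[of 1 2 k "\<lambda>t. 0" "\<lambda>k. 0"] ext12 z by (simp add: w)
  next
    fix k :: nat assume "0 < k" "k < 10" "k < M"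
    then show "(\<Sum>m | wt m = k + 7. f 3 m * mon_deriv (2 :: 'n bit0) m) - (\<Sum>m | wt m = k + 3. f 2 m * mon_deriv (3 :: 'n bit0) m) = 0"
      using rel[of 2 3 k "\<lambda>t. 0" "\<lambda>k. 0"] ext23 z by (simp add: w)
  next
    fix j assume O: "(\<lambda>s. a (axis 2 s) (axis j 1)) \<in> O[at 0](\<lambda>s. s ^ 3)"
    \<comment> \<open>Substituting s = t^7 turns order 3 in s into order 21 in t, beyond 17; in
      particular the coefficient of t^14, that of x_2^2, vanishes.\<close>
    have "filterlim (\<lambda>t::real. t ^ 7) (at 0) (at 0)"
    proof (rule filterlim_atI)
      have "((\<lambda>t::real. t ^ 7) \<longlongrightarrow> 0 ^ 7) (at 0)" by (intro tendsto_intros)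
      then show "((\<lambda>t::real. t ^ 7) \<longlongrightarrow> 0) (at 0)" by simp
      show "eventually (\<lambda>t::real. t ^ 7 \<noteq> 0) (at 0)"
        using eventually_neq_at_within[of 0 0 UNIV] by eventually_elim simp
    qed
    from landau_o.big.compose[OF O this]
    have "(\<lambda>t. a (axis 2 (t ^ 7)) (axis j 1)) \<in> O[at 0](\<lambda>t. t ^ 21)" by (simp flip: power_mult)
    then have "(\<lambda>t. a (axis 2 (t ^ 7)) (axis j 1)) \<in> O[at 0](\<lambda>t. t ^ 17)" by (rule bigo_power_weaken) simp
    from has_jet_unique[OF curve[OF wcurve_axis[OF n]] has_jet_bigo[OF this], of 14]
    show "f j (0, 2, 0) = 0" by (simp add: wt_sets)
  qed
qed

text \<open>Weights 8 and 6 carry one monomial each, x_1 x_3 and x_3^2, so both coefficients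
  entering the relation for p 3 vanish separately.\<close>

lemma order_bound_8: "p 3 = 0" if "9 \<le> M"
proof (rule coefficient_relations)
  fix f assume f: "\<And>j k. k < M \<Longrightarrow> (\<Sum>m | wt m = k. f j m * sgn2 m) = 0"
    "\<And>k. 0 < k \<Longrightarrow> k < 12 \<Longrightarrow> k < M \<Longrightarrow>
      (\<Sum>m | wt m = k + 5. f 3 m * mon_deriv (1 :: 'n bit0) m) - (\<Sum>m | wt m = k + 3. f 1 m * mon_deriv (3 :: 'n bit0) m) = p k"
  note s = wt_sets sgn2_def mon_deriv_simps[OF n]
  show ?thesis using that f(1)[of 8 3] f(1)[of 6 1] f(2)[of 3] by (simp add: s)
qed

text \<open>Weight 10 carries x_1^2 and x_2 x_3, whose values on the branch are opposite. The dx_2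
  dx_3 relation eliminates x_2 x_3, because weight 6 in the second component has the single monomial
  x_3^2.\<close>

lemma order_bound_10: "p 5 = 0" if "11 \<le> M"
proof (rule coefficient_relations)
  fix f assume f: "\<And>j k. k < M \<Longrightarrow> (\<Sum>m | wt m = k. f j m * sgn2 m) = 0"
    "\<And>k. 0 < k \<Longrightarrow> k < 12 \<Longrightarrow> k < M \<Longrightarrow>
      (\<Sum>m | wt m = k + 5. f 3 m * mon_deriv (1 :: 'n bit0) m) - (\<Sum>m | wt m = k + 3. f 1 m * mon_deriv (3 :: 'n bit0) m) = p k"
    "\<And>k. 0 < k \<Longrightarrow> k < 10 \<Longrightarrow> k < M \<Longrightarrow>
      (\<Sum>m | wt m = k + 7. f 3 m * mon_deriv (2 :: 'n bit0) m) - (\<Sum>m | wt m = k + 3. f 2 m * mon_deriv (3 :: 'n bit0) m) = 0"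
  note s = wt_sets sgn2_def mon_deriv_simps[OF n]
  show ?thesis using that f(1)[of 10 3] f(1)[of 8 1] f(1)[of 6 2] f(2)[of 5] f(3)[of 3] by (simp add: s)
qed

lemma order_bound_11: "p 6 = 0" if "12 \<le> M"
proof (rule coefficient_relations)
  fix f assume f: "\<And>j k. k < M \<Longrightarrow> (\<Sum>m | wt m = k. f j m * sgn2 m) = 0"
    "\<And>k. 0 < k \<Longrightarrow> k < 12 \<Longrightarrow> k < M \<Longrightarrow>
      (\<Sum>m | wt m = k + 5. f 3 m * mon_deriv (1 :: 'n bit0) m) - (\<Sum>m | wt m = k + 3. f 1 m * mon_deriv (3 :: 'n bit0) m) = p k"
  note s = wt_sets sgn2_def mon_deriv_simps[OF n]
  show ?thesis using that f(1)[of 11 3] f(1)[of 9 1] f(2)[of 6] by (simp add: s)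
qed

text \<open>As in weight 10: of the two monomials x_1^2 x_3 and x_2 x_3^2 of weight 13 the second is
  eliminated by the dx_2 dx_3 relation.\<close>

lemma order_bound_13: "p 8 = 0" if "14 \<le> M"
proof (rule coefficient_relations)
  fix f assume f: "\<And>j k. k < M \<Longrightarrow> (\<Sum>m | wt m = k. f j m * sgn2 m) = 0"
    "\<And>k. 0 < k \<Longrightarrow> k < 12 \<Longrightarrow> k < M \<Longrightarrow>
      (\<Sum>m | wt m = k + 5. f 3 m * mon_deriv (1 :: 'n bit0) m) - (\<Sum>m | wt m = k + 3. f 1 m * mon_deriv (3 :: 'n bit0) m) = p k"
    "\<And>k. 0 < k \<Longrightarrow> k < 10 \<Longrightarrow> k < M \<Longrightarrow>
      (\<Sum>m | wt m = k + 7. f 3 m * mon_deriv (2 :: 'n bit0) m) - (\<Sum>m | wt m = k + 3. f 2 m * mon_deriv (3 :: 'n bit0) m) = 0"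
  note s = wt_sets sgn2_def mon_deriv_simps[OF n]
  show ?thesis using that f(1)[of 13 3] f(1)[of 11 1] f(1)[of 9 2] f(2)[of 8] f(3)[of 6] by (simp add: s)
qed

text \<open>The singular branch alone leaves one free unknown, the coefficient c of x_2^2 in the
  third component; all others are multiples of it and p 9 = -17 c, in accordance with the primitive
  of \<theta>8 that vanishes on the singular branch. The nonsingular branch gives c = 0.\<close>

lemma order_bound_14:
  assumes "15 \<le> M" and ax: "\<And>j. (\<lambda>s. a (axis 2 s) (axis j 1)) \<in> O[at 0](\<lambda>s. s ^ 3)"
  shows "p 9 = 0"
proof (rule coefficient_relations)
  fix f assume f: "\<And>j k. k < M \<Longrightarrow> (\<Sum>m | wt m = k. f j m * sgn2 m) = 0"
    "\<And>k. 0 < k \<Longrightarrow> k < 12 \<Longrightarrow> k < M \<Longrightarrow>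
      (\<Sum>m | wt m = k + 5. f 3 m * mon_deriv (1 :: 'n bit0) m) - (\<Sum>m | wt m = k + 3. f 1 m * mon_deriv (3 :: 'n bit0) m) = p k"
    "\<And>k. 0 < k \<Longrightarrow> k < 10 \<Longrightarrow> k < M \<Longrightarrow>
      (\<Sum>m | wt m = k + 5. f 2 m * mon_deriv (1 :: 'n bit0) m) - (\<Sum>m | wt m = k + 7. f 1 m * mon_deriv (2 :: 'n bit0) m) = 0"
    "\<And>k. 0 < k \<Longrightarrow> k < 10 \<Longrightarrow> k < M \<Longrightarrow>
      (\<Sum>m | wt m = k + 7. f 3 m * mon_deriv (2 :: 'n bit0) m) - (\<Sum>m | wt m = k + 3. f 2 m * mon_deriv (3 :: 'n bit0) m) = 0"
    "\<And>j. (\<lambda>s. a (axis 2 s) (axis j 1)) \<in> O[at 0](\<lambda>s. s ^ 3) \<Longrightarrow> f j (0, 2, 0) = 0"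
  note s = wt_sets sgn2_def mon_deriv_simps[OF n]
  show ?thesis
    using assms(1) f(1)[of 14 3] f(5)[OF ax, of 3] f(1)[of 12 1] f(3)[of 5] f(1)[of 10 2] f(4)[of 7] f(2)[of 9] by (simp add: s)
qed

text \<open>The same phenomenon with c the coefficient of x_2^2 in the first component: the
  relations give p 11 = 19 c, and the nonsingular branch gives c = 0.\<close>

lemma order_bound_16:
  assumes "17 \<le> M" and ax: "\<And>j. (\<lambda>s. a (axis 2 s) (axis j 1)) \<in> O[at 0](\<lambda>s. s ^ 3)"
  shows "p 11 = 0"
proof (rule coefficient_relations)
  fix f assume f: "\<And>j k. k < M \<Longrightarrow> (\<Sum>m | wt m = k. f j m * sgn2 m) = 0"
    "\<And>k. 0 < k \<Longrightarrow> k < 12 \<Longrightarrow> k < M \<Longrightarrow>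
      (\<Sum>m | wt m = k + 5. f 3 m * mon_deriv (1 :: 'n bit0) m) - (\<Sum>m | wt m = k + 3. f 1 m * mon_deriv (3 :: 'n bit0) m) = p k"
    "\<And>k. 0 < k \<Longrightarrow> k < 10 \<Longrightarrow> k < M \<Longrightarrow>
      (\<Sum>m | wt m = k + 5. f 2 m * mon_deriv (1 :: 'n bit0) m) - (\<Sum>m | wt m = k + 7. f 1 m * mon_deriv (2 :: 'n bit0) m) = 0"
    "\<And>k. 0 < k \<Longrightarrow> k < 10 \<Longrightarrow> k < M \<Longrightarrow>
      (\<Sum>m | wt m = k + 7. f 3 m * mon_deriv (2 :: 'n bit0) m) - (\<Sum>m | wt m = k + 3. f 2 m * mon_deriv (3 :: 'n bit0) m) = 0"
    "\<And>j. (\<lambda>s. a (axis 2 s) (axis j 1)) \<in> O[at 0](\<lambda>s. s ^ 3) \<Longrightarrow> f j (0, 2, 0) = 0"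
  note s = wt_sets sgn2_def mon_deriv_simps[OF n]
  show ?thesis
    using assms(1) f(1)[of 14 1] f(5)[OF ax, of 1] f(1)[of 16 3] f(4)[of 9] f(1)[of 12 2] f(3)[of 7] f(2)[of 11] by (simp add: s)
qed

end

section \<open>Primitives controlled by a Lagrangian germ\<close>

lemma smooth_on_bounded_cball:
  fixes f :: "'a::euclidean_space \<Rightarrow> 'b::real_normed_vector"
  assumes "smooth_on (ball 0 r) f" "s < r"
  obtains B where "0 \<le> B" "\<And>x. x \<in> cball 0 s \<Longrightarrow> norm (f x) \<le> B"
proof -
  have "cball 0 s \<subseteq> ball (0 :: 'a) r" using assms(2) by auto
  then have "bounded (f ` cball 0 s)"
    by (intro compact_imp_bounded compact_continuous_image compact_cball continuous_on_subset[OF smooth_on_continuous[OF assms(1)]])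
  then obtain B where "\<forall>x\<in>cball 0 s. norm (f x) \<le> B" unfolding bounded_iff by blast
  then have "\<And>x. x \<in> cball 0 s \<Longrightarrow> norm (f x) \<le> max 0 B" by (meson le_max_iff_disj)
  then show thesis using that[of "max 0 B"] by simp
qed

lemma smooth_on_lipschitz_cball:
  fixes f :: "'a::euclidean_space \<Rightarrow> 'b::real_normed_vector"
  assumes sm: "smooth_on (ball 0 r) f" and s: "s < r"
  obtains L where "0 \<le> L" "\<And>x y. x \<in> cball 0 s \<Longrightarrow> y \<in> cball 0 s \<Longrightarrow> norm (f x - f y) \<le> L * norm (x - y)"
proof -
  have "\<exists>B. \<forall>x\<in>cball 0 s. norm (frechet_derivative f (at x) b) \<le> B" for b
    by (rule smooth_on_bounded_cball[OF smooth_on_frechet[OF sm] s]) blast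
  then obtain B where B: "\<And>b x. x \<in> cball 0 s \<Longrightarrow> norm (frechet_derivative f (at x) b) \<le> B b" by metis
  define M where "M = (\<Sum>b\<in>Basis. \<bar>B b\<bar>)"
  have BM: "norm (frechet_derivative f (at x) b) \<le> M" if "b \<in> Basis" "x \<in> cball 0 s" for b x
  proof -
    have "norm (frechet_derivative f (at x) b) \<le> \<bar>B b\<bar>" using B[OF that(2), of b] by linarith
    also have "\<dots> \<le> M" unfolding M_def by (rule member_le_sum[OF that(1)]) auto
    finally show ?thesis .
  qed
  show thesis
  proof (rule that[of "of_nat DIM('a) * M"])
    show "0 \<le> of_nat DIM('a) * M" by (simp add: M_def sum_nonneg)
    fix x y :: 'a assume x: "x \<in> cball 0 s" and y: "y \<in> cball 0 s"
    show "norm (f x - f y) \<le> of_nat DIM('a) * M * norm (x - y)"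
    proof (rule differentiable_bound[OF convex_cball[of 0 s] _ _ x y])
      fix z :: 'a assume z: "z \<in> cball 0 s"
      then have d: "(f has_derivative frechet_derivative f (at z)) (at z)"
        by (intro smooth_on_has_derivative[OF sm]) (use s in auto)
      then show "(f has_derivative frechet_derivative f (at z)) (at z within cball 0 s)"
        by (rule has_derivative_at_withinI)
      show "onorm (frechet_derivative f (at z)) \<le> of_nat DIM('a) * M"
        by (rule onorm_le, rule norm_linear_le_Basis[OF has_derivative_linear[OF d]]) (rule BM[OF _ z])
    qed
  qed
qed

text \<open>Modulo terms of the size of the defining equations, a form vanishing on the Lagrangian germ is
  the differential of a 1-form of that size. Near \<open>0\<close> the equations become linear in the chart
  \<open>G x = x + R\<^sub>0 (H x - M\<^sub>0 x)\<close>, where \<open>M\<^sub>0 = DH(0)\<close> and \<open>M\<^sub>0 R\<^sub>0 = id\<close>.\<close>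

theorem lagrangian_germ_primitive:
  fixes \<omega> :: "(real ^ ('n::finite) bit0) form2"
  assumes U: "open U" "0 \<in> U" "two_form_on U \<omega>" and lag: "lagrangian_germ \<omega> H"
  obtains r \<mu> where "0 < r" "ball 0 r \<subseteq> U" "one_form_on (ball 0 r) \<mu>"
    "\<And>v. \<exists>C. \<forall>x\<in>ball 0 r. \<bar>\<mu> x v\<bar> \<le> C * norm (H x)"
    "\<And>u v. \<exists>C. \<forall>x\<in>ball 0 r. \<bar>ext_deriv \<mu> x u v - \<omega> x u v\<bar> \<le> C * norm (H x)"
proof -
  obtain U1 where U1: "open U1" "0 \<in> U1" "smooth_on U1 H" "\<And>x. x \<in> U1 \<Longrightarrow> surj (frechet_derivative H (at x))"
    "\<And>x u v. x \<in> U1 \<Longrightarrow> H x = 0 \<Longrightarrow> frechet_derivative H (at x) u = 0 \<Longrightarrow> frechet_derivative H (at x) v = 0 \<Longrightarrow> \<omega> x u v = 0"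
    and H0: "H 0 = 0"
    using lag unfolding lagrangian_germ_def by blast
  let ?DH = "\<lambda>x. frechet_derivative H (at x)"
  define M0 where "M0 = ?DH 0"
  have linM0: "linear M0" unfolding M0_def by (rule smooth_on_linear_frechet[OF U1(3,2)])
  obtain R0 where R0: "linear R0" "M0 \<circ> R0 = id"
    using linear_surjective_right_inverse[OF linM0] U1(4)[OF U1(2)] unfolding M0_def by blast
  have MR: "M0 (R0 c) = c" for c using R0(2) by (metis comp_apply id_apply)
  have blR0: "bounded_linear R0" and blM0: "bounded_linear M0"
    using R0(1) linM0 linear_conv_bounded_linear by blast+
  define G where "G = (\<lambda>x. x + R0 (H x - M0 x))"
  define DG where "DG = (\<lambda>x v. v + R0 (?DH x v - M0 v))"
  have dG: "(G has_derivative DG x) (at x)" if "x \<in> U1" for x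
    unfolding G_def DG_def
    by (intro has_derivative_add has_derivative_ident bounded_linear.has_derivative[OF blR0] has_derivative_diff
        smooth_on_has_derivative[OF U1(3) that] bounded_linear_imp_has_derivative blM0)
  have M0G: "M0 (G x) = H x" for x by (simp add: G_def linear_add[OF linM0] MR)
  have M0DG: "M0 (DG x v) = ?DH x v" for x v by (simp add: DG_def linear_add[OF linM0] MR)
  have linDG: "linear (DG x)" if "x \<in> U1" for x by (rule has_derivative_linear[OF dG[OF that]])
  have smDG: "smooth_on U1 (\<lambda>x. DG x v)" for v
    unfolding DG_def
    by (intro smooth_on_add smooth_on_const smooth_on_bounded_linear_compose[OF _ blR0] smooth_on_diff smooth_on_frechet U1)
  have DG0: "DG 0 v = v" for v by (simp add: DG_def M0_def linear_0[OF R0(1)])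
  have G0: "G 0 = 0" by (simp add: G_def H0 linear_0[OF linM0] linear_0[OF R0(1)])
  let ?d = "real DIM(real ^ 'n bit0)"
  \<comment> \<open>A radius on which the derivative of the chart differs from the identity by at
    most 1/2 in norm; the operator norm is estimated through the basis, hence the division by the
    dimension.\<close>
  have "\<exists>\<rho>>0. ball 0 \<rho> \<subseteq> U \<inter> U1 \<and> (\<forall>x\<in>ball 0 \<rho>. \<forall>b\<in>Basis. norm (DG x b - b) \<le> 1 / (2 * ?d))"
  proof -
    obtain e where e: "e > 0" "ball 0 e \<subseteq> U \<inter> U1" using U U1 openE[of "U \<inter> U1" 0] by blast
    have "\<exists>\<rho>>0. \<forall>x. dist x 0 < \<rho> \<longrightarrow> dist (DG x b) (DG 0 b) < 1 / (2 * ?d)" for b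
    proof -
      have "isCont (\<lambda>x. DG x b) 0"
        using smooth_on_continuous[OF smDG] U1(1,2) by (simp add: continuous_on_eq_continuous_at)
      moreover have "0 < 1 / (2 * ?d)" using DIM_positive[where 'a="real ^ 'n bit0"] by (simp del: DIM_cart)
      ultimately show ?thesis unfolding continuous_at_eps_delta by blast
    qed
    then obtain \<rho> where \<rho>: "\<And>b. \<rho> b > 0" "\<And>b x. dist x 0 < \<rho> b \<Longrightarrow> dist (DG x b) (DG 0 b) < 1 / (2 * ?d)" by metis
    define \<rho>' where "\<rho>' = Min (insert e (\<rho> ` Basis))"
    have \<rho>': "\<rho>' > 0" "\<rho>' \<le> e" "\<And>b. b \<in> Basis \<Longrightarrow> \<rho>' \<le> \<rho> b"
      using \<rho>(1) e(1) by (auto simp: \<rho>'_def intro: min.coboundedI2)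
    show ?thesis
    proof (intro exI[of _ \<rho>'] conjI ballI)
      show "ball 0 \<rho>' \<subseteq> U \<inter> U1" using e(2) \<rho>'(2) by auto
      fix x b :: "real ^ 'n bit0" assume x: "x \<in> ball 0 \<rho>'" and b: "b \<in> Basis"
      have "dist (DG x b) (DG 0 b) < 1 / (2 * ?d)" by (rule \<rho>(2)) (use x \<rho>'(3)[OF b] in auto)
      then show "norm (DG x b - b) \<le> 1 / (2 * ?d)" by (simp add: DG0 dist_norm)
    qed (rule \<rho>'(1))
  qed
  then obtain \<rho> where \<rho>: "\<rho> > 0" "ball 0 \<rho> \<subseteq> U \<inter> U1" "\<And>x b. x \<in> ball 0 \<rho> \<Longrightarrow> b \<in> Basis \<Longrightarrow> norm (DG x b - b) \<le> 1 / (2 * ?d)" by blast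
  let ?B = "ball (0 :: real ^ 'n bit0) \<rho>"
  have BU: "x \<in> U" "x \<in> U1" if "x \<in> ?B" for x using \<rho>(2) that by blast+
  have near: "norm (DG x v - v) \<le> (1/2) * norm v" if "x \<in> ?B" for x v
  proof -
    have "linear (\<lambda>v. DG x v - v)" by (intro linear_compose_sub linDG BU that linear_ident)
    from norm_linear_le_Basis[OF this \<rho>(3)[OF that], of v]
    have "norm (DG x v - v) \<le> ?d * (1 / (2 * ?d)) * norm v" .
    moreover have "?d * (1 / (2 * ?d)) = 1/2" using DIM_positive[where 'a="real ^ 'n bit0"] by (simp del: DIM_cart)
    ultimately show ?thesis by simp
  qed
  have contr: "norm ((G x - x) - (G y - y)) \<le> (1/2) * norm (x - y)" if x: "x \<in> ?B" and y: "y \<in> ?B" for x y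
  proof (rule differentiable_bound[OF convex_ball[of 0 \<rho>] _ _ x y])
    fix z assume z: "z \<in> ?B"
    show "((\<lambda>x. G x - x) has_derivative (\<lambda>v. DG z v - v)) (at z within ?B)"
      by (intro has_derivative_at_withinI[OF has_derivative_diff] dG BU z has_derivative_ident)
    show "onorm (\<lambda>v. DG z v - v) \<le> 1/2" by (rule onorm_le) (rule near[OF z])
  qed
  have inj: "v = 0" if "x \<in> ?B" "DG x v = 0" for x v using near[OF that(1), of v] that(2) by simp
  define A where "A = (\<lambda>x. (\<chi> j i. DG x (axis i 1) $ j) :: real ^ 'n bit0 ^ 'n bit0)"
  have Av: "A x *v v = DG x v" if "x \<in> ?B" for x v
  proof -
    note l = linDG[OF BU(2)[OF that]]
    have "DG x v = DG x (\<Sum>i\<in>UNIV. v $ i *\<^sub>R axis i 1)"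
      by (simp add: basis_expansion flip: scalar_mult_eq_scaleR)
    also have "\<dots> = (\<Sum>i\<in>UNIV. v $ i *\<^sub>R DG x (axis i 1))" by (simp add: linear_sum[OF l] linear_cmul[OF l])
    finally show ?thesis by (simp add: A_def matrix_vector_mult_def vec_eq_iff mult.commute)
  qed
  have detA: "det (A x) \<noteq> 0" if "x \<in> ?B" for x
    by (rule det_nonzeroI) (use inj[OF that] Av[OF that] in simp)
  \<comment> \<open>The inverse of \<open>DG x\<close>, written by Cramer's rule so that its
    smoothness in x is visible.\<close>
  define S where "S = (\<lambda>x c. \<chi> k. det (\<chi> i j. if j = k then c $ i else A x $ i $ j) / det (A x))"
  have S: "DG x (S x c) = c" if "x \<in> ?B" for x c
    using cramer[OF detA[OF that], of "S x c" c] Av[OF that] by (simp add: S_def)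
  have S_unique: "S x c = v" if "x \<in> ?B" "DG x v = c" for x c v
  proof -
    have "DG x (S x c - v) = 0" using S[OF that(1)] that(2) by (simp add: linear_diff[OF linDG[OF BU(2)[OF that(1)]]])
    from inj[OF that(1) this] show ?thesis by simp
  qed
  have linS: "linear (S x)" if x: "x \<in> ?B" for x
    unfolding linear_iff
    by (intro conjI allI; rule S_unique[OF x])
      (simp_all add: linear_add[OF linDG[OF BU(2)[OF x]]] linear_cmul[OF linDG[OF BU(2)[OF x]]] S[OF x])
  have B1: "?B \<subseteq> U1" using \<rho>(2) by blast
  have smS: "smooth_on ?B (\<lambda>x. S x (b x))" if b: "smooth_on ?B b" for b
  proof (rule smooth_on_linear_solve[OF open_ball, of 0 \<rho> A b])
    show "smooth_on ?B (\<lambda>x. A x $ i $ j)" for i j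
      unfolding A_def by (simp, intro smooth_on_vec_nth smooth_on_subset[OF smDG B1] open_ball)
    show "smooth_on ?B (\<lambda>x. b x $ i)" for i by (rule smooth_on_vec_nth[OF open_ball b])
    show "A x *v S x (b x) = b x" if "x \<in> ?B" for x using Av[OF that] S[OF that] by simp
  qed (rule detA)
  have smH: "smooth_on ?B H" by (rule smooth_on_subset[OF U1(3) B1])
  \<comment> \<open>P x v has the same image as v under the derivative of H, so v - P x v is tangent
    to the level set of H through x.\<close>
  define P where "P = (\<lambda>x v. S x (R0 (?DH x v)))"
  have linP: "linear (P x)" if "x \<in> ?B" for x
    unfolding P_def
    using linear_compose[OF linear_compose[OF smooth_on_linear_frechet[OF smH that] R0(1)] linS[OF that]] by (simp add: o_def)
  have DHS: "?DH x (S x (R0 c)) = c" if "x \<in> ?B" for x c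
    using M0DG[of x "S x (R0 c)"] S[OF that] MR by simp
  have smP: "smooth_on ?B (\<lambda>x. P x v)" for v
    unfolding P_def by (intro smS smooth_on_bounded_linear_compose[OF open_ball blR0] smooth_on_frechet smH)
  \<comment> \<open>The contraction of \<omega> with the field dual to dH_i, corrected by half of
    the doubly transversal part so that the sum of dH_i \<and> \<sigma>_i is \<omega> minus its
    tangential part. Multiplying by H_i therefore yields a primitive up to terms of the size of
    H.\<close>
  define \<sigma> where "\<sigma> = (\<lambda>i x v. \<omega> x (S x (R0 (axis i 1))) (v - (1/2) *\<^sub>R P x v))"
  have two: "two_form_on ?B \<omega>" by (rule two_form_on_subset[OF U(3)]) (use \<rho>(2) in blast)
  note bl = two_form_onD(1)[OF two]
  have one\<sigma>: "one_form_on ?B (\<sigma> i)" for i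
    unfolding one_form_on_def
  proof (intro conjI ballI allI)
    fix x assume x: "x \<in> ?B"
    show "linear (\<sigma> i x)"
      unfolding \<sigma>_def linear_iff
      by (simp add: linear_add[OF linP[OF x]] linear_cmul[OF linP[OF x]] bilinear_radd[OF bl[OF x]] bilinear_rsub[OF bl[OF x]]
          bilinear_rmul[OF bl[OF x]] algebra_simps)
  next
    fix v
    show "smooth_on ?B (\<lambda>x. \<sigma> i x v)"
      unfolding \<sigma>_def
    proof (rule smooth_on_two_form[OF open_ball open_ball two])
      show "smooth_on ?B (\<lambda>x. S x (R0 (axis i 1)))" by (intro smS smooth_on_const open_ball)
      show "smooth_on ?B (\<lambda>x. v - (1/2) *\<^sub>R P x v)"
        by (intro smooth_on_diff smooth_on_const smooth_on_scaleR smP open_ball)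
      show "smooth_on ?B (\<lambda>x. x)" by (intro smooth_on_bounded_linear bounded_linear_ident open_ball)
    qed auto
  qed
  define \<mu> where "\<mu> = (\<lambda>x v. \<Sum>i\<in>UNIV. H x $ i * \<sigma> i x v)"
  have one\<mu>: "one_form_on ?B \<mu>"
    unfolding one_form_on_def
  proof (intro conjI ballI allI)
    fix x assume x: "x \<in> ?B"
    have l: "linear (\<sigma> i x)" for i by (rule one_form_onD(1)[OF one\<sigma> x])
    show "linear (\<mu> x)"
      unfolding \<mu>_def linear_iff
      by (simp add: linear_add[OF l] linear_cmul[OF l] distrib_left sum.distrib sum_distrib_left mult.left_commute)
  next
    fix v
    show "smooth_on ?B (\<lambda>x. \<mu> x v)"
      unfolding \<mu>_def by (intro smooth_on_sum smooth_on_mult smooth_on_vec_nth open_ball smH one_form_onD(2)[OF one\<sigma>])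
  qed
  have d\<mu>: "dform1 \<mu> x h v = (\<Sum>i\<in>UNIV. ?DH x h $ i * \<sigma> i x v) + (\<Sum>i\<in>UNIV. H x $ i * dform1 (\<sigma> i) x h v)" if x: "x \<in> ?B" for x h v
  proof -
    have dH: "((\<lambda>x. H x $ i) has_derivative (\<lambda>h. ?DH x h $ i)) (at x)" for i
      by (rule bounded_linear.has_derivative[OF bounded_linear_vec_nth smooth_on_has_derivative[OF smH x]])
    have "((\<lambda>x. \<mu> x v) has_derivative (\<lambda>h. \<Sum>i\<in>UNIV. H x $ i * dform1 (\<sigma> i) x h v + ?DH x h $ i * \<sigma> i x v)) (at x)"
      unfolding \<mu>_def by (intro has_derivative_sum has_derivative_mult dH one_form_has_derivative_at[OF one\<sigma> x])
    from frechet_at[OF this] show ?thesis unfolding dform1_def by (simp add: sum.distrib)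
  qed
  have \<sigma>sum: "(\<Sum>i\<in>UNIV. c $ i * \<sigma> i x v) = \<omega> x (S x (R0 c)) (v - (1/2) *\<^sub>R P x v)" if x: "x \<in> ?B" for c x v
  proof -
    have l: "linear (\<lambda>c. \<omega> x (S x (R0 c)) w)" for w
      unfolding linear_iff
      by (simp add: linear_add[OF R0(1)] linear_cmul[OF R0(1)] linear_add[OF linS[OF x]] linear_cmul[OF linS[OF x]]
          bilinear_ladd[OF bl[OF x]] bilinear_lmul[OF bl[OF x]])
    have "\<omega> x (S x (R0 c)) w = \<omega> x (S x (R0 (\<Sum>i\<in>UNIV. c $ i *\<^sub>R axis i 1))) w" for w
      by (simp add: basis_expansion flip: scalar_mult_eq_scaleR)
    also have "\<dots> w = (\<Sum>i\<in>UNIV. c $ i * \<omega> x (S x (R0 (axis i 1))) w)" for w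
      by (simp add: linear_sum[OF l] linear_cmul[OF l])
    finally show ?thesis by (simp add: \<sigma>_def)
  qed
  \<comment> \<open>The form \<omega> evaluated on the parts tangent to the level sets of H; it
    vanishes where H = 0, since there these parts are tangent to the Lagrangian germ.\<close>
  define \<tau> where "\<tau> = (\<lambda>u v x. \<omega> x (u - P x u) (v - P x v))"
  have ext\<mu>: "ext_deriv \<mu> x u v - \<omega> x u v = - \<tau> u v x + (\<Sum>i\<in>UNIV. H x $ i * ext_deriv (\<sigma> i) x u v)" if x: "x \<in> ?B" for x u v
  proof -
    have 1: "ext_deriv \<mu> x u v = \<omega> x (P x u) (v - (1/2) *\<^sub>R P x v) - \<omega> x (P x v) (u - (1/2) *\<^sub>R P x u) + (\<Sum>i\<in>UNIV. H x $ i * ext_deriv (\<sigma> i) x u v)"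
    proof -
      have p: "S x (R0 (?DH x w)) = P x w" for w by (simp add: P_def)
      show ?thesis unfolding ext_deriv_alt d\<mu>[OF x] \<sigma>sum[OF x] p
        by (simp add: right_diff_distrib sum_subtractf)
    qed
    have 2: "\<omega> x (P x v) u = - \<omega> x u (P x v)" "\<omega> x (P x v) (P x u) = - \<omega> x (P x u) (P x v)"
      by (rule two_form_on_antisym[OF two x])+
    have 3: "\<tau> u v x = \<omega> x u v - \<omega> x u (P x v) - (\<omega> x (P x u) v - \<omega> x (P x u) (P x v))"
      unfolding \<tau>_def bilinear_lsub[OF bl[OF x]] bilinear_rsub[OF bl[OF x]] by simp
    show ?thesis unfolding 1 3 bilinear_rsub[OF bl[OF x]] bilinear_rmul[OF bl[OF x]] 2 by simp
  qed
  define s where "s = \<rho> / 2"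
  have s: "0 < s" "s < \<rho>" using \<rho>(1) by (auto simp: s_def)
  have sB: "x \<in> ?B" if "x \<in> cball 0 s" for x using that s by auto
  \<comment> \<open>G differs from the identity by a map with Lipschitz constant 1/2, so sending y
    to z - (G y - y) is a contraction of the closed ball.\<close>
  have solve: "\<exists>y\<in>cball 0 s. G y = z" if z: "norm z \<le> s / 2" for z :: "real ^ 'n bit0"
  proof -
    have "\<exists>!y::real ^ 'n bit0. y \<in> cball 0 s \<and> z - (G y - y) = y"
    proof (rule Banach_fix[where c="1/2"])
      show "complete (cball (0 :: real ^ 'n bit0) s)" by (simp add: compact_imp_complete)
      show "cball (0 :: real ^ 'n bit0) s \<noteq> {}" using s by simp
      show "(\<lambda>y. z - (G y - y)) ` cball 0 s \<subseteq> cball 0 s"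
      proof (rule image_subsetI)
        fix y :: "real ^ 'n bit0" assume y: "y \<in> cball 0 s"
        have "norm (z - (G y - y)) \<le> norm z + norm (G y - y)" by (rule norm_triangle_ineq4)
        also have "norm (G y - y) \<le> (1/2) * norm y" using contr[OF sB[OF y], of 0] \<rho>(1) G0 by simp
        also have "norm z + (1/2) * norm y \<le> s" using z y by simp
        finally show "z - (G y - y) \<in> cball 0 s" by simp
      qed
      fix x y :: "real ^ 'n bit0" assume x: "x \<in> cball 0 s" and y: "y \<in> cball 0 s"
      have "z - (G x - x) - (z - (G y - y)) = (G y - y) - (G x - x)" by simp
      then show "dist (z - (G x - x)) (z - (G y - y)) \<le> 1/2 * dist x y"
        using contr[OF sB[OF y] sB[OF x]] by (simp only: dist_norm norm_minus_commute[of y x])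
    qed auto
    then obtain y where y: "y \<in> cball 0 s" "z - (G y - y) = y" by blast
    from y(2) have "G y = z" by (simp add: algebra_simps)
    with y(1) show ?thesis by blast
  qed
  obtain K where K: "\<And>c. norm (R0 c) \<le> norm c * K" "0 \<le> K" using bounded_linear.nonneg_bounded[OF blR0] by blast
  have "isCont (\<lambda>x. G x - R0 (H x)) 0"
  proof -
    have "isCont G 0" using dG[OF U1(2)] has_derivative_continuous by blast
    moreover have "isCont H 0" using smooth_on_has_derivative[OF U1(3,2)] has_derivative_continuous by blast
    ultimately show ?thesis by (intro continuous_intros bounded_linear.isCont[OF blR0])
  qed
  moreover have "0 < s / 2" using s by simp
  ultimately obtain r0 where r0: "r0 > 0" "\<And>x. dist x 0 < r0 \<Longrightarrow> dist (G x - R0 (H x)) (G 0 - R0 (H 0)) < s / 2"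
    unfolding continuous_at_eps_delta by metis
  define r where "r = min r0 s"
  have r: "0 < r" "r \<le> s" "r \<le> r0" using r0 s by (auto simp: r_def)
  have rs: "x \<in> cball 0 s" if "x \<in> ball 0 r" for x using that r by auto
  \<comment> \<open>A zero of H at distance comparable to the norm of H x: in the chart the
    equations are linear, and subtracting \<open>R0 (H x)\<close> there moves x onto the zero
    set.\<close>
  have foot: "\<exists>y\<in>cball 0 s. H y = 0 \<and> norm (x - y) \<le> 2 * K * norm (H x)" if x: "x \<in> ball 0 r" for x
  proof -
    have "norm (G x - R0 (H x)) \<le> s / 2"
      using r0(2)[of x] x r by (simp add: G0 H0 linear_0[OF R0(1)])
    from solve[OF this] obtain y where y: "y \<in> cball 0 s" "G y = G x - R0 (H x)" by blast
    have "H y = M0 (G x) - M0 (R0 (H x))" using M0G[of y] by (simp add: y(2) linear_diff[OF linM0])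
    then have "H y = 0" by (simp add: M0G MR)
    moreover have "norm (x - y) \<le> 2 * K * norm (H x)"
    proof -
      have "norm ((G x - x) - (G y - y)) \<le> (1/2) * norm (x - y)" by (rule contr[OF sB[OF rs[OF x]] sB[OF y(1)]])
      moreover have "(G x - x) - (G y - y) = R0 (H x) - (x - y)" by (simp add: y(2))
      ultimately have "norm (x - y) - norm (R0 (H x)) \<le> (1/2) * norm (x - y)"
        using norm_triangle_ineq2[of "x - y" "R0 (H x)"] by (simp add: norm_minus_commute)
      then have "norm (x - y) \<le> 2 * norm (R0 (H x))" by simp
      also have "\<dots> \<le> 2 * (norm (H x) * K)" using K(1)[of "H x"] by simp
      finally show ?thesis by (simp add: mult.commute mult.left_commute)
    qed
    ultimately show ?thesis using y(1) by blast
  qed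
  have \<tau>0: "\<tau> u v y = 0" if y: "y \<in> cball 0 s" "H y = 0" for u v y
  proof -
    have yB: "y \<in> ?B" by (rule sB[OF y(1)])
    have "?DH y (w - P y w) = 0" for w
      using DHS[OF yB, of "?DH y w"] by (simp add: P_def linear_diff[OF smooth_on_linear_frechet[OF smH yB]])
    then show ?thesis unfolding \<tau>_def by (intro U1(5)[OF BU(2)[OF yB] y(2)])
  qed
  show thesis
  proof (rule that[OF r(1)])
    show "ball 0 r \<subseteq> U" using rs sB BU(1) by blast
    have sub: "ball 0 r \<subseteq> ?B" using rs sB by blast
    show "one_form_on (ball 0 r) \<mu>" by (rule one_form_on_subset[OF one\<mu> sub])
    fix v
    have "\<exists>C. \<forall>x\<in>cball 0 s. norm (\<sigma> i x v) \<le> C" for i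
      by (rule smooth_on_bounded_cball[OF one_form_onD(2)[OF one\<sigma>] s(2)]) blast
    then obtain C where C: "\<And>i x. x \<in> cball 0 s \<Longrightarrow> \<bar>\<sigma> i x v\<bar> \<le> C i" by (metis real_norm_def)
    show "\<exists>C. \<forall>x\<in>ball 0 r. \<bar>\<mu> x v\<bar> \<le> C * norm (H x)"
    proof (intro exI[of _ "\<Sum>i\<in>UNIV. C i"] ballI)
      fix x :: "real ^ 'n bit0" assume x: "x \<in> ball 0 r"
      have "\<bar>\<mu> x v\<bar> \<le> (\<Sum>i\<in>UNIV. \<bar>H x $ i * \<sigma> i x v\<bar>)" unfolding \<mu>_def by (rule sum_abs)
      also have "\<dots> \<le> (\<Sum>i\<in>UNIV. norm (H x) * C i)"
        by (rule sum_mono) (auto simp: abs_mult intro!: mult_mono component_le_norm_cart C[OF rs[OF x]])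
      finally show "\<bar>\<mu> x v\<bar> \<le> (\<Sum>i\<in>UNIV. C i) * norm (H x)" by (simp add: sum_distrib_right mult.commute)
    qed
  next
    fix u v
    have "smooth_on ?B (\<tau> u v)"
      unfolding \<tau>_def
    proof (rule smooth_on_two_form[OF open_ball open_ball two])
      show "smooth_on ?B (\<lambda>x. x)" by (intro smooth_on_bounded_linear bounded_linear_ident open_ball)
      show "smooth_on ?B (\<lambda>x. u - P x u)" "smooth_on ?B (\<lambda>x. v - P x v)"
        by (intro smooth_on_diff smooth_on_const smP open_ball)+
    qed auto
    \<comment> \<open>Lipschitz continuity together with \<tau> = 0 at the nearby zero y of H makes
      \<tau> at x of the size of H x.\<close>
    from smooth_on_lipschitz_cball[OF this s(2)] obtain L where L: "0 \<le> L"
      "\<And>x y. x \<in> cball 0 s \<Longrightarrow> y \<in> cball 0 s \<Longrightarrow> norm (\<tau> u v x - \<tau> u v y) \<le> L * norm (x - y)" by blast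
    have "\<exists>C. \<forall>x\<in>cball 0 s. norm (ext_deriv (\<sigma> i) x u v) \<le> C" for i
      by (rule smooth_on_bounded_cball[OF two_form_onD(3)[OF ext_deriv_two_form[OF open_ball one\<sigma>]] s(2)]) blast
    then obtain C where C: "\<And>i x. x \<in> cball 0 s \<Longrightarrow> \<bar>ext_deriv (\<sigma> i) x u v\<bar> \<le> C i" by (metis real_norm_def)
    show "\<exists>C. \<forall>x\<in>ball 0 r. \<bar>ext_deriv \<mu> x u v - \<omega> x u v\<bar> \<le> C * norm (H x)"
    proof (intro exI[of _ "L * (2 * K) + (\<Sum>i\<in>UNIV. C i)"] ballI)
      fix x :: "real ^ 'n bit0" assume x: "x \<in> ball 0 r"
      obtain y where y: "y \<in> cball 0 s" "H y = 0" "norm (x - y) \<le> 2 * K * norm (H x)" using foot[OF x] by blast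
      have "\<bar>\<tau> u v x\<bar> \<le> L * norm (x - y)" using L(2)[OF rs[OF x] y(1)] \<tau>0[OF y(1,2)] by simp
      also have "\<dots> \<le> L * (2 * K * norm (H x))" by (rule mult_left_mono[OF y(3) L(1)])
      finally have 1: "\<bar>\<tau> u v x\<bar> \<le> L * (2 * K * norm (H x))" .
      have "\<bar>\<Sum>i\<in>UNIV. H x $ i * ext_deriv (\<sigma> i) x u v\<bar> \<le> (\<Sum>i\<in>UNIV. \<bar>H x $ i * ext_deriv (\<sigma> i) x u v\<bar>)" by (rule sum_abs)
      also have "\<dots> \<le> (\<Sum>i\<in>UNIV. norm (H x) * C i)"
        by (rule sum_mono) (auto simp: abs_mult intro!: mult_mono component_le_norm_cart C[OF rs[OF x]])
      finally have 2: "\<bar>\<Sum>i\<in>UNIV. H x $ i * ext_deriv (\<sigma> i) x u v\<bar> \<le> (\<Sum>i\<in>UNIV. C i) * norm (H x)"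
        by (simp add: sum_distrib_left sum_distrib_right mult.commute)
      show "\<bar>ext_deriv \<mu> x u v - \<omega> x u v\<bar> \<le> (L * (2 * K) + (\<Sum>i\<in>UNIV. C i)) * norm (H x)"
        unfolding ext\<mu>[OF sB[OF rs[OF x]]] using 1 2 by (simp add: algebra_simps)
    qed
  qed
qed

section \<open>Orders of vanishing\<close>

lemma smooth_on_deriv:
  fixes g :: "real \<Rightarrow> real"
  assumes S: "open S" and g: "smooth_on S g"
  shows "smooth_on S (deriv g)" and "x \<in> S \<Longrightarrow> (g has_real_derivative deriv g x) (at x)"
proof -
  have d: "(g has_real_derivative frechet_derivative g (at x) 1) (at x)" if "x \<in> S" for x
  proof -
    have h: "(g has_derivative frechet_derivative g (at x)) (at x)" by (rule smooth_on_has_derivative[OF g that])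
    have "frechet_derivative g (at x) = (*) (frechet_derivative g (at x) 1)"
    proof
      fix h' show "frechet_derivative g (at x) h' = frechet_derivative g (at x) 1 * h'"
        using linear_cmul[OF has_derivative_linear[OF h], of h' 1] by simp
    qed
    with h show ?thesis unfolding has_field_derivative_def by simp
  qed
  have e: "deriv g x = frechet_derivative g (at x) 1" if "x \<in> S" for x by (rule DERIV_imp_deriv[OF d[OF that]])
  show "x \<in> S \<Longrightarrow> (g has_real_derivative deriv g x) (at x)" using d e by simp
  show "smooth_on S (deriv g)"
    using smooth_on_cong[OF S, of "deriv g" "\<lambda>x. frechet_derivative g (at x) 1"] e smooth_on_frechet[OF g] by simp
qed

lemma smooth_on_funpow_deriv:
  fixes g :: "real \<Rightarrow> real"
  assumes S: "open S" and g: "smooth_on S g"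
  shows "smooth_on S ((deriv ^^ k) g)"
  by (induction k) (simp_all add: g smooth_on_deriv(1)[OF S])

lemma smooth_has_jet:
  fixes g :: "real \<Rightarrow> real"
  assumes S: "open S" "0 \<in> S" and g: "smooth_on S g"
  shows "has_jet K g (\<lambda>k. (deriv ^^ k) g 0 / fact k)"
proof -
  obtain e where e: "e > 0" "cball 0 e \<subseteq> S" using S open_contains_cball by blast
  note sm = smooth_on_funpow_deriv[OF S(1) g]
  have "bounded ((deriv ^^ K) g ` cball 0 e)"
    by (intro compact_imp_bounded compact_continuous_image compact_cball continuous_on_subset[OF smooth_on_continuous[OF sm] e(2)])
  then obtain B where B: "\<And>x. x \<in> cball 0 e \<Longrightarrow> norm ((deriv ^^ K) g x) \<le> B" unfolding bounded_iff by blast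
  have "norm (g t - (\<Sum>k<K. (deriv ^^ k) g 0 / fact k * t ^ k)) \<le> B * norm (t ^ K)" if t: "t \<in> ball 0 e" for t
  proof -
    have "\<exists>u. \<bar>u\<bar> \<le> \<bar>t\<bar> \<and> g t = (\<Sum>k<K. (deriv ^^ k) g 0 / fact k * t ^ k) + (deriv ^^ K) g u / fact K * t ^ K"
    proof (rule Maclaurin_bi_le)
      show "\<forall>m u. m < K \<and> \<bar>u\<bar> \<le> \<bar>t\<bar> \<longrightarrow> ((deriv ^^ m) g has_real_derivative (deriv ^^ Suc m) g u) (at u)"
      proof (intro allI impI)
        fix m and u :: real assume "m < K \<and> \<bar>u\<bar> \<le> \<bar>t\<bar>"
        then have "u \<in> S" using t e(2) by (auto simp: subset_iff)
        then show "((deriv ^^ m) g has_real_derivative (deriv ^^ Suc m) g u) (at u)"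
          using smooth_on_deriv(2)[OF S(1) sm] by simp
      qed
    qed simp
    then obtain u where u: "\<bar>u\<bar> \<le> \<bar>t\<bar>" "g t = (\<Sum>k<K. (deriv ^^ k) g 0 / fact k * t ^ k) + (deriv ^^ K) g u / fact K * t ^ K" by blast
    have "norm ((deriv ^^ K) g u / fact K) \<le> norm ((deriv ^^ K) g u)"
      using divide_left_mono[of 1 "fact K" "norm ((deriv ^^ K) g u)"] by (simp add: fact_ge_1)
    also have "\<dots> \<le> B" by (rule B) (use u t in auto)
    finally have "norm ((deriv ^^ K) g u / fact K * t ^ K) \<le> B * norm (t ^ K)"
      unfolding norm_mult by (rule mult_right_mono) simp
    then show ?thesis using u(2) by simp
  qed
  then have "\<forall>\<^sub>F t in at 0. norm (g t - (\<Sum>k<K. (deriv ^^ k) g 0 / fact k * t ^ k)) \<le> B * norm (t ^ K)"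
    using e(1) unfolding eventually_at_topological by (intro exI[of _ "ball 0 e"]) auto
  then show ?thesis unfolding has_jet_def by (rule bigoI)
qed

lemma vanishing_order_ge: "enat k \<le> vanishing_order g \<longleftrightarrow> (\<forall>j<k. (deriv ^^ j) g 0 = 0)"
  unfolding vanishing_order_def le_Inf_iff by (auto simp: not_less[symmetric])

text \<open>Orders are defined by derivatives but compared by estimates, which also survive a
  reparametrization that is not known to be differentiable.\<close>

lemma vanishing_order_ge_iff_bigo:
  fixes g :: "real \<Rightarrow> real"
  assumes S: "open S" "0 \<in> S" "smooth_on S g"
  shows "enat k \<le> vanishing_order g \<longleftrightarrow> g \<in> O[at 0](\<lambda>t. t ^ k)"
proof
  note jet = smooth_has_jet[OF S, of k]
  show "g \<in> O[at 0](\<lambda>t. t ^ k)" if "enat k \<le> vanishing_order g"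
    using jet that unfolding vanishing_order_ge has_jet_def by simp
  show "enat k \<le> vanishing_order g" if "g \<in> O[at 0](\<lambda>t. t ^ k)"
    unfolding vanishing_order_ge using has_jet_unique[OF jet has_jet_bigo[OF that]] by simp
qed

lemma bigo_vec_iff:
  fixes h :: "real \<Rightarrow> real ^ 'n::finite"
  shows "(\<lambda>t. norm (h t)) \<in> O[F](g) \<longleftrightarrow> (\<forall>j. (\<lambda>t. h t $ j) \<in> O[F](g))"
proof
  assume a: "(\<lambda>t. norm (h t)) \<in> O[F](g)"
  show "\<forall>j. (\<lambda>t. h t $ j) \<in> O[F](g)"
  proof
    fix j
    have "(\<lambda>t. h t $ j) \<in> O[F](\<lambda>t. norm (h t))"
      by (rule bigoI[of _ 1]) (simp add: component_le_norm_cart)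
    from landau_o.big_trans[OF this a] show "(\<lambda>t. h t $ j) \<in> O[F](g)" .
  qed
next
  assume a: "\<forall>j. (\<lambda>t. h t $ j) \<in> O[F](g)"
  have "(\<lambda>t. norm (h t)) \<in> O[F](\<lambda>t. \<Sum>j\<in>UNIV. \<bar>h t $ j\<bar>)"
    by (rule bigoI[of _ 1]) (simp add: norm_le_l1_cart sum_nonneg)
  moreover have "(\<lambda>t. \<Sum>j\<in>UNIV. \<bar>h t $ j\<bar>) \<in> O[F](g)"
    by (rule big_sum_in_bigo) (use a in simp)
  ultimately show "(\<lambda>t. norm (h t)) \<in> O[F](g)" by (rule landau_o.big_trans)
qed

lemma tangency_order_ge_iff:
  fixes h :: "'a \<Rightarrow> real ^ 'n::finite"
  assumes S: "open S" "0 \<in> S" "smooth_on S (\<lambda>t. h (f t))"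
  shows "enat k \<le> tangency_order f h \<longleftrightarrow> (\<lambda>t. norm (h (f t))) \<in> O[at 0](\<lambda>t. t ^ k)"
proof -
  have "enat k \<le> tangency_order f h \<longleftrightarrow> (\<forall>j. enat k \<le> vanishing_order (\<lambda>t. h (f t) $ j))"
    unfolding tangency_order_def by (subst Min_ge_iff) auto
  also have "\<dots> \<longleftrightarrow> (\<forall>j. (\<lambda>t. h (f t) $ j) \<in> O[at 0](\<lambda>t. t ^ k))"
    using vanishing_order_ge_iff_bigo[OF S(1,2) smooth_on_vec_nth[OF S(1,3)]] by simp
  finally show ?thesis unfolding bigo_vec_iff .
qed

text \<open>An extended natural number is determined by its finite lower bounds, infinity included;
  estimates O(t^k) only ever give finite ones.\<close>

lemma enat_eqI: "(\<And>k. enat k \<le> x \<longleftrightarrow> enat k \<le> y) \<Longrightarrow> x = y"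
proof (rule antisym)
  have le: "x \<le> y" if "\<And>k. enat k \<le> x \<Longrightarrow> enat k \<le> y" for x y :: enat
  proof (cases x)
    case infinity
    then have "enat k \<le> y" for k using that by simp
    then show ?thesis using infinity by (cases y) (auto dest: meta_spec[of _ "Suc (the_enat y)"])
  qed (use that in simp)
  assume "\<And>k. enat k \<le> x \<longleftrightarrow> enat k \<le> y"
  then show "x \<le> y" "y \<le> x" by (auto intro: le)
qed

lemma enat_eq_infinityI: "(\<And>k. enat k \<le> x) \<Longrightarrow> x = \<infinity>"
  by (rule enat_eqI) simp

lemma smooth_branches:
  "smooth_on UNIV (branch1 :: real \<Rightarrow> real ^ ('n::finite) bit0)"
  "smooth_on UNIV (branch2 :: real \<Rightarrow> real ^ ('n::finite) bit0)"
proof -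
  have ax: "smooth_on UNIV (\<lambda>t. axis i (t ^ k) :: real ^ 'n bit0)" for i k
  proof (rule smooth_on_vec[OF open_UNIV])
    fix j
    show "smooth_on UNIV (\<lambda>t. (axis i (t ^ k) :: real ^ 'n bit0) $ j)"
      by (cases "j = i") (simp_all add: axis_def smooth_on_const smooth_on_power smooth_on_bounded_linear bounded_linear_ident)
  qed
  show "smooth_on UNIV (branch1 :: real \<Rightarrow> real ^ 'n bit0)" using ax[of 2 1] by (simp add: branch1_def[abs_def])
  show "smooth_on UNIV (branch2 :: real \<Rightarrow> real ^ 'n bit0)"
    unfolding branch2_def by (intro smooth_on_add smooth_on_diff ax open_UNIV)
qed

lemma branches_0: "branch1 0 = 0" "branch2 0 = 0"
  by (simp_all add: branch1_def branch2_def vec_eq_iff axis_def)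

section \<open>Symmetries of \<open>U\<^sub>9\<close>\<close>

text \<open>The derivative is Lipschitz near 0, so f minus its linear part has derivative O(norm x),
  and the mean value inequality adds a second factor norm x.\<close>

lemma smooth_quadratic_bound:
  fixes f :: "'a::euclidean_space \<Rightarrow> 'b::real_normed_vector"
  assumes S: "open S" "0 \<in> S" "smooth_on S f" and f0: "f 0 = 0"
  obtains K \<epsilon> where "0 \<le> K" "0 < \<epsilon>" "ball 0 \<epsilon> \<subseteq> S"
    "\<And>x. x \<in> ball 0 \<epsilon> \<Longrightarrow> norm (f x - frechet_derivative f (at 0) x) \<le> K * (norm x)\<^sup>2"
proof -
  let ?L = "\<lambda>x. frechet_derivative f (at x)"
  obtain r where r: "r > 0" "ball 0 r \<subseteq> S" using S openE by blast
  note sm = smooth_on_subset[OF S(3) r(2)]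
  have "\<exists>B. 0 \<le> B \<and> (\<forall>x\<in>cball 0 (r/2). \<forall>y\<in>cball 0 (r/2). norm (?L x b - ?L y b) \<le> B * norm (x - y))" for b
    by (rule smooth_on_lipschitz_cball[OF smooth_on_frechet[OF sm], of "r/2" b]) (use r in auto)
  then obtain B where B: "\<And>b. 0 \<le> B b"
    "\<And>b x y. x \<in> cball 0 (r/2) \<Longrightarrow> y \<in> cball 0 (r/2) \<Longrightarrow> norm (?L x b - ?L y b) \<le> B b * norm (x - y)" by metis
  define M where "M = (\<Sum>b\<in>Basis. B b)"
  have M: "B b \<le> M" if "b \<in> Basis" for b unfolding M_def by (rule member_le_sum[OF that]) (use B in auto)
  let ?K = "of_nat DIM('a) * M"
  have M0: "0 \<le> M" unfolding M_def by (rule sum_nonneg) (rule B(1))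
  show thesis
  proof (rule that[of ?K "r/2"])
    show "0 \<le> ?K" using M0 by simp
    show "0 < r/2" using r by simp
    show "ball 0 (r/2) \<subseteq> S" using r(2) r(1) by (auto simp: subset_iff)
    fix x :: 'a assume x: "x \<in> ball 0 (r/2)"
    have S0: "0 \<in> ball (0::'a) r" using r by simp
    have linL: "bounded_linear (?L 0)" by (rule has_derivative_bounded_linear[OF smooth_on_has_derivative[OF sm S0]])
    have "norm ((f x - ?L 0 x) - (f 0 - ?L 0 0)) \<le> (?K * norm x) * norm (x - 0)"
    proof (rule differentiable_bound[OF convex_cball[of 0 "norm x"]])
      fix z :: 'a assume z: "z \<in> cball 0 (norm x)"
      then have zr: "z \<in> ball 0 r" and z2: "z \<in> cball 0 (r/2)" using x r by auto
      note d = smooth_on_has_derivative[OF sm zr]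
      show "((\<lambda>x. f x - ?L 0 x) has_derivative (\<lambda>v. ?L z v - ?L 0 v)) (at z within cball 0 (norm x))"
        by (intro has_derivative_at_withinI[OF has_derivative_diff] d bounded_linear_imp_has_derivative linL)
      have lin: "linear (\<lambda>v. ?L z v - ?L 0 v)"
        by (intro linear_compose_sub has_derivative_linear[OF d] bounded_linear.linear[OF linL])
      show "onorm (\<lambda>v. ?L z v - ?L 0 v) \<le> ?K * norm x"
      proof (rule onorm_le)
        fix v
        have "norm (?L z v - ?L 0 v) \<le> of_nat DIM('a) * (M * norm x) * norm v"
        proof (rule norm_linear_le_Basis[OF lin])
          fix b :: 'a assume b: "b \<in> Basis"
          have "norm (?L z b - ?L 0 b) \<le> B b * norm (z - 0)" by (rule B(2)[OF z2]) (use r in simp)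
          also have "\<dots> \<le> M * norm x" by (intro mult_mono M b M0) (use z in auto)
          finally show "norm (?L z b - ?L 0 b) \<le> M * norm x" .
        qed
        then show "norm (?L z v - ?L 0 v) \<le> ?K * norm x * norm v" by (simp add: mult.assoc)
      qed
    qed auto
    then show "norm (f x - ?L 0 x) \<le> ?K * (norm x)\<^sup>2"
      by (simp add: f0 linear_0[OF bounded_linear.linear[OF linL]] power2_eq_square mult.assoc)
  qed
qed

section \<open>Transition maps between parametrizations of the same germ\<close>

lemma germ_diffeoE:
  assumes "germ_diffeo \<Phi> A B"
  obtains U V \<Psi> where "open U" "open V" "0 \<in> U" "0 \<in> V" "homeomorphism U V \<Phi> \<Psi>"
    "smooth_on U \<Phi>" "smooth_on V \<Psi>" "\<Phi> ` (A \<inter> U) = B \<inter> V" "\<Phi> 0 = 0" "\<Psi> 0 = 0"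
proof -
  from assms obtain U V \<Psi> where h: "open U" "open V" "0 \<in> U" "0 \<in> V" "homeomorphism U V \<Phi> \<Psi>"
    "smooth_on U \<Phi>" "smooth_on V \<Psi>" "\<Phi> ` (A \<inter> U) = B \<inter> V" "\<Phi> 0 = 0"
    unfolding germ_diffeo_def by blast
  have "\<Psi> 0 = 0" using homeomorphism_apply1[OF h(5,3)] h(9) by simp
  from that[OF h this] show thesis .
qed

lemma homeomorphism_frechet_inverse:
  fixes \<Phi> :: "'a::real_normed_vector \<Rightarrow> 'a"
  assumes U: "open U" "homeomorphism U V \<Phi> \<Psi>" "smooth_on U \<Phi>" "smooth_on V \<Psi>" and x: "x \<in> U"
  shows "frechet_derivative \<Psi> (at (\<Phi> x)) (frechet_derivative \<Phi> (at x) v) = v"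
proof -
  have "\<Phi> x \<in> V" using U(2) x by (auto simp: homeomorphism_def)
  then have "(\<Psi> \<circ> \<Phi> has_derivative frechet_derivative \<Psi> (at (\<Phi> x)) \<circ> frechet_derivative \<Phi> (at x)) (at x)"
    by (intro diff_chain_at smooth_on_has_derivative[OF U(3) x] smooth_on_has_derivative[OF U(4)])
  moreover have "(\<Psi> \<circ> \<Phi> has_derivative id) (at x)"
    by (rule has_derivative_transform_within_open[OF has_derivative_id U(1) x]) (simp add: homeomorphism_apply1[OF U(2)])
  ultimately show ?thesis using has_derivative_unique by (metis comp_apply id_apply)
qed

text \<open>Two diffeomorphisms from A onto the same germ N differ by a symmetry of A. Only the
  inclusion of the image of A in A is recorded; interchanging the two diffeomorphisms gives the
  rest.\<close>

lemma germ_diffeo_transition: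
  fixes \<Phi> \<Phi>' :: "'a::euclidean_space \<Rightarrow> 'a"
  assumes "germ_diffeo \<Phi> A N" "germ_diffeo \<Phi>' A N"
  obtains T \<Psi> where "open T" "0 \<in> T" "smooth_on T \<Psi>" "\<Psi> 0 = 0" "\<And>x. x \<in> T \<Longrightarrow> \<Phi> x = \<Phi>' (\<Psi> x)"
    "\<And>x. x \<in> A \<Longrightarrow> x \<in> T \<Longrightarrow> \<Psi> x \<in> A"
    "\<And>v. frechet_derivative \<Psi> (at 0) v = 0 \<Longrightarrow> v = 0"
    "\<And>v. frechet_derivative \<Phi> (at 0) v = frechet_derivative \<Phi>' (at 0) (frechet_derivative \<Psi> (at 0) v)"
proof -
  obtain U V \<Psi>1 where 1: "open U" "open V" "0 \<in> U" "0 \<in> V" "homeomorphism U V \<Phi> \<Psi>1"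
    "smooth_on U \<Phi>" "smooth_on V \<Psi>1" "\<Phi> ` (A \<inter> U) = N \<inter> V" "\<Phi> 0 = 0" "\<Psi>1 0 = 0"
    using germ_diffeoE[OF assms(1)] .
  obtain U' V' \<Psi>' where 2: "open U'" "open V'" "0 \<in> U'" "0 \<in> V'" "homeomorphism U' V' \<Phi>' \<Psi>'"
    "smooth_on U' \<Phi>'" "smooth_on V' \<Psi>'" "\<Phi>' ` (A \<inter> U') = N \<inter> V'" "\<Phi>' 0 = 0" "\<Psi>' 0 = 0"
    using germ_diffeoE[OF assms(2)] .
  define T where "T = U \<inter> \<Phi> -` V'"
  define \<Psi> where "\<Psi> = (\<lambda>x. \<Psi>' (\<Phi> x))"
  have T: "open T" "0 \<in> T" unfolding T_def
    using continuous_open_preimage[OF smooth_on_continuous[OF 1(6)] 1(1) 2(2)] 1 2 by auto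
  have TU: "T \<subseteq> U" "\<Phi> ` T \<subseteq> V'" by (auto simp: T_def)
  have sm: "smooth_on T \<Psi>" unfolding \<Psi>_def
    by (rule smooth_on_compose[OF T(1) 2(2) TU(2) 2(7) smooth_on_subset[OF 1(6) TU(1)]])
  have \<Psi>0: "\<Psi> 0 = 0" by (simp add: \<Psi>_def 1 2)
  have e: "\<Phi> x = \<Phi>' (\<Psi> x)" if "x \<in> T" for x
    unfolding \<Psi>_def using homeomorphism_apply2[OF 2(5)] TU(2) that by auto
  have D: "frechet_derivative \<Phi> (at 0) v = frechet_derivative \<Phi>' (at 0) (frechet_derivative \<Psi> (at 0) v)" for v
  proof -
    have "(\<Phi>' has_derivative frechet_derivative \<Phi>' (at 0)) (at (\<Psi> 0))"
      using smooth_on_has_derivative[OF 2(6,3)] by (simp add: \<Psi>0)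
    from diff_chain_at[OF smooth_on_has_derivative[OF sm T(2)] this]
    have "(\<Phi> has_derivative frechet_derivative \<Phi>' (at 0) \<circ> frechet_derivative \<Psi> (at 0)) (at 0)"
      by (rule has_derivative_transform_within_open[OF _ T]) (simp add: e)
    from frechet_at[OF this] show ?thesis by simp
  qed
  show thesis
  proof (rule that[OF T sm \<Psi>0 e])
    show "\<Psi> x \<in> A" if "x \<in> A" "x \<in> T" for x
    proof -
      have "\<Phi> x \<in> N \<inter> V'" using that 1(8) by (auto simp: T_def)
      then obtain a where "a \<in> A \<inter> U'" "\<Phi> x = \<Phi>' a" using 2(8) by (metis imageE)
      then show ?thesis unfolding \<Psi>_def using homeomorphism_apply1[OF 2(5)] by simp
    qed
    show "v = 0" if "frechet_derivative \<Psi> (at 0) v = 0" for v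
    proof -
      have "frechet_derivative \<Phi> (at 0) v = 0"
        unfolding D that by (rule linear_0[OF smooth_on_linear_frechet[OF 2(6,3)]])
      then have "v = frechet_derivative \<Psi>1 (at (\<Phi> 0)) 0"
        using homeomorphism_frechet_inverse[OF 1(1,5,6,7,3), of v] by simp
      also have "\<dots> = 0" using linear_0[OF smooth_on_linear_frechet[OF 1(7,4)]] 1(9) by simp
      finally show ?thesis .
    qed
    show "frechet_derivative \<Phi> (at 0) v = frechet_derivative \<Phi>' (at 0) (frechet_derivative \<Psi> (at 0) v)" for v by (rule D)
  qed
qed

lemma tendsto_div_power_cong:
  fixes f p :: "real \<Rightarrow> real"
  assumes "\<forall>\<^sub>F t in at 0. \<bar>f t - p t\<bar> \<le> K * \<bar>t\<bar> ^ n" "m < n" "((\<lambda>t. p t / t ^ m) \<longlongrightarrow> l) (at 0)"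
  shows "((\<lambda>t. f t / t ^ m) \<longlongrightarrow> l) (at 0)"
proof -
  have "((\<lambda>t. (f t - p t) / t ^ m) \<longlongrightarrow> 0) (at 0)"
  proof (rule Lim_null_comparison)
    show "\<forall>\<^sub>F t in at 0. norm ((f t - p t) / t ^ m) \<le> K * \<bar>t\<bar> ^ (n - m)"
      using assms(1) eventually_neq_at_within[of 0 0 UNIV]
    proof eventually_elim
      case (elim t)
      have "\<bar>t\<bar> ^ n = \<bar>t\<bar> ^ (n - m) * \<bar>t\<bar> ^ m" using assms(2) by (simp flip: power_add)
      with elim show ?case by (simp add: abs_divide power_abs divide_le_eq mult.assoc)
    qed
    have "((\<lambda>t. K * \<bar>t\<bar> ^ (n - m)) \<longlongrightarrow> K * \<bar>0\<bar> ^ (n - m)) (at (0::real))" by (intro tendsto_intros)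
    then show "((\<lambda>t. K * \<bar>t\<bar> ^ (n - m)) \<longlongrightarrow> 0) (at (0::real))" using assms(2) by (simp add: zero_power)
  qed
  from tendsto_add[OF this assms(3)] show ?thesis by (simp add: diff_divide_distrib)
qed

text \<open>The equation x_1^3 = x_3^5 holds on both branches, so it can be exploited before it is
  known on which branch an image point lies.\<close>

lemma U9_cases:
  assumes n: "CARD('n::finite) \<ge> 2" and y: "(y :: real ^ 'n bit0) \<in> U9"
  shows "y $ 1 ^ 3 = y $ 3 ^ 5" "i \<notin> {1, 2, 3} \<Longrightarrow> y $ i = 0"
    and "(y $ 3 = 0 \<and> y = branch1 (y $ 2)) \<or> (y $ 2 ^ 3 = - (y $ 3 ^ 7) \<and> (\<exists>s. y = branch2 s \<and> s ^ 3 = y $ 3))"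
proof -
  note d = bit0_123_distinct[OF n]
  have "y \<in> range branch1 \<or> y \<in> range branch2" using y U9_branches[OF n] by blast
  then have "y $ 1 ^ 3 = y $ 3 ^ 5 \<and> (i \<notin> {1, 2, 3} \<longrightarrow> y $ i = 0) \<and>
    ((y $ 3 = 0 \<and> y = branch1 (y $ 2)) \<or> (y $ 2 ^ 3 = - (y $ 3 ^ 7) \<and> (\<exists>s. y = branch2 s \<and> s ^ 3 = y $ 3)))"
  proof
    assume "y \<in> range branch1"
    then obtain t where t: "y = branch1 t" by blast
    show ?thesis unfolding t using d by (simp add: branch1_def axis_def)
  next
    assume "y \<in> range branch2"
    then obtain t where t: "y = branch2 t" by blast
    show ?thesis unfolding t using branch2_component[OF n, where t=t] branch2_component(4)[OF n, of i, where t=t]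
      by (auto simp flip: power_mult)
  qed
  then show "y $ 1 ^ 3 = y $ 3 ^ 5" "i \<notin> {1, 2, 3} \<Longrightarrow> y $ i = 0"
    "(y $ 3 = 0 \<and> y = branch1 (y $ 2)) \<or> (y $ 2 ^ 3 = - (y $ 3 ^ 7) \<and> (\<exists>s. y = branch2 s \<and> s ^ 3 = y $ 3))" by blast+
qed

lemma branches_in_U9:
  assumes "CARD('n::finite) \<ge> 2"
  shows "branch1 t \<in> (U9 :: (real ^ 'n bit0) set)" "branch2 t \<in> (U9 :: (real ^ 'n bit0) set)"
  using U9_branches[OF assms] by auto

lemma branch2_eq: "branch2 t = t ^ 5 *\<^sub>R axis 1 1 - t ^ 7 *\<^sub>R axis 2 1 + t ^ 3 *\<^sub>R axis 3 1"
  by (simp add: branch2_def vec_eq_iff axis_def)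

lemma branch1_eq: "branch1 t = t *\<^sub>R axis 2 1"
  by (simp add: branch1_def vec_eq_iff axis_def)

lemma norm_branch2_le:
  assumes "\<bar>t\<bar> \<le> 1"
  shows "norm (branch2 t :: real ^ ('n::finite) bit0) \<le> 3 * \<bar>t\<bar> ^ 3"
proof -
  have p: "\<bar>t\<bar> ^ k \<le> \<bar>t\<bar> ^ 3" if "3 \<le> k" for k by (rule power_decreasing[OF that]) (use assms in auto)
  have "norm (branch2 t :: real ^ 'n bit0) \<le> \<bar>t\<bar> ^ 5 + \<bar>t\<bar> ^ 7 + \<bar>t\<bar> ^ 3"
    unfolding branch2_eq
    by (intro norm_triangle_le norm_triangle_le_diff add_mono) (simp_all add: norm_axis_1 power_abs)
  also have "\<dots> \<le> 3 * \<bar>t\<bar> ^ 3" using p[of 5] p[of 7] by simp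
  finally show ?thesis .
qed

lemma branch2_tendsto: "(branch2 \<longlongrightarrow> (0 :: real ^ ('n::finite) bit0)) (at 0)"
  using smooth_on_continuous[OF smooth_branches(2)]
  by (metis UNIV_I branches_0(2) continuous_on_def)

lemma branch1_tendsto: "(branch1 \<longlongrightarrow> (0 :: real ^ ('n::finite) bit0)) (at 0)"
  using smooth_on_continuous[OF smooth_branches(1)]
  by (metis UNIV_I branches_0(1) continuous_on_def)

text \<open>The singular branch has norm O(t^3), so the quadratic remainder is O(t^6): the terms in
  t^3 and t^5 are exactly those of the linear part L.\<close>

lemma branch2_smooth_bound:
  fixes f :: "real ^ ('n::finite) bit0 \<Rightarrow> 'b::real_normed_vector"
  assumes f: "0 \<le> K" "0 < \<epsilon>" "\<And>x. x \<in> ball 0 \<epsilon> \<Longrightarrow> norm (f x - L x) \<le> K * (norm x)\<^sup>2"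
  shows "\<forall>\<^sub>F t in at 0. norm (f (branch2 t) - L (branch2 t)) \<le> (9 * K) * \<bar>t\<bar> ^ 6"
proof -
  have "\<forall>\<^sub>F t in at (0::real). \<bar>t\<bar> < 1"
    unfolding eventually_at by (intro exI[of _ 1]) simp
  moreover have "\<forall>\<^sub>F t in at 0. branch2 t \<in> ball (0 :: real ^ 'n bit0) \<epsilon>"
    using tendstoD[OF branch2_tendsto f(2)] by simp
  ultimately show ?thesis
  proof eventually_elim
    case (elim t)
    have "norm (f (branch2 t) - L (branch2 t)) \<le> K * (norm (branch2 t :: real ^ 'n bit0))\<^sup>2" by (rule f(3)[OF elim(2)])
    also have "\<dots> \<le> K * (3 * \<bar>t\<bar> ^ 3)\<^sup>2"
      by (intro mult_left_mono power_mono norm_branch2_le f(1)) (use elim(1) in auto)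
    also have "\<dots> = (9 * K) * \<bar>t\<bar> ^ 6" by (simp add: power_mult_distrib flip: power_mult)
    finally show ?case .
  qed
qed

text \<open>The equations of the two branches, compared in lowest order along the images of the
  branches, determine the differential up to scalars: axis 2 and axis 3 are eigenlines and the plane
  of axes 1 and 3 is preserved. The reparametrization s is merely chosen pointwise, with a linear
  bound, and this suffices for orders of vanishing.\<close>

theorem U9_symmetry:
  fixes \<Psi> :: "real ^ ('n::finite) bit0 \<Rightarrow> real ^ 'n bit0"
  assumes n: "CARD('n) \<ge> 2" and T: "open T" "0 \<in> T" "smooth_on T \<Psi>" "\<Psi> 0 = 0"
    and U9: "\<And>x. x \<in> U9 \<Longrightarrow> x \<in> T \<Longrightarrow> \<Psi> x \<in> U9"
    and inj: "\<And>v. frechet_derivative \<Psi> (at 0) v = 0 \<Longrightarrow> v = 0"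
  shows "\<exists>s C. \<forall>\<^sub>F t in at 0. \<Psi> (branch1 t) = branch1 (s t) \<and> \<bar>s t\<bar> \<le> C * \<bar>t\<bar>" (is ?branch1)
    and "\<exists>s C. \<forall>\<^sub>F t in at 0. \<Psi> (branch2 t) = branch2 (s t) \<and> \<bar>s t\<bar> \<le> C * \<bar>t\<bar>" (is ?branch2)
    and "S \<in> {W0, l1_0, l2_0, V0} \<Longrightarrow> frechet_derivative \<Psi> (at 0) ` S \<subseteq> S"
proof -
  note d = bit0_123_distinct[OF n]
  define L where "L = frechet_derivative \<Psi> (at 0)"
  have lin: "linear L" unfolding L_def by (rule smooth_on_linear_frechet[OF T(3,2)])
  obtain K \<epsilon> where K: "0 \<le> K" "0 < \<epsilon>" "ball 0 \<epsilon> \<subseteq> T"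
    "\<And>x. x \<in> ball 0 \<epsilon> \<Longrightarrow> norm (\<Psi> x - L x) \<le> K * (norm x)\<^sup>2"
    by (rule smooth_quadratic_bound[OF T, folded L_def]) (assumption | rule that)+
  define v w z where vwz: "v = L (axis 2 1)" "w = L (axis 3 1)" "z = L (axis 1 1)"
  have e0: "(axis i 1 :: real ^ 'n bit0) \<noteq> 0" for i by (simp add: axis_eq_0_iff)
  have v0: "v \<noteq> 0" using inj[of "axis 2 1"] e0 unfolding vwz L_def by blast

  define d' where "d' = (\<lambda>t. \<Psi> (branch1 t))"
  have dT: "\<forall>\<^sub>F t in at 0. branch1 t \<in> T"
    using topological_tendstoD[OF branch1_tendsto T(1,2)] by simp
  have dU: "\<forall>\<^sub>F t in at 0. d' t \<in> U9"
    using dT by eventually_elim (simp add: d'_def U9 branches_in_U9[OF n])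
  have "\<forall>\<^sub>F t in at 0. branch1 t \<in> ball (0 :: real ^ 'n bit0) \<epsilon>"
    using tendstoD[OF branch1_tendsto K(2)] by simp
  then have dv: "\<forall>\<^sub>F t in at 0. norm (d' t - t *\<^sub>R v) \<le> K * \<bar>t\<bar> ^ 2"
  proof eventually_elim
    case (elim t)
    have "L (branch1 t) = t *\<^sub>R v" "norm (branch1 t :: real ^ 'n bit0) = \<bar>t\<bar>"
      by (simp_all add: branch1_eq linear_cmul[OF lin] vwz norm_axis_1)
    with K(4)[OF elim] show ?case by (simp add: d'_def)
  qed
  have dvi: "\<forall>\<^sub>F t in at 0. \<bar>d' t $ i - t * v $ i\<bar> \<le> K * \<bar>t\<bar> ^ 2" for i
    using dv
  proof eventually_elim
    case (elim t)
    have "d' t $ i - t * v $ i = (d' t - t *\<^sub>R v) $ i" by simp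
    then show ?case using component_le_norm_cart[of "d' t - t *\<^sub>R v" i] elim by linarith
  qed
  have dlim: "((\<lambda>t. d' t $ i / t) \<longlongrightarrow> v $ i) (at 0)" for i
  proof -
    have "((\<lambda>t. t * v $ i / t ^ 1) \<longlongrightarrow> v $ i) (at 0)"
      by (rule tendsto_eventually) (auto simp: eventually_at_filter)
    from tendsto_div_power_cong[OF dvi _ this] show ?thesis by simp
  qed
  \<comment> \<open>Dividing x_1^3 = x_3^5 by t^3 leaves a right side of order t^2.\<close>
  have v1: "v $ 1 = 0"
  proof -
    have "((\<lambda>t. (d' t $ 1 / t) ^ 3) \<longlongrightarrow> v $ 1 ^ 3) (at 0)" by (intro tendsto_intros dlim)
    moreover have "((\<lambda>t. (d' t $ 3 / t) ^ 5 * t ^ 2) \<longlongrightarrow> v $ 3 ^ 5 * 0 ^ 2) (at 0)" by (intro tendsto_intros dlim)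
    then have "((\<lambda>t. (d' t $ 1 / t) ^ 3) \<longlongrightarrow> v $ 3 ^ 5 * 0 ^ 2) (at 0)"
    proof (rule Lim_transform_eventually)
      show "\<forall>\<^sub>F t in at 0. (d' t $ 3 / t) ^ 5 * t ^ 2 = (d' t $ 1 / t) ^ 3"
        using dU eventually_neq_at_within[of 0 0 UNIV]
        by eventually_elim (simp add: U9_cases(1)[OF n] power_divide divide_simps flip: power_add)
    qed
    ultimately have "v $ 1 ^ 3 = v $ 3 ^ 5 * 0 ^ 2" by (rule tendsto_unique[OF at_neq_bot])
    then show ?thesis by simp
  qed
  \<comment> \<open>Now the first component is O(t^2), hence x_3^5 = x_1^3 is O(t^6), more than
    t^5.\<close>
  have v3: "v $ 3 = 0"
  proof -
    have "((\<lambda>t. (d' t $ 3 / t) ^ 5) \<longlongrightarrow> v $ 3 ^ 5) (at 0)" by (intro tendsto_intros dlim)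
    moreover have "((\<lambda>t. (d' t $ 3 / t) ^ 5) \<longlongrightarrow> 0) (at 0)"
    proof (rule Lim_null_comparison)
      show "\<forall>\<^sub>F t in at 0. norm ((d' t $ 3 / t) ^ 5) \<le> K ^ 3 * \<bar>t\<bar>"
        using dU dvi[of 1] eventually_neq_at_within[of 0 0 UNIV]
      proof eventually_elim
        case (elim t)
        have "\<bar>d' t $ 3\<bar> ^ 5 = \<bar>d' t $ 1\<bar> ^ 3" using U9_cases(1)[OF n elim(1)] by (simp flip: power_abs)
        also have "\<dots> \<le> (K * \<bar>t\<bar> ^ 2) ^ 3" using elim(2) by (intro power_mono) (auto simp: v1)
        also have "\<dots> = K ^ 3 * \<bar>t\<bar> * \<bar>t\<bar> ^ 5" by (simp add: power_mult_distrib power_numeral_reduce)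
        finally show ?case using elim(3) by (simp add: power_divide divide_le_eq power_abs)
      qed
      have "((\<lambda>t. K ^ 3 * \<bar>t\<bar>) \<longlongrightarrow> K ^ 3 * \<bar>0\<bar>) (at (0::real))" by (intro tendsto_intros)
      then show "((\<lambda>t. K ^ 3 * \<bar>t\<bar>) \<longlongrightarrow> 0) (at (0::real))" by simp
    qed
    ultimately have "v $ 3 ^ 5 = 0" by (rule tendsto_unique[OF at_neq_bot])
    then show ?thesis by simp
  qed
  have vi: "v $ i = 0" if "i \<notin> {1, 2, 3}" for i
  proof -
    have "((\<lambda>t. d' t $ i / t) \<longlongrightarrow> 0) (at 0)"
      by (rule tendsto_eventually, use dU in eventually_elim) (use U9_cases(2)[OF n] that in auto)
    from tendsto_unique[OF at_neq_bot dlim this] show ?thesis .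
  qed
  have v_eq: "v = v $ 2 *\<^sub>R axis 2 1"
    unfolding vec_eq_iff
  proof
    fix i show "v $ i = (v $ 2 *\<^sub>R axis 2 1) $ i"
      using v1 v3 vi[of i] d by (cases "i \<in> {1, 2, 3}") (auto simp: axis_def)
  qed
  have v2: "v $ 2 \<noteq> 0" using v_eq v0 by force
  show ?branch1
  proof (intro exI)
    have "\<forall>\<^sub>F t in at 0. dist (d' t $ 2 / t) (v $ 2) < \<bar>v $ 2\<bar> / 2"
      using tendstoD[OF dlim, of "\<bar>v $ 2\<bar> / 2" 2] v2 by simp
    moreover have "\<forall>\<^sub>F t in at 0. dist (d' t $ 3 / t) (v $ 3) < min 1 (\<bar>v $ 2\<bar> / 2)"
      using tendstoD[OF dlim, of "min 1 (\<bar>v $ 2\<bar> / 2)" 3] v2 by simp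
    moreover have "\<forall>\<^sub>F t in at (0::real). \<bar>t\<bar> < 1"
      unfolding eventually_at by (intro exI[of _ 1]) simp
    ultimately show "\<forall>\<^sub>F t in at 0. \<Psi> (branch1 t) = branch1 (d' t $ 2) \<and> \<bar>d' t $ 2\<bar> \<le> (2 * \<bar>v $ 2\<bar>) * \<bar>t\<bar>"
      using dU eventually_neq_at_within[of 0 0 UNIV]
    proof eventually_elim
      case (elim t)
      have t0: "\<bar>t\<bar> > 0" using elim(5) by simp
      have a: "\<bar>d' t $ 2 / t\<bar> \<le> 2 * \<bar>v $ 2\<bar>" "\<bar>v $ 2\<bar> / 2 < \<bar>d' t $ 2 / t\<bar>"
        using elim(1) v2 unfolding dist_real_def by linarith+
      have b: "\<bar>d' t $ 3 / t\<bar> < 1" "\<bar>d' t $ 3 / t\<bar> < \<bar>v $ 2\<bar> / 2" using elim(2) by (simp_all add: v3)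
      have c: "\<bar>d' t $ 3\<bar> < 1" using b(1) elim(3) t0 by (simp add: abs_divide)
      have less: "\<bar>d' t $ 3\<bar> < \<bar>d' t $ 2\<bar>"
        using order.strict_trans[OF b(2) a(2)] t0 by (simp add: abs_divide divide_less_cancel)
      \<comment> \<open>On the singular branch the cube of x_2 and the seventh power of x_3 have
        equal absolute value, which is impossible when x_3 is below 1 and below x_2 in absolute
        value.\<close>
      have "\<not> (d' t $ 2 ^ 3 = - (d' t $ 3 ^ 7))"
      proof
        assume "d' t $ 2 ^ 3 = - (d' t $ 3 ^ 7)"
        then have "\<bar>d' t $ 2\<bar> ^ 3 = \<bar>d' t $ 3\<bar> ^ 7" by (metis abs_minus_cancel power_abs)
        also have "\<dots> \<le> \<bar>d' t $ 3\<bar> ^ 3" by (rule power_decreasing) (use c in auto)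
        also have "\<dots> < \<bar>d' t $ 2\<bar> ^ 3" by (rule power_strict_mono[OF less]) auto
        finally show False by simp
      qed
      then have "d' t = branch1 (d' t $ 2)" using U9_cases(3)[OF n elim(4)] by blast
      then show ?case using a(1) t0 by (simp add: d'_def abs_divide divide_le_eq)
    qed
  qed

  define c where "c = (\<lambda>t. \<Psi> (branch2 t))"
  have cT: "\<forall>\<^sub>F t in at 0. branch2 t \<in> T"
    using topological_tendstoD[OF branch2_tendsto T(1,2)] by simp
  have cU: "\<forall>\<^sub>F t in at 0. c t \<in> U9"
    using cT by eventually_elim (simp add: c_def U9 branches_in_U9[OF n])
  have Lb: "L (branch2 t) = t ^ 5 *\<^sub>R z - t ^ 7 *\<^sub>R v + t ^ 3 *\<^sub>R w" for t
    unfolding branch2_eq by (simp add: linear_add[OF lin] linear_diff[OF lin] linear_cmul[OF lin] vwz)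
  have "\<forall>\<^sub>F t in at 0. norm (c t - L (branch2 t)) \<le> (9 * K) * \<bar>t\<bar> ^ 6"
    unfolding c_def by (rule branch2_smooth_bound[OF K(1,2,4)])
  then have cb: "\<forall>\<^sub>F t in at 0. \<bar>c t $ i - (t ^ 5 * z $ i - t ^ 7 * v $ i + t ^ 3 * w $ i)\<bar> \<le> (9 * K) * \<bar>t\<bar> ^ 6" for i
  proof eventually_elim
    case (elim t)
    have "c t $ i - (t ^ 5 * z $ i - t ^ 7 * v $ i + t ^ 3 * w $ i) = (c t - L (branch2 t)) $ i" by (simp add: Lb)
    then show ?case using component_le_norm_cart[of "c t - L (branch2 t)" i] elim by linarith
  qed
  have c3: "((\<lambda>t. c t $ i / t ^ 3) \<longlongrightarrow> w $ i) (at 0)" for i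
  proof (rule tendsto_div_power_cong[OF cb])
    have "((\<lambda>t. t ^ 2 * z $ i - t ^ 4 * v $ i + w $ i) \<longlongrightarrow> 0 ^ 2 * z $ i - 0 ^ 4 * v $ i + w $ i) (at 0)"
      by (intro tendsto_intros)
    then have "((\<lambda>t. (t ^ 5 * z $ i - t ^ 7 * v $ i + t ^ 3 * w $ i) / t ^ 3) \<longlongrightarrow> 0 ^ 2 * z $ i - 0 ^ 4 * v $ i + w $ i) (at 0)"
    proof (rule Lim_transform_eventually)
      show "\<forall>\<^sub>F t in at 0. t ^ 2 * z $ i - t ^ 4 * v $ i + w $ i = (t ^ 5 * z $ i - t ^ 7 * v $ i + t ^ 3 * w $ i) / t ^ 3"
        using eventually_neq_at_within[of 0 0 UNIV] by eventually_elim (simp add: field_simps power_numeral_reduce)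
    qed
    then show "((\<lambda>t. (t ^ 5 * z $ i - t ^ 7 * v $ i + t ^ 3 * w $ i) / t ^ 3) \<longlongrightarrow> w $ i) (at 0)" by simp
  qed simp
  have c5: "((\<lambda>t. c t $ i / t ^ 5) \<longlongrightarrow> z $ i) (at 0)" if "w $ i = 0" for i
  proof (rule tendsto_div_power_cong[OF cb])
    have "((\<lambda>t. z $ i - t ^ 2 * v $ i) \<longlongrightarrow> z $ i - 0 ^ 2 * v $ i) (at 0)"
      by (intro tendsto_intros)
    then have "((\<lambda>t. (t ^ 5 * z $ i - t ^ 7 * v $ i + t ^ 3 * w $ i) / t ^ 5) \<longlongrightarrow> z $ i - 0 ^ 2 * v $ i) (at 0)"
    proof (rule Lim_transform_eventually)
      show "\<forall>\<^sub>F t in at 0. z $ i - t ^ 2 * v $ i = (t ^ 5 * z $ i - t ^ 7 * v $ i + t ^ 3 * w $ i) / t ^ 5"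
        using eventually_neq_at_within[of 0 0 UNIV] by eventually_elim (simp add: that field_simps power_numeral_reduce)
    qed
    then show "((\<lambda>t. (t ^ 5 * z $ i - t ^ 7 * v $ i + t ^ 3 * w $ i) / t ^ 5) \<longlongrightarrow> z $ i) (at 0)" by simp
  qed simp
  have w1: "w $ 1 = 0"
  proof -
    have "((\<lambda>t. (c t $ 1 / t ^ 3) ^ 3) \<longlongrightarrow> w $ 1 ^ 3) (at 0)" by (intro tendsto_intros c3)
    moreover have "((\<lambda>t. (c t $ 3 / t ^ 3) ^ 5 * t ^ 6) \<longlongrightarrow> w $ 3 ^ 5 * 0 ^ 6) (at 0)" by (intro tendsto_intros c3)
    then have "((\<lambda>t. (c t $ 1 / t ^ 3) ^ 3) \<longlongrightarrow> w $ 3 ^ 5 * 0 ^ 6) (at 0)"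
    proof (rule Lim_transform_eventually)
      show "\<forall>\<^sub>F t in at 0. (c t $ 3 / t ^ 3) ^ 5 * t ^ 6 = (c t $ 1 / t ^ 3) ^ 3"
        using cU eventually_neq_at_within[of 0 0 UNIV]
        by eventually_elim (simp add: U9_cases(1)[OF n] power_divide divide_simps flip: power_mult power_add)
    qed
    ultimately have "w $ 1 ^ 3 = w $ 3 ^ 5 * 0 ^ 6" by (rule tendsto_unique[OF at_neq_bot])
    then show ?thesis by simp
  qed
  have wi: "w $ i = 0" "z $ i = 0" if "i \<notin> {1, 2, 3}" for i
  proof -
    have "((\<lambda>t. c t $ i / t ^ 3) \<longlongrightarrow> 0) (at 0)"
      by (rule tendsto_eventually, use cU in eventually_elim) (use U9_cases(2)[OF n] that in auto)
    from tendsto_unique[OF at_neq_bot c3 this] show "w $ i = 0" .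
    note wi = this
    have "((\<lambda>t. c t $ i / t ^ 5) \<longlongrightarrow> 0) (at 0)"
      by (rule tendsto_eventually, use cU in eventually_elim) (use U9_cases(2)[OF n] that in auto)
    from tendsto_unique[OF at_neq_bot c5[OF wi] this] show "z $ i = 0" .
  qed
  have comb: "x = x $ 1 *\<^sub>R axis 1 1 + x $ 2 *\<^sub>R axis 2 1 + x $ 3 *\<^sub>R axis 3 1" if "\<And>i. i \<notin> {1, 2, 3} \<Longrightarrow> x $ i = 0" for x :: "real ^ 'n bit0"
    unfolding vec_eq_iff
  proof
    fix i show "x $ i = (x $ 1 *\<^sub>R axis 1 1 + x $ 2 *\<^sub>R axis 2 1 + x $ 3 *\<^sub>R axis 3 1) $ i"
      using that[of i] d by (cases "i \<in> {1, 2, 3}") (auto simp: axis_def)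
  qed
  \<comment> \<open>Otherwise the images of axes 2 and 3 would be parallel, against injectivity of
    the differential. A nonzero third coordinate then places the image on the singular
    branch.\<close>
  have w3: "w $ 3 \<noteq> 0"
  proof
    assume "w $ 3 = 0"
    then have "w = w $ 2 *\<^sub>R axis 2 1" using comb[OF wi(1)] w1 by simp
    then have "L (axis 3 1 - (w $ 2 / v $ 2) *\<^sub>R axis 2 1) = 0"
    proof -
      have "(w $ 2 / v $ 2) *\<^sub>R v = ((w $ 2 / v $ 2) * v $ 2) *\<^sub>R axis 2 1" using v_eq by (metis scaleR_scaleR)
      also have "\<dots> = w" using v2 \<open>w = w $ 2 *\<^sub>R axis 2 1\<close> by simp
      finally show ?thesis by (simp add: linear_diff[OF lin] linear_cmul[OF lin] flip: vwz)
    qed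
    then have "(axis 3 1 - (w $ 2 / v $ 2) *\<^sub>R axis 2 1 :: real ^ 'n bit0) = 0" using inj unfolding L_def by blast
    then have "(axis 3 1 - (w $ 2 / v $ 2) *\<^sub>R axis 2 1 :: real ^ 'n bit0) $ 3 = 0" by simp
    then show False using d by (simp add: axis_def)
  qed
  have ev3: "\<forall>\<^sub>F t in at 0. dist (c t $ 3 / t ^ 3) (w $ 3) < \<bar>w $ 3\<bar>"
    using tendstoD[OF c3, of "\<bar>w $ 3\<bar>" 3] w3 by simp
  have cbr: "\<forall>\<^sub>F t in at 0. c t $ 2 ^ 3 = - (c t $ 3 ^ 7) \<and> (\<exists>s. c t = branch2 s \<and> s ^ 3 = c t $ 3)"
    using ev3 cU
  proof eventually_elim
    case (elim t)
    have "c t $ 3 \<noteq> 0" using elim(1) by (auto simp: dist_real_def)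
    then show ?case using U9_cases(3)[OF n elim(2)] by blast
  qed
  have w2: "w $ 2 = 0"
  proof -
    have "((\<lambda>t. (c t $ 2 / t ^ 3) ^ 3) \<longlongrightarrow> w $ 2 ^ 3) (at 0)" by (intro tendsto_intros c3)
    moreover have "((\<lambda>t. - ((c t $ 3 / t ^ 3) ^ 7 * t ^ 12)) \<longlongrightarrow> - (w $ 3 ^ 7 * 0 ^ 12)) (at 0)" by (intro tendsto_intros c3)
    then have "((\<lambda>t. (c t $ 2 / t ^ 3) ^ 3) \<longlongrightarrow> - (w $ 3 ^ 7 * 0 ^ 12)) (at 0)"
    proof (rule Lim_transform_eventually)
      show "\<forall>\<^sub>F t in at 0. - ((c t $ 3 / t ^ 3) ^ 7 * t ^ 12) = (c t $ 2 / t ^ 3) ^ 3"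
        using cbr eventually_neq_at_within[of 0 0 UNIV]
        by eventually_elim (simp add: power_divide divide_simps flip: power_mult power_add)
    qed
    ultimately have "w $ 2 ^ 3 = - (w $ 3 ^ 7 * 0 ^ 12)" by (rule tendsto_unique[OF at_neq_bot])
    then show ?thesis by simp
  qed
  \<comment> \<open>Since w $ 2 = 0, z $ 2 is the coefficient of t^5 in the second component; but
    x_2^3 = -x_3^7 has order 21 at least, more than 15.\<close>
  have z2: "z $ 2 = 0"
  proof -
    have "((\<lambda>t. (c t $ 2 / t ^ 5) ^ 3) \<longlongrightarrow> z $ 2 ^ 3) (at 0)" by (intro tendsto_intros c5 w2)
    moreover have "((\<lambda>t. - ((c t $ 3 / t ^ 3) ^ 7 * t ^ 6)) \<longlongrightarrow> - (w $ 3 ^ 7 * 0 ^ 6)) (at 0)" by (intro tendsto_intros c3)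
    then have "((\<lambda>t. (c t $ 2 / t ^ 5) ^ 3) \<longlongrightarrow> - (w $ 3 ^ 7 * 0 ^ 6)) (at 0)"
    proof (rule Lim_transform_eventually)
      show "\<forall>\<^sub>F t in at 0. - ((c t $ 3 / t ^ 3) ^ 7 * t ^ 6) = (c t $ 2 / t ^ 5) ^ 3"
        using cbr eventually_neq_at_within[of 0 0 UNIV]
        by eventually_elim (simp add: power_divide divide_simps flip: power_mult power_add)
    qed
    ultimately have "z $ 2 ^ 3 = - (w $ 3 ^ 7 * 0 ^ 6)" by (rule tendsto_unique[OF at_neq_bot])
    then show ?thesis by simp
  qed
  show ?branch2
  proof -
    define s where "s = (\<lambda>t. SOME s. c t = branch2 s \<and> s ^ 3 = c t $ 3)"
    \<comment> \<open>The bound on the third coordinate concerns the cube of s t; taking ?C at least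
      1 makes ?C at most its own cube, so a linear bound follows without a cube root.\<close>
    let ?C = "max 1 (2 * \<bar>w $ 3\<bar>)"
    have "\<forall>\<^sub>F t in at 0. \<Psi> (branch2 t) = branch2 (s t) \<and> \<bar>s t\<bar> \<le> ?C * \<bar>t\<bar>"
      using cbr ev3 eventually_neq_at_within[of 0 0 UNIV]
    proof eventually_elim
      case (elim t)
      then have s: "c t = branch2 (s t)" "s t ^ 3 = c t $ 3" unfolding s_def by (metis (mono_tags, lifting) someI_ex)+
      have "\<bar>c t $ 3 / t ^ 3\<bar> \<le> 2 * \<bar>w $ 3\<bar>" using elim(2) unfolding dist_real_def by linarith
      also have "\<dots> \<le> ?C ^ 3"
        using self_le_power[of ?C 3] by simp
      finally have "\<bar>c t $ 3\<bar> \<le> ?C ^ 3 * \<bar>t ^ 3\<bar>" using elim(3) by (simp add: abs_divide divide_le_eq)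
      then have "\<bar>s t\<bar> ^ 3 \<le> (?C * \<bar>t\<bar>) ^ 3" by (simp add: power_mult_distrib power_abs flip: s(2))
      then have "\<bar>s t\<bar> \<le> ?C * \<bar>t\<bar>" by (rule power_le_imp_le_base[where n=2, simplified]) simp
      then show ?case using s(1) by (simp add: c_def)
    qed
    then show ?thesis by blast
  qed
  have Lz: "L (axis 1 1) = z $ 1 *\<^sub>R axis 1 1 + z $ 3 *\<^sub>R axis 3 1" using comb[OF wi(2)] z2 by (simp add: vwz)
  have Lw: "L (axis 3 1) = w $ 3 *\<^sub>R axis 3 1" using comb[OF wi(1)] w1 w2 by (simp add: vwz)
  have Lv: "L (axis 2 1) = v $ 2 *\<^sub>R axis 2 1" using v_eq by (simp add: vwz)
  show "frechet_derivative \<Psi> (at 0) ` S \<subseteq> S" if "S \<in> {W0, l1_0, l2_0, V0}"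
  proof -
    have span: "L ` span B \<subseteq> span B" if "\<And>b. b \<in> B \<Longrightarrow> L b \<in> span B" for B
      unfolding linear_span_image[OF lin, symmetric] by (rule span_minimal) (use that in auto)
    have "L ` W0 \<subseteq> W0" "L ` l1_0 \<subseteq> l1_0" "L ` l2_0 \<subseteq> l2_0" "L ` V0 \<subseteq> V0"
      unfolding W0_def l1_0_def l2_0_def V0_def
      by (rule span; auto simp: Lz Lw Lv intro!: span_add span_mul intro: span_base)+
    then show ?thesis using that unfolding L_def by blast
  qed
qed

section \<open>Independence of the chosen diffeomorphism\<close>

lemma transport_independent:
  fixes \<Phi> \<Phi>' :: "real ^ ('n::finite) bit0 \<Rightarrow> real ^ 'n bit0"
  assumes n: "CARD('n) \<ge> 2" and "germ_diffeo \<Phi> U9 N" "germ_diffeo \<Phi>' U9 N" and S: "S \<in> {W0, l1_0, l2_0, V0}"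
  shows "transport \<Phi> S = transport \<Phi>' S"
proof -
  have "transport \<Phi> S \<subseteq> transport \<Phi>' S" if "germ_diffeo \<Phi> U9 N" "germ_diffeo \<Phi>' U9 N" for \<Phi> \<Phi>' :: "real ^ 'n bit0 \<Rightarrow> real ^ 'n bit0"
  proof (rule germ_diffeo_transition[OF that])
    fix T \<Psi> assume T: "open T" "0 \<in> T" "smooth_on T \<Psi>" "\<Psi> 0 = 0" "\<And>x. x \<in> U9 \<Longrightarrow> x \<in> T \<Longrightarrow> \<Psi> x \<in> U9"
      "\<And>v. frechet_derivative \<Psi> (at 0) v = 0 \<Longrightarrow> v = 0"
      and D: "\<And>v. frechet_derivative \<Phi> (at 0) v = frechet_derivative \<Phi>' (at 0) (frechet_derivative \<Psi> (at 0) v)"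
    from U9_symmetry(3)[OF n T S] D show "transport \<Phi> S \<subseteq> transport \<Phi>' S"
      unfolding transport_def by (simp add: image_subset_iff)
  qed
  from this[OF assms(2,3)] this[OF assms(3,2)] show ?thesis by (rule antisym)
qed

lemma smooth_along_branches:
  fixes \<Phi> :: "real ^ ('n::finite) bit0 \<Rightarrow> real ^ 'n bit0" and H :: "real ^ 'n bit0 \<Rightarrow> 'b::real_normed_vector"
  assumes U: "open U" "0 \<in> U" "smooth_on U \<Phi>" "\<Phi> 0 = 0" and V: "open V" "0 \<in> V" "smooth_on V H"
    and b: "b \<in> {branch1, branch2}"
  obtains S where "open S" "0 \<in> S" "smooth_on S (\<lambda>t. H (\<Phi> (b t)))"
proof -
  define T where "T = U \<inter> \<Phi> -` V"
  have T: "open T" "0 \<in> T" unfolding T_def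
    using continuous_open_preimage[OF smooth_on_continuous[OF U(3)] U(1) V(1)] U V by auto
  have smb: "smooth_on UNIV b" using smooth_branches b by blast
  have b0: "b 0 = 0" using b branches_0 by auto
  define S where "S = b -` T"
  have S: "open S" "0 \<in> S"
    unfolding S_def using continuous_on_open_vimage[OF open_UNIV, of b] smooth_on_continuous[OF smb] T b0 by auto
  have "smooth_on S (\<lambda>t. H (\<Phi> (b t)))"
  proof (rule smooth_on_compose[OF S(1) T(1), where g=b and f="\<lambda>x. H (\<Phi> x)"])
    show "b ` S \<subseteq> T" by (auto simp: S_def)
    show "smooth_on S b" by (rule smooth_on_subset[OF smb]) simp
    show "smooth_on T (\<lambda>x. H (\<Phi> x))"
      by (rule smooth_on_compose[OF T(1) V(1) _ V(3)]) (auto simp: T_def intro: smooth_on_subset[OF U(3)])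
  qed
  with S show thesis by (rule that)
qed

text \<open>Along a branch the two parametrizations are related by \<Phi> (b t) = \<Phi>' (b (s t))
  with s t bounded by a multiple of t, so an estimate of order k passes from one to the other, and
  conversely by interchanging them.\<close>

lemma tangency_order_independent:
  fixes \<Phi> \<Phi>' :: "real ^ ('n::finite) bit0 \<Rightarrow> real ^ 'n bit0" and H :: "real ^ 'n bit0 \<Rightarrow> real ^ 'n"
  assumes n: "CARD('n) \<ge> 2" and "germ_diffeo \<Phi> U9 N" "germ_diffeo \<Phi>' U9 N"
    and H: "lagrangian_germ \<omega> H" and b: "b \<in> {branch1, branch2}"
  shows "tangency_order (\<Phi> \<circ> b) H = tangency_order (\<Phi>' \<circ> b) H"
proof (rule enat_eqI)
  fix k
  have le: "enat k \<le> tangency_order (\<Phi> \<circ> b) H" if d: "germ_diffeo \<Phi> U9 N" "germ_diffeo \<Phi>' U9 N"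
    and ord: "enat k \<le> tangency_order (\<Phi>' \<circ> b) H" for \<Phi> \<Phi>' :: "real ^ 'n bit0 \<Rightarrow> real ^ 'n bit0"
  proof -
    obtain V where V: "open V" "0 \<in> V" "smooth_on V H" and H0: "H 0 = 0" using H unfolding lagrangian_germ_def by blast
    have sm: "\<exists>S. open S \<and> 0 \<in> S \<and> smooth_on S (\<lambda>t. H ((\<Phi> \<circ> b) t))" if "germ_diffeo \<Phi> U9 N" for \<Phi> :: "real ^ 'n bit0 \<Rightarrow> real ^ 'n bit0"
    proof (rule germ_diffeoE[OF that])
      fix U assume U: "open U" "0 \<in> U" "smooth_on U \<Phi>" "\<Phi> 0 = 0"
      show ?thesis by (rule smooth_along_branches[OF U V b]) (auto simp: o_def)
    qed
    obtain S where S: "open S" "0 \<in> S" "smooth_on S (\<lambda>t. H ((\<Phi> \<circ> b) t))" using sm[OF d(1)] by blast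
    obtain S' where S': "open S'" "0 \<in> S'" "smooth_on S' (\<lambda>t. H ((\<Phi>' \<circ> b) t))" using sm[OF d(2)] by blast
    have "(\<lambda>t. norm (H ((\<Phi>' \<circ> b) t))) \<in> O[at 0](\<lambda>t. t ^ k)" using ord tangency_order_ge_iff[where f="\<Phi>' \<circ> b" and h=H, OF S'] by simp
    then obtain B where B: "B > 0" "\<forall>\<^sub>F t in at 0. norm (norm (H ((\<Phi>' \<circ> b) t))) \<le> B * norm (t ^ k)"
      by (rule landau_o.bigE)
    then obtain \<delta> where \<delta>: "\<delta> > 0" "\<And>t. t \<noteq> 0 \<Longrightarrow> dist t 0 < \<delta> \<Longrightarrow> norm (H (\<Phi>' (b t))) \<le> B * \<bar>t\<bar> ^ k"
      unfolding eventually_at by (auto simp: power_abs)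
    have b0: "b 0 = 0" using b branches_0 by auto
    have \<Phi>0: "\<Phi>' 0 = 0" using d(2) unfolding germ_diffeo_def by blast
    \<comment> \<open>The estimate is needed at the parameter s t, which may be 0 although t is not;
      hence the value at 0 is included.\<close>
    have \<delta>': "norm (H (\<Phi>' (b t))) \<le> B * \<bar>t\<bar> ^ k" if "\<bar>t\<bar> < \<delta>" for t
      using \<delta>(2)[of t] that B(1) by (cases "t = 0") (auto simp: b0 \<Phi>0 H0)
    have "\<exists>s C. \<forall>\<^sub>F t in at 0. \<Phi> (b t) = \<Phi>' (b (s t)) \<and> \<bar>s t\<bar> \<le> C * \<bar>t\<bar>"
    proof (rule germ_diffeo_transition[OF d])
      fix T \<Psi> assume T: "open T" "0 \<in> T" "smooth_on T \<Psi>" "\<Psi> 0 = 0" "\<And>x. x \<in> U9 \<Longrightarrow> x \<in> T \<Longrightarrow> \<Psi> x \<in> U9"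
        "\<And>v. frechet_derivative \<Psi> (at 0) v = 0 \<Longrightarrow> v = 0" and e: "\<And>x. x \<in> T \<Longrightarrow> \<Phi> x = \<Phi>' (\<Psi> x)"
      have "\<exists>s C. \<forall>\<^sub>F t in at 0. \<Psi> (b t) = b (s t) \<and> \<bar>s t\<bar> \<le> C * \<bar>t\<bar>"
        using U9_symmetry(1,2)[OF n T] b by blast
      then obtain s C where s: "\<forall>\<^sub>F t in at 0. \<Psi> (b t) = b (s t) \<and> \<bar>s t\<bar> \<le> C * \<bar>t\<bar>" by blast
      have "\<forall>\<^sub>F t in at 0. b t \<in> T"
        using b topological_tendstoD[OF branch1_tendsto T(1,2)] topological_tendstoD[OF branch2_tendsto T(1,2)] by auto
      with s have "\<forall>\<^sub>F t in at 0. \<Phi> (b t) = \<Phi>' (b (s t)) \<and> \<bar>s t\<bar> \<le> C * \<bar>t\<bar>"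
        by eventually_elim (simp add: e)
      then show ?thesis by blast
    qed
    then obtain s C where s: "\<forall>\<^sub>F t in at 0. \<Phi> (b t) = \<Phi>' (b (s t)) \<and> \<bar>s t\<bar> \<le> C * \<bar>t\<bar>" by blast
    define D where "D = max 1 C"
    have D: "D > 0" "C \<le> D" by (auto simp: D_def)
    have "\<forall>\<^sub>F t in at 0. dist t 0 < \<delta> / D"
      unfolding eventually_at using \<delta>(1) D(1) by (intro exI[of _ "\<delta> / D"]) simp
    with s have "\<forall>\<^sub>F t in at 0. norm (norm (H ((\<Phi> \<circ> b) t))) \<le> (B * D ^ k) * norm (t ^ k)"
    proof eventually_elim
      case (elim t)
      have st: "\<bar>s t\<bar> \<le> D * \<bar>t\<bar>" using elim(1) mult_right_mono[OF D(2), of "\<bar>t\<bar>"] by simp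
      also have "\<dots> < \<delta>" using elim(2) D(1) by (simp add: pos_less_divide_eq mult.commute)
      finally have "norm (H (\<Phi>' (b (s t)))) \<le> B * \<bar>s t\<bar> ^ k" by (rule \<delta>')
      also have "\<dots> \<le> B * (D * \<bar>t\<bar>) ^ k" by (intro mult_left_mono power_mono st) (use B in auto)
      finally show ?case using elim(1) by (simp add: power_mult_distrib power_abs mult.assoc)
    qed
    then have "(\<lambda>t. norm (H ((\<Phi> \<circ> b) t))) \<in> O[at 0](\<lambda>t. t ^ k)" by (rule bigoI)
    then show ?thesis using tangency_order_ge_iff[where f="\<Phi> \<circ> b" and h=H, OF S] by simp
  qed
  show "enat k \<le> tangency_order (\<Phi> \<circ> b) H \<longleftrightarrow> enat k \<le> tangency_order (\<Phi>' \<circ> b) H"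
    using le[OF assms(2,3)] le[OF assms(3,2)] by blast
qed

section \<open>Transport of symplectic forms and Lagrangian germs\<close>

lemma symplectic_germ_pullback:
  assumes \<omega>: "symplectic_germ \<omega>" and \<Phi>: "germ_diffeo \<Phi> A N"
  obtains U where "open U" "0 \<in> U" "two_form_on U (pullback \<Phi> \<omega>)" "closed_form_on U (pullback \<Phi> \<omega>)"
    "\<And>x u. x \<in> U \<Longrightarrow> (\<And>v. pullback \<Phi> \<omega> x u v = 0) \<Longrightarrow> u = 0"
proof (rule germ_diffeoE[OF \<Phi>])
  fix U V \<Psi> assume h: "open U" "open V" "0 \<in> U" "0 \<in> V" "homeomorphism U V \<Phi> \<Psi>"
    "smooth_on U \<Phi>" "smooth_on V \<Psi>" "\<Phi> 0 = 0"
  obtain U1 where U1: "open U1" "0 \<in> U1" "two_form_on U1 \<omega>" "closed_form_on U1 \<omega>"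
    "\<And>x u. x \<in> U1 \<Longrightarrow> (\<forall>v. \<omega> x u v = 0) \<longrightarrow> u = 0"
    using \<omega> unfolding symplectic_germ_def by blast
  define T where "T = U \<inter> \<Phi> -` U1"
  have T: "open T" "0 \<in> T" unfolding T_def
    using continuous_open_preimage[OF smooth_on_continuous[OF h(6)] h(1) U1(1)] U1(2) h by auto
  have TU: "T \<subseteq> U" "\<Phi> ` T \<subseteq> U1" by (auto simp: T_def)
  note sm = smooth_on_subset[OF h(6) TU(1)]
  show thesis
  proof (rule that[OF T])
    show "two_form_on T (pullback \<Phi> \<omega>)" by (rule pullback_two_form[OF T(1) U1(1,3) TU(2) sm])
    show "closed_form_on T (pullback \<Phi> \<omega>)" by (rule pullback_closed[OF T(1) U1(1,3,4) TU(2) sm])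
    fix x u assume x: "x \<in> T" and z: "\<And>v. pullback \<Phi> \<omega> x u v = 0"
    have xU: "x \<in> U" "\<Phi> x \<in> U1" using x by (auto simp: T_def)
    have V: "\<Phi> x \<in> V" "\<Psi> (\<Phi> x) = x" using h(5) xU by (auto simp: homeomorphism_def)
    have inv: "frechet_derivative \<Phi> (at x) (frechet_derivative \<Psi> (at (\<Phi> x)) v) = v" for v
      using homeomorphism_frechet_inverse[OF h(2) homeomorphism_symD[OF h(5)] h(7,6) V(1)] V(2) by simp
    have "\<forall>v. \<omega> (\<Phi> x) (frechet_derivative \<Phi> (at x) u) v = 0"
      using z[of "frechet_derivative \<Psi> (at (\<Phi> x)) _"] unfolding pullback_def inv by simp
    then have "frechet_derivative \<Phi> (at x) u = 0" using U1(5)[OF xU(2)] by blast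
    then show "u = 0"
      using homeomorphism_frechet_inverse[OF h(1,5,6,7) xU(1), of u]
        linear_0[OF smooth_on_linear_frechet[OF h(7) V(1)]] by simp
  qed
qed

text \<open>The form \<omega>' is only required to agree with the pullback on U. This makes the
  lemma usable for the inverse map too, where pulling back twice restores the original form only
  locally.\<close>

lemma lagrangian_germ_compose:
  fixes \<Phi> \<Psi> :: "real ^ ('n::finite) bit0 \<Rightarrow> real ^ 'n bit0"
  assumes h: "open U" "open V" "0 \<in> U" "homeomorphism U V \<Phi> \<Psi>" "smooth_on U \<Phi>" "smooth_on V \<Psi>" "\<Phi> 0 = 0"
    and H: "lagrangian_germ \<omega> H"
    and \<omega>': "\<And>x u v. x \<in> U \<Longrightarrow> \<omega>' x u v = pullback \<Phi> \<omega> x u v"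
  shows "lagrangian_germ \<omega>' (\<lambda>x. H (\<Phi> x))"
proof -
  obtain U1 where U1: "open U1" "0 \<in> U1" "smooth_on U1 H" "\<And>x. x \<in> U1 \<Longrightarrow> surj (frechet_derivative H (at x))"
    "\<And>x u v. x \<in> U1 \<Longrightarrow> H x = 0 \<Longrightarrow> frechet_derivative H (at x) u = 0 \<Longrightarrow> frechet_derivative H (at x) v = 0 \<Longrightarrow> \<omega> x u v = 0"
    and H0: "H 0 = 0"
    using H unfolding lagrangian_germ_def by blast
  define T where "T = U \<inter> \<Phi> -` U1"
  have T: "open T" "0 \<in> T" unfolding T_def
    using continuous_open_preimage[OF smooth_on_continuous[OF h(5)] h(1) U1(1)] U1(2) h by auto
  have D: "frechet_derivative (\<lambda>x. H (\<Phi> x)) (at x) v = frechet_derivative H (at (\<Phi> x)) (frechet_derivative \<Phi> (at x) v)"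
    if "x \<in> T" for x v
  proof -
    have "x \<in> U" "\<Phi> x \<in> U1" using that by (auto simp: T_def)
    then show ?thesis
      using frechet_at[OF diff_chain_at[OF smooth_on_has_derivative[OF h(5)] smooth_on_has_derivative[OF U1(3)]]] by (simp add: o_def)
  qed
  show ?thesis
    unfolding lagrangian_germ_def
  proof (intro conjI exI[of _ T] ballI impI allI T)
    show "H (\<Phi> 0) = 0" by (simp add: h H0)
    show "smooth_on T (\<lambda>x. H (\<Phi> x))"
      by (rule smooth_on_compose[OF T(1) U1(1) _ U1(3)]) (auto simp: T_def intro: smooth_on_subset[OF h(5)])
    fix x assume x: "x \<in> T"
    have xU: "x \<in> U" "\<Phi> x \<in> U1" using x by (auto simp: T_def)
    have V: "\<Phi> x \<in> V" "\<Psi> (\<Phi> x) = x" using h(4) xU by (auto simp: homeomorphism_def)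
    show "surj (frechet_derivative (\<lambda>x. H (\<Phi> x)) (at x))"
    proof (rule surjI)
      fix y
      obtain v where v: "frechet_derivative H (at (\<Phi> x)) v = y" using U1(4)[OF xU(2)] by (metis surjD)
      have "frechet_derivative \<Phi> (at x) (frechet_derivative \<Psi> (at (\<Phi> x)) v) = v"
        using homeomorphism_frechet_inverse[OF h(2) homeomorphism_symD[OF h(4)] h(6,5) V(1)] V(2) by simp
      then have "frechet_derivative (\<lambda>x. H (\<Phi> x)) (at x) (frechet_derivative \<Psi> (at (\<Phi> x)) v) = y" by (simp add: D[OF x] v)
      then show "frechet_derivative (\<lambda>x. H (\<Phi> x)) (at x) (SOME w. frechet_derivative (\<lambda>x. H (\<Phi> x)) (at x) w = y) = y" by (rule someI)
    qed
    fix u v assume "H (\<Phi> x) = 0" "frechet_derivative (\<lambda>x. H (\<Phi> x)) (at x) u = 0" "frechet_derivative (\<lambda>x. H (\<Phi> x)) (at x) v = 0"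
    then show "\<omega>' x u v = 0" unfolding \<omega>'[OF xU(1)] pullback_def D[OF x] by (intro U1(5)[OF xU(2)])
  qed
qed

lemma lagrangian_germ_pullback:
  assumes "germ_diffeo \<Phi> A N" "lagrangian_germ \<omega> H"
  shows "lagrangian_germ (pullback \<Phi> \<omega>) (\<lambda>x. H (\<Phi> x))"
proof (rule germ_diffeoE[OF assms(1)])
  fix U V \<Psi> assume h: "open U" "open V" "0 \<in> U" "homeomorphism U V \<Phi> \<Psi>" "smooth_on U \<Phi>" "smooth_on V \<Psi>" "\<Phi> 0 = 0"
  show ?thesis by (rule lagrangian_germ_compose[OF h assms(2)]) simp
qed

lemma lagrangian_germ_pushforward:
  assumes "germ_diffeo \<Phi> A N" "lagrangian_germ (pullback \<Phi> \<omega>) H"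
  obtains H' where "lagrangian_germ \<omega> H'" "\<forall>\<^sub>F x in nhds 0. H' (\<Phi> x) = H x"
    "(\<forall>\<^sub>F x in nhds 0. x \<in> A \<longrightarrow> H x = 0) \<Longrightarrow> (\<forall>\<^sub>F x in nhds 0. x \<in> N \<longrightarrow> H' x = 0)"
proof (rule germ_diffeoE[OF assms(1)])
  fix U V \<Psi> assume h: "open U" "open V" "0 \<in> U" "0 \<in> V" "homeomorphism U V \<Phi> \<Psi>" "smooth_on U \<Phi>" "smooth_on V \<Psi>"
    "\<Phi> ` (A \<inter> U) = N \<inter> V" "\<Phi> 0 = 0" "\<Psi> 0 = 0"
  show thesis
  proof (rule that)
    show "lagrangian_germ \<omega> (\<lambda>y. H (\<Psi> y))"
    proof (rule lagrangian_germ_compose[OF h(2,1,4) homeomorphism_symD[OF h(5)] h(7,6,10) assms(2)])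
      fix y u v assume y: "y \<in> V"
      have U: "\<Psi> y \<in> U" "\<Phi> (\<Psi> y) = y" using h(5) y by (auto simp: homeomorphism_def)
      have "frechet_derivative \<Phi> (at (\<Psi> y)) (frechet_derivative \<Psi> (at y) v) = v" for v
        by (rule homeomorphism_frechet_inverse[OF h(2) homeomorphism_symD[OF h(5)] h(7,6) y])
      then show "\<omega> y u v = pullback \<Psi> (pullback \<Phi> \<omega>) y u v" by (simp add: pullback_def U)
    qed
    show "\<forall>\<^sub>F x in nhds 0. H (\<Psi> (\<Phi> x)) = H x"
      using eventually_nhds_in_open[OF h(1,3)] by eventually_elim (simp add: homeomorphism_apply1[OF h(5)])
    assume "\<forall>\<^sub>F x in nhds 0. x \<in> A \<longrightarrow> H x = 0"
    then obtain S where S: "open S" "0 \<in> S" "\<And>x. x \<in> S \<Longrightarrow> x \<in> A \<Longrightarrow> H x = 0" unfolding eventually_nhds by blast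
    have "isCont \<Psi> 0" using smooth_on_has_derivative[OF h(7,4)] has_derivative_continuous by blast
    then have "\<forall>\<^sub>F y in nhds 0. \<Psi> y \<in> S"
      using S(1,2) h(10) by (metis continuous_at tendsto_def tendsto_at_iff_tendsto_nhds)
    then show "\<forall>\<^sub>F y in nhds 0. y \<in> N \<longrightarrow> H (\<Psi> y) = 0"
      using eventually_nhds_in_open[OF h(2,4)]
    proof eventually_elim
      case (elim y)
      show ?case
      proof
        assume "y \<in> N"
        then obtain a where "a \<in> A \<inter> U" "y = \<Phi> a" using h(8) elim(2) by (metis IntI imageE)
        then show "H (\<Psi> y) = 0" using S(3)[OF elim(1)] homeomorphism_apply1[OF h(5)] by simp
      qed
    qed
  qed
qed

section \<open>Symplectic forms in normal coordinates\<close>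

lemma zero_in_U9: "0 \<in> U9" by (simp add: U9_def)

text \<open>U9 is infinitesimally large enough to span \<open>W0\<close>: the nonsingular branch
  detects the derivative along axis 2, the terms t^3 and t^5 along the singular branch those along
  axes 3 and 1. Hence the differential of a 1-form vanishing on U9 restricts to 0 on
  \<open>W0\<close> at the origin.\<close>

lemma vanishing_on_U9_derivative:
  fixes g :: "real ^ ('n::finite) bit0 \<Rightarrow> real"
  assumes n: "CARD('n) \<ge> 2" and U: "open U" "0 \<in> U" "smooth_on U g" and z: "\<And>x. x \<in> U9 \<Longrightarrow> x \<in> U \<Longrightarrow> g x = 0"
    and v: "v \<in> W0"
  shows "frechet_derivative g (at 0) v = 0"
proof -
  define L where "L = frechet_derivative g (at 0)"
  have lin: "linear L" unfolding L_def by (rule smooth_on_linear_frechet[OF U(3,2)])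
  have g0: "g 0 = 0" by (rule z[OF zero_in_U9 U(2)])
  obtain K \<epsilon> where K: "0 \<le> K" "0 < \<epsilon>" "ball 0 \<epsilon> \<subseteq> U" "\<And>x. x \<in> ball 0 \<epsilon> \<Longrightarrow> norm (g x - L x) \<le> K * (norm x)\<^sup>2"
    by (rule smooth_quadratic_bound[OF U g0, folded L_def]) (assumption | rule that)+
  have 2: "L (axis 2 1) = 0"
  proof -
    have "\<forall>\<^sub>F t in at 0. branch1 t \<in> ball (0 :: real ^ 'n bit0) \<epsilon>"
      using tendstoD[OF branch1_tendsto K(2)] by simp
    then have "\<forall>\<^sub>F t in at 0. \<bar>0 - t * L (axis 2 1)\<bar> \<le> K * \<bar>t\<bar> ^ 2"
    proof eventually_elim
      case (elim t)
      have "g (branch1 t) = 0" using z[OF branches_in_U9(1)[OF n]] K(3) elim by blast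
      then show ?case using K(4)[OF elim] by (simp add: branch1_eq linear_cmul[OF lin] norm_axis_1)
    qed
    moreover have "((\<lambda>t. t * L (axis 2 1) / t ^ 1) \<longlongrightarrow> L (axis 2 1)) (at 0)"
      by (rule tendsto_eventually) (auto simp: eventually_at_filter)
    ultimately have "((\<lambda>t::real. 0 / t ^ 1) \<longlongrightarrow> L (axis 2 1)) (at 0)"
      by (intro tendsto_div_power_cong[of "\<lambda>t. 0" "\<lambda>t. t * L (axis 2 1)" K 2 1]) simp_all
    then show ?thesis by (simp add: tendsto_const_iff)
  qed
  have b: "\<forall>\<^sub>F t in at 0. \<bar>0 - (t ^ 5 * L (axis 1 1) + t ^ 3 * L (axis 3 1))\<bar> \<le> (9 * K) * \<bar>t\<bar> ^ 6"
  proof -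
    have "\<forall>\<^sub>F t in at 0. branch2 t \<in> U" using topological_tendstoD[OF branch2_tendsto U(1,2)] .
    moreover have "\<forall>\<^sub>F t in at 0. norm (g (branch2 t) - L (branch2 t)) \<le> (9 * K) * \<bar>t\<bar> ^ 6"
      by (rule branch2_smooth_bound[OF K(1,2,4)])
    ultimately show ?thesis
    proof eventually_elim
      case (elim t)
      have "g (branch2 t) = 0" by (rule z[OF branches_in_U9(2)[OF n] elim(1)])
      moreover have "L (branch2 t) = t ^ 5 * L (axis 1 1) + t ^ 3 * L (axis 3 1)"
        unfolding branch2_eq by (simp add: linear_add[OF lin] linear_diff[OF lin] linear_cmul[OF lin] 2)
      ultimately show ?case using elim(2) by simp
    qed
  qed
  have 3: "L (axis 3 1) = 0"
  proof -
    have "((\<lambda>t. t ^ 2 * L (axis 1 1) + L (axis 3 1)) \<longlongrightarrow> 0 ^ 2 * L (axis 1 1) + L (axis 3 1)) (at 0)"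
      by (intro tendsto_intros)
    then have "((\<lambda>t. (t ^ 5 * L (axis 1 1) + t ^ 3 * L (axis 3 1)) / t ^ 3) \<longlongrightarrow> 0 ^ 2 * L (axis 1 1) + L (axis 3 1)) (at 0)"
    proof (rule Lim_transform_eventually)
      show "\<forall>\<^sub>F t in at 0. t ^ 2 * L (axis 1 1) + L (axis 3 1) = (t ^ 5 * L (axis 1 1) + t ^ 3 * L (axis 3 1)) / t ^ 3"
        using eventually_neq_at_within[of 0 0 UNIV] by eventually_elim (simp add: field_simps power_numeral_reduce)
    qed
    then have "((\<lambda>t. (t ^ 5 * L (axis 1 1) + t ^ 3 * L (axis 3 1)) / t ^ 3) \<longlongrightarrow> L (axis 3 1)) (at 0)" by simp
    then have "((\<lambda>t::real. 0 / t ^ 3) \<longlongrightarrow> L (axis 3 1)) (at 0)" by (intro tendsto_div_power_cong[OF b]) simp_all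
    then show ?thesis by (simp add: tendsto_const_iff)
  qed
  have 1: "L (axis 1 1) = 0"
  proof -
    have "((\<lambda>t. (t ^ 5 * L (axis 1 1) + t ^ 3 * L (axis 3 1)) / t ^ 5) \<longlongrightarrow> L (axis 1 1)) (at 0)"
      by (rule tendsto_eventually) (auto simp: eventually_at_filter 3)
    then have "((\<lambda>t::real. 0 / t ^ 5) \<longlongrightarrow> L (axis 1 1)) (at 0)" by (intro tendsto_div_power_cong[OF b]) simp_all
    then show ?thesis by (simp add: tendsto_const_iff)
  qed
  have "L x = 0" if "x \<in> {axis 1 1, axis 2 1, axis 3 1}" for x using that 1 2 3 by blast
  from linear_eq_0_on_span[OF lin this] v show ?thesis unfolding W0_def L_def by blast
qed

text \<open>The two defining equations are quasi-homogeneous, of weighted degrees 10 and 12.\<close>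

lemma wscale_U9:
  assumes n: "CARD('n::finite) \<ge> 2" and x: "(x :: real ^ 'n bit0) \<in> U9"
  shows "wscale U9_weight s x \<in> U9"
proof -
  have "(wscale U9_weight s x $ 1)\<^sup>2 + wscale U9_weight s x $ 2 * wscale U9_weight s x $ 3 = s ^ 10 * ((x $ 1)\<^sup>2 + x $ 2 * x $ 3)"
    "wscale U9_weight s x $ 1 * wscale U9_weight s x $ 2 + (wscale U9_weight s x $ 3) ^ 4 = s ^ 12 * (x $ 1 * x $ 2 + (x $ 3) ^ 4)"
    by (simp_all add: wscale_def U9_weight_simps[OF n] power_mult_distrib distrib_left flip: power_mult)
  then show ?thesis using x by (simp add: U9_def wscale_def)
qed

lemma U9_subset_W0:
  assumes n: "CARD('n::finite) \<ge> 2"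
  shows "(U9 :: (real ^ 'n bit0) set) \<subseteq> W0"
  unfolding U9_branches[OF n] W0_def
  by (auto simp: branch1_eq branch2_eq intro!: span_add span_diff span_mul intro: span_base)

text \<open>An algebraic restriction with all its witnesses on one common neighbourhood, in
  coordinates in which N has become U9: \<omega> stands for the symplectic form pulled back by the
  diffeomorphism of the normal form.\<close>

locale U9_form =
  fixes \<omega> \<theta> \<alpha> :: "(real ^ ('n::finite) bit0) form2" and \<beta> :: "(real ^ 'n bit0) form1" and U :: "(real ^ 'n bit0) set"
  assumes n: "CARD('n) \<ge> 2" and U: "open U" "0 \<in> U"
    and \<omega>: "two_form_on U \<omega>" "closed_form_on U \<omega>" and nondegenerate: "\<And>x u. x \<in> U \<Longrightarrow> (\<And>v. \<omega> x u v = 0) \<Longrightarrow> u = 0"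
    and \<alpha>: "two_form_on U \<alpha>" "\<And>x u v. x \<in> U9 \<Longrightarrow> x \<in> U \<Longrightarrow> \<alpha> x u v = 0"
    and \<beta>: "one_form_on U \<beta>" "\<And>x v. x \<in> U9 \<Longrightarrow> x \<in> U \<Longrightarrow> \<beta> x v = 0"
    and eq: "\<And>x u v. x \<in> U \<Longrightarrow> \<omega> x u v = \<theta> x u v + \<alpha> x u v + ext_deriv \<beta> x u v"
begin

lemma restrict_W0:
  assumes "u \<in> W0" "v \<in> W0"
  shows "\<omega> 0 u v = \<theta> 0 u v"
proof -
  have "frechet_derivative (\<lambda>y. \<beta> y v) (at 0) u = 0" if "u \<in> W0" for u v
    by (rule vanishing_on_U9_derivative[OF n U one_form_onD(2)[OF \<beta>(1)] \<beta>(2) that])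
  then have "ext_deriv \<beta> 0 u v = 0" using assms by (simp add: ext_deriv_def)
  then show ?thesis using eq[OF U(2), of u v] \<alpha>(2)[OF zero_in_U9 U(2)] by simp
qed

lemma lagrangian_exists:
  assumes \<kappa>: "one_form_on U \<kappa>" "\<And>x u v. x \<in> U \<Longrightarrow> ext_deriv \<kappa> x u v = \<theta> x u v" "\<And>v. \<kappa> 0 v = 0"
    and \<theta>0: "\<And>u v. u \<in> W0 \<Longrightarrow> v \<in> W0 \<Longrightarrow> \<theta> 0 u v = 0"
  obtains H C \<delta> where "lagrangian_germ \<omega> H" "0 < \<delta>"
    "\<And>x. x \<in> U9 \<Longrightarrow> norm x < \<delta> \<Longrightarrow> norm (H x) \<le> C * (\<Sum>b\<in>Basis. \<bar>\<kappa> x b\<bar>)"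
proof -
  define \<nu> where "\<nu> = (\<lambda>x v. \<kappa> x v + \<beta> x v)"
  have \<nu>: "one_form_on U \<nu>" unfolding \<nu>_def by (rule one_form_on_add(1)[OF U(1) \<kappa>(1) \<beta>(1)])
  have ext\<nu>: "ext_deriv \<nu> x u v = \<theta> x u v + ext_deriv \<beta> x u v" if "x \<in> U" for x u v
    unfolding \<kappa>(2)[OF that, symmetric] ext_deriv_alt \<nu>_def one_form_on_add(2)[OF U(1) \<kappa>(1) \<beta>(1) that] by simp
  have \<alpha>_eq: "\<alpha> x u v = \<omega> x u v - ext_deriv \<nu> x u v" if "x \<in> U" for x u v using eq[OF that] ext\<nu>[OF that] by simp
  note ext\<nu>2 = ext_deriv_two_form[OF U(1) \<nu>]
  have d\<alpha>: "dform2 \<alpha> x h u v = dform2 \<omega> x h u v - dform2 (ext_deriv \<nu>) x h u v" if x: "x \<in> U" for x h u v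
  proof -
    have "((\<lambda>y. \<omega> y u v - ext_deriv \<nu> y u v) has_derivative (\<lambda>h. dform2 \<omega> x h u v - dform2 (ext_deriv \<nu>) x h u v)) (at x)"
      by (rule has_derivative_diff[OF two_form_has_derivative_at[OF \<omega>(1) x] two_form_has_derivative_at[OF ext\<nu>2 x]])
    then have "((\<lambda>y. \<alpha> y u v) has_derivative (\<lambda>h. dform2 \<omega> x h u v - dform2 (ext_deriv \<nu>) x h u v)) (at x)"
      by (rule has_derivative_transform_within_open[OF _ U(1) x]) (simp add: \<alpha>_eq)
    from frechet_at[OF this] show ?thesis unfolding dform2_def[of \<alpha>] by simp
  qed
  \<comment> \<open>With \<theta> exact, \<alpha> is the difference of the closed form \<omega> and
    an exact form; this is what admits it to the Poincare lemma.\<close>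
  have closed: "closed_form_on U \<alpha>"
    using \<omega>(2) ext_deriv_closed[OF U(1) \<nu>] unfolding closed_form_on_alt by (simp add: d\<alpha> algebra_simps)
  have weight: "U9_weight i \<noteq> 0" for i :: "'n bit0" by (simp add: U9_weight_def)
  show thesis
  proof (rule weighted_poincare[where w=U9_weight, OF U \<alpha>(1) closed weight])
    fix r and \<gamma> :: "(real ^ 'n bit0) form1"
    assume r: "0 < r" "ball 0 r \<subseteq> U" and \<gamma>: "one_form_on (ball 0 r) \<gamma>"
      "\<And>x u v. x \<in> ball 0 r \<Longrightarrow> ext_deriv \<gamma> x u v = \<alpha> x u v"
      "\<And>x s. x \<in> ball 0 r \<Longrightarrow> s \<in> {0..1} \<Longrightarrow> wscale U9_weight s x \<in> U"
      "\<And>x u. x \<in> ball 0 r \<Longrightarrow> (\<And>s u v. s \<in> {0..1} \<Longrightarrow> \<alpha> (wscale U9_weight s x) u v = 0) \<Longrightarrow> \<gamma> x u = 0"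
    let ?B = "ball (0 :: real ^ 'n bit0) r"
    have \<gamma>U9: "\<gamma> x u = 0" if "x \<in> ?B" "x \<in> U9" for x u
      by (rule \<gamma>(4)[OF that(1)]) (intro \<alpha>(2) wscale_U9[OF n that(2)] \<gamma>(3)[OF that(1)])
    \<comment> \<open>A primitive of \<omega> itself. Its summands \<beta> and \<gamma> vanish on
      U9, so the bound by \<mu> on \<open>W0\<close> becomes a bound by \<kappa> on U9.\<close>
    define \<mu> where "\<mu> = (\<lambda>x v. \<nu> x v + \<gamma> x v)"
    note \<nu>B = one_form_on_subset[OF \<nu> r(2)]
    have \<mu>U9: "\<mu> x v = \<kappa> x v" if "x \<in> ?B" "x \<in> U9" for x v
      using \<gamma>U9[OF that] \<beta>(2)[OF that(2)] that(1) r(2) by (auto simp: \<mu>_def \<nu>_def)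
    have 0: "0 \<in> ?B" using r(1) by simp
    have \<mu>1: "one_form_on ?B \<mu>" unfolding \<mu>_def by (rule one_form_on_add(1)[OF open_ball \<nu>B \<gamma>(1)])
    have \<mu>2: "ext_deriv \<mu> x u v = \<omega> x u v" if "x \<in> ?B" for x u v
    proof -
      have "ext_deriv \<mu> x u v = ext_deriv \<nu> x u v + ext_deriv \<gamma> x u v"
        unfolding ext_deriv_alt \<mu>_def one_form_on_add(2)[OF open_ball \<nu>B \<gamma>(1) that] by simp
      moreover have "x \<in> U" using that r(2) by blast
      ultimately show ?thesis using \<gamma>(2)[OF that] \<alpha>_eq by simp
    qed
    have \<mu>3: "\<mu> 0 v = 0" for v using \<mu>U9[OF 0 zero_in_U9] \<kappa>(3) by simp
    have nd: "u = 0" if "x \<in> ?B" "\<And>v. \<omega> x u v = 0" for x u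
      by (rule nondegenerate[OF _ that(2)]) (use that(1) r(2) in blast)
    have W: "subspace (W0 :: (real ^ 'n bit0) set)" unfolding W0_def by (rule subspace_span)
    have iso: "\<omega> 0 u v = 0" if "u \<in> W0" "v \<in> W0" for u v using restrict_W0[OF that] \<theta>0[OF that] by simp
    show thesis
    proof (rule lagrangian_from_primitive[OF open_ball 0 two_form_on_subset[OF \<omega>(1) r(2)] closed_form_on_subset[OF \<omega>(2) r(2)]
          nd \<mu>1 \<mu>2 \<mu>3 W iso])
      fix H :: "real ^ 'n bit0 \<Rightarrow> real ^ 'n" and C \<delta> :: real
      assume H: "lagrangian_germ \<omega> H" "0 < \<delta>"
        and bound: "\<And>x. x \<in> W0 \<Longrightarrow> norm x < \<delta> \<Longrightarrow> norm (H x) \<le> C * (\<Sum>b\<in>Basis. \<bar>\<mu> x b\<bar>)"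
      show thesis
      proof (rule that[OF H(1), of "min \<delta> r" C])
        show "0 < min \<delta> r" using H(2) r(1) by simp
        fix x :: "real ^ 'n bit0" assume x: "x \<in> U9" "norm x < min \<delta> r"
        have xB: "x \<in> ?B" using x(2) by simp
        have "norm (H x) \<le> C * (\<Sum>b\<in>Basis. \<bar>\<mu> x b\<bar>)" by (rule bound) (use x U9_subset_W0[OF n] in auto)
        then show "norm (H x) \<le> C * (\<Sum>b\<in>Basis. \<bar>\<kappa> x b\<bar>)" unfolding \<mu>U9[OF xB x(1)] .
      qed
    qed
  qed
qed

text \<open>Subtracting \<beta> from the primitive controlled by H does not change its size on U9,
  since \<beta> vanishes there, while its differential becomes \<theta> + \<alpha> up to the size of
  H; and \<alpha> vanishes on the branch.\<close>

lemma lagrangian_primitive: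
  assumes H: "lagrangian_germ \<omega> H" "(\<lambda>t. norm (H (branch2 t))) \<in> O[at 0](\<lambda>t. t ^ M)" and M: "M \<le> 17"
    and f: "\<And>x u v. \<theta> x u v = f x * (u $ 1 * v $ 3 - u $ 3 * v $ 1)" and p: "has_jet M (\<lambda>t. f (branch2 t)) p"
  obtains a :: "(real ^ 'n bit0) form1" and r where "U9_primitive a r M (\<lambda>t. f (branch2 t)) p"
    "\<forall>k. (\<lambda>s. norm (H (branch1 s))) \<in> O[at 0](\<lambda>s. s ^ k) \<longrightarrow> (\<forall>j. (\<lambda>s. a (axis 2 s) (axis j 1)) \<in> O[at 0](\<lambda>s. s ^ k))"
proof (rule lagrangian_germ_primitive[OF U \<omega>(1) H(1)])
  note d = bit0_123_distinct[OF n]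
  fix r and \<mu> :: "(real ^ 'n bit0) form1"
  assume r: "0 < r" "ball 0 r \<subseteq> U" and \<mu>: "one_form_on (ball 0 r) \<mu>"
    "\<And>v. \<exists>C. \<forall>x\<in>ball 0 r. \<bar>\<mu> x v\<bar> \<le> C * norm (H x)"
    "\<And>u v. \<exists>C. \<forall>x\<in>ball 0 r. \<bar>ext_deriv \<mu> x u v - \<omega> x u v\<bar> \<le> C * norm (H x)"
  let ?B = "ball (0 :: real ^ 'n bit0) r"
  note \<beta>B = one_form_on_subset[OF \<beta>(1) r(2)]
  define a where "a = (\<lambda>x v. \<mu> x v - \<beta> x v)"
  have a: "one_form_on ?B a" unfolding a_def by (rule one_form_on_diff(1)[OF open_ball \<mu>(1) \<beta>B])
  have ext_a: "ext_deriv a x u v = ext_deriv \<mu> x u v - ext_deriv \<beta> x u v" if "x \<in> ?B" for x u v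
    unfolding ext_deriv_alt a_def one_form_on_diff(2)[OF open_ball \<mu>(1) \<beta>B that] by simp
  have order: "(\<lambda>t. a (c t) v) \<in> O[at 0](\<lambda>t. t ^ k)"
    if c: "\<And>t. c t \<in> U9" "(c \<longlongrightarrow> 0) (at 0)" and Hc: "(\<lambda>t. norm (H (c t))) \<in> O[at 0](\<lambda>t. t ^ k)" for c k v
  proof -
    obtain C where C: "\<And>x. x \<in> ?B \<Longrightarrow> \<bar>\<mu> x v\<bar> \<le> C * norm (H x)" using \<mu>(2) by blast
    have "(\<lambda>t. a (c t) v) \<in> O[at 0](\<lambda>t. norm (H (c t)))"
    proof (rule bigoI)
      show "\<forall>\<^sub>F t in at 0. norm (a (c t) v) \<le> C * norm (norm (H (c t)))"
        using tendstoD[OF c(2) r(1)]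
      proof eventually_elim
        case (elim t)
        then have B: "c t \<in> ?B" by simp
        have "\<beta> (c t) v = 0" by (rule \<beta>(2)[OF c(1)]) (use B r(2) in blast)
        then show ?case using C[OF B] by (simp add: a_def)
      qed
    qed
    from landau_o.big_trans[OF this Hc] show ?thesis .
  qed
  have ext_order: "(\<lambda>t. ext_deriv a (branch2 t) u v - \<theta> (branch2 t) u v) \<in> O[at 0](\<lambda>t. t ^ M)" for u v
  proof -
    obtain C where C: "\<And>x. x \<in> ?B \<Longrightarrow> \<bar>ext_deriv \<mu> x u v - \<omega> x u v\<bar> \<le> C * norm (H x)" using \<mu>(3) by blast
    have "(\<lambda>t. ext_deriv a (branch2 t) u v - \<theta> (branch2 t) u v) \<in> O[at 0](\<lambda>t. norm (H (branch2 t)))"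
    proof (rule bigoI)
      have "\<forall>\<^sub>F t in at 0. dist (branch2 t :: real ^ 'n bit0) 0 < r" by (rule tendstoD[OF branch2_tendsto r(1)])
      then show "\<forall>\<^sub>F t in at 0. norm (ext_deriv a (branch2 t) u v - \<theta> (branch2 t) u v) \<le> C * norm (norm (H (branch2 t)))"
      proof eventually_elim
        case (elim t)
        then have B: "branch2 t \<in> ?B" by simp
        then have BU: "branch2 t \<in> U" using r(2) by blast
        have "ext_deriv a (branch2 t) u v - \<theta> (branch2 t) u v = ext_deriv \<mu> (branch2 t) u v - \<omega> (branch2 t) u v"
          using eq[OF BU, of u v] \<alpha>(2)[OF branches_in_U9(2)[OF n] BU, of u v] by (simp add: ext_a[OF B])
        then show ?case using C[OF B] by simp
      qed
    qed
    from landau_o.big_trans[OF this H(2)] show ?thesis .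
  qed
  show thesis
  proof (rule that)
    show "U9_primitive a r M (\<lambda>t. f (branch2 t)) p"
    proof
      show "CARD('n) \<ge> 2" "0 < r" "one_form_on ?B a" "M \<le> 17" "has_jet M (\<lambda>t. f (branch2 t)) p" by (fact n r(1) a M p)+
      show "(\<lambda>t. a (branch2 t) (axis j 1)) \<in> O[at 0](\<lambda>t. t ^ M)" for j
        by (rule order[OF branches_in_U9(2)[OF n] branch2_tendsto H(2)])
      show "(\<lambda>t. ext_deriv a (branch2 t) (axis 1 1) (axis 3 1) - f (branch2 t)) \<in> O[at 0](\<lambda>t. t ^ M)"
        using ext_order[of "axis 1 1" "axis 3 1"] d by (simp add: f axis_def)
      show "(\<lambda>t. ext_deriv a (branch2 t) (axis 1 1) (axis 2 1)) \<in> O[at 0](\<lambda>t. t ^ M)"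
        using ext_order[of "axis 1 1" "axis 2 1"] d by (simp add: f axis_def)
      show "(\<lambda>t. ext_deriv a (branch2 t) (axis 2 1) (axis 3 1)) \<in> O[at 0](\<lambda>t. t ^ M)"
        using ext_order[of "axis 2 1" "axis 3 1"] d by (simp add: f axis_def)
    qed
    show "\<forall>k. (\<lambda>s. norm (H (branch1 s))) \<in> O[at 0](\<lambda>s. s ^ k) \<longrightarrow> (\<forall>j. (\<lambda>s. a (axis 2 s) (axis j 1)) \<in> O[at 0](\<lambda>s. s ^ k))"
      using order[OF branches_in_U9(1)[OF n] branch1_tendsto] by (simp add: branch1_def)
  qed
qed

end

section \<open>Invariants of the classes\<close>

lemma span_axis:
  "span ((\<lambda>i. axis i 1) ` I) = {x :: real ^ 'i::finite. \<forall>i. i \<notin> I \<longrightarrow> x $ i = 0}"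
proof (intro equalityI subsetI)
  fix x :: "real ^ 'i" assume "x \<in> span ((\<lambda>i. axis i 1) ` I)"
  then show "x \<in> {x. \<forall>i. i \<notin> I \<longrightarrow> x $ i = 0}"
    by (rule span_induct) (auto simp: subspace_def axis_def)
next
  fix x :: "real ^ 'i" assume x: "x \<in> {x. \<forall>i. i \<notin> I \<longrightarrow> x $ i = 0}"
  have "x = (\<Sum>i\<in>UNIV. x $ i *\<^sub>R axis i 1)" by (simp add: basis_expansion flip: scalar_mult_eq_scaleR)
  also have "\<dots> = (\<Sum>i\<in>I. x $ i *\<^sub>R axis i 1)" by (rule sum.mono_neutral_right) (use x in auto)
  finally show "x \<in> span ((\<lambda>i. axis i 1) ` I)"
    by (metis (no_types, lifting) image_eqI span_base span_mul span_sum)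
qed

lemma model_subspaces:
  "(W0 :: (real ^ ('n::finite) bit0) set) = {x. \<forall>i. i \<notin> {1, 2, 3} \<longrightarrow> x $ i = 0}"
  "(l1_0 :: (real ^ 'n bit0) set) = {x. \<forall>i. i \<notin> {2} \<longrightarrow> x $ i = 0}"
  "(l2_0 :: (real ^ 'n bit0) set) = {x. \<forall>i. i \<notin> {3} \<longrightarrow> x $ i = 0}"
  "(V0 :: (real ^ 'n bit0) set) = {x. \<forall>i. i \<notin> {1, 3} \<longrightarrow> x $ i = 0}"
  using span_axis[of "{1, 2, 3} :: 'n bit0 set"] span_axis[of "{2} :: 'n bit0 set"] span_axis[of "{3} :: 'n bit0 set"]
    span_axis[of "{1, 3} :: 'n bit0 set"]
  unfolding W0_def l1_0_def l2_0_def V0_def by simp_all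

lemma lagrangian_germ_smooth:
  assumes "lagrangian_germ \<omega> H"
  obtains V where "open V" "0 \<in> V" "smooth_on V H"
  using assms unfolding lagrangian_germ_def by blast

lemma lagrangian_germ_tangency:
  fixes H :: "real ^ ('n::finite) bit0 \<Rightarrow> real ^ 'n"
  assumes H: "lagrangian_germ \<omega> H" and b: "b \<in> {branch1, branch2}"
  shows "enat k \<le> tangency_order b H \<longleftrightarrow> (\<lambda>t. norm (H (b t))) \<in> O[at 0](\<lambda>t. t ^ k)"
proof (rule lagrangian_germ_smooth[OF H])
  fix V assume V: "open V" "0 \<in> V" "smooth_on V H"
  have id: "smooth_on UNIV (\<lambda>x :: real ^ 'n bit0. x)" by (intro smooth_on_bounded_linear open_UNIV bounded_linear_ident)
  show ?thesis
    by (rule smooth_along_branches[OF open_UNIV UNIV_I id refl V b]) (rule tangency_order_ge_iff)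
qed

section \<open>Transfer of the invariants between two parametrizations of N\<close>

context
  fixes \<omega> :: "(real ^ ('n::finite) bit0) form2" and N :: "(real ^ 'n bit0) set" and \<Phi> \<Phi>' :: "real ^ 'n bit0 \<Rightarrow> real ^ 'n bit0"
  assumes n: "CARD('n) \<ge> 2" and \<Phi>: "germ_diffeo \<Phi> U9 N" "germ_diffeo \<Phi>' U9 N"
begin

text \<open>Germs of equations correspond by composition with \<Phi>'. Both orders are kept for the
  same H, because Lt takes the minimum over the branches germ by germ before the maximum is
  formed.\<close>

lemma tangency_transfer:
  "(\<exists>H. lagrangian_germ \<omega> H \<and> tangency_order (\<Phi> \<circ> branch1) H = i \<and> tangency_order (\<Phi> \<circ> branch2) H = j) \<longleftrightarrow>
   (\<exists>H. lagrangian_germ (pullback \<Phi>' \<omega>) H \<and> tangency_order branch1 H = i \<and> tangency_order branch2 H = j)"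
proof
  assume "\<exists>H. lagrangian_germ \<omega> H \<and> tangency_order (\<Phi> \<circ> branch1) H = i \<and> tangency_order (\<Phi> \<circ> branch2) H = j"
  then obtain H where H: "lagrangian_germ \<omega> H" "tangency_order (\<Phi> \<circ> branch1) H = i" "tangency_order (\<Phi> \<circ> branch2) H = j" by blast
  have "tangency_order b (\<lambda>x. H (\<Phi>' x)) = tangency_order (\<Phi> \<circ> b) H" if "b \<in> {branch1, branch2}" for b
    unfolding tangency_order_independent[OF n \<Phi> H(1) that] by (simp add: tangency_order_def)
  with H lagrangian_germ_pullback[OF \<Phi>(2) H(1)]
  show "\<exists>H. lagrangian_germ (pullback \<Phi>' \<omega>) H \<and> tangency_order branch1 H = i \<and> tangency_order branch2 H = j"
    by (intro exI[of _ "\<lambda>x. H (\<Phi>' x)"]) simp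
next
  assume "\<exists>H. lagrangian_germ (pullback \<Phi>' \<omega>) H \<and> tangency_order branch1 H = i \<and> tangency_order branch2 H = j"
  then obtain H where H: "lagrangian_germ (pullback \<Phi>' \<omega>) H" "tangency_order branch1 H = i" "tangency_order branch2 H = j" by blast
  obtain H' where H': "lagrangian_germ \<omega> H'" "\<forall>\<^sub>F x in nhds 0. H' (\<Phi>' x) = H x"
    by (rule lagrangian_germ_pushforward[OF \<Phi>(2) H(1)]) (rule that)
  have "tangency_order (\<Phi> \<circ> b) H' = tangency_order b H" if b: "b \<in> {branch1, branch2}" for b
  proof -
    have "tangency_order (\<Phi> \<circ> b) H' = tangency_order b (\<lambda>x. H' (\<Phi>' x))"
      unfolding tangency_order_independent[OF n \<Phi> H'(1) b] by (simp add: tangency_order_def)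
    also have "\<dots> = tangency_order b H"
    proof (rule enat_eqI)
      fix k
      have "(b \<longlongrightarrow> 0) (at 0)" using b branch1_tendsto branch2_tendsto by auto
      with H'(2) have "\<forall>\<^sub>F t in at 0. H' (\<Phi>' (b t)) = H (b t)" by (rule eventually_compose_filterlim)
      then have "\<forall>\<^sub>F t in at 0. norm (H' (\<Phi>' (b t))) = norm (H (b t))" by eventually_elim simp
      from landau_o.big.in_cong[OF this]
      show "enat k \<le> tangency_order b (\<lambda>x. H' (\<Phi>' x)) \<longleftrightarrow> enat k \<le> tangency_order b H"
        unfolding lagrangian_germ_tangency[OF H(1) b] lagrangian_germ_tangency[OF lagrangian_germ_pullback[OF \<Phi>(2) H'(1)] b] .
    qed
    finally show ?thesis .
  qed
  with H(2,3) H'(1)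
  show "\<exists>H. lagrangian_germ \<omega> H \<and> tangency_order (\<Phi> \<circ> branch1) H = i \<and> tangency_order (\<Phi> \<circ> branch2) H = j" by auto
qed

lemma maxima_transfer:
  "Lt_is \<omega> \<Phi> m \<longleftrightarrow> is_maximum m {min (tangency_order branch1 H) (tangency_order branch2 H) | H. lagrangian_germ (pullback \<Phi>' \<omega>) H}"
  "L2_is \<omega> \<Phi> m \<longleftrightarrow> is_maximum m {tangency_order branch2 H | H. lagrangian_germ (pullback \<Phi>' \<omega>) H}"
proof -
  have "{F (tangency_order (\<Phi> \<circ> branch1) H) (tangency_order (\<Phi> \<circ> branch2) H) | H. lagrangian_germ \<omega> H} =
    {F (tangency_order branch1 H) (tangency_order branch2 H) | H. lagrangian_germ (pullback \<Phi>' \<omega>) H}" for F :: "enat \<Rightarrow> enat \<Rightarrow> enat"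
    using tangency_transfer by (safe; metis)
  from this[of min] this[of "\<lambda>i j. j"]
  show "Lt_is \<omega> \<Phi> m \<longleftrightarrow> is_maximum m {min (tangency_order branch1 H) (tangency_order branch2 H) | H. lagrangian_germ (pullback \<Phi>' \<omega>) H}"
    "L2_is \<omega> \<Phi> m \<longleftrightarrow> is_maximum m {tangency_order branch2 H | H. lagrangian_germ (pullback \<Phi>' \<omega>) H}"
    unfolding Lt_is_def L2_is_def by simp_all
qed

lemma restrict_transfer:
  assumes S: "S \<in> {W0, l1_0, l2_0, V0}"
  shows "restr_zero \<omega> (transport \<Phi> S) \<longleftrightarrow> (\<forall>u\<in>S. \<forall>v\<in>S. pullback \<Phi>' \<omega> 0 u v = 0)"
    and "restr_kernel \<omega> (transport \<Phi> S) = transport \<Phi>' {u\<in>S. \<forall>v\<in>S. pullback \<Phi>' \<omega> 0 u v = 0}"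
proof -
  have "\<Phi>' 0 = 0" using \<Phi>(2) unfolding germ_diffeo_def by blast
  then show "restr_zero \<omega> (transport \<Phi> S) \<longleftrightarrow> (\<forall>u\<in>S. \<forall>v\<in>S. pullback \<Phi>' \<omega> 0 u v = 0)"
    "restr_kernel \<omega> (transport \<Phi> S) = transport \<Phi>' {u\<in>S. \<forall>v\<in>S. pullback \<Phi>' \<omega> 0 u v = 0}"
    unfolding transport_independent[OF n \<Phi> S] by (auto simp: restr_zero_def restr_kernel_def transport_def pullback_def)
qed

lemma restrict_transfer_l1_l2:
  "restr_zero \<omega> (transport \<Phi> l1_0 + transport \<Phi> l2_0) \<longleftrightarrow> (\<forall>u\<in>l1_0 + l2_0. \<forall>v\<in>l1_0 + l2_0. pullback \<Phi>' \<omega> 0 u v = 0)"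
proof (rule germ_diffeoE[OF \<Phi>(2)])
  fix U assume U: "0 \<in> U" "smooth_on U \<Phi>'" "\<Phi>' 0 = 0"
  have lin: "linear (frechet_derivative \<Phi>' (at 0))" by (rule smooth_on_linear_frechet[OF U(2,1)])
  have "transport \<Phi>' l1_0 + transport \<Phi>' l2_0 = transport \<Phi>' (l1_0 + l2_0)"
  proof (intro equalityI subsetI)
    fix x assume "x \<in> transport \<Phi>' l1_0 + transport \<Phi>' l2_0"
    then obtain p q where pq: "x = p + q" "p \<in> transport \<Phi>' l1_0" "q \<in> transport \<Phi>' l2_0" by (rule set_plus_elim)
    then obtain a b where ab: "a \<in> l1_0" "b \<in> l2_0"
      "x = frechet_derivative \<Phi>' (at 0) a + frechet_derivative \<Phi>' (at 0) b"
      unfolding transport_def by blast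
    then have "x = frechet_derivative \<Phi>' (at 0) (a + b)" by (simp add: linear_add[OF lin])
    then show "x \<in> transport \<Phi>' (l1_0 + l2_0)" unfolding transport_def by (rule image_eqI) (rule set_plus_intro[OF ab(1,2)])
  next
    fix x assume "x \<in> transport \<Phi>' (l1_0 + l2_0)"
    then obtain c where c: "x = frechet_derivative \<Phi>' (at 0) c" "c \<in> l1_0 + l2_0" unfolding transport_def by (rule imageE)
    then obtain a b where "c = a + b" and ab: "a \<in> l1_0" "b \<in> l2_0" by (meson set_plus_elim)
    with c have "x = frechet_derivative \<Phi>' (at 0) (a + b)" by simp
    then have "x = frechet_derivative \<Phi>' (at 0) a + frechet_derivative \<Phi>' (at 0) b" by (simp add: linear_add[OF lin])
    then show "x \<in> transport \<Phi>' l1_0 + transport \<Phi>' l2_0"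
      unfolding transport_def using set_plus_intro[OF imageI imageI, OF ab(1,2)] by (simp only:)
  qed
  then have "transport \<Phi> l1_0 + transport \<Phi> l2_0 = transport \<Phi>' (l1_0 + l2_0)"
    using transport_independent[OF n \<Phi>, of l1_0] transport_independent[OF n \<Phi>, of l2_0] by simp
  then show ?thesis by (simp add: restr_zero_def transport_def pullback_def U(3))
qed

lemma transport_l2: "transport \<Phi> l2_0 = transport \<Phi>' l2_0"
  by (rule transport_independent[OF n \<Phi>]) simp

text \<open>On the 3-space \<open>W0\<close> the form has components A, B, C, and its kernel, when
  it is nonzero, is the line through (B, -A, C). So that line is axis 3 exactly when A = B = 0 and C
  is not 0.\<close>

lemma linear_invariants:
  assumes \<omega>: "\<And>u v. u \<in> W0 \<Longrightarrow> v \<in> W0 \<Longrightarrow> pullback \<Phi>' \<omega> 0 u v =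
    A * (u $ 1 * v $ 3 - u $ 3 * v $ 1) + B * (u $ 2 * v $ 3 - u $ 3 * v $ 2) + C * (u $ 1 * v $ 2 - u $ 2 * v $ 1)"
  shows "restr_zero \<omega> (transport \<Phi> V0) \<longleftrightarrow> A = 0"
    and "restr_zero \<omega> (transport \<Phi> l1_0 + transport \<Phi> l2_0) \<longleftrightarrow> B = 0"
    and "B \<noteq> 0 \<Longrightarrow> restr_kernel \<omega> (transport \<Phi> W0) \<noteq> transport \<Phi> l2_0"
    and "A = 0 \<Longrightarrow> B = 0 \<Longrightarrow> C \<noteq> 0 \<Longrightarrow> restr_kernel \<omega> (transport \<Phi> W0) = transport \<Phi> l2_0"
    and "A = 0 \<Longrightarrow> B = 0 \<Longrightarrow> C = 0 \<Longrightarrow> restr_zero \<omega> (transport \<Phi> W0)"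
proof -
  note d = bit0_123_distinct[OF n]
  have ax: "axis i 1 \<in> (W0 :: (real ^ 'n bit0) set)" if "i \<in> {1, 2, 3}" for i
    using that d by (auto simp: model_subspaces axis_def)
  have V: "V0 \<subseteq> W0" by (auto simp: model_subspaces)
  have l: "l1_0 + l2_0 = {x :: real ^ 'n bit0. \<forall>i. i \<notin> {2, 3} \<longrightarrow> x $ i = 0}"
  proof (intro equalityI subsetI)
    fix x :: "real ^ 'n bit0" assume x: "x \<in> {x. \<forall>i. i \<notin> {2, 3} \<longrightarrow> x $ i = 0}"
    have e: "x = axis 2 (x $ 2) + axis 3 (x $ 3)" using x d by (auto simp: vec_eq_iff axis_def)
    have "axis 2 (x $ 2) \<in> (l1_0 :: (real ^ 'n bit0) set)" "axis 3 (x $ 3) \<in> (l2_0 :: (real ^ 'n bit0) set)"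
      by (simp_all add: model_subspaces axis_def)
    then have m: "axis 2 (x $ 2) + axis 3 (x $ 3) \<in> (l1_0 + l2_0 :: (real ^ 'n bit0) set)" by (rule set_plus_intro)
    show "x \<in> l1_0 + l2_0" by (subst e) (rule m)
  qed (auto simp: model_subspaces set_plus_def)
  have lW: "l1_0 + l2_0 \<subseteq> (W0 :: (real ^ 'n bit0) set)" unfolding l by (auto simp: model_subspaces)
  show "restr_zero \<omega> (transport \<Phi> V0) \<longleftrightarrow> A = 0"
  proof
    assume "restr_zero \<omega> (transport \<Phi> V0)"
    moreover have "axis 1 1 \<in> (V0 :: (real ^ 'n bit0) set)" "axis 3 1 \<in> (V0 :: (real ^ 'n bit0) set)"
      using d by (auto simp: model_subspaces axis_def)
    ultimately have "pullback \<Phi>' \<omega> 0 (axis 1 1) (axis 3 1) = 0" using restrict_transfer(1)[of V0] by blast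
    then show "A = 0" using \<omega>[OF ax ax, of 1 3] d by (simp add: axis_def)
  next
    assume "A = 0"
    have "pullback \<Phi>' \<omega> 0 u v = 0" if uv: "u \<in> V0" "v \<in> V0" for u v
    proof -
      have "u \<in> W0" "v \<in> W0" using uv V by blast+
      moreover have "u $ 2 = 0" "v $ 2 = 0" using uv d unfolding model_subspaces by simp_all
      ultimately show ?thesis using \<omega>[of u v] \<open>A = 0\<close> by simp
    qed
    then show "restr_zero \<omega> (transport \<Phi> V0)" using restrict_transfer(1)[of V0] by blast
  qed
  show "restr_zero \<omega> (transport \<Phi> l1_0 + transport \<Phi> l2_0) \<longleftrightarrow> B = 0"
  proof
    assume "restr_zero \<omega> (transport \<Phi> l1_0 + transport \<Phi> l2_0)"
    moreover have "axis 2 1 \<in> (l1_0 + l2_0 :: (real ^ 'n bit0) set)" "axis 3 1 \<in> (l1_0 + l2_0 :: (real ^ 'n bit0) set)"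
      unfolding l using d by (auto simp: axis_def)
    ultimately have "pullback \<Phi>' \<omega> 0 (axis 2 1) (axis 3 1) = 0" using restrict_transfer_l1_l2 by blast
    then show "B = 0" using \<omega>[OF ax ax, of 2 3] d by (simp add: axis_def)
  next
    assume "B = 0"
    have "pullback \<Phi>' \<omega> 0 u v = 0" if uv: "u \<in> l1_0 + l2_0" "v \<in> l1_0 + l2_0" for u v
    proof -
      have "u \<in> W0" "v \<in> W0" using uv lW by blast+
      moreover have "u $ 1 = 0" "v $ 1 = 0" using uv d unfolding l by simp_all
      ultimately show ?thesis using \<omega>[of u v] \<open>B = 0\<close> by simp
    qed
    then show "restr_zero \<omega> (transport \<Phi> l1_0 + transport \<Phi> l2_0)" using restrict_transfer_l1_l2 by blast
  qed
  let ?K = "{u\<in>W0. \<forall>v\<in>W0. pullback \<Phi>' \<omega> 0 u v = 0}"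
  have kernel: "restr_kernel \<omega> (transport \<Phi> W0) = transport \<Phi>' ?K" by (rule restrict_transfer(2)) simp
  have l2: "axis 3 1 \<in> (l2_0 :: (real ^ 'n bit0) set)" by (auto simp: model_subspaces axis_def)
  show "restr_kernel \<omega> (transport \<Phi> W0) \<noteq> transport \<Phi> l2_0" if "B \<noteq> 0"
  proof
    assume "restr_kernel \<omega> (transport \<Phi> W0) = transport \<Phi> l2_0"
    then have "frechet_derivative \<Phi>' (at 0) (axis 3 1) \<in> frechet_derivative \<Phi>' (at 0) ` ?K"
      using imageI[OF l2, of "frechet_derivative \<Phi>' (at 0)"] unfolding kernel transport_l2 unfolding transport_def by (simp only:)
    then obtain u where u: "frechet_derivative \<Phi>' (at 0) (axis 3 1) = frechet_derivative \<Phi>' (at 0) u" "u \<in> ?K"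
      by (rule imageE)
    have "axis 2 1 \<in> (W0 :: (real ^ 'n bit0) set)" by (rule ax) simp
    then have "pullback \<Phi>' \<omega> 0 u (axis 2 1) = 0" using u(2) by blast
    \<comment> \<open>The pullback sees a vector only through its image under the differential, so u
      may be replaced by axis 3, which has the same image.\<close>
    then have "pullback \<Phi>' \<omega> 0 (axis 3 1) (axis 2 1) = 0" unfolding pullback_def u(1) .
    then show False using \<omega>[OF ax ax, of 3 2] d that by (simp add: axis_def)
  qed
  show "restr_kernel \<omega> (transport \<Phi> W0) = transport \<Phi> l2_0" if "A = 0" "B = 0" "C \<noteq> 0"
  proof -
    have "?K = l2_0"
    proof (intro equalityI subsetI)
      fix u :: "real ^ 'n bit0" assume u: "u \<in> ?K"
      then have "pullback \<Phi>' \<omega> 0 u (axis 2 1) = 0" "pullback \<Phi>' \<omega> 0 u (axis 1 1) = 0" using ax by simp_all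
      then have "u $ 1 = 0" "u $ 2 = 0"
        using \<omega>[OF _ ax, of u 2] \<omega>[OF _ ax, of u 1] u that d by (simp_all add: axis_def)
      moreover have "u $ i = 0" if "i \<notin> {1, 2, 3}" for i using u that unfolding model_subspaces by blast
      ultimately have "u $ i = 0" if "i \<noteq> 3" for i using that by (cases "i \<in> {1, 2, 3}") auto
      then show "u \<in> l2_0" by (simp add: model_subspaces)
    next
      fix u :: "real ^ 'n bit0" assume u: "u \<in> l2_0"
      then have "u \<in> W0" "u $ 1 = 0" "u $ 2 = 0" using d by (auto simp: model_subspaces)
      then show "u \<in> ?K" using \<omega> that by simp
    qed
    then show ?thesis unfolding kernel transport_l2 by simp
  qed
  show "restr_zero \<omega> (transport \<Phi> W0)" if "A = 0" "B = 0" "C = 0"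
    using restrict_transfer(1)[of W0] \<omega> that by simp
qed

end

lemma alg_restr_U9_form:
  fixes \<omega> :: "(real ^ ('n::finite) bit0) form2"
  assumes n: "CARD('n) \<ge> 2" and \<omega>: "symplectic_germ \<omega>" and \<Phi>: "germ_diffeo \<Phi> U9 N" and eq: "alg_restr_eq U9 (pullback \<Phi> \<omega>) \<theta>"
  obtains \<alpha> \<beta> U where "U9_form (pullback \<Phi> \<omega>) \<theta> \<alpha> \<beta> U"
proof (rule symplectic_germ_pullback[OF \<omega> \<Phi>])
  fix U assume U: "open U" "0 \<in> U" "two_form_on U (pullback \<Phi> \<omega>)" "closed_form_on U (pullback \<Phi> \<omega>)"
    "\<And>x u. x \<in> U \<Longrightarrow> (\<And>v. pullback \<Phi> \<omega> x u v = 0) \<Longrightarrow> u = 0"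
  obtain V \<alpha> \<beta> where V: "open V" "0 \<in> V" "two_form_on V \<alpha>" "one_form_on V \<beta>"
    "\<forall>x\<in>U9 \<inter> V. (\<forall>u v. \<alpha> x u v = 0) \<and> (\<forall>u. \<beta> x u = 0)"
    "\<forall>x\<in>V. \<forall>u v. pullback \<Phi> \<omega> x u v - \<theta> x u v = \<alpha> x u v + ext_deriv \<beta> x u v"
    using eq unfolding alg_restr_eq_def by blast
  have "U9_form (pullback \<Phi> \<omega>) \<theta> \<alpha> \<beta> (U \<inter> V)"
  proof
    show "two_form_on (U \<inter> V) (pullback \<Phi> \<omega>)" by (rule two_form_on_subset[OF U(3)]) simp
    show "closed_form_on (U \<inter> V) (pullback \<Phi> \<omega>)" by (rule closed_form_on_subset[OF U(4)]) simp
    show "two_form_on (U \<inter> V) \<alpha>" by (rule two_form_on_subset[OF V(3)]) simp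
    show "one_form_on (U \<inter> V) \<beta>" by (rule one_form_on_subset[OF V(4)]) simp
    show "u = 0" if "x \<in> U \<inter> V" "\<And>v. pullback \<Phi> \<omega> x u v = 0" for x u by (rule U(5)[OF _ that(2)]) (use that(1) in simp)
    show "pullback \<Phi> \<omega> x u v = \<theta> x u v + \<alpha> x u v + ext_deriv \<beta> x u v" if "x \<in> U \<inter> V" for x u v
    proof -
      have "pullback \<Phi> \<omega> x u v - \<theta> x u v = \<alpha> x u v + ext_deriv \<beta> x u v" using V(6) that by blast
      then show ?thesis by simp
    qed
    show "\<alpha> x u v = 0" if "x \<in> U9" "x \<in> U \<inter> V" for x u v using V(5) that by blast
    show "\<beta> x u = 0" if "x \<in> U9" "x \<in> U \<inter> V" for x u using V(5) that by blast
    show "CARD('n) \<ge> 2" "open (U \<inter> V)" "0 \<in> U \<inter> V" using n U(1,2) V(1,2) by auto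
  qed
  then show thesis by (rule that)
qed

section \<open>Polynomial normal forms and their primitives\<close>

lemma three_term_one_form:
  fixes A1 A2 A3 :: "real ^ ('n::finite) bit0 \<Rightarrow> real"
  assumes sm: "smooth_on UNIV A1" "smooth_on UNIV A2" "smooth_on UNIV A3"
  shows "one_form_on UNIV (\<lambda>x v. A1 x * v $ 1 + A2 x * v $ 2 + A3 x * v $ 3)"
    and "(A1 has_derivative A1') (at x) \<Longrightarrow> (A2 has_derivative A2') (at x) \<Longrightarrow> (A3 has_derivative A3') (at x) \<Longrightarrow>
      ext_deriv (\<lambda>x v. A1 x * v $ 1 + A2 x * v $ 2 + A3 x * v $ 3) x u v =
        (A1' u * v $ 1 - A1' v * u $ 1) + (A2' u * v $ 2 - A2' v * u $ 2) + (A3' u * v $ 3 - A3' v * u $ 3)"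
proof -
  show "one_form_on UNIV (\<lambda>x v. A1 x * v $ 1 + A2 x * v $ 2 + A3 x * v $ 3)"
    unfolding one_form_on_def
    by (intro conjI ballI allI smooth_on_add smooth_on_mult smooth_on_const sm open_UNIV)
      (simp add: linear_iff algebra_simps)
  assume A': "(A1 has_derivative A1') (at x)" "(A2 has_derivative A2') (at x)" "(A3 has_derivative A3') (at x)"
  have "((\<lambda>x. A1 x * v $ 1 + A2 x * v $ 2 + A3 x * v $ 3) has_derivative (\<lambda>h. A1' h * v $ 1 + A2' h * v $ 2 + A3' h * v $ 3)) (at x)"
    for v :: "real ^ 'n bit0"
    by (intro has_derivative_add has_derivative_mult_left A')
  from frechet_at[OF this]
  show "ext_deriv (\<lambda>x v. A1 x * v $ 1 + A2 x * v $ 2 + A3 x * v $ 3) x u v =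
      (A1' u * v $ 1 - A1' v * u $ 1) + (A2' u * v $ 2 - A2' v * u $ 2) + (A3' u * v $ 3 - A3' v * u $ 3)"
    by (simp add: ext_deriv_def)
qed

text \<open>The parameters are numbered like \<theta>4 to \<theta>9. One family thus covers the
  normal forms of \<open>class_3_1\<close> to \<open>class_8\<close>, and the first nonzero
  parameter decides the tangency orders.\<close>

definition poly_coeff :: "real \<Rightarrow> real \<Rightarrow> real \<Rightarrow> real \<Rightarrow> real \<Rightarrow> real \<Rightarrow> real ^ ('n::finite) bit0 \<Rightarrow> real" where
  "poly_coeff a4 a5 a6 a7 a8 a9 x =
     a4 * x $ 3 + a5 * x $ 1 + a6 * x $ 3 ^ 2 + a7 * (x $ 1 * x $ 3) + a8 * x $ 3 ^ 3 + a9 * (x $ 1 * x $ 3 ^ 2)"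

definition poly_form :: "real \<Rightarrow> real \<Rightarrow> real \<Rightarrow> real \<Rightarrow> real \<Rightarrow> real \<Rightarrow> (real ^ ('n::finite) bit0) form2" where
  "poly_form a4 a5 a6 a7 a8 a9 x u v = poly_coeff a4 a5 a6 a7 a8 a9 x * (u $ 1 * v $ 3 - u $ 3 * v $ 1)"

lemma vec_nth_has_derivative: "((\<lambda>x. x $ i) has_derivative (\<lambda>h. h $ i)) F"
  by (rule bounded_linear_imp_has_derivative[OF bounded_linear_vec_nth])

text \<open>\<open>F\<close> is the antiderivative of the coefficient with respect to \<open>x\<^sub>1\<close>, so that it vanishes along the
  nonsingular branch.\<close>

lemma poly_form_primitive:
  fixes F :: "real ^ ('n::finite) bit0 \<Rightarrow> real"
  assumes F_def: "F = (\<lambda>x. a4 * (x $ 1 * x $ 3) + a5 / 2 * x $ 1 ^ 2 + a6 * (x $ 1 * x $ 3 ^ 2) +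
    a7 / 2 * (x $ 1 ^ 2 * x $ 3) + a8 * (x $ 1 * x $ 3 ^ 3) + a9 / 2 * (x $ 1 ^ 2 * x $ 3 ^ 2))"
  shows "one_form_on UNIV (\<lambda>x v. F x * v $ 3)" "ext_deriv (\<lambda>x v. F x * v $ 3) x u v = poly_form a4 a5 a6 a7 a8 a9 x u v"
proof -
  have sm: "smooth_on UNIV F" unfolding F_def
    by (intro smooth_on_add smooth_on_mult smooth_on_power smooth_on_const smooth_on_component open_UNIV)
  have F': "(F has_derivative (\<lambda>h. poly_coeff a4 a5 a6 a7 a8 a9 x * h $ 1 +
    (a4 * x $ 1 + 2 * a6 * x $ 1 * x $ 3 + a7 / 2 * x $ 1 ^ 2 + 3 * a8 * x $ 1 * x $ 3 ^ 2 + a9 * x $ 1 ^ 2 * x $ 3) * h $ 3)) (at x)"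
    unfolding F_def poly_coeff_def
    by (rule derivative_eq_intros vec_nth_has_derivative refl)+ (simp add: fun_eq_iff algebra_simps power2_eq_square power3_eq_cube)
  have z: "smooth_on UNIV (\<lambda>x :: real ^ 'n bit0. 0 :: real)" by (rule smooth_on_const[OF open_UNIV])
  note t = three_term_one_form[OF z z sm]
  show "one_form_on UNIV (\<lambda>x v. F x * v $ 3)" using t(1) by simp
  have "ext_deriv (\<lambda>x v. F x * v $ 3) x u v = (poly_coeff a4 a5 a6 a7 a8 a9 x * u $ 1 +
    (a4 * x $ 1 + 2 * a6 * x $ 1 * x $ 3 + a7 / 2 * x $ 1 ^ 2 + 3 * a8 * x $ 1 * x $ 3 ^ 2 + a9 * x $ 1 ^ 2 * x $ 3) * u $ 3) * v $ 3 -
    (poly_coeff a4 a5 a6 a7 a8 a9 x * v $ 1 +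
    (a4 * x $ 1 + 2 * a6 * x $ 1 * x $ 3 + a7 / 2 * x $ 1 ^ 2 + 3 * a8 * x $ 1 * x $ 3 ^ 2 + a9 * x $ 1 ^ 2 * x $ 3) * v $ 3) * u $ 3"
    using t(2)[OF has_derivative_const has_derivative_const F'] by simp
  then show "ext_deriv (\<lambda>x v. F x * v $ 3) x u v = poly_form a4 a5 a6 a7 a8 a9 x u v"
    by (simp add: poly_form_def algebra_simps)
qed

text \<open>With \<open>g = x\<^sub>2\<^sup>2 - x\<^sub>1 x\<^sub>3\<^sup>3\<close>, \<open>h\<^sub>1 = x\<^sub>1\<^sup>2 + x\<^sub>2 x\<^sub>3\<close> and \<open>h\<^sub>2 = x\<^sub>1 x\<^sub>2 + x\<^sub>3\<^sup>4\<close>, which vanish on the singular branch,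
  \<open>-17 \<theta>\<^sub>8 = d (g dx\<^sub>3 + 2 h\<^sub>1 dx\<^sub>2 + 4 h\<^sub>2 dx\<^sub>1)\<close> and \<open>19 \<theta>\<^sub>9 = d (g dx\<^sub>1 + 2 h\<^sub>2 dx\<^sub>2 + 8 h\<^sub>1 x\<^sub>3\<^sup>2 dx\<^sub>3)\<close>.\<close>

lemma poly_form_primitive_vanishing:
  fixes a8 a9 :: real
  assumes n: "CARD('n::finite) \<ge> 2"
  obtains \<kappa> :: "(real ^ ('n::finite) bit0) form1" where "one_form_on UNIV \<kappa>" "\<And>x u v. ext_deriv \<kappa> x u v = poly_form 0 0 0 0 a8 a9 x u v"
    "\<And>v. \<kappa> 0 v = 0" "\<And>t v. \<kappa> (branch2 t) v = 0"
proof -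
  define b c where "b = - a8 / 17" and "c = a9 / 19"
  have bc: "a8 = - 17 * b" "a9 = 19 * c" by (simp_all add: b_def c_def)
  define A1 where "A1 = (\<lambda>x :: real ^ 'n bit0. 4 * b * (x $ 1 * x $ 2 + x $ 3 ^ 4) + c * (x $ 2 ^ 2 - x $ 1 * x $ 3 ^ 3))"
  define A2 where "A2 = (\<lambda>x :: real ^ 'n bit0. 2 * b * (x $ 1 ^ 2 + x $ 2 * x $ 3) + 2 * c * (x $ 1 * x $ 2 + x $ 3 ^ 4))"
  define A3 where "A3 = (\<lambda>x :: real ^ 'n bit0. b * (x $ 2 ^ 2 - x $ 1 * x $ 3 ^ 3) + 8 * c * ((x $ 1 ^ 2 + x $ 2 * x $ 3) * x $ 3 ^ 2))"
  have sm: "smooth_on UNIV A1" "smooth_on UNIV A2" "smooth_on UNIV A3" unfolding A1_def A2_def A3_def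
    by (intro smooth_on_add smooth_on_diff smooth_on_mult smooth_on_power smooth_on_const smooth_on_component open_UNIV)+
  have d: "(A1 has_derivative (\<lambda>h. 4 * b * (h $ 1 * x $ 2 + x $ 1 * h $ 2 + 4 * x $ 3 ^ 3 * h $ 3) +
      c * (2 * x $ 2 * h $ 2 - h $ 1 * x $ 3 ^ 3 - 3 * x $ 1 * x $ 3 ^ 2 * h $ 3))) (at x)"
    "(A2 has_derivative (\<lambda>h. 2 * b * (2 * x $ 1 * h $ 1 + h $ 2 * x $ 3 + x $ 2 * h $ 3) +
      2 * c * (h $ 1 * x $ 2 + x $ 1 * h $ 2 + 4 * x $ 3 ^ 3 * h $ 3))) (at x)"
    "(A3 has_derivative (\<lambda>h. b * (2 * x $ 2 * h $ 2 - h $ 1 * x $ 3 ^ 3 - 3 * x $ 1 * x $ 3 ^ 2 * h $ 3) +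
      8 * c * (2 * x $ 1 * x $ 3 ^ 2 * h $ 1 + h $ 2 * x $ 3 ^ 3 + (2 * x $ 1 ^ 2 * x $ 3 + 3 * x $ 2 * x $ 3 ^ 2) * h $ 3))) (at x)" for x
    unfolding A1_def A2_def A3_def
    by ((rule derivative_eq_intros vec_nth_has_derivative refl)+; simp add: fun_eq_iff algebra_simps power2_eq_square power3_eq_cube)+
  show thesis
  proof (rule that)
    let ?\<kappa> = "\<lambda>x v. A1 x * v $ 1 + A2 x * v $ 2 + A3 x * v $ 3"
    show "one_form_on UNIV ?\<kappa>" by (rule three_term_one_form(1)[OF sm])
    show "ext_deriv ?\<kappa> x u v = poly_form 0 0 0 0 a8 a9 x u v" for x u v
      unfolding three_term_one_form(2)[OF sm d] poly_form_def poly_coeff_def bc by (simp add: algebra_simps)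
    show "?\<kappa> 0 v = 0" for v by (simp add: A1_def A2_def A3_def)
    show "?\<kappa> (branch2 t) v = 0" for t v
      by (simp add: A1_def A2_def A3_def branch2_component[OF n] flip: power_mult power_add)
  qed
qed

context U9_form
begin

text \<open>One germ H serves both branches and all k at once: infinite order, and simultaneous
  orders on the two branches, are then statements about a single germ.\<close>

lemma lagrangian_with_order:
  assumes \<kappa>: "one_form_on UNIV \<kappa>" "\<And>x u v. ext_deriv \<kappa> x u v = \<theta> x u v" "\<And>v. \<kappa> 0 v = 0"
    and \<theta>0: "\<And>u v. \<theta> 0 u v = 0"
  shows "\<exists>H. lagrangian_germ \<omega> H \<and>
    (\<forall>b\<in>{branch1, branch2}. \<forall>k. (\<forall>v. (\<lambda>t. \<kappa> (b t) v) \<in> O[at 0](\<lambda>t. t ^ k)) \<longrightarrow> enat k \<le> tangency_order b H) \<and>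
    ((\<forall>x v. \<kappa> x v = 0) \<longrightarrow> (\<forall>\<^sub>F x in nhds 0. x \<in> U9 \<longrightarrow> H x = 0))"
proof (rule lagrangian_exists)
  show "one_form_on U \<kappa>" by (rule one_form_on_subset[OF \<kappa>(1)]) simp
  fix H C \<delta>
  assume H: "lagrangian_germ \<omega> H" "0 < \<delta>"
    and bound: "\<And>x. x \<in> U9 \<Longrightarrow> norm x < \<delta> \<Longrightarrow> norm (H x) \<le> C * (\<Sum>b\<in>Basis. \<bar>\<kappa> x b\<bar>)"
  show ?thesis
  proof (intro exI[of _ H] conjI ballI allI impI H(1))
    fix b :: "real \<Rightarrow> real ^ 'n bit0" and k
    assume b: "b \<in> {branch1, branch2}" and ord: "\<forall>v. (\<lambda>t. \<kappa> (b t) v) \<in> O[at 0](\<lambda>t. t ^ k)"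
    have bt: "(b \<longlongrightarrow> 0) (at 0)" using b branch1_tendsto branch2_tendsto by auto
    have bU: "b t \<in> U9" for t using b branches_in_U9[OF n] by auto
    have "(\<lambda>t. norm (H (b t))) \<in> O[at 0](\<lambda>t. \<Sum>v\<in>Basis. \<bar>\<kappa> (b t) v\<bar>)"
    proof (rule bigoI)
      show "\<forall>\<^sub>F t in at 0. norm (norm (H (b t))) \<le> C * norm (\<Sum>v\<in>Basis. \<bar>\<kappa> (b t) v\<bar>)"
        using tendstoD[OF bt H(2)]
      proof eventually_elim
        case (elim t)
        show ?case using bound[OF bU, of t] elim by (simp add: sum_nonneg)
      qed
    qed
    moreover have "(\<lambda>t. \<Sum>v\<in>Basis. \<bar>\<kappa> (b t) v\<bar>) \<in> O[at 0](\<lambda>t. t ^ k)"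
      by (rule big_sum_in_bigo) (use ord in simp)
    ultimately have "(\<lambda>t. norm (H (b t))) \<in> O[at 0](\<lambda>t. t ^ k)" by (rule landau_o.big_trans)
    then show "enat k \<le> tangency_order b H" using lagrangian_germ_tangency[OF H(1) b] by simp
  next
    assume z: "\<forall>x v. \<kappa> x v = 0"
    have "\<forall>\<^sub>F x in nhds 0. x \<in> ball (0 :: real ^ 'n bit0) \<delta>"
      by (rule eventually_nhds_in_open) (use H(2) in auto)
    then show "\<forall>\<^sub>F x in nhds 0. x \<in> U9 \<longrightarrow> H x = 0"
    proof eventually_elim
      case (elim x)
      then show ?case using bound[of x] by (simp add: z)
    qed
  qed
qed (use assms in auto)

end

lemma poly_coeff_branch2:
  assumes "CARD('n::finite) \<ge> 2"
  shows "poly_coeff a4 a5 a6 a7 a8 a9 (branch2 t :: real ^ 'n bit0) =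
    a4 * t ^ 3 + a5 * t ^ 5 + a6 * t ^ 6 + a7 * t ^ 8 + a8 * t ^ 9 + a9 * t ^ 11"
  by (simp add: poly_coeff_def branch2_component[OF assms] flip: power_mult power_add)

lemma bigo_monomial: "c = 0 \<or> k \<le> e \<Longrightarrow> (\<lambda>t::real. c * t ^ e) \<in> O[at 0](\<lambda>t. t ^ k)"
  using landau_o.big.cmult_in_iff'[of c] bigo_power_le[of k e] by (cases "c = 0") auto

locale U9_poly_form = U9_form \<omega> "poly_form a4 a5 a6 a7 a8 a9" \<alpha> \<beta> U
  for \<omega> \<alpha> :: "(real ^ ('n::finite) bit0) form2" and \<beta> :: "(real ^ 'n bit0) form1" and U
    and a4 a5 a6 a7 a8 a9 :: real
begin

lemma poly_form_0: "poly_form a4 a5 a6 a7 a8 a9 0 u v = 0"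
  by (simp add: poly_form_def poly_coeff_def)

text \<open>Restricted to the singular branch, the six monomials of the primitive F have orders 8,
  10, 11, 13, 14, 16; every monomial of F contains x_1 and therefore vanishes on the nonsingular
  branch.\<close>

lemma order_attained:
  assumes "a4 = 0 \<or> k \<le> 8" "a5 = 0 \<or> k \<le> 10" "a6 = 0 \<or> k \<le> 11" "a7 = 0 \<or> k \<le> 13" "a8 = 0 \<or> k \<le> 14" "a9 = 0 \<or> k \<le> 16"
  obtains H where "lagrangian_germ \<omega> H" "tangency_order branch1 H = \<infinity>" "enat k \<le> tangency_order branch2 H"
proof -
  note d = bit0_123_distinct[OF n]
  define F where "F = (\<lambda>x :: real ^ 'n bit0. a4 * (x $ 1 * x $ 3) + a5 / 2 * x $ 1 ^ 2 + a6 * (x $ 1 * x $ 3 ^ 2) +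
    a7 / 2 * (x $ 1 ^ 2 * x $ 3) + a8 * (x $ 1 * x $ 3 ^ 3) + a9 / 2 * (x $ 1 ^ 2 * x $ 3 ^ 2))"
  let ?\<kappa> = "\<lambda>x (v :: real ^ 'n bit0). F x * v $ 3"
  have "?\<kappa> 0 v = 0" for v by (simp add: F_def)
  then obtain H where H: "lagrangian_germ \<omega> H"
    "\<forall>b\<in>{branch1, branch2}. \<forall>k. (\<forall>v. (\<lambda>t. ?\<kappa> (b t) v) \<in> O[at 0](\<lambda>t. t ^ k)) \<longrightarrow> enat k \<le> tangency_order b H"
    using lagrangian_with_order[of ?\<kappa>, OF poly_form_primitive[OF F_def] _ poly_form_0] by blast
  have "tangency_order branch1 H = \<infinity>"
  proof (rule enat_eq_infinityI)
    fix k
    have "F (branch1 t) = 0" for t using d by (simp add: F_def branch1_def axis_def)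
    then have "\<forall>v. (\<lambda>t. ?\<kappa> (branch1 t) v) \<in> O[at 0](\<lambda>t. t ^ k)" by simp
    then show "enat k \<le> tangency_order branch1 H" using H(2) by blast
  qed
  moreover have "enat k \<le> tangency_order branch2 H"
  proof -
    have "F (branch2 t) = a4 * t ^ 8 + a5 / 2 * t ^ 10 + a6 * t ^ 11 + a7 / 2 * t ^ 13 + a8 * t ^ 14 + a9 / 2 * t ^ 16" for t
      by (simp add: F_def branch2_component[OF n] flip: power_mult power_add)
    moreover have "(\<lambda>t. a4 * t ^ 8 + a5 / 2 * t ^ 10 + a6 * t ^ 11 + a7 / 2 * t ^ 13 + a8 * t ^ 14 + a9 / 2 * t ^ 16)
        \<in> O[at 0](\<lambda>t. t ^ k)"
      by (intro sum_in_bigo bigo_monomial) (use assms in auto)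
    ultimately have "(\<lambda>t. F (branch2 t)) \<in> O[at 0](\<lambda>t. t ^ k)" by simp
    then have "(\<lambda>t. ?\<kappa> (branch2 t) v) \<in> O[at 0](\<lambda>t. t ^ k)" for v by (cases "v $ 3 = 0") simp_all
    then show ?thesis using H(2) by blast
  qed
  ultimately show thesis using that H(1) by blast
qed

lemma order_infinite:
  assumes "a4 = 0" "a5 = 0" "a6 = 0" "a7 = 0"
  obtains H where "lagrangian_germ \<omega> H" "tangency_order branch2 H = \<infinity>"
proof (rule poly_form_primitive_vanishing[OF n, where ?a8.0=a8 and ?a9.0=a9])
  fix \<kappa> :: "(real ^ 'n bit0) form1"
  assume \<kappa>: "one_form_on UNIV \<kappa>" "\<And>x u v. ext_deriv \<kappa> x u v = poly_form 0 0 0 0 a8 a9 x u v" "\<And>v. \<kappa> 0 v = 0"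
    and z: "\<And>t v. \<kappa> (branch2 t) v = 0"
  have "ext_deriv \<kappa> x u v = poly_form a4 a5 a6 a7 a8 a9 x u v" for x u v using \<kappa>(2) assms by simp
  from lagrangian_with_order[OF \<kappa>(1) this \<kappa>(3) poly_form_0] obtain H where H: "lagrangian_germ \<omega> H"
    "\<forall>b\<in>{branch1, branch2}. \<forall>k. (\<forall>v. (\<lambda>t. \<kappa> (b t) v) \<in> O[at 0](\<lambda>t. t ^ k)) \<longrightarrow> enat k \<le> tangency_order b H"
    by blast
  have "tangency_order branch2 H = \<infinity>"
  proof (rule enat_eq_infinityI)
    fix k
    have "\<forall>v. (\<lambda>t. \<kappa> (branch2 t) v) \<in> O[at 0](\<lambda>t. t ^ k)" by (simp add: z)
    then show "enat k \<le> tangency_order branch2 H" using H(2) by blast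
  qed
  with H(1) show thesis by (rule that)
qed

lemma coefficients_vanish:
  assumes H: "lagrangian_germ \<omega> H" and M: "enat M \<le> tangency_order branch2 H" "M \<le> 17"
  shows "9 \<le> M \<Longrightarrow> a4 = 0" "11 \<le> M \<Longrightarrow> a5 = 0" "12 \<le> M \<Longrightarrow> a6 = 0" "14 \<le> M \<Longrightarrow> a7 = 0"
    and "15 \<le> M \<Longrightarrow> enat M \<le> tangency_order branch1 H \<Longrightarrow> a8 = 0"
    and "17 \<le> M \<Longrightarrow> enat M \<le> tangency_order branch1 H \<Longrightarrow> a9 = 0"
proof -
  \<comment> \<open>On the singular branch the six monomials of the coefficient have the distinct
    orders 3, 5, 6, 8, 9, 11, so each parameter is read off at its own exponent.\<close>
  let ?p = "\<lambda>k::nat. (if k = 3 then a4 else 0) + (if k = 5 then a5 else 0) + (if k = 6 then a6 else 0) +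
    (if k = 8 then a7 else 0) + (if k = 9 then a8 else 0) + (if k = 11 then a9 else 0)"
  have jet: "has_jet M (\<lambda>t. poly_coeff a4 a5 a6 a7 a8 a9 (branch2 t :: real ^ 'n bit0)) ?p"
    unfolding poly_coeff_branch2[OF n] by (intro has_jet_add has_jet_monomial)
  have b2: "(\<lambda>t. norm (H (branch2 t))) \<in> O[at 0](\<lambda>t. t ^ M)" using M(1) lagrangian_germ_tangency[OF H, of branch2] by simp
  obtain a :: "(real ^ 'n bit0) form1" and r where a: "U9_primitive a r M (\<lambda>t. poly_coeff a4 a5 a6 a7 a8 a9 (branch2 t :: real ^ 'n bit0)) ?p"
    and b1: "\<forall>k. (\<lambda>s. norm (H (branch1 s))) \<in> O[at 0](\<lambda>s. s ^ k) \<longrightarrow> (\<forall>j. (\<lambda>s. a (axis 2 s) (axis j 1)) \<in> O[at 0](\<lambda>s. s ^ k))"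
    by (rule lagrangian_primitive[OF H b2 M(2) poly_form_def jet]) (rule that)
  show "9 \<le> M \<Longrightarrow> a4 = 0" "11 \<le> M \<Longrightarrow> a5 = 0" "12 \<le> M \<Longrightarrow> a6 = 0" "14 \<le> M \<Longrightarrow> a7 = 0"
    using U9_primitive.order_bound_8[OF a] U9_primitive.order_bound_10[OF a] U9_primitive.order_bound_11[OF a]
      U9_primitive.order_bound_13[OF a] by simp_all
  have "(\<lambda>s. a (axis 2 s) (axis j 1)) \<in> O[at 0](\<lambda>s. s ^ 3)" if "enat M \<le> tangency_order branch1 H" "15 \<le> M" for j
  proof -
    have "(\<lambda>s. norm (H (branch1 s))) \<in> O[at 0](\<lambda>s. s ^ M)" using that(1) lagrangian_germ_tangency[OF H, of branch1] by simp
    then have "(\<lambda>s. norm (H (branch1 s))) \<in> O[at 0](\<lambda>s. s ^ 3)" by (rule bigo_power_weaken) (use that(2) in simp)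
    with b1 show ?thesis by blast
  qed
  then show "15 \<le> M \<Longrightarrow> enat M \<le> tangency_order branch1 H \<Longrightarrow> a8 = 0"
    "17 \<le> M \<Longrightarrow> enat M \<le> tangency_order branch1 H \<Longrightarrow> a9 = 0"
    using U9_primitive.order_bound_14[OF a] U9_primitive.order_bound_16[OF a] by simp_all
qed

text \<open>The germ from \<open>order_attained\<close> has infinite order on the nonsingular
  branch, so its minimum is its order on the singular one, and it realizes both maxima.\<close>

lemma maximum_both:
  assumes H: "\<And>H. lagrangian_germ \<omega> H \<Longrightarrow> \<not> enat (Suc m) \<le> tangency_order branch2 H"
    and m: "a4 = 0 \<or> m \<le> 8" "a5 = 0 \<or> m \<le> 10" "a6 = 0 \<or> m \<le> 11" "a7 = 0 \<or> m \<le> 13" "a8 = 0 \<or> m \<le> 14" "a9 = 0 \<or> m \<le> 16"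
  shows "is_maximum (enat m) {min (tangency_order branch1 H) (tangency_order branch2 H) | H. lagrangian_germ \<omega> H}"
    "is_maximum (enat m) {tangency_order branch2 H | H. lagrangian_germ \<omega> H}"
proof -
  have le: "tangency_order branch2 H \<le> enat m" if "lagrangian_germ \<omega> H" for H
    using H[OF that] by (metis Suc_ile_eq linorder_not_less)
  obtain H0 where H0: "lagrangian_germ \<omega> H0" "tangency_order branch1 H0 = \<infinity>" "enat m \<le> tangency_order branch2 H0"
    using order_attained[OF m] .
  have eq: "tangency_order branch2 H0 = enat m" using le[OF H0(1)] H0(3) by (rule antisym)
  show "is_maximum (enat m) {min (tangency_order branch1 H) (tangency_order branch2 H) | H. lagrangian_germ \<omega> H}"
    unfolding is_maximum_def
  proof (intro conjI ballI)
    show "enat m \<in> {min (tangency_order branch1 H) (tangency_order branch2 H) | H. lagrangian_germ \<omega> H}"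
      using H0 eq by (auto intro!: exI[of _ H0])
    fix k assume "k \<in> {min (tangency_order branch1 H) (tangency_order branch2 H) | H. lagrangian_germ \<omega> H}"
    then obtain H where "lagrangian_germ \<omega> H" "k = min (tangency_order branch1 H) (tangency_order branch2 H)" by blast
    then show "k \<le> enat m" using le[of H] by (simp add: min.coboundedI2)
  qed
  show "is_maximum (enat m) {tangency_order branch2 H | H. lagrangian_germ \<omega> H}"
    unfolding is_maximum_def using H0 eq le by (auto intro!: exI[of _ H0])
qed

text \<open>The two maxima are realized by different germs: one with infinite order on the
  nonsingular branch, the other with infinite order on the singular branch.\<close>

lemma maximum_min:
  assumes H: "\<And>H. lagrangian_germ \<omega> H \<Longrightarrow> enat (Suc m) \<le> tangency_order branch1 H \<Longrightarrow> \<not> enat (Suc m) \<le> tangency_order branch2 H"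
    and a: "a4 = 0" "a5 = 0" "a6 = 0" "a7 = 0" and m: "a8 = 0 \<or> m \<le> 14" "a9 = 0 \<or> m \<le> 16"
  shows "is_maximum (enat m) {min (tangency_order branch1 H) (tangency_order branch2 H) | H. lagrangian_germ \<omega> H}"
    "is_maximum \<infinity> {tangency_order branch2 H | H. lagrangian_germ \<omega> H}"
proof -
  have le: "min (tangency_order branch1 H) (tangency_order branch2 H) \<le> enat m" if "lagrangian_germ \<omega> H" for H
    using H[OF that] by (metis Suc_ile_eq linorder_not_less min_less_iff_conj)
  obtain H0 where H0: "lagrangian_germ \<omega> H0" "tangency_order branch1 H0 = \<infinity>" "enat m \<le> tangency_order branch2 H0"
    using order_attained[OF disjI1[OF a(1)] disjI1[OF a(2)] disjI1[OF a(3)] disjI1[OF a(4)] m] .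
  have "tangency_order branch2 H0 \<le> enat m" using le[OF H0(1)] H0(2) by simp
  then have "tangency_order branch2 H0 = enat m" using H0(3) by (rule antisym)
  then have eq: "min (tangency_order branch1 H0) (tangency_order branch2 H0) = enat m" using H0(2) by simp
  show "is_maximum (enat m) {min (tangency_order branch1 H) (tangency_order branch2 H) | H. lagrangian_germ \<omega> H}"
    unfolding is_maximum_def
  proof (intro conjI ballI)
    show "enat m \<in> {min (tangency_order branch1 H) (tangency_order branch2 H) | H. lagrangian_germ \<omega> H}"
      using H0(1) eq by (metis (mono_tags, lifting) mem_Collect_eq)
    fix k assume "k \<in> {min (tangency_order branch1 H) (tangency_order branch2 H) | H. lagrangian_germ \<omega> H}"
    then obtain H where "lagrangian_germ \<omega> H" "k = min (tangency_order branch1 H) (tangency_order branch2 H)" by blast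
    then show "k \<le> enat m" using le[of H] by simp
  qed
  obtain H1 where "lagrangian_germ \<omega> H1" "tangency_order branch2 H1 = \<infinity>" using order_infinite[OF a] .
  then show "is_maximum \<infinity> {tangency_order branch2 H | H. lagrangian_germ \<omega> H}"
    unfolding is_maximum_def by (auto intro!: exI[of _ H1])
qed

end

section \<open>Reading the invariants off a normal form\<close>

context
  fixes \<omega> :: "(real ^ ('n::finite) bit0) form2" and N :: "(real ^ 'n bit0) set" and \<Phi> :: "real ^ 'n bit0 \<Rightarrow> real ^ 'n bit0"
  assumes n: "CARD('n) \<ge> 2" and \<omega>: "symplectic_germ \<omega>" and \<Phi>: "germ_diffeo \<Phi> U9 N"
begin

lemma normal_form_linear:
  assumes "normal_form_U9 \<omega> N \<theta>"
    and \<theta>: "\<And>u v. \<theta> 0 u v =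
      A * (u $ 1 * v $ 3 - u $ 3 * v $ 1) + B * (u $ 2 * v $ 3 - u $ 3 * v $ 2) + C * (u $ 1 * v $ 2 - u $ 2 * v $ 1)"
  shows "restr_zero \<omega> (transport \<Phi> V0) \<longleftrightarrow> A = 0"
    and "restr_zero \<omega> (transport \<Phi> l1_0 + transport \<Phi> l2_0) \<longleftrightarrow> B = 0"
    and "B \<noteq> 0 \<Longrightarrow> restr_kernel \<omega> (transport \<Phi> W0) \<noteq> transport \<Phi> l2_0"
    and "A = 0 \<Longrightarrow> B = 0 \<Longrightarrow> C \<noteq> 0 \<Longrightarrow> restr_kernel \<omega> (transport \<Phi> W0) = transport \<Phi> l2_0"
    and "A = 0 \<Longrightarrow> B = 0 \<Longrightarrow> C = 0 \<Longrightarrow> restr_zero \<omega> (transport \<Phi> W0)"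
proof -
  obtain \<Phi>' where \<Phi>': "germ_diffeo \<Phi>' U9 N" and eq: "alg_restr_eq U9 (pullback \<Phi>' \<omega>) \<theta>"
    using assms(1) unfolding normal_form_U9_def alg_restr_diffeo_def by blast
  obtain \<alpha> \<beta> U where f: "U9_form (pullback \<Phi>' \<omega>) \<theta> \<alpha> \<beta> U" using alg_restr_U9_form[OF n \<omega> \<Phi>' eq] .
  have "pullback \<Phi>' \<omega> 0 u v =
      A * (u $ 1 * v $ 3 - u $ 3 * v $ 1) + B * (u $ 2 * v $ 3 - u $ 3 * v $ 2) + C * (u $ 1 * v $ 2 - u $ 2 * v $ 1)"
    if "u \<in> W0" "v \<in> W0" for u v using U9_form.restrict_W0[OF f that] \<theta> by simp
  note res = linear_invariants[OF n \<Phi> \<Phi>' this]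
  show "restr_zero \<omega> (transport \<Phi> V0) \<longleftrightarrow> A = 0" by (rule res(1))
  show "restr_zero \<omega> (transport \<Phi> l1_0 + transport \<Phi> l2_0) \<longleftrightarrow> B = 0" by (rule res(2))
  show "B \<noteq> 0 \<Longrightarrow> restr_kernel \<omega> (transport \<Phi> W0) \<noteq> transport \<Phi> l2_0" by (rule res(3))
  show "A = 0 \<Longrightarrow> B = 0 \<Longrightarrow> C \<noteq> 0 \<Longrightarrow> restr_kernel \<omega> (transport \<Phi> W0) = transport \<Phi> l2_0" by (rule res(4))
  show "A = 0 \<Longrightarrow> B = 0 \<Longrightarrow> C = 0 \<Longrightarrow> restr_zero \<omega> (transport \<Phi> W0)" by (rule res(5))
qed

lemma normal_form_poly:
  assumes "normal_form_U9 \<omega> N \<theta>" and \<theta>: "\<theta> = poly_form a4 a5 a6 a7 a8 a9"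
  shows "a4 \<noteq> 0 \<Longrightarrow> Lt_is \<omega> \<Phi> 8 \<and> L2_is \<omega> \<Phi> 8"
    and "a4 = 0 \<Longrightarrow> a5 \<noteq> 0 \<Longrightarrow> Lt_is \<omega> \<Phi> 10 \<and> L2_is \<omega> \<Phi> 10"
    and "a4 = 0 \<Longrightarrow> a5 = 0 \<Longrightarrow> a6 \<noteq> 0 \<Longrightarrow> Lt_is \<omega> \<Phi> 11 \<and> L2_is \<omega> \<Phi> 11"
    and "a4 = 0 \<Longrightarrow> a5 = 0 \<Longrightarrow> a6 = 0 \<Longrightarrow> a7 \<noteq> 0 \<Longrightarrow> Lt_is \<omega> \<Phi> 13 \<and> L2_is \<omega> \<Phi> 13"
    and "a4 = 0 \<Longrightarrow> a5 = 0 \<Longrightarrow> a6 = 0 \<Longrightarrow> a7 = 0 \<Longrightarrow> a8 \<noteq> 0 \<Longrightarrow> Lt_is \<omega> \<Phi> 14 \<and> L2_is \<omega> \<Phi> \<infinity>"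
    and "a4 = 0 \<Longrightarrow> a5 = 0 \<Longrightarrow> a6 = 0 \<Longrightarrow> a7 = 0 \<Longrightarrow> a8 = 0 \<Longrightarrow> a9 \<noteq> 0 \<Longrightarrow> Lt_is \<omega> \<Phi> 16 \<and> L2_is \<omega> \<Phi> \<infinity>"
    and "restr_zero \<omega> (transport \<Phi> W0)"
proof -
  obtain \<Phi>' where \<Phi>': "germ_diffeo \<Phi>' U9 N" and eq: "alg_restr_eq U9 (pullback \<Phi>' \<omega>) (poly_form a4 a5 a6 a7 a8 a9)"
    using assms unfolding normal_form_U9_def alg_restr_diffeo_def by blast
  obtain \<alpha> \<beta> U where "U9_form (pullback \<Phi>' \<omega>) (poly_form a4 a5 a6 a7 a8 a9) \<alpha> \<beta> U"
    using alg_restr_U9_form[OF n \<omega> \<Phi>' eq] .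
  then interpret U9_poly_form "pullback \<Phi>' \<omega>" \<alpha> \<beta> U a4 a5 a6 a7 a8 a9 by (rule U9_poly_form.intro)
  show "restr_zero \<omega> (transport \<Phi> W0)"
    by (rule normal_form_linear(5)[OF assms(1), of 0 0 0]) (simp_all add: \<theta> poly_form_0)
  note tr = maxima_transfer[OF n \<Phi> \<Phi>'] numeral_eq_enat
  \<comment> \<open>Here and in the following cases M is one more than the asserted order: tangency
    of that order would annihilate the leading parameter.\<close>
  show "Lt_is \<omega> \<Phi> 8 \<and> L2_is \<omega> \<Phi> 8" if "a4 \<noteq> 0"
    unfolding tr by (intro conjI maximum_both notI) (use coefficients_vanish(1)[where M=9] that in auto)
  show "Lt_is \<omega> \<Phi> 10 \<and> L2_is \<omega> \<Phi> 10" if "a4 = 0" "a5 \<noteq> 0"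
    unfolding tr by (intro conjI maximum_both notI) (use coefficients_vanish(2)[where M=11] that in auto)
  show "Lt_is \<omega> \<Phi> 11 \<and> L2_is \<omega> \<Phi> 11" if "a4 = 0" "a5 = 0" "a6 \<noteq> 0"
    unfolding tr by (intro conjI maximum_both notI) (use coefficients_vanish(3)[where M=12] that in auto)
  show "Lt_is \<omega> \<Phi> 13 \<and> L2_is \<omega> \<Phi> 13" if "a4 = 0" "a5 = 0" "a6 = 0" "a7 \<noteq> 0"
    unfolding tr by (intro conjI maximum_both notI) (use coefficients_vanish(4)[where M=14] that in auto)
  show "Lt_is \<omega> \<Phi> 14 \<and> L2_is \<omega> \<Phi> \<infinity>" if "a4 = 0" "a5 = 0" "a6 = 0" "a7 = 0" "a8 \<noteq> 0"
    unfolding tr by (intro conjI maximum_min[where m=14] notI) (use coefficients_vanish(5)[where M=15] that in auto)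
  show "Lt_is \<omega> \<Phi> 16 \<and> L2_is \<omega> \<Phi> \<infinity>" if "a4 = 0" "a5 = 0" "a6 = 0" "a7 = 0" "a8 = 0" "a9 \<noteq> 0"
    unfolding tr by (intro conjI maximum_min[where m=16] notI) (use coefficients_vanish(6)[where M=17] that in auto)
qed

text \<open>With the zero form as its own primitive the bound on H reads H = 0 on U9 near 0:
  containment, and not merely infinite order of tangency.\<close>

lemma normal_form_zero:
  assumes "normal_form_U9 \<omega> N zero_form"
  shows "in_lagrangian \<omega> N"
proof -
  obtain \<Phi>' where \<Phi>': "germ_diffeo \<Phi>' U9 N" and eq: "alg_restr_eq U9 (pullback \<Phi>' \<omega>) zero_form"
    using assms unfolding normal_form_U9_def alg_restr_diffeo_def by blast
  obtain \<alpha> \<beta> U where f: "U9_form (pullback \<Phi>' \<omega>) zero_form \<alpha> \<beta> U" using alg_restr_U9_form[OF n \<omega> \<Phi>' eq] .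
  have one: "one_form_on UNIV (\<lambda>x v :: real ^ 'n bit0. 0)"
    by (simp add: one_form_on_def linear_zero smooth_on_const)
  have ext: "ext_deriv (\<lambda>x v. 0) x u v = zero_form x u v" for x u v :: "real ^ 'n bit0"
    by (simp add: ext_deriv_def zero_form_def frechet_at[OF has_derivative_const])
  obtain H where H: "lagrangian_germ (pullback \<Phi>' \<omega>) H" "\<forall>\<^sub>F x in nhds 0. x \<in> U9 \<longrightarrow> H x = 0"
    using U9_form.lagrangian_with_order[OF f one ext] by (auto simp: zero_form_def)
  show ?thesis
    using lagrangian_germ_pushforward[OF \<Phi>' H(1)] H(2) unfolding in_lagrangian_def by metis
qed

end

theorem theorem5p3:
  fixes \<omega> :: "(real ^ ('n::finite) bit0) form2"
    and N :: "(real ^ 'n bit0) set"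
    and \<Phi> :: "real ^ 'n bit0 \<Rightarrow> real ^ 'n bit0"
    and W l1 l2 V :: "(real ^ 'n bit0) set"
  assumes "2 * CARD('n) \<ge> 4"
    and "symplectic_germ \<omega>"
    and "germ_diffeo \<Phi> U9 N"
    and "W = transport \<Phi> W0" and "l1 = transport \<Phi> l1_0"
    and "l2 = transport \<Phi> l2_0" and "V = transport \<Phi> V0"
  shows
    "(class_0_nonzero \<omega> N \<longrightarrow> \<not> restr_zero \<omega> V \<and> \<not> restr_zero \<omega> (l1 + l2)) \<and>
     (class_0_zero \<omega> N \<longrightarrow> \<not> restr_zero \<omega> V \<and> restr_zero \<omega> (l1 + l2)) \<and>
     (class_1 \<omega> N \<longrightarrow>
        restr_zero \<omega> V \<and> \<not> restr_zero \<omega> (l1 + l2) \<and> restr_kernel \<omega> W \<noteq> l2) \<and>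
     (class_2 \<omega> N \<or> class_3_0 \<omega> N \<or> class_4_0 \<omega> N \<longrightarrow>
        restr_zero \<omega> V \<and> restr_kernel \<omega> W = l2) \<and>
     (class_3_1 \<omega> N \<longrightarrow> restr_zero \<omega> W \<and> Lt_is \<omega> \<Phi> 8 \<and> L2_is \<omega> \<Phi> 8) \<and>
     (class_4_1 \<omega> N \<longrightarrow> restr_zero \<omega> W \<and> Lt_is \<omega> \<Phi> 10 \<and> L2_is \<omega> \<Phi> 10) \<and>
     (class_5 \<omega> N \<longrightarrow> restr_zero \<omega> W \<and> Lt_is \<omega> \<Phi> 11 \<and> L2_is \<omega> \<Phi> 11) \<and>
     (class_6 \<omega> N \<longrightarrow> restr_zero \<omega> W \<and> Lt_is \<omega> \<Phi> 13 \<and> L2_is \<omega> \<Phi> 13) \<and>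
     (class_7 \<omega> N \<longrightarrow> restr_zero \<omega> W \<and> Lt_is \<omega> \<Phi> 14 \<and> L2_is \<omega> \<Phi> \<infinity>) \<and>
     (class_8 \<omega> N \<longrightarrow> restr_zero \<omega> W \<and> Lt_is \<omega> \<Phi> 16 \<and> L2_is \<omega> \<Phi> \<infinity>) \<and>
     (class_9 \<omega> N \<longrightarrow> restr_zero \<omega> W \<and> in_lagrangian \<omega> N)"
proof -
  have n: "CARD('n) \<ge> 2" using assms(1) by simp
  note linear = normal_form_linear[OF n assms(2,3)] and poly = normal_form_poly[OF n assms(2,3)]
  note form_simps = form_add_def form_scale_def dx_dx_def zero_form_def \<theta>1_def \<theta>2_def \<theta>3_def \<theta>4_def \<theta>5_def \<theta>6_def
    \<theta>7_def \<theta>8_def \<theta>9_def poly_form_def poly_coeff_def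
  have c0n: "\<not> restr_zero \<omega> V \<and> \<not> restr_zero \<omega> (l1 + l2)" if c: "class_0_nonzero \<omega> N"
  proof -
    obtain s c1 c2 where s: "s \<in> {1, -1}" "c1 \<noteq> 0" and nf: "normal_form_U9 \<omega> N (s \<odot>\<^sub>f \<theta>1 \<oplus>\<^sub>f c1 \<odot>\<^sub>f \<theta>2 \<oplus>\<^sub>f c2 \<odot>\<^sub>f \<theta>3)"
      using c unfolding class_0_nonzero_def by blast
    show ?thesis unfolding assms(4-7) using linear(1,2)[OF nf, of s c1 c2] s by (auto simp: form_simps)
  qed
  have c0z: "\<not> restr_zero \<omega> V \<and> restr_zero \<omega> (l1 + l2)" if c: "class_0_zero \<omega> N"
  proof -
    obtain s c2 where s: "s \<in> {1, -1}" and nf: "normal_form_U9 \<omega> N (s \<odot>\<^sub>f \<theta>1 \<oplus>\<^sub>f c2 \<odot>\<^sub>f \<theta>3)"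
      using c unfolding class_0_zero_def by blast
    show ?thesis unfolding assms(4-7) using linear(1,2)[OF nf, of s 0 c2] s by (auto simp: form_simps)
  qed
  have c1: "restr_zero \<omega> V \<and> \<not> restr_zero \<omega> (l1 + l2) \<and> restr_kernel \<omega> W \<noteq> l2" if c: "class_1 \<omega> N"
  proof -
    obtain s c1 c2 c3 where s: "s \<in> {1, -1}"
      and nf: "normal_form_U9 \<omega> N (s \<odot>\<^sub>f \<theta>2 \<oplus>\<^sub>f c1 \<odot>\<^sub>f \<theta>3 \<oplus>\<^sub>f c2 \<odot>\<^sub>f \<theta>4 \<oplus>\<^sub>f c3 \<odot>\<^sub>f \<theta>6)"
      using c unfolding class_1_def by blast
    show ?thesis unfolding assms(4-7) using linear(1-3)[OF nf, of 0 s c1] s by (auto simp: form_simps)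
  qed
  \<comment> \<open>The normal forms of \<open>class_2\<close>, \<open>class_3_0\<close> and
    \<open>class_4_0\<close> differ only in terms that vanish at the origin, so their linear data
    agree.\<close>
  have kernel: "restr_zero \<omega> V \<and> restr_kernel \<omega> W = l2"
    if s: "s \<in> {1, -1}" and nf: "normal_form_U9 \<omega> N \<theta>" and \<theta>: "\<And>u v. \<theta> 0 u v = s * (u $ 1 * v $ 2 - u $ 2 * v $ 1)" for s \<theta>
    unfolding assms(4-7) using linear(1,4)[OF nf, of 0 0 s] s by (auto simp: \<theta>)
  have c234: "restr_zero \<omega> V \<and> restr_kernel \<omega> W = l2" if c: "class_2 \<omega> N \<or> class_3_0 \<omega> N \<or> class_4_0 \<omega> N"
  proof -
    from c obtain s \<theta> where s: "s \<in> {1, -1}" "normal_form_U9 \<omega> N \<theta>" "\<And>u v. \<theta> 0 u v = s * (u $ 1 * v $ 2 - u $ 2 * v $ 1)"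
    proof (elim disjE)
      assume "class_2 \<omega> N"
      then obtain s c1 c2 where "s \<in> {1, -1}" "normal_form_U9 \<omega> N (s \<odot>\<^sub>f \<theta>3 \<oplus>\<^sub>f c1 \<odot>\<^sub>f \<theta>4 \<oplus>\<^sub>f c2 \<odot>\<^sub>f \<theta>5)"
        unfolding class_2_def by blast
      then show thesis by (rule that) (simp add: form_simps)
    next
      assume "class_3_0 \<omega> N"
      then obtain s c1 c2 where "s \<in> {1, -1}" "normal_form_U9 \<omega> N (s \<odot>\<^sub>f \<theta>3 \<oplus>\<^sub>f c1 \<odot>\<^sub>f \<theta>5 \<oplus>\<^sub>f c2 \<odot>\<^sub>f \<theta>6)"
        unfolding class_3_0_def by blast
      then show thesis by (rule that) (simp add: form_simps)
    next
      assume "class_4_0 \<omega> N"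
      then obtain s c1 c2 where "s \<in> {1, -1}" "normal_form_U9 \<omega> N (s \<odot>\<^sub>f \<theta>3 \<oplus>\<^sub>f c1 \<odot>\<^sub>f \<theta>6 \<oplus>\<^sub>f c2 \<odot>\<^sub>f \<theta>7)"
        unfolding class_4_0_def by blast
      then show thesis by (rule that) (simp add: form_simps)
    qed
    then show ?thesis by (rule kernel)
  qed
  have c31: "restr_zero \<omega> W \<and> Lt_is \<omega> \<Phi> 8 \<and> L2_is \<omega> \<Phi> 8" if c: "class_3_1 \<omega> N"
  proof -
    obtain c where nf: "normal_form_U9 \<omega> N (\<theta>4 \<oplus>\<^sub>f c \<odot>\<^sub>f \<theta>5)" using c unfolding class_3_1_def by blast
    \<comment> \<open>The leading parameter 1 in the slot of \<theta>4 decides the order, whatever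
      the value of c.\<close>
    have "(\<theta>4 \<oplus>\<^sub>f c \<odot>\<^sub>f \<theta>5 :: (real ^ 'n bit0) form2) = poly_form 1 c 0 0 0 0"
      by (intro ext) (simp add: form_simps algebra_simps)
    from poly(1,7)[OF nf this] show ?thesis by (simp add: assms(4))
  qed
  have c41: "restr_zero \<omega> W \<and> Lt_is \<omega> \<Phi> 10 \<and> L2_is \<omega> \<Phi> 10" if c: "class_4_1 \<omega> N"
  proof -
    obtain c1 c2 where nf: "normal_form_U9 \<omega> N (\<theta>5 \<oplus>\<^sub>f c1 \<odot>\<^sub>f \<theta>6 \<oplus>\<^sub>f c2 \<odot>\<^sub>f \<theta>8)" using c unfolding class_4_1_def by blast
    have "(\<theta>5 \<oplus>\<^sub>f c1 \<odot>\<^sub>f \<theta>6 \<oplus>\<^sub>f c2 \<odot>\<^sub>f \<theta>8 :: (real ^ 'n bit0) form2) = poly_form 0 1 c1 0 c2 0"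
      by (intro ext) (simp add: form_simps algebra_simps)
    from poly(2,7)[OF nf this] show ?thesis by (simp add: assms(4))
  qed
  have c5: "restr_zero \<omega> W \<and> Lt_is \<omega> \<Phi> 11 \<and> L2_is \<omega> \<Phi> 11" if c: "class_5 \<omega> N"
  proof -
    obtain s c where s: "s \<in> {1, -1}" and nf: "normal_form_U9 \<omega> N (s \<odot>\<^sub>f \<theta>6 \<oplus>\<^sub>f c \<odot>\<^sub>f \<theta>7)"
      using c unfolding class_5_def by blast
    have "(s \<odot>\<^sub>f \<theta>6 \<oplus>\<^sub>f c \<odot>\<^sub>f \<theta>7 :: (real ^ 'n bit0) form2) = poly_form 0 0 s c 0 0"
      by (intro ext) (simp add: form_simps algebra_simps)
    from poly(3,7)[OF nf this] s show ?thesis by (auto simp: assms(4))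
  qed
  have c6: "restr_zero \<omega> W \<and> Lt_is \<omega> \<Phi> 13 \<and> L2_is \<omega> \<Phi> 13" if c: "class_6 \<omega> N"
  proof -
    obtain s c where s: "s \<in> {1, -1}" and nf: "normal_form_U9 \<omega> N (s \<odot>\<^sub>f \<theta>7 \<oplus>\<^sub>f c \<odot>\<^sub>f \<theta>8)"
      using c unfolding class_6_def by blast
    have "(s \<odot>\<^sub>f \<theta>7 \<oplus>\<^sub>f c \<odot>\<^sub>f \<theta>8 :: (real ^ 'n bit0) form2) = poly_form 0 0 0 s c 0"
      by (intro ext) (simp add: form_simps algebra_simps)
    from poly(4,7)[OF nf this] s show ?thesis by (auto simp: assms(4))
  qed
  have c7: "restr_zero \<omega> W \<and> Lt_is \<omega> \<Phi> 14 \<and> L2_is \<omega> \<Phi> \<infinity>" if c: "class_7 \<omega> N"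
  proof -
    obtain c where nf: "normal_form_U9 \<omega> N (\<theta>8 \<oplus>\<^sub>f c \<odot>\<^sub>f \<theta>9)" using c unfolding class_7_def by blast
    have "(\<theta>8 \<oplus>\<^sub>f c \<odot>\<^sub>f \<theta>9 :: (real ^ 'n bit0) form2) = poly_form 0 0 0 0 1 c"
      by (intro ext) (simp add: form_simps algebra_simps)
    from poly(5,7)[OF nf this] show ?thesis by (simp add: assms(4))
  qed
  have c8: "restr_zero \<omega> W \<and> Lt_is \<omega> \<Phi> 16 \<and> L2_is \<omega> \<Phi> \<infinity>" if c: "class_8 \<omega> N"
  proof -
    have "(\<theta>9 :: (real ^ 'n bit0) form2) = poly_form 0 0 0 0 0 1"
      by (intro ext) (simp add: form_simps algebra_simps)
    from poly(6,7)[OF c[unfolded class_8_def] this] show ?thesis by (simp add: assms(4))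
  qed
  have c9: "restr_zero \<omega> W \<and> in_lagrangian \<omega> N" if c: "class_9 \<omega> N"
    using normal_form_zero[OF n assms(2,3)] linear(5)[of zero_form 0 0 0] c
    unfolding class_9_def by (simp add: assms(4) zero_form_def)
  show ?thesis using c0n c0z c1 c234 c31 c41 c5 c6 c7 c8 c9 by blast
qed

end
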